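(* Let $M$ be a smooth manifold with a symmetric or skew-symmetric generalized complex structure $\mathcal J$ and a linear connection $D$. Let $L^{\tau}(E,\alpha)$ be the holomorphic bundle of $\mathcal J$, where $E\subset T^{\mathbb C}M$ is a complex subbundle and $\alpha\in\Gamma(E^*\otimes\tau(E)^* )$. Then the almost complex structure $J^{\mathcal J,D}$ on the cotangent manifold $T^*M$ is integrable if and only if the following conditions hold: (i) $E$ is an involutive subbundle of $T^{\mathbb C}M$; (ii) the complex linear extensions of $D$ and of its curvature $R^D$ satisfy $$D_{\Gamma(E)}\Gamma(\tau(E))\subset\Gamma(\tau(E)),\qquad R^D|_{E\times E}(\tau(E))=0;$$ (iii) for any $X,Y,Z\in\Gamma(E)$, $$(D_X\alpha)(Y,\tau(Z))-(D_Y\alpha)(X,\tau(Z))+\alpha(T^D_XY,\tau(Z))=0,$$ where $T^D$ is the torsion of $D$. (Given (i) and (ii), the left-hand side is understood as $X(\alpha(Y,\tau(Z)))-Y(\alpha(X,\tau(Z)))-\alpha(Y,D_X(\tau(Z)))+\alpha(X,D_Y(\tau(Z)))-\alpha([X,Y],\tau(Z))$.)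
   Context: Let $\mathbb TM=TM\oplus T^*M$ with the metric $g_{\mathrm{can}}(X+\xi,Y+\eta)=\frac12(\xi(Y)+\eta(X))$. A generalized complex structure on $M$ is a smooth field $\mathcal J$ of endomorphisms of $\mathbb TM$ with $\mathcal J^2=-\mathrm{Id}$ (no integrability is assumed); it is symmetric (resp. skew-symmetric) if it is so with respect to $g_{\mathrm{can}}$. Its holomorphic bundle $L\subset\mathbb T^{\mathbb C}M$ is the $i$-eigenbundle. Let $\tau$ denote the complex conjugation both on $T^{\mathbb C}M$ and on $\mathbb C$ if $\mathcal J$ is symmetric, and the identity maps if $\mathcal J$ is skew-symmetric. The holomorphic bundle always has the form $$L^\tau(E,\alpha)=\{X+\xi\in E\oplus(T^{\mathbb C}M)^*:\ \xi|_{\tau(E)}=i_X\alpha\},$$ where $E$ is the image of $L$ under the projection to $T^{\mathbb C}M$, $E+\bar E=T^{\mathbb C}M$, $\alpha$ is complex bilinear with $\alpha(X,\tau(Y))+\tau(\alpha(Y,\tau(X)))=0$ for $X,Y\in E$, and $\mathrm{Im}(\alpha|_\Delta)$ is non-degenerate on $\Delta\subset TM$, where $\Delta^{\mathbb C}=E\cap\bar E$. It is assumed that $E$ is a genuine complex vector bundle (constant rank). The connection $D$, acting on $\pi:T^*M\to M$, induces a decomposition $T(T^*M)=H^D\oplus T^{\mathrm{vert}}(T^*M)\cong\pi^*(TM)\oplus\pi^*(T^*M)=\pi^*(\mathbb TM)$ into horizontal and vertical bundles. The almost complex structure $J^{\mathcal J,D}$ on $T^*M$ is $\pi^*(\mathcal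 J)$ under this identification. Curvature convention: $R^D_{X,Y}=-D_XD_Y+D_YD_X+D_{[X,Y]}$; torsion: $T^D_XY=D_XY-D_YX-[X,Y]$. *)

theory Defs
  imports "HOL-Analysis.Analysis"
begin

section \<open>Smooth manifolds\<close>

text \<open>Iterated directional differentiability; only used for open \<open>S\<close> in a finite-dimensional space.\<close>

primrec Ck_on :: "nat \<Rightarrow> 'e::euclidean_space set \<Rightarrow> ('e \<Rightarrow> 'b::real_normed_vector) \<Rightarrow> bool" where
  "Ck_on 0 S f \<longleftrightarrow> continuous_on S f"
| "Ck_on (Suc k) S f \<longleftrightarrow> (\<forall>x\<in>S. f differentiable (at x)) \<and>
     (\<forall>v. Ck_on k S (\<lambda>x. frechet_derivative f (at x) v))"

definition smooth_on :: "'e::euclidean_space set \<Rightarrow> ('e \<Rightarrow> 'b::real_normed_vector) \<Rightarrow> bool" where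
  "smooth_on S f \<longleftrightarrow> (\<forall>k. Ck_on k S f)"

text \<open>A chart is its domain together with its coordinate map, whose values outside the domain
  are irrelevant.\<close>

type_synonym ('a, 'e) chart = "'a set \<times> ('a \<Rightarrow> 'e)"

text \<open>\<open>A\<close> is any smooth atlas, not necessarily maximal.\<close>

locale smooth_manifold =
  fixes T :: "'a topology" and A :: "('a, 'e::euclidean_space) chart set"
  assumes Hausdorff: "Hausdorff_space T"
    and second_countable: "second_countable T"
    and charts_cover: "\<Union> (fst ` A) = topspace T"
    and chart: "\<And>U \<phi>. (U, \<phi>) \<in> A \<Longrightarrow> openin T U \<and> open (\<phi> ` U) \<and>
          homeomorphic_map (subtopology T U) (top_of_set (\<phi> ` U)) \<phi>"
    and compatible: "\<And>U \<phi> V \<psi>. (U, \<phi>) \<in> A \<Longrightarrow> (V, \<psi>) \<in> A \<Longrightarrow>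
          smooth_on (\<phi> ` (U \<inter> V)) (\<psi> \<circ> inv_into U \<phi>)"

definition points :: "('a, 'e) chart set \<Rightarrow> 'a set" where
  "points A = \<Union> (fst ` A)"

text \<open>Smoothness constrains a function only at the points of the manifold.\<close>

definition smooth_fun :: "('a, 'e::euclidean_space) chart set \<Rightarrow> ('a \<Rightarrow> 'b::real_normed_vector) \<Rightarrow> bool" where
  "smooth_fun A f \<longleftrightarrow> (\<forall>(U, \<phi>)\<in>A. smooth_on (\<phi> ` U) (f \<circ> inv_into U \<phi>))"


section \<open>Tangent and cotangent spaces\<close>

text \<open>Tangent vectors at \<open>p\<close> are derivations at \<open>p\<close> of the algebra of smooth real functions;
  elements of the complexified tangent space are the corresponding complex-valued derivations.
  Tangent vectors vanish on non-smooth functions, covectors vanish off the (complexified)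
  tangent space, and sections vanish off the manifold, so that each of these is determined
  by its meaningful values.\<close>

type_synonym 'a tvec = "('a \<Rightarrow> real) \<Rightarrow> real"
type_synonym 'a ctvec = "('a \<Rightarrow> real) \<Rightarrow> complex"
type_synonym 'a covec = "'a tvec \<Rightarrow> real"
type_synonym 'a ccovec = "'a ctvec \<Rightarrow> complex"

definition tangent_space :: "('a, 'e::euclidean_space) chart set \<Rightarrow> 'a \<Rightarrow> 'a tvec set" where
  "tangent_space A p = {v.
     (\<forall>f g a b. smooth_fun A f \<longrightarrow> smooth_fun A g \<longrightarrow>
        v (\<lambda>q. a * f q + b * g q) = a * v f + b * v g) \<and>
     (\<forall>f g. smooth_fun A f \<longrightarrow> smooth_fun A g \<longrightarrow>
        v (\<lambda>q. f q * g q) = f p * v g + g p * v f) \<and>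
     (\<forall>f. \<not> smooth_fun A f \<longrightarrow> v f = 0)}"

definition cotangent_space :: "('a, 'e::euclidean_space) chart set \<Rightarrow> 'a \<Rightarrow> 'a covec set" where
  "cotangent_space A p = {\<xi>.
     (\<forall>v\<in>tangent_space A p. \<forall>w\<in>tangent_space A p. \<forall>a b.
        \<xi> (\<lambda>f. a * v f + b * w f) = a * \<xi> v + b * \<xi> w) \<and>
     (\<forall>v. v \<notin> tangent_space A p \<longrightarrow> \<xi> v = 0)}"

definition ctangent_space :: "('a, 'e::euclidean_space) chart set \<Rightarrow> 'a \<Rightarrow> 'a ctvec set" where
  "ctangent_space A p =
     {v. (\<lambda>f. Re (v f)) \<in> tangent_space A p \<and> (\<lambda>f. Im (v f)) \<in> tangent_space A p}"

definition ccotangent_space :: "('a, 'e::euclidean_space) chart set \<Rightarrow> 'a \<Rightarrow> 'a ccovec set" where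
  "ccotangent_space A p = {\<xi>.
     (\<forall>v\<in>ctangent_space A p. \<forall>w\<in>ctangent_space A p. \<forall>a b.
        \<xi> (\<lambda>f. a * v f + b * w f) = a * \<xi> v + b * \<xi> w) \<and>
     (\<forall>v. v \<notin> ctangent_space A p \<longrightarrow> \<xi> v = 0)}"

definition pushforward ::
    "('b, 'f::euclidean_space) chart set \<Rightarrow> ('a \<Rightarrow> 'b) \<Rightarrow> 'a tvec \<Rightarrow> 'b tvec" where
  "pushforward B F v = (\<lambda>f. if smooth_fun B f then v (f \<circ> F) else 0)"

text \<open>For a basis vector \<open>e\<close> this is the coordinate vector field of the chart in direction \<open>e\<close>.\<close>

definition coord_vec ::
    "('a, 'e::euclidean_space) chart set \<Rightarrow> ('a, 'e) chart \<Rightarrow> 'e \<Rightarrow> 'a \<Rightarrow> 'a tvec" where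
  "coord_vec A c e p = (\<lambda>f. if smooth_fun A f
     then frechet_derivative (f \<circ> inv_into (fst c) (snd c)) (at (snd c p)) e else 0)"


section \<open>Vector fields, one-forms, integrability\<close>

definition vector_fields :: "('a, 'e::euclidean_space) chart set \<Rightarrow> ('a \<Rightarrow> 'a tvec) set" where
  "vector_fields A = {X. (\<forall>p\<in>points A. X p \<in> tangent_space A p) \<and>
     (\<forall>p. p \<notin> points A \<longrightarrow> X p = (\<lambda>f. 0)) \<and>
     (\<forall>f. smooth_fun A f \<longrightarrow> smooth_fun A (\<lambda>p. X p f))}"

definition one_forms :: "('a, 'e::euclidean_space) chart set \<Rightarrow> ('a \<Rightarrow> 'a covec) set" where
  "one_forms A = {s. (\<forall>p\<in>points A. s p \<in> cotangent_space A p) \<and>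
     (\<forall>p. p \<notin> points A \<longrightarrow> s p = (\<lambda>v. 0)) \<and>
     (\<forall>X\<in>vector_fields A. smooth_fun A (\<lambda>p. s p (X p)))}"

definition cvector_fields :: "('a, 'e::euclidean_space) chart set \<Rightarrow> ('a \<Rightarrow> 'a ctvec) set" where
  "cvector_fields A = {X. (\<forall>p\<in>points A. X p \<in> ctangent_space A p) \<and>
     (\<forall>p. p \<notin> points A \<longrightarrow> X p = (\<lambda>f. 0)) \<and>
     (\<forall>f. smooth_fun A f \<longrightarrow> smooth_fun A (\<lambda>p. X p f))}"

definition lie_bracket :: "('a \<Rightarrow> 'a tvec) \<Rightarrow> ('a \<Rightarrow> 'a tvec) \<Rightarrow> 'a \<Rightarrow> 'a tvec" where
  "lie_bracket X Y p = (\<lambda>f. X p (\<lambda>q. Y q f) - Y p (\<lambda>q. X q f))"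

text \<open>Derivative of a complex function along a complex tangent vector, by complex-linear extension.\<close>

definition cderiv :: "'a ctvec \<Rightarrow> ('a \<Rightarrow> complex) \<Rightarrow> complex" where
  "cderiv v g = v (\<lambda>q. Re (g q)) + \<i> * v (\<lambda>q. Im (g q))"

definition clie_bracket :: "('a \<Rightarrow> 'a ctvec) \<Rightarrow> ('a \<Rightarrow> 'a ctvec) \<Rightarrow> 'a \<Rightarrow> 'a ctvec" where
  "clie_bracket X Y p = (\<lambda>f. cderiv (X p) (\<lambda>q. Y q f) - cderiv (Y p) (\<lambda>q. X q f))"

definition nijenhuis ::
    "('a \<Rightarrow> 'a tvec \<Rightarrow> 'a tvec) \<Rightarrow> ('a \<Rightarrow> 'a tvec) \<Rightarrow> ('a \<Rightarrow> 'a tvec) \<Rightarrow> 'a \<Rightarrow> 'a tvec" where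
  "nijenhuis K X Y p = (\<lambda>f.
     lie_bracket (\<lambda>q. K q (X q)) (\<lambda>q. K q (Y q)) p f
     - K p (lie_bracket (\<lambda>q. K q (X q)) Y p) f
     - K p (lie_bracket X (\<lambda>q. K q (Y q)) p) f
     - lie_bracket X Y p f)"

definition integrable_acs ::
    "('a, 'e::euclidean_space) chart set \<Rightarrow> ('a \<Rightarrow> 'a tvec \<Rightarrow> 'a tvec) \<Rightarrow> bool" where
  "integrable_acs A K \<longleftrightarrow>
     (\<forall>X\<in>vector_fields A. \<forall>Y\<in>vector_fields A. \<forall>p\<in>points A. nijenhuis K X Y p = (\<lambda>f. 0))"


section \<open>Linear connections\<close>

definition linear_connection ::
    "('a, 'e::euclidean_space) chart set \<Rightarrow>
     (('a \<Rightarrow> 'a tvec) \<Rightarrow> ('a \<Rightarrow> 'a tvec) \<Rightarrow> 'a \<Rightarrow> 'a tvec) \<Rightarrow> bool" where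
  "linear_connection A D \<longleftrightarrow>
     (\<forall>X\<in>vector_fields A. \<forall>Y\<in>vector_fields A. D X Y \<in> vector_fields A) \<and>
     (\<forall>X\<in>vector_fields A. \<forall>Y\<in>vector_fields A. \<forall>Z\<in>vector_fields A.
        D (\<lambda>p f. X p f + Y p f) Z = (\<lambda>p f. D X Z p f + D Y Z p f)) \<and>
     (\<forall>h. smooth_fun A h \<longrightarrow> (\<forall>X\<in>vector_fields A. \<forall>Y\<in>vector_fields A.
        D (\<lambda>p f. h p * X p f) Y = (\<lambda>p f. h p * D X Y p f))) \<and>
     (\<forall>X\<in>vector_fields A. \<forall>Y\<in>vector_fields A. \<forall>Z\<in>vector_fields A.
        D X (\<lambda>p f. Y p f + Z p f) = (\<lambda>p f. D X Y p f + D X Z p f)) \<and>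
     (\<forall>h. smooth_fun A h \<longrightarrow> (\<forall>X\<in>vector_fields A. \<forall>Y\<in>vector_fields A.
        D X (\<lambda>p f. h p * Y p f) = (\<lambda>p f. X p h * Y p f + h p * D X Y p f)))"

text \<open>\<open>dual_conn D X s Y\<close> is the function \<open>(D\<^sub>X s)(Y)\<close> for the induced connection on one-forms.\<close>

definition dual_conn ::
    "(('a \<Rightarrow> 'a tvec) \<Rightarrow> ('a \<Rightarrow> 'a tvec) \<Rightarrow> 'a \<Rightarrow> 'a tvec) \<Rightarrow>
     ('a \<Rightarrow> 'a tvec) \<Rightarrow> ('a \<Rightarrow> 'a covec) \<Rightarrow> ('a \<Rightarrow> 'a tvec) \<Rightarrow> 'a \<Rightarrow> real" where
  "dual_conn D X s Y p = X p (\<lambda>q. s q (Y q)) - s p (D X Y p)"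

text \<open>Complex-linear extension: \<open>D\<^sub>X\<^sub>+\<^sub>i\<^sub>X\<^sub>' (Y + iY') = (D\<^sub>X Y - D\<^sub>X\<^sub>' Y') + i (D\<^sub>X Y' + D\<^sub>X\<^sub>' Y)\<close>.\<close>

definition complex_conn ::
    "(('a \<Rightarrow> 'a tvec) \<Rightarrow> ('a \<Rightarrow> 'a tvec) \<Rightarrow> 'a \<Rightarrow> 'a tvec) \<Rightarrow>
     ('a \<Rightarrow> 'a ctvec) \<Rightarrow> ('a \<Rightarrow> 'a ctvec) \<Rightarrow> 'a \<Rightarrow> 'a ctvec" where
  "complex_conn D X Y =
     (let X1 = (\<lambda>p f. Re (X p f)); X2 = (\<lambda>p f. Im (X p f));
          Y1 = (\<lambda>p f. Re (Y p f)); Y2 = (\<lambda>p f. Im (Y p f))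
      in (\<lambda>p f. Complex (D X1 Y1 p f - D X2 Y2 p f) (D X1 Y2 p f + D X2 Y1 p f)))"

definition complex_curvature ::
    "(('a \<Rightarrow> 'a tvec) \<Rightarrow> ('a \<Rightarrow> 'a tvec) \<Rightarrow> 'a \<Rightarrow> 'a tvec) \<Rightarrow>
     ('a \<Rightarrow> 'a ctvec) \<Rightarrow> ('a \<Rightarrow> 'a ctvec) \<Rightarrow> ('a \<Rightarrow> 'a ctvec) \<Rightarrow> 'a \<Rightarrow> 'a ctvec" where
  "complex_curvature D X Y Z = (\<lambda>p f.
     - complex_conn D X (complex_conn D Y Z) p f
     + complex_conn D Y (complex_conn D X Z) p f
     + complex_conn D (clie_bracket X Y) Z p f)"


section \<open>Generalized complex structures\<close>

datatype gcs_type = Symmetric | Skew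

definition g_can :: "'a tvec \<times> 'a covec \<Rightarrow> 'a tvec \<times> 'a covec \<Rightarrow> real" where
  "g_can u v = (snd u (fst v) + snd v (fst u)) / 2"

type_synonym 'a gen_endo = "'a \<Rightarrow> 'a tvec \<times> 'a covec \<Rightarrow> 'a tvec \<times> 'a covec"

definition generalized_complex_structure ::
    "('a, 'e::euclidean_space) chart set \<Rightarrow> 'a gen_endo \<Rightarrow> bool" where
  "generalized_complex_structure A J \<longleftrightarrow>
     (\<forall>p\<in>points A. \<forall>u \<in> tangent_space A p \<times> cotangent_space A p.
        J p u \<in> tangent_space A p \<times> cotangent_space A p \<and>
        J p (J p u) = (\<lambda>f. - fst u f, \<lambda>v. - snd u v)) \<and>
     (\<forall>p\<in>points A. \<forall>u \<in> tangent_space A p \<times> cotangent_space A p.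
        \<forall>w \<in> tangent_space A p \<times> cotangent_space A p. \<forall>a b.
        J p (\<lambda>f. a * fst u f + b * fst w f, \<lambda>v. a * snd u v + b * snd w v) =
          (\<lambda>f. a * fst (J p u) f + b * fst (J p w) f,
           \<lambda>v. a * snd (J p u) v + b * snd (J p w) v)) \<and>
     (\<forall>X\<in>vector_fields A. \<forall>s\<in>one_forms A.
        (\<forall>f. smooth_fun A f \<longrightarrow> smooth_fun A (\<lambda>p. fst (J p (X p, s p)) f)) \<and>
        (\<forall>Y\<in>vector_fields A. smooth_fun A (\<lambda>p. snd (J p (X p, s p)) (Y p))))"

definition gcs_has_type ::
    "('a, 'e::euclidean_space) chart set \<Rightarrow> 'a gen_endo \<Rightarrow> gcs_type \<Rightarrow> bool" where
  "gcs_has_type A J k \<longleftrightarrow>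
     (\<forall>p\<in>points A. \<forall>u \<in> tangent_space A p \<times> cotangent_space A p.
        \<forall>w \<in> tangent_space A p \<times> cotangent_space A p.
        g_can (J p u) w = (case k of Symmetric \<Rightarrow> g_can u (J p w) | Skew \<Rightarrow> - g_can u (J p w)))"

text \<open>The map \<open>\<tau>\<close> on complex tangent vectors.\<close>

definition tau :: "gcs_type \<Rightarrow> 'a ctvec \<Rightarrow> 'a ctvec" where
  "tau k v = (case k of Symmetric \<Rightarrow> (\<lambda>f. cnj (v f)) | Skew \<Rightarrow> v)"

text \<open>A complex covector \<open>\<xi> = \<xi>1 + i \<xi>2\<close> has components \<open>\<xi>1, \<xi>2\<close> obtained as real and imaginary
  part of the restriction of \<open>\<xi>\<close> to real tangent vectors; conversely \<open>join_covec A p \<xi>1 \<xi>2\<close> is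
  \<open>\<xi>1 + i \<xi>2\<close>, the two real covectors being extended complex linearly.\<close>

definition re_covec :: "'a ccovec \<Rightarrow> 'a covec" where
  "re_covec \<xi> = (\<lambda>v. Re (\<xi> (\<lambda>f. complex_of_real (v f))))"

definition im_covec :: "'a ccovec \<Rightarrow> 'a covec" where
  "im_covec \<xi> = (\<lambda>v. Im (\<xi> (\<lambda>f. complex_of_real (v f))))"

definition join_covec ::
    "('a, 'e::euclidean_space) chart set \<Rightarrow> 'a \<Rightarrow> 'a covec \<Rightarrow> 'a covec \<Rightarrow> 'a ccovec" where
  "join_covec A p \<xi>1 \<xi>2 = (\<lambda>V. if V \<in> ctangent_space A p
     then Complex (\<xi>1 (\<lambda>f. Re (V f))) (\<xi>1 (\<lambda>f. Im (V f)))
        + \<i> * Complex (\<xi>2 (\<lambda>f. Re (V f))) (\<xi>2 (\<lambda>f. Im (V f)))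
     else 0)"

definition complexify ::
    "('a, 'e::euclidean_space) chart set \<Rightarrow> 'a gen_endo \<Rightarrow>
     'a \<Rightarrow> 'a ctvec \<times> 'a ccovec \<Rightarrow> 'a ctvec \<times> 'a ccovec" where
  "complexify A J p U =
     (let u1 = J p (\<lambda>f. Re (fst U f), re_covec (snd U));
          u2 = J p (\<lambda>f. Im (fst U f), im_covec (snd U))
      in (\<lambda>f. Complex (fst u1 f) (fst u2 f), join_covec A p (snd u1) (snd u2)))"

definition holomorphic_bundle ::
    "('a, 'e::euclidean_space) chart set \<Rightarrow> 'a gen_endo \<Rightarrow> 'a \<Rightarrow> ('a ctvec \<times> 'a ccovec) set" where
  "holomorphic_bundle A J p =
     {U \<in> ctangent_space A p \<times> ccotangent_space A p.
        complexify A J p U = (\<lambda>f. \<i> * fst U f, \<lambda>V. \<i> * snd U V)}"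


section \<open>Complex subbundles and the bundles \<open>L\<^sup>\<tau>(E, \<alpha>)\<close>\<close>

text \<open>Constant rank \<open>r\<close>, with local frames. Each frame consists of fields that are defined on the
  whole manifold and are only required to frame \<open>E\<close> over a neighbourhood; by cut-off
  this is the same as having local frames defined on neighbourhoods only.\<close>

definition complex_subbundle ::
    "'a topology \<Rightarrow> ('a, 'e::euclidean_space) chart set \<Rightarrow> ('a \<Rightarrow> 'a ctvec set) \<Rightarrow> bool" where
  "complex_subbundle T A E \<longleftrightarrow> (\<exists>r::nat. \<forall>p\<in>points A. \<exists>U X. openin T U \<and> p \<in> U \<and>
     (\<forall>i<r. X i \<in> cvector_fields A) \<and>
     (\<forall>q\<in>U. bij_betw (\<lambda>c f. \<Sum>i<r. c i * X i q f) ({..<r} \<rightarrow>\<^sub>E UNIV) (E q)))"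

definition sections ::
    "('a, 'e::euclidean_space) chart set \<Rightarrow> ('a \<Rightarrow> 'a ctvec set) \<Rightarrow> ('a \<Rightarrow> 'a ctvec) set" where
  "sections A E = {X \<in> cvector_fields A. \<forall>p\<in>points A. X p \<in> E p}"

definition involutive ::
    "('a, 'e::euclidean_space) chart set \<Rightarrow> ('a \<Rightarrow> 'a ctvec set) \<Rightarrow> bool" where
  "involutive A E \<longleftrightarrow> (\<forall>X\<in>sections A E. \<forall>Y\<in>sections A E. clie_bracket X Y \<in> sections A E)"

text \<open>Smooth sections of \<open>E\<^sup>* \<otimes> F\<^sup>*\<close>; \<open>\<alpha> p V W\<close> is meaningful only for \<open>V \<in> E p\<close> and \<open>W \<in> F p\<close>.\<close>

definition bilinear_section ::
    "('a, 'e::euclidean_space) chart set \<Rightarrow> ('a \<Rightarrow> 'a ctvec set) \<Rightarrow> ('a \<Rightarrow> 'a ctvec set) \<Rightarrow>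
     ('a \<Rightarrow> 'a ctvec \<Rightarrow> 'a ctvec \<Rightarrow> complex) \<Rightarrow> bool" where
  "bilinear_section A E F \<alpha> \<longleftrightarrow>
     (\<forall>p\<in>points A. \<forall>V\<in>E p. \<forall>V'\<in>E p. \<forall>W\<in>F p. \<forall>a b.
        \<alpha> p (\<lambda>f. a * V f + b * V' f) W = a * \<alpha> p V W + b * \<alpha> p V' W) \<and>
     (\<forall>p\<in>points A. \<forall>V\<in>E p. \<forall>W\<in>F p. \<forall>W'\<in>F p. \<forall>a b.
        \<alpha> p V (\<lambda>f. a * W f + b * W' f) = a * \<alpha> p V W + b * \<alpha> p V W') \<and>
     (\<forall>X\<in>sections A E. \<forall>Y\<in>sections A F. smooth_fun A (\<lambda>p. \<alpha> p (X p) (Y p)))"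

definition L_tau ::
    "('a, 'e::euclidean_space) chart set \<Rightarrow> gcs_type \<Rightarrow> ('a \<Rightarrow> 'a ctvec set) \<Rightarrow>
     ('a \<Rightarrow> 'a ctvec \<Rightarrow> 'a ctvec \<Rightarrow> complex) \<Rightarrow> 'a \<Rightarrow> ('a ctvec \<times> 'a ccovec) set" where
  "L_tau A k E \<alpha> p =
     {(X, \<xi>). X \<in> E p \<and> \<xi> \<in> ccotangent_space A p \<and> (\<forall>Y \<in> tau k ` E p. \<xi> Y = \<alpha> p X Y)}"


section \<open>The cotangent manifold\<close>

text \<open>Points are pairs \<open>(p, \<xi>)\<close> with \<open>\<xi>\<close> a covector at \<open>p\<close>. A chart with coordinates \<open>x\<close> induces the
  chart \<open>(p, \<xi>) \<mapsto> (x(p), \<Sum>\<^sub>b \<xi>(\<partial>\<^sub>b) b)\<close>, where \<open>b\<close> ranges over the standard basis.\<close>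

type_synonym 'a ct = "'a \<times> 'a covec"

definition cotangent_chart ::
    "('a, 'e::euclidean_space) chart set \<Rightarrow> ('a, 'e) chart \<Rightarrow> ('a ct, 'e \<times> 'e) chart" where
  "cotangent_chart A c =
     ({u. fst u \<in> fst c \<and> snd u \<in> cotangent_space A (fst u)},
      \<lambda>u. (snd c (fst u), \<Sum>b\<in>Basis. snd u (coord_vec A c b (fst u)) *\<^sub>R b))"

definition cotangent_atlas ::
    "('a, 'e::euclidean_space) chart set \<Rightarrow> ('a ct, 'e \<times> 'e) chart set" where
  "cotangent_atlas A = cotangent_chart A ` A"

definition vertical_lift ::
    "('a, 'e::euclidean_space) chart set \<Rightarrow> 'a ct \<Rightarrow> 'a covec \<Rightarrow> 'a ct tvec" where
  "vertical_lift A u \<eta> = (\<lambda>F. if smooth_fun (cotangent_atlas A) F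
     then deriv (\<lambda>t. F (fst u, \<lambda>v. snd u v + t * \<eta> v)) 0 else 0)"

text \<open>The horizontal space at \<open>u\<close> consists of the velocities \<open>s\<^sub>*(X)\<close> of one-forms \<open>s\<close> through \<open>u\<close>
  with \<open>D\<^sub>X s = 0\<close> at the base point.\<close>

definition horizontal_space ::
    "('a, 'e::euclidean_space) chart set \<Rightarrow>
     (('a \<Rightarrow> 'a tvec) \<Rightarrow> ('a \<Rightarrow> 'a tvec) \<Rightarrow> 'a \<Rightarrow> 'a tvec) \<Rightarrow> 'a ct \<Rightarrow> 'a ct tvec set" where
  "horizontal_space A D u =
     {pushforward (cotangent_atlas A) (\<lambda>q. (q, s q)) (X (fst u)) | s X.
        s \<in> one_forms A \<and> X \<in> vector_fields A \<and> s (fst u) = snd u \<and>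
        (\<forall>Y\<in>vector_fields A. dual_conn D X s Y (fst u) = 0)}"

text \<open>The identification of the tangent space of the cotangent manifold at \<open>u\<close> with \<open>TM \<oplus> T\<^sup>*M\<close> at
  the base point: projection to \<open>M\<close> on the horizontal part, and the covector whose vertical lift
  is the vertical part.\<close>

definition horizontal_vertical_split ::
    "('a, 'e::euclidean_space) chart set \<Rightarrow>
     (('a \<Rightarrow> 'a tvec) \<Rightarrow> ('a \<Rightarrow> 'a tvec) \<Rightarrow> 'a \<Rightarrow> 'a tvec) \<Rightarrow>
     'a ct \<Rightarrow> 'a ct tvec \<Rightarrow> 'a tvec \<times> 'a covec" where
  "horizontal_vertical_split A D u w = (pushforward A fst w,
     THE \<eta>. \<eta> \<in> cotangent_space A (fst u) \<and>
       (\<lambda>F. w F - vertical_lift A u \<eta> F) \<in> horizontal_space A D u)"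

definition cotangent_acs ::
    "('a, 'e::euclidean_space) chart set \<Rightarrow> 'a gen_endo \<Rightarrow>
     (('a \<Rightarrow> 'a tvec) \<Rightarrow> ('a \<Rightarrow> 'a tvec) \<Rightarrow> 'a \<Rightarrow> 'a tvec) \<Rightarrow>
     'a ct \<Rightarrow> 'a ct tvec \<Rightarrow> 'a ct tvec" where
  "cotangent_acs A J D u w =
     inv_into (tangent_space (cotangent_atlas A) u) (horizontal_vertical_split A D u)
       (J (fst u) (horizontal_vertical_split A D u w))"

end

theory Submission
  imports Defs
begin

text \<open>A tangent vector of the cotangent manifold is determined by its values on the pullbacks of
  functions on \<open>M\<close> and on the fibrewise linear functions \<open>(p, \<xi>) \<mapsto> \<xi>(X p)\<close>. In these terms the splitting
  defined by \<open>D\<close> is explicit: every section \<open>X + s\<close> of \<open>TM \<oplus> T\<^sup>*M\<close> lifts to a vector field, the almost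
  complex structure sends the lift of a section to the lift of its image under \<open>J\<close>, and at \<open>(p, \<xi>)\<close> the
  bracket of the lifts of \<open>X + s\<close> and \<open>Y + t\<close> has horizontal part \<open>[X, Y]\<close> and vertical part
  \<open>D\<^sub>X t - D\<^sub>Y s - \<xi> \<circ> R(X, Y)\<close>. Since the lifts span every tangent space, integrability means that for
  every \<open>\<xi>\<close> this bracket preserves the sections of the holomorphic bundle \<open>L\<close>. Taking first \<open>\<xi> = 0\<close>, this says
  that \<open>[X, Y]\<close> lies in \<open>E\<close>, that \<open>D\<^sub>X t - D\<^sub>Y s\<close> restricts to \<open>\<alpha>([X, Y], _)\<close> on \<open>\<tau>(E)\<close>, and that
  \<open>\<xi> \<circ> R(X, Y)\<close> vanishes on \<open>\<tau>(E)\<close>. Applied to \<open>X = 0\<close>, where \<open>s\<close> is an arbitrary one-form annihilating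
  \<open>\<tau>(E)\<close>, the second condition says that \<open>D\<^sub>Y\<close> preserves \<open>\<tau>(E)\<close>; what remains of it is (iii).\<close>


section \<open>Smooth maps on open subsets of Euclidean space\<close>

text \<open>Two obstacles shape the proof. Tangent vectors are derivations of globally defined
  smooth functions, and fields, forms and connections are global too, so every local argument
  (coordinates, frames, dual frames) has to be made global by bump functions, on M and again on the
  cotangent manifold. Moreover a section X of E does not by itself give a section of L: \<alpha>(X,
  _) lives on \<tau>(E) only and must be extended smoothly to the whole complexified tangent space,
  which a dual coframe does near a point.

  Passing from real to complex sections loses nothing: X + s is the real part of the section (X + s)
  - i J(X + s) of L. If P + iQ is the bracket of two fields in the i-eigenbundle of the almost
  complex structure K, the Nijenhuis tensor of their real parts is KQ - P, which vanishes exactly if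
  P + iQ is again in that eigenbundle.

  Curvature arises because the functions (p, \<xi>) -> \<xi>(Z) are differentiated along two lifts
  in both orders, while the vertical part of the bracket is measured against the horizontal lift of
  [X, Y].\<close>

lemma frechet_derivative_eq:
  "(f has_derivative f') (at x) \<Longrightarrow> frechet_derivative f (at x) = f'"
  by (metis frechet_derivative_at)

lemma Ck_on_SucD:
  assumes "Ck_on (Suc k) S f"
  shows "\<And>x. x \<in> S \<Longrightarrow> (f has_derivative frechet_derivative f (at x)) (at x)"
    and "\<And>v. Ck_on k S (\<lambda>x. frechet_derivative f (at x) v)"
  using assms by (auto simp: frechet_derivative_works)

text \<open>\<open>Ck_on\<close> differentiates in the ambient space, so agreement on S alone would
  not compare derivatives; openness of S turns it into agreement near each point.\<close>

lemma Ck_on_cong: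
  assumes "open S" "\<And>x. x \<in> S \<Longrightarrow> f x = g x" "Ck_on k S f"
  shows "Ck_on k S g"
  using assms(2,3)
proof (induction k arbitrary: f g)
  case 0
  then show ?case using continuous_on_cong[of S S f g] by auto
next
  case (Suc k)
  have *: "(g has_derivative frechet_derivative f (at x)) (at x)" if "x \<in> S" for x
    using Suc.prems that assms(1)
    by (auto intro: has_derivative_transform_within_open simp: frechet_derivative_works)
  show ?case
    unfolding Ck_on.simps
  proof (intro conjI allI ballI)
    fix x assume "x \<in> S"
    then show "g differentiable (at x)" using * differentiableI by blast
  next
    fix v
    show "Ck_on k S (\<lambda>x. frechet_derivative g (at x) v)"
      by (rule Suc.IH[OF _ Ck_on_SucD(2)[OF Suc.prems(2)]]) (simp only: frechet_derivative_eq[OF *])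
  qed
qed

text \<open>The step of the inductions below: an explicit derivative may be supplied in place of
  \<open>frechet_derivative\<close>.\<close>

lemma Ck_on_SucI:
  assumes "open S" "\<And>x. x \<in> S \<Longrightarrow> (f has_derivative f' x) (at x)"
    and "\<And>v. Ck_on k S (\<lambda>x. f' x v)"
  shows "Ck_on (Suc k) S f"
proof -
  have "Ck_on k S (\<lambda>x. frechet_derivative f (at x) v)" for v
    using frechet_derivative_eq[OF assms(2)] by (intro Ck_on_cong[OF assms(1) _ assms(3)[of v]]) simp
  moreover have "\<forall>x\<in>S. f differentiable (at x)" using assms(2) differentiableI by blast
  ultimately show ?thesis by simp
qed

lemma Ck_on_Suc_imp: "Ck_on (Suc k) S f \<Longrightarrow> Ck_on k S f"
proof (induction k arbitrary: f)
  case 0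
  then show ?case
    by (auto intro!: continuous_at_imp_continuous_on differentiable_imp_continuous_within)
next
  case (Suc k)
  then show ?case by (metis Ck_on.simps(2))
qed

lemma Ck_on_subset: "Ck_on k S f \<Longrightarrow> T \<subseteq> S \<Longrightarrow> Ck_on k T f"
  by (induction k arbitrary: f) (auto intro: continuous_on_subset)

lemma Ck_on_const: "Ck_on k S (\<lambda>x. c)"
  by (induction k arbitrary: c) auto

lemma Ck_on_bounded_linear:
  assumes "open S" "bounded_linear L"
  shows "Ck_on k S f \<Longrightarrow> Ck_on k S (\<lambda>x. L (f x))"
proof (induction k arbitrary: f)
  case 0
  then show ?case using assms(2) by (auto intro: bounded_linear.continuous_on)
next
  case (Suc k)
  show ?case
    by (rule Ck_on_SucI[OF assms(1) bounded_linear.has_derivative[OF assms(2) Ck_on_SucD(1)[OF Suc.prems]]])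
      (auto intro!: Suc.IH Ck_on_SucD(2)[OF Suc.prems])
qed

lemma Ck_on_add:
  assumes "open S"
  shows "Ck_on k S f \<Longrightarrow> Ck_on k S g \<Longrightarrow> Ck_on k S (\<lambda>x. f x + g x)"
proof (induction k arbitrary: f g)
  case 0
  then show ?case by (auto intro: continuous_on_add)
next
  case (Suc k)
  show ?case
    by (rule Ck_on_SucI[OF assms(1) has_derivative_add[OF Ck_on_SucD(1)[OF Suc.prems(1)] Ck_on_SucD(1)[OF Suc.prems(2)]]])
      (auto intro!: Suc.IH Ck_on_SucD(2)[OF Suc.prems(1)] Ck_on_SucD(2)[OF Suc.prems(2)])
qed

lemma Ck_on_sum:
  assumes "open S" "\<And>i. i \<in> I \<Longrightarrow> Ck_on k S (f i)"
  shows "Ck_on k S (\<lambda>x. \<Sum>i\<in>I. f i x)"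
  using assms(2)
  by (induction I rule: infinite_finite_induct) (auto intro: Ck_on_const Ck_on_add[OF assms(1)])

text \<open>An arbitrary bounded bilinear map lets products, scalar multiples and inner products
  share one induction. The product rule leaves one factor undifferentiated, hence the appeal to
  \<open>Ck_on_Suc_imp\<close>.\<close>

lemma Ck_on_bilinear:
  assumes "open S" "bounded_bilinear B"
  shows "Ck_on k S f \<Longrightarrow> Ck_on k S g \<Longrightarrow> Ck_on k S (\<lambda>x. B (f x) (g x))"
proof (induction k arbitrary: f g)
  case 0
  then show ?case using bounded_bilinear.continuous_on[OF assms(2)] by auto
next
  case (Suc k)
  show ?case
    by (rule Ck_on_SucI[OF assms(1) bounded_bilinear.FDERIV[OF assms(2) Ck_on_SucD(1)[OF Suc.prems(1)] Ck_on_SucD(1)[OF Suc.prems(2)]]])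
      (auto intro!: Suc.IH Ck_on_add[OF assms(1)] Ck_on_SucD(2)[OF Suc.prems(1)] Ck_on_SucD(2)[OF Suc.prems(2)]
        Ck_on_Suc_imp[OF Suc.prems(1)] Ck_on_Suc_imp[OF Suc.prems(2)])
qed

text \<open>The derivative of 1/f contains 1/f again, so the induction feeds its own conclusion at
  order k into the undifferentiated factors.\<close>

lemma Ck_on_inverse:
  fixes f :: "'e::euclidean_space \<Rightarrow> 'b::real_normed_field"
  assumes "open S" "\<And>x. x \<in> S \<Longrightarrow> f x \<noteq> 0"
  shows "Ck_on k S f \<Longrightarrow> Ck_on k S (\<lambda>x. inverse (f x))"
proof (induction k)
  case 0
  then show ?case using assms(2) by (auto intro: continuous_on_inverse)
next
  case (Suc k)
  have IH: "Ck_on k S (\<lambda>x. inverse (f x))" using Suc Ck_on_Suc_imp by blast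
  show ?case
  proof (rule Ck_on_SucI[OF assms(1)])
    fix x assume "x \<in> S"
    then show "((\<lambda>x. inverse (f x)) has_derivative
        (\<lambda>h. - (inverse (f x) * frechet_derivative f (at x) h * inverse (f x)))) (at x)"
      using assms(2) Ck_on_SucD(1)[OF Suc.prems] by (intro Deriv.has_derivative_inverse) auto
  next
    fix v
    show "Ck_on k S (\<lambda>x. - (inverse (f x) * frechet_derivative f (at x) v * inverse (f x)))"
      by (rule Ck_on_bounded_linear[OF assms(1) bounded_linear_minus[OF bounded_linear_ident]]
          Ck_on_bilinear[OF assms(1) bounded_bilinear_mult] IH Ck_on_SucD(2)[OF Suc.prems])+
  qed
qed

lemma Ck_on_compose:
  fixes f :: "'e::euclidean_space \<Rightarrow> 'f::euclidean_space"
  assumes "open S" "open S'" "f ` S \<subseteq> S'"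
  shows "Ck_on k S f \<Longrightarrow> Ck_on k S' g \<Longrightarrow> Ck_on k S (\<lambda>x. g (f x))"
proof (induction k arbitrary: g)
  case 0
  then show ?case using assms(3) by (auto intro: continuous_on_compose2)
next
  case (Suc k)
  have f: "(f has_derivative frechet_derivative f (at x)) (at x)" if "x \<in> S" for x
    using Ck_on_SucD(1)[OF Suc.prems(1) that] .
  have g: "(g has_derivative frechet_derivative g (at (f x))) (at (f x))" if "x \<in> S" for x
    using Ck_on_SucD(1)[OF Suc.prems(2), of "f x"] that assms(3) by auto
  show ?case
  proof (rule Ck_on_SucI[OF assms(1)])
    fix x assume x: "x \<in> S"
    have "((\<lambda>x. g (f x)) has_derivative (\<lambda>v. frechet_derivative g (at (f x)) (frechet_derivative f (at x) v))) (at x)"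
      using has_derivative_compose[OF f[OF x] g[OF x]] by simp
    \<comment> \<open>\<open>Ck_on\<close> controls the derivatives of g in fixed directions only,
      whereas the chain rule applies them to a vector that depends on x. Expanding this vector in
      the basis separates the two dependences.\<close>
    moreover have "frechet_derivative g (at (f x)) w
        = (\<Sum>b\<in>Basis. (w \<bullet> b) *\<^sub>R frechet_derivative g (at (f x)) b)" for w
    proof -
      interpret linear "frechet_derivative g (at (f x))" using has_derivative_linear[OF g[OF x]] .
      show ?thesis by (subst euclidean_representation[symmetric, of w]) (simp only: sum scale)
    qed
    ultimately show "((\<lambda>x. g (f x)) has_derivative
      (\<lambda>v. \<Sum>b\<in>Basis. (frechet_derivative f (at x) v \<bullet> b) *\<^sub>R frechet_derivative g (at (f x)) b)) (at x)"
      by (elim has_derivative_eq_rhs) (rule ext)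
  next
    fix v
    show "Ck_on k S (\<lambda>x. \<Sum>b\<in>Basis. (frechet_derivative f (at x) v \<bullet> b) *\<^sub>R frechet_derivative g (at (f x)) b)"
      by (intro Ck_on_sum Ck_on_bilinear[OF assms(1) bounded_bilinear_scaleR] assms(1)
          Ck_on_bounded_linear[OF assms(1) bounded_linear_inner_left] Ck_on_SucD(2)[OF Suc.prems(1)]
          Suc.IH Ck_on_SucD(2)[OF Suc.prems(2)] Ck_on_Suc_imp[OF Suc.prems(1)])
  qed
qed

lemma smooth_on_cong:
  "open S \<Longrightarrow> (\<And>x. x \<in> S \<Longrightarrow> f x = g x) \<Longrightarrow> smooth_on S f \<longleftrightarrow> smooth_on S g"
  unfolding smooth_on_def using Ck_on_cong[of S f g] Ck_on_cong[of S g f] by metis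

lemma smooth_on_imp_differentiable: "smooth_on S f \<Longrightarrow> x \<in> S \<Longrightarrow> f differentiable (at x)"
  unfolding smooth_on_def by (metis Ck_on.simps(2))

lemma smooth_on_imp_continuous: "smooth_on S f \<Longrightarrow> continuous_on S f"
  unfolding smooth_on_def by (metis Ck_on.simps(1))

lemma smooth_on_derivative:
  "smooth_on S f \<Longrightarrow> smooth_on S (\<lambda>x. frechet_derivative f (at x) v)"
  unfolding smooth_on_def by (metis Ck_on.simps(2))

lemma smooth_on_subset: "smooth_on S f \<Longrightarrow> T \<subseteq> S \<Longrightarrow> smooth_on T f"
  unfolding smooth_on_def using Ck_on_subset by blast

lemma smooth_on_const: "smooth_on S (\<lambda>x. c)"
  unfolding smooth_on_def using Ck_on_const by blast

lemma smooth_on_bounded_linear: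
  "open S \<Longrightarrow> bounded_linear L \<Longrightarrow> smooth_on S f \<Longrightarrow> smooth_on S (\<lambda>x. L (f x))"
  unfolding smooth_on_def using Ck_on_bounded_linear by blast

lemma smooth_on_add:
  "open S \<Longrightarrow> smooth_on S f \<Longrightarrow> smooth_on S g \<Longrightarrow> smooth_on S (\<lambda>x. f x + g x)"
  unfolding smooth_on_def using Ck_on_add by blast

lemma smooth_on_sum:
  "open S \<Longrightarrow> (\<And>i. i \<in> I \<Longrightarrow> smooth_on S (f i)) \<Longrightarrow> smooth_on S (\<lambda>x. \<Sum>i\<in>I. f i x)"
  unfolding smooth_on_def by (intro allI Ck_on_sum) auto

lemma smooth_on_bilinear:
  "open S \<Longrightarrow> bounded_bilinear B \<Longrightarrow> smooth_on S f \<Longrightarrow> smooth_on S g \<Longrightarrow> smooth_on S (\<lambda>x. B (f x) (g x))"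
  unfolding smooth_on_def using Ck_on_bilinear by blast

lemmas smooth_on_mult = smooth_on_bilinear[OF _ bounded_bilinear_mult]
lemmas smooth_on_scaleR = smooth_on_bilinear[OF _ bounded_bilinear_scaleR]

lemma smooth_on_inverse:
  fixes f :: "'e::euclidean_space \<Rightarrow> 'b::real_normed_field"
  shows "open S \<Longrightarrow> (\<And>x. x \<in> S \<Longrightarrow> f x \<noteq> 0) \<Longrightarrow> smooth_on S f \<Longrightarrow> smooth_on S (\<lambda>x. inverse (f x))"
  unfolding smooth_on_def using Ck_on_inverse by blast

lemma smooth_on_compose:
  fixes f :: "'e::euclidean_space \<Rightarrow> 'f::euclidean_space"
  shows "open S \<Longrightarrow> open S' \<Longrightarrow> f ` S \<subseteq> S' \<Longrightarrow> smooth_on S f \<Longrightarrow> smooth_on S' g \<Longrightarrow> smooth_on S (\<lambda>x. g (f x))"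
  unfolding smooth_on_def using Ck_on_compose by blast

lemma smooth_on_ident: "open S \<Longrightarrow> smooth_on S (\<lambda>x. x)"
proof -
  assume S: "open S"
  have "Ck_on k S (\<lambda>x. x)" for k
    by (cases k) (auto intro!: Ck_on_SucI[OF S, of _ "\<lambda>x v. v"] Ck_on_const continuous_on_id)
  then show ?thesis by (simp add: smooth_on_def)
qed

lemma smooth_on_linear: "open S \<Longrightarrow> bounded_linear L \<Longrightarrow> smooth_on S L"
  using smooth_on_bounded_linear[OF _ _ smooth_on_ident] by blast

lemma smooth_on_local:
  assumes "\<And>x. x \<in> S \<Longrightarrow> \<exists>U. open U \<and> x \<in> U \<and> smooth_on U f"
  shows "smooth_on S f"
proof -
  have "Ck_on k S g" if "\<And>x. x \<in> S \<Longrightarrow> \<exists>U. open U \<and> x \<in> U \<and> Ck_on k U g" for k and g :: "'a \<Rightarrow> 'b"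
    using that
  proof (induction k arbitrary: g)
    case 0
    have "isCont g x" if "x \<in> S" for x
      using 0[OF that] continuous_on_eq_continuous_at by auto
    then show ?case by (simp add: continuous_at_imp_continuous_on)
  next
    case (Suc k)
    have "g differentiable (at x)" if "x \<in> S" for x
      using Suc.prems[OF that] unfolding Ck_on.simps by blast
    moreover have "Ck_on k S (\<lambda>x. frechet_derivative g (at x) v)" for v
    proof (rule Suc.IH)
      fix x assume "x \<in> S"
      from Suc.prems[OF this] show "\<exists>U. open U \<and> x \<in> U \<and> Ck_on k U (\<lambda>x. frechet_derivative g (at x) v)"
        unfolding Ck_on.simps by blast
    qed
    ultimately show ?case by simp
  qed
  note loc = this
  show ?thesis
    unfolding smooth_on_def
  proof (intro allI loc)
    fix k x assume "x \<in> S"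
    from assms[OF this] obtain U where "open U" "x \<in> U" "smooth_on U f" by blast
    then show "\<exists>U. open U \<and> x \<in> U \<and> Ck_on k U f" unfolding smooth_on_def by blast
  qed
qed

lemma smooth_on_Pair:
  fixes f :: "'e::euclidean_space \<Rightarrow> 'f::euclidean_space" and g :: "'e \<Rightarrow> 'g::euclidean_space"
  assumes "open S" "smooth_on S f" "smooth_on S g"
  shows "smooth_on S (\<lambda>x. (f x, g x))"
proof -
  have "bounded_linear (\<lambda>y::'f. (y, 0::'g))" "bounded_linear (\<lambda>y::'g. (0::'f, y))"
    by (auto intro!: bounded_linear_Pair bounded_linear_ident bounded_linear_zero)
  from this[THEN smooth_on_bounded_linear[OF assms(1)]] assms
  have "smooth_on S (\<lambda>x. (f x, 0::'g) + (0::'f, g x))" by (intro smooth_on_add) auto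
  then show ?thesis by simp
qed

lemma smooth_on_fst: "open S \<Longrightarrow> smooth_on S fst"
  and smooth_on_snd: "open S \<Longrightarrow> smooth_on S snd"
  by (auto intro: smooth_on_linear bounded_linear_fst bounded_linear_snd)


subsection \<open>Bump functions\<close>

text \<open>\<open>flat 0\<close> is the classical function exp(-1/x), extended by zero. The powers
  of 1/x make the family closed under differentiation up to linear combinations.\<close>

definition flat :: "nat \<Rightarrow> real \<Rightarrow> real" where
  "flat n x = (if 0 < x then inverse x ^ n * exp (- inverse x) else 0)"

text \<open>From the right, y = 1/x reduces this to the decay of y^n exp(-y) at infinity; from the
  left the function is zero.\<close>

lemma isCont_flat_0: "isCont (flat n) 0"
proof -
  have "((\<lambda>x::real. inverse x ^ n * exp (- inverse x)) \<longlongrightarrow> 0) (at_right 0)"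
  proof -
    have "((\<lambda>y::real. y ^ n * exp (- y)) \<longlongrightarrow> 0) at_top"
      using tendsto_power_div_exp_0[of n] by (simp add: exp_minus divide_inverse)
    then show ?thesis using filterlim_compose filterlim_inverse_at_top_right by blast
  qed
  then have "(flat n \<longlongrightarrow> 0) (at_right 0)"
    by (rule tendsto_cong[THEN iffD1, rotated]) (auto simp: flat_def eventually_at intro: exI[of _ 1])
  moreover have "(flat n \<longlongrightarrow> 0) (at_left 0)"
    by (rule tendsto_cong[THEN iffD1, rotated, of "\<lambda>x. 0"]) (auto simp: flat_def eventually_at intro: exI[of _ 1])
  ultimately have "(flat n \<longlongrightarrow> 0) (at 0)" by (simp add: filterlim_split_at)
  then show ?thesis by (simp add: continuous_within flat_def)
qed

lemma flat_has_derivative: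
  "(flat n has_field_derivative (flat (n + 2) x - real n * flat (n + 1) x)) (at x)"
proof -
  consider "0 < x" | "x < 0" | "x = 0" by linarith
  then show ?thesis
  proof cases
    case 1
    \<comment> \<open>Differentiating an n-th power produces the exponent n - 1, truncated at zero;
      this relates it to the full power.\<close>
    have pow: "m = 0 \<or> inverse x ^ m = inverse x * inverse x ^ (m - Suc 0)" for m by (cases m) auto
    have "((\<lambda>x. inverse x ^ n * exp (- inverse x)) has_field_derivative
        (flat (n + 2) x - real n * flat (n + 1) x)) (at x)"
      using 1 pow[of "n - 1"] pow[of n]
      by (cases n) (auto intro!: derivative_eq_intros simp: flat_def algebra_simps power2_eq_square)
    then show ?thesis
      by (rule has_field_derivative_transform_within_open[of _ _ _ "{0<..}"]) (use 1 in \<open>auto simp: flat_def\<close>)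
  next
    case 2
    have "((\<lambda>x. 0) has_field_derivative (flat (n + 2) x - real n * flat (n + 1) x)) (at x)"
      using 2 by (auto simp: flat_def)
    then show ?thesis
      by (rule has_field_derivative_transform_within_open[of _ _ _ "{..<0}"]) (use 2 in \<open>auto simp: flat_def\<close>)
  next
    case 3
    \<comment> \<open>At the origin the difference quotient of one member of the family is exactly
      the next member, so differentiability there is the continuity already proved.\<close>
    have "(\<lambda>h. (flat n (0 + h) - flat n 0) / h) = flat (n + 1)"
      by (auto simp: flat_def fun_eq_iff field_simps)
    then have "(flat n has_field_derivative 0) (at 0)"
      using isCont_flat_0[of "n + 1"] by (simp add: DERIV_def isCont_def flat_def)
    then show ?thesis using 3 by (simp add: flat_def)
  qed
qed

text \<open>The exponent has to vary in the induction, because the derivative of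
  \<open>flat n\<close> involves the exponents n + 1 and n + 2.\<close>

lemma smooth_on_flat: "smooth_on UNIV (flat n)"
proof -
  have "Ck_on k UNIV (flat n)" for k
  proof (induction k arbitrary: n)
    case 0
    show ?case by (auto intro!: continuous_at_imp_continuous_on DERIV_isCont flat_has_derivative)
  next
    case (Suc k)
    show ?case
    proof (rule Ck_on_SucI)
      fix v
      have "Ck_on k UNIV (\<lambda>x. v * (flat (n + 2) x + (- real n) * flat (n + 1) x))"
        by (intro Ck_on_bilinear[OF _ bounded_bilinear_mult] Ck_on_add Ck_on_const Suc.IH) auto
      then show "Ck_on k UNIV (\<lambda>x. (flat (n + 2) x - real n * flat (n + 1) x) * v)"
        by (simp add: mult.commute)
    qed (use flat_has_derivative[of n] in \<open>auto simp: has_field_derivative_def\<close>)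
  qed
  then show ?thesis by (simp add: smooth_on_def)
qed

lemma smooth_bump_exists:
  fixes a :: "'e::euclidean_space"
  assumes "0 < r"
  obtains \<rho> :: "'e \<Rightarrow> real" where "smooth_on UNIV \<rho>" "\<And>x. dist a x < r \<Longrightarrow> \<rho> x = 1"
    "\<And>x. 2 * r < dist a x \<Longrightarrow> \<rho> x = 0"
proof -
  \<comment> \<open>The squared distance is smooth at the centre, where the distance itself is
    not.\<close>
  define t where "t = (\<lambda>x. (x - a) \<bullet> (x - a))"
  have sum_id: "(\<lambda>x. x + (- a)) = (\<lambda>x. x - a)" by auto
  have sm: "smooth_on UNIV (\<lambda>x::'e. x - a)"
    using smooth_on_add[OF open_UNIV smooth_on_ident smooth_on_const, of "- a"] by (simp add: sum_id)
  have t: "smooth_on UNIV t"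
    unfolding t_def by (rule smooth_on_bilinear[OF open_UNIV bounded_bilinear_inner sm sm])
  have fl: "smooth_on UNIV (\<lambda>x. flat 0 (c + s * t x))" for c s
    by (rule smooth_on_compose[OF _ _ _ _ smooth_on_flat]) (auto intro!: smooth_on_add smooth_on_mult smooth_on_const t)
  \<comment> \<open>u vanishes from distance 2r on, v up to distance r, and never both at once. So u
    / (u + v) is smooth, equals 1 where v is zero and 0 where u is zero.\<close>
  define u v where "u = (\<lambda>x. flat 0 (4 * r\<^sup>2 + (-1) * t x))" and "v = (\<lambda>x. flat 0 (- r\<^sup>2 + 1 * t x))"
  have pos: "0 < u x + v x" for x
  proof -
    have "0 < 4 * r\<^sup>2 + (-1) * t x \<or> 0 < - r\<^sup>2 + 1 * t x" using assms zero_less_power[of r 2] by (smt (verit))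
    then show ?thesis by (auto simp: u_def v_def flat_def add_pos_nonneg add_nonneg_pos)
  qed
  define \<rho> where "\<rho> = (\<lambda>x. u x * inverse (u x + v x))"
  have uv: "smooth_on UNIV u" "smooth_on UNIV v" unfolding u_def v_def by (rule fl)+
  have ne: "u x + v x \<noteq> 0" for x using pos[of x] by simp
  have "smooth_on UNIV \<rho>"
    unfolding \<rho>_def
    by (rule smooth_on_mult[OF open_UNIV uv(1) smooth_on_inverse[OF open_UNIV ne smooth_on_add[OF open_UNIV uv]]])
  moreover have t': "t x = (dist a x)\<^sup>2" for x
    by (metis t_def dist_commute dist_norm power2_norm_eq_inner)
  have "\<rho> x = 1" if "dist a x < r" for x
  proof -
    have "v x = 0" using power_strict_mono[OF that, of 2] by (simp add: v_def flat_def t')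
    then show ?thesis using pos[of x] by (simp add: \<rho>_def)
  qed
  moreover have "\<rho> x = 0" if "2 * r < dist a x" for x
  proof -
    have "u x = 0" using power_strict_mono[OF that, of 2] assms by (simp add: u_def flat_def t' power_mult_distrib)
    then show ?thesis by (simp add: \<rho>_def)
  qed
  ultimately show thesis using that by blast
qed


subsection \<open>Hadamard's lemma\<close>

text \<open>Each differentiation in x pulls out one factor t by the chain rule. The weight t^m
  absorbs it, so these integrals form a class closed under differentiation, and the induction runs
  over all m and h at once.\<close>

lemma smooth_on_ray_average:
  fixes h :: "'e::euclidean_space \<Rightarrow> real"
  assumes "0 < r" "smooth_on (ball a r) h"
  shows "smooth_on (ball a r) (\<lambda>x. integral (cbox 0 1) (\<lambda>t. t ^ m * h (a + t *\<^sub>R (x - a))))"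
proof -
  have mem: "a + t *\<^sub>R (x - a) \<in> ball a r" if "x \<in> ball a r" "t \<in> cbox 0 1" for x t
  proof -
    have "(1 - t) *\<^sub>R a + t *\<^sub>R x \<in> ball a r"
      using that assms(1) by (intro convexD[OF convex_ball]) (auto simp: cbox_interval)
    then show ?thesis by (simp add: algebra_simps)
  qed
  have cont: "continuous_on (ball a r \<times> cbox 0 1) (\<lambda>(x, t). t ^ m * h (a + t *\<^sub>R (x - a)))"
    if "continuous_on (ball a r) h" for m and h :: "'e \<Rightarrow> real"
    unfolding split_beta
    using mem by (intro continuous_intros continuous_on_compose2[OF that]) auto
  have cont1: "continuous_on (cbox 0 1) (\<lambda>t. t ^ m * h (a + t *\<^sub>R (x - a)))"
    if "x \<in> ball a r" "continuous_on (ball a r) h" for m x and h :: "'e \<Rightarrow> real"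
  proof -
    have "continuous_on (cbox 0 1) (\<lambda>t. case (x, t) of (x, t) \<Rightarrow> t ^ m * h (a + t *\<^sub>R (x - a)))"
      using that(1) by (intro continuous_on_compose2[OF cont[OF that(2), of m]] continuous_intros) auto
    then show ?thesis by simp
  qed
  have "Ck_on k (ball a r) (\<lambda>x. integral (cbox 0 1) (\<lambda>t. t ^ m * h (a + t *\<^sub>R (x - a))))" for k
    using assms(2)
  proof (induction k arbitrary: m h)
    case (Suc k)
    note h = Suc.prems
    let ?h' = "\<lambda>v x. frechet_derivative h (at x) v"
    \<comment> \<open>Differentiation under the integral asks for a jointly continuous derivative
      with values in the bounded linear maps; its continuity is then checked componentwise.\<close>
    define F where "F = (\<lambda>x t. Blinfun (\<lambda>v. t ^ Suc m * ?h' v (a + t *\<^sub>R (x - a))))"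
    have hd: "(h has_derivative (\<lambda>v. ?h' v x)) (at x)" if "x \<in> ball a r" for x
      using smooth_on_imp_differentiable[OF h that] by (simp add: frechet_derivative_works)
    have lin: "bounded_linear (\<lambda>v. t ^ Suc m * ?h' v (a + t *\<^sub>R (x - a)))" if "x \<in> ball a r" "t \<in> cbox 0 1" for x t
      using has_derivative_bounded_linear[OF hd[OF mem[OF that]]]
      by (intro bounded_linear_const_mult)
    have F: "blinfun_apply (F x t) v = t ^ Suc m * ?h' v (a + t *\<^sub>R (x - a))" if "x \<in> ball a r" "t \<in> cbox 0 1" for x t v
      using lin[OF that] by (simp add: F_def bounded_linear_Blinfun_apply)
    have contF: "continuous_on (ball a r \<times> cbox 0 1) (\<lambda>(x, t). F x t)"
    proof (rule continuous_on_blinfun_componentwise)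
      fix i :: 'e
      have "continuous_on (ball a r \<times> cbox 0 1) (\<lambda>(x, t). t ^ Suc m * ?h' i (a + t *\<^sub>R (x - a)))"
        by (intro cont smooth_on_imp_continuous smooth_on_derivative h)
      then show "continuous_on (ball a r \<times> cbox 0 1) (\<lambda>x. blinfun_apply (case x of (x, t) \<Rightarrow> F x t) i)"
        by (rule continuous_on_cong[THEN iffD1, rotated 2]) (auto simp: F)
    qed
    have der: "((\<lambda>x. integral (cbox 0 1) (\<lambda>t. t ^ m * h (a + t *\<^sub>R (x - a)))) has_derivative
        blinfun_apply (integral (cbox 0 1) (F x))) (at x)" if x: "x \<in> ball a r" for x
    proof -
      have "((\<lambda>x. integral (cbox 0 1) (\<lambda>t. t ^ m * h (a + t *\<^sub>R (x - a)))) has_derivative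
        blinfun_apply (integral (cbox 0 1) (F x))) (at x within ball a r)"
      proof (rule leibniz_rule[OF _ _ contF x convex_ball])
        fix y t assume y: "y \<in> ball a r" and t: "t \<in> cbox (0::real) 1"
        have "((\<lambda>x. h (a + t *\<^sub>R (x - a))) has_derivative (\<lambda>v. ?h' (t *\<^sub>R v) (a + t *\<^sub>R (y - a)))) (at y)"
          by (rule has_derivative_compose[where f="\<lambda>x. a + t *\<^sub>R (x - a)", OF _ hd[OF mem[OF y t]]])
             (auto intro!: derivative_eq_intros)
        then have "((\<lambda>x. t ^ m * h (a + t *\<^sub>R (x - a))) has_derivative (\<lambda>v. t ^ m * ?h' (t *\<^sub>R v) (a + t *\<^sub>R (y - a)))) (at y)"
          by (intro has_derivative_mult_right)
        moreover have "?h' (t *\<^sub>R v) z = t * ?h' v z" if "z \<in> ball a r" for v z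
          using linear_scale[OF has_derivative_linear[OF hd[OF that]]] by simp
        ultimately have "((\<lambda>x. t ^ m * h (a + t *\<^sub>R (x - a))) has_derivative blinfun_apply (F y t)) (at y)"
          using mem[OF y t] by (elim has_derivative_eq_rhs) (simp add: F[OF y t] fun_eq_iff)
        then show "((\<lambda>x. t ^ m * h (a + t *\<^sub>R (x - a))) has_derivative blinfun_apply (F y t)) (at y within ball a r)"
          by (rule has_derivative_at_withinI)
      qed (intro integrable_continuous cont1 smooth_on_imp_continuous h)
      then show ?thesis using x by (simp add: at_within_open[OF x open_ball])
    qed
    show ?case
    proof (rule Ck_on_SucI[OF open_ball der])
      fix v
      have "Ck_on k (ball a r) (\<lambda>x. integral (cbox 0 1) (\<lambda>t. t ^ Suc m * ?h' v (a + t *\<^sub>R (x - a))))"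
        by (rule Suc.IH[OF smooth_on_derivative[OF h]])
      then show "Ck_on k (ball a r) (\<lambda>x. blinfun_apply (integral (cbox 0 1) (F x)) v)"
      proof (rule Ck_on_cong[OF open_ball, rotated])
        fix x assume x: "x \<in> ball a r"
        have "continuous_on (cbox 0 1) (F x)"
        proof -
          have "continuous_on (cbox 0 1) (\<lambda>t. case (x, t) of (x, t) \<Rightarrow> F x t)"
            using x by (intro continuous_on_compose2[OF contF] continuous_intros) auto
          then show ?thesis by simp
        qed
        then have "F x integrable_on cbox 0 1" by (rule integrable_continuous)
        from blinfun_apply_integral[OF this, of v]
        show "integral (cbox 0 1) (\<lambda>t. t ^ Suc m * ?h' v (a + t *\<^sub>R (x - a))) = blinfun_apply (integral (cbox 0 1) (F x)) v"
          using F[OF x] by (metis (no_types, lifting) Henstock_Kurzweil_Integration.integral_cong)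
      qed
    qed
  next
    case 0
    have "continuous_on (ball a r) (\<lambda>x. integral (cbox 0 1) (\<lambda>t. t ^ m * h (a + t *\<^sub>R (x - a))))"
      by (rule integral_continuous_on_param[OF cont[OF smooth_on_imp_continuous[OF 0]]])
    then show ?case by simp
  qed
  then show ?thesis by (simp add: smooth_on_def)
qed

text \<open>The coefficient for b is the integral of the b-th partial derivative along the segment
  from a to x, and the expansion is the fundamental theorem of calculus on that segment. At x = a
  the integrand is constant, which gives the coefficients there.\<close>

lemma Hadamard_lemma:
  fixes f :: "'e::euclidean_space \<Rightarrow> real"
  assumes "0 < r" "smooth_on (ball a r) f"
  obtains g where "\<And>b. smooth_on (ball a r) (g b)"
    "\<And>x. x \<in> ball a r \<Longrightarrow> f x = f a + (\<Sum>b\<in>Basis. ((x - a) \<bullet> b) * g b x)"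
    "\<And>b. g b a = frechet_derivative f (at a) b"
proof
  let ?f' = "\<lambda>v x. frechet_derivative f (at x) v"
  \<comment> \<open>The factor \<open>t ^ 0\<close> brings the integrand into the form of
    \<open>smooth_on_ray_average\<close>.\<close>
  let ?g = "\<lambda>b x. integral (cbox 0 1) (\<lambda>t. t ^ 0 * ?f' b (a + t *\<^sub>R (x - a)))"
  show "smooth_on (ball a r) (?g b)" for b
    by (rule smooth_on_ray_average[OF assms(1) smooth_on_derivative[OF assms(2)]])
  show "?g b a = ?f' b a" for b by simp
  fix x assume x: "x \<in> ball a r"
  have mem: "a + t *\<^sub>R (x - a) \<in> ball a r" if "t \<in> cbox 0 1" for t
  proof -
    have "(1 - t) *\<^sub>R a + t *\<^sub>R x \<in> ball a r"
      using that x assms(1) by (intro convexD[OF convex_ball]) (auto simp: cbox_interval)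
    then show ?thesis by (simp add: algebra_simps)
  qed
  have hd: "(f has_derivative (\<lambda>v. ?f' v y)) (at y)" if "y \<in> ball a r" for y
    using smooth_on_imp_differentiable[OF assms(2) that] by (simp add: frechet_derivative_works)
  have int: "(\<lambda>t. ?f' b (a + t *\<^sub>R (x - a))) integrable_on cbox 0 1" for b
    using mem by (intro integrable_continuous continuous_intros
        continuous_on_compose2[OF smooth_on_imp_continuous[OF smooth_on_derivative[OF assms(2)]]]) auto
  have "((\<lambda>t. ?f' (x - a) (a + t *\<^sub>R (x - a))) has_integral
      f (a + 1 *\<^sub>R (x - a)) - f (a + 0 *\<^sub>R (x - a))) {0..1}"
  proof (rule fundamental_theorem_of_calculus)
    fix t :: real assume t: "t \<in> {0..1}"
    have "((\<lambda>t. f (a + t *\<^sub>R (x - a))) has_derivative (\<lambda>s. ?f' (s *\<^sub>R (x - a)) (a + t *\<^sub>R (x - a)))) (at t)"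
      using t by (intro has_derivative_compose[where f="\<lambda>t. a + t *\<^sub>R (x - a)" and g=f, OF _ hd[OF mem]])
         (auto intro!: derivative_eq_intros)
    then show "((\<lambda>t. f (a + t *\<^sub>R (x - a))) has_vector_derivative ?f' (x - a) (a + t *\<^sub>R (x - a))) (at t within {0..1})"
      using linear_scale[OF has_derivative_linear[OF hd[OF mem]], of t] t
      by (auto simp: has_vector_derivative_def intro: has_derivative_at_withinI)
  qed auto
  then have "f x - f a = integral (cbox 0 1) (\<lambda>t. ?f' (x - a) (a + t *\<^sub>R (x - a)))"
    by (simp add: integral_unique cbox_interval)
  also have "\<dots> = integral (cbox 0 1) (\<lambda>t. \<Sum>b\<in>Basis. ((x - a) \<bullet> b) * ?f' b (a + t *\<^sub>R (x - a)))"
  proof (rule integral_cong)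
    fix t :: real assume "t \<in> cbox 0 1"
    then interpret linear "\<lambda>v. ?f' v (a + t *\<^sub>R (x - a))"
      using has_derivative_linear[OF hd[OF mem]] by blast
    show "?f' (x - a) (a + t *\<^sub>R (x - a)) = (\<Sum>b\<in>Basis. ((x - a) \<bullet> b) * ?f' b (a + t *\<^sub>R (x - a)))"
      by (subst euclidean_representation[symmetric, of "x - a"]) (simp only: sum scale real_scaleR_def)
  qed
  also have "\<dots> = (\<Sum>b\<in>Basis. ((x - a) \<bullet> b) * ?g b x)"
    using int by (subst integral_sum) (auto intro!: integrable_on_mult_right)
  finally show "f x = f a + (\<Sum>b\<in>Basis. ((x - a) \<bullet> b) * ?g b x)" by simp
qed


section \<open>Atlases admitting bump functions\<close>

text \<open>The topology induced by the atlas replaces the given topology of the manifold, so that no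
  topology has to be constructed on the cotangent manifold.\<close>

definition aopen :: "('a, 'e::euclidean_space) chart set \<Rightarrow> 'a set \<Rightarrow> bool" where
  "aopen A N \<longleftrightarrow> N \<subseteq> points A \<and> (\<forall>(U, \<phi>)\<in>A. open (\<phi> ` (U \<inter> N)))"

definition smooth_fun_on ::
    "('a, 'e::euclidean_space) chart set \<Rightarrow> 'a set \<Rightarrow> ('a \<Rightarrow> 'b::real_normed_vector) \<Rightarrow> bool" where
  "smooth_fun_on A N f \<longleftrightarrow> (\<forall>(U, \<phi>)\<in>A. smooth_on (\<phi> ` (U \<inter> N)) (f \<circ> inv_into U \<phi>))"

text \<open>Unlike \<^const>\<open>vector_fields\<close>, this puts no condition on \<open>X\<close> off the manifold.\<close>

definition vfield :: "('a, 'e::euclidean_space) chart set \<Rightarrow> ('a \<Rightarrow> 'a tvec) \<Rightarrow> bool" where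
  "vfield A X \<longleftrightarrow> (\<forall>p\<in>points A. X p \<in> tangent_space A p) \<and>
     (\<forall>f. smooth_fun A f \<longrightarrow> smooth_fun A (\<lambda>p. X p f))"

text \<open>The differential of f. The case distinction is the normalisation that
  \<open>cotangent_space\<close> and \<open>one_forms\<close> demand off the tangent spaces and off
  the manifold.\<close>

definition dform :: "('a, 'e::euclidean_space) chart set \<Rightarrow> ('a \<Rightarrow> real) \<Rightarrow> 'a \<Rightarrow> 'a covec" where
  "dform A f p = (\<lambda>v. if p \<in> points A \<and> v \<in> tangent_space A p then v f else 0)"

lemma chart_subset_points: "(U, \<phi>) \<in> A \<Longrightarrow> U \<subseteq> points A"
  by (force simp: points_def)

lemma pointsE: assumes "p \<in> points A" obtains U \<phi> where "(U, \<phi>) \<in> A" "p \<in> U"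
  using assms by (auto simp: points_def)

lemma smooth_fun_onD:
  "smooth_fun_on A N f \<Longrightarrow> (U, \<phi>) \<in> A \<Longrightarrow> smooth_on (\<phi> ` (U \<inter> N)) (f \<circ> inv_into U \<phi>)"
  unfolding smooth_fun_on_def by blast

lemma smooth_fun_iff_on: "smooth_fun A f \<longleftrightarrow> smooth_fun_on A (points A) f"
proof -
  have "U \<inter> points A = U" if "(U, \<phi>) \<in> A" for U \<phi> using chart_subset_points[OF that] by blast
  then show ?thesis unfolding smooth_fun_on_def smooth_fun_def by (auto split: prod.splits)
qed

lemma smooth_fun_on_subset: "smooth_fun_on A N f \<Longrightarrow> N' \<subseteq> N \<Longrightarrow> smooth_fun_on A N' f"
  unfolding smooth_fun_on_def by (fast intro: smooth_on_subset)

lemma smooth_fun_imp_on: "smooth_fun A f \<Longrightarrow> N \<subseteq> points A \<Longrightarrow> smooth_fun_on A N f"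
  using smooth_fun_iff_on smooth_fun_on_subset by blast

text \<open>Calculus without bump functions is kept apart, so that it is available on the cotangent
  manifold while the bump functions of the latter are still being built.\<close>

locale charted_space =
  fixes A :: "('a, 'e::euclidean_space) chart set"
  assumes chart_inj: "\<And>U \<phi>. (U, \<phi>) \<in> A \<Longrightarrow> inj_on \<phi> U"
    and overlap_open: "\<And>U \<phi> V \<psi>. (U, \<phi>) \<in> A \<Longrightarrow> (V, \<psi>) \<in> A \<Longrightarrow> open (\<phi> ` (U \<inter> V))"
    and transition_smooth: "\<And>U \<phi> V \<psi>. (U, \<phi>) \<in> A \<Longrightarrow> (V, \<psi>) \<in> A \<Longrightarrow>
          smooth_on (\<phi> ` (U \<inter> V)) (\<psi> \<circ> inv_into U \<phi>)"
begin

section \<open>Open sets and smooth functions of an atlas\<close>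

lemma aopen_image: "aopen A N \<Longrightarrow> (U, \<phi>) \<in> A \<Longrightarrow> open (\<phi> ` (U \<inter> N))"
  unfolding aopen_def by blast

lemma aopen_subset_points: "aopen A N \<Longrightarrow> N \<subseteq> points A"
  unfolding aopen_def by blast

lemma aopen_chart: "(U, \<phi>) \<in> A \<Longrightarrow> aopen A U"
  unfolding aopen_def using chart_subset_points overlap_open by (auto simp: Int_commute)

lemma aopen_points: "aopen A (points A)"
proof -
  have "U \<inter> points A = U \<inter> U" if "(U, \<phi>) \<in> A" for U \<phi> using chart_subset_points[OF that] by blast
  then show ?thesis unfolding aopen_def using overlap_open by (metis (no_types, lifting) case_prodI2 order_refl)
qed

lemma aopen_Int:
  assumes "aopen A N" "aopen A M"
  shows "aopen A (N \<inter> M)"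
  unfolding aopen_def
proof (intro conjI ballI)
  show "N \<inter> M \<subseteq> points A" using assms aopen_subset_points by blast
  fix c assume "c \<in> A"
  obtain U \<phi> where c: "c = (U, \<phi>)" by force
  then have "inj_on \<phi> U" using chart_inj \<open>c \<in> A\<close> by blast
  then have "\<phi> ` (U \<inter> (N \<inter> M)) = \<phi> ` (U \<inter> N) \<inter> \<phi> ` (U \<inter> M)"
    by (subst inj_on_image_Int[symmetric, of \<phi> U]) (auto intro: arg_cong[of _ _ "(`) \<phi>"])
  then show "case c of (U, \<phi>) \<Rightarrow> open (\<phi> ` (U \<inter> (N \<inter> M)))"
    using assms aopen_image \<open>c \<in> A\<close> by (simp add: c open_Int)
qed

lemma inv_chart: "(U, \<phi>) \<in> A \<Longrightarrow> q \<in> U \<Longrightarrow> inv_into U \<phi> (\<phi> q) = q"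
  by (simp add: chart_inj)

lemma aopen_Union:
  assumes "\<And>N. N \<in> NN \<Longrightarrow> aopen A N"
  shows "aopen A (\<Union>NN)"
proof -
  have "\<phi> ` (U \<inter> \<Union>NN) = (\<Union>N\<in>NN. \<phi> ` (U \<inter> N))" for U and \<phi> :: "'a \<Rightarrow> 'e" by auto
  then show ?thesis using assms unfolding aopen_def by (fastforce intro: open_UN)
qed

lemma smooth_fun_on_cong:
  assumes "aopen A N" "\<And>q. q \<in> N \<Longrightarrow> f q = g q" "smooth_fun_on A N f"
  shows "smooth_fun_on A N g"
  unfolding smooth_fun_on_def
proof clarify
  fix U \<phi> assume c: "(U, \<phi>) \<in> A"
  show "smooth_on (\<phi> ` (U \<inter> N)) (g \<circ> inv_into U \<phi>)"
    using smooth_fun_onD[OF assms(3) c] assms(2)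
    by (subst smooth_on_cong[OF aopen_image[OF assms(1) c], of _ "f \<circ> inv_into U \<phi>"]) (auto simp: inv_chart[OF c])
qed

lemma smooth_fun_cong: "(\<And>q. q \<in> points A \<Longrightarrow> f q = g q) \<Longrightarrow> smooth_fun A f \<Longrightarrow> smooth_fun A g"
  unfolding smooth_fun_iff_on using smooth_fun_on_cong[OF aopen_points] by blast

lemma smooth_fun_on_local:
  assumes "\<And>p. p \<in> N \<Longrightarrow> \<exists>M. aopen A M \<and> p \<in> M \<and> smooth_fun_on A M f"
  shows "smooth_fun_on A N f"
  unfolding smooth_fun_on_def
proof clarify
  fix U \<phi> assume c: "(U, \<phi>) \<in> A"
  show "smooth_on (\<phi> ` (U \<inter> N)) (f \<circ> inv_into U \<phi>)"
  proof (rule smooth_on_local)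
    fix x assume "x \<in> \<phi> ` (U \<inter> N)"
    then obtain p where p: "x = \<phi> p" "p \<in> U" "p \<in> N" by blast
    from assms[OF p(3)] obtain M where "aopen A M" "p \<in> M" "smooth_fun_on A M f" by blast
    then show "\<exists>S. open S \<and> x \<in> S \<and> smooth_on S (f \<circ> inv_into U \<phi>)"
      using p c by (intro exI[of _ "\<phi> ` (U \<inter> M)"]) (auto intro: aopen_image smooth_fun_onD)
  qed
qed

lemma smooth_fun_local:
  assumes "\<And>p. p \<in> points A \<Longrightarrow> \<exists>M. aopen A M \<and> p \<in> M \<and> smooth_fun_on A M f"
  shows "smooth_fun A f"
  unfolding smooth_fun_iff_on by (rule smooth_fun_on_local[OF assms])

lemma smooth_fun_on_const: "smooth_fun_on A N (\<lambda>q. c)"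
  unfolding smooth_fun_on_def comp_def using smooth_on_const by blast

lemma smooth_fun_on_linear:
  assumes "aopen A N" "bounded_linear L" "smooth_fun_on A N f"
  shows "smooth_fun_on A N (\<lambda>q. L (f q))"
  unfolding smooth_fun_on_def comp_def
proof clarify
  fix U \<phi> assume c: "(U, \<phi>) \<in> A"
  show "smooth_on (\<phi> ` (U \<inter> N)) (\<lambda>x. L (f (inv_into U \<phi> x)))"
    using smooth_on_bounded_linear[OF aopen_image[OF assms(1) c] assms(2) smooth_fun_onD[OF assms(3) c]] by simp
qed

lemma smooth_fun_on_bilinear:
  assumes "aopen A N" "bounded_bilinear B" "smooth_fun_on A N f" "smooth_fun_on A N g"
  shows "smooth_fun_on A N (\<lambda>q. B (f q) (g q))"
  unfolding smooth_fun_on_def comp_def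
proof clarify
  fix U \<phi> assume c: "(U, \<phi>) \<in> A"
  show "smooth_on (\<phi> ` (U \<inter> N)) (\<lambda>x. B (f (inv_into U \<phi> x)) (g (inv_into U \<phi> x)))"
    using smooth_on_bilinear[OF aopen_image[OF assms(1) c] assms(2) smooth_fun_onD[OF assms(3) c] smooth_fun_onD[OF assms(4) c]]
    by simp
qed

lemma smooth_fun_on_add:
  assumes "aopen A N" "smooth_fun_on A N f" "smooth_fun_on A N g"
  shows "smooth_fun_on A N (\<lambda>q. f q + g q)"
  unfolding smooth_fun_on_def comp_def
proof clarify
  fix U \<phi> assume c: "(U, \<phi>) \<in> A"
  show "smooth_on (\<phi> ` (U \<inter> N)) (\<lambda>x. f (inv_into U \<phi> x) + g (inv_into U \<phi> x))"
    using smooth_on_add[OF aopen_image[OF assms(1) c] smooth_fun_onD[OF assms(2) c] smooth_fun_onD[OF assms(3) c]]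
    by simp
qed

lemma smooth_fun_on_sum:
  assumes "aopen A N" "\<And>i. i \<in> I \<Longrightarrow> smooth_fun_on A N (f i)"
  shows "smooth_fun_on A N (\<lambda>q. \<Sum>i\<in>I. f i q)"
  using assms(2)
  by (induction I rule: infinite_finite_induct) (auto intro: smooth_fun_on_const smooth_fun_on_add[OF assms(1)])

lemma smooth_fun_on_inverse:
  fixes f :: "'a \<Rightarrow> 'b::real_normed_field"
  assumes "aopen A N" "smooth_fun_on A N f" "\<And>q. q \<in> N \<Longrightarrow> f q \<noteq> 0"
  shows "smooth_fun_on A N (\<lambda>q. inverse (f q))"
  unfolding smooth_fun_on_def comp_def
proof clarify
  fix U \<phi> assume c: "(U, \<phi>) \<in> A"
  have "(f \<circ> inv_into U \<phi>) x \<noteq> 0" if "x \<in> \<phi> ` (U \<inter> N)" for x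
    using that assms(3) by (auto simp: inv_chart[OF c])
  from smooth_on_inverse[OF aopen_image[OF assms(1) c] this smooth_fun_onD[OF assms(2) c]]
  show "smooth_on (\<phi> ` (U \<inter> N)) (\<lambda>x. inverse (f (inv_into U \<phi> x)))" by simp
qed

lemma smooth_fun_on_compose:
  fixes f :: "'a \<Rightarrow> 'f::euclidean_space"
  assumes "aopen A N" "smooth_fun_on A N f" "\<And>q. q \<in> N \<Longrightarrow> f q \<in> S" "open S" "smooth_on S g"
  shows "smooth_fun_on A N (\<lambda>q. g (f q))"
  unfolding smooth_fun_on_def comp_def
proof clarify
  fix U \<phi> assume c: "(U, \<phi>) \<in> A"
  have "(f \<circ> inv_into U \<phi>) ` (\<phi> ` (U \<inter> N)) \<subseteq> S"
    using assms(3) by (auto simp: inv_chart[OF c])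
  from smooth_on_compose[OF aopen_image[OF assms(1) c] assms(4) this smooth_fun_onD[OF assms(2) c] assms(5)]
  show "smooth_on (\<phi> ` (U \<inter> N)) (\<lambda>x. g (f (inv_into U \<phi> x)))" by simp
qed

lemma smooth_fun_on_chart:
  assumes "(U, \<phi>) \<in> A"
  shows "smooth_fun_on A U \<phi>"
  unfolding smooth_fun_on_def
proof clarify
  fix V \<psi> assume "(V, \<psi>) \<in> A"
  then show "smooth_on (\<psi> ` (V \<inter> U)) (\<phi> \<circ> inv_into V \<psi>)" by (rule transition_smooth[OF _ assms])
qed

text \<open>One chart suffices: f is its own coordinate expression composed with the chart map, and
  the latter is smooth in every other chart by smoothness of the transition maps.\<close>

lemma smooth_fun_on_in_chart:
  assumes "(U, \<phi>) \<in> A" "aopen A N" "N \<subseteq> U" "smooth_on (\<phi> ` N) (f \<circ> inv_into U \<phi>)"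
  shows "smooth_fun_on A N f"
proof -
  have UN: "U \<inter> N = N" using assms(3) by blast
  have "smooth_fun_on A N (\<lambda>q. (f \<circ> inv_into U \<phi>) (\<phi> q))"
    using aopen_image[OF assms(2,1)]
    by (intro smooth_fun_on_compose[OF assms(2) smooth_fun_on_subset[OF smooth_fun_on_chart[OF assms(1)] assms(3)] _ _ assms(4)])
      (simp_all add: UN)
  then show ?thesis
    using assms(3) by (elim smooth_fun_on_cong[OF assms(2), rotated]) (auto simp: inv_chart[OF assms(1)])
qed

lemma aopen_vimage:
  fixes f :: "'a \<Rightarrow> 'b::real_normed_vector"
  assumes "aopen A N" "smooth_fun_on A N f" "open W"
  shows "aopen A {q \<in> N. f q \<in> W}"
  unfolding aopen_def
proof (intro conjI ballI)
  show "{q \<in> N. f q \<in> W} \<subseteq> points A" using aopen_subset_points[OF assms(1)] by blast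
  fix c assume "c \<in> A"
  then obtain U \<phi> where c: "c = (U, \<phi>)" "(U, \<phi>) \<in> A" by (metis surj_pair)
  have "\<phi> ` (U \<inter> {q \<in> N. f q \<in> W}) = \<phi> ` (U \<inter> N) \<inter> (f \<circ> inv_into U \<phi>) -` W"
    by (auto simp: inv_chart[OF c(2)])
  then show "case c of (U, \<phi>) \<Rightarrow> open (\<phi> ` (U \<inter> {q \<in> N. f q \<in> W}))"
    using continuous_open_preimage[OF smooth_on_imp_continuous[OF smooth_fun_onD[OF assms(2) c(2)]]
        aopen_image[OF assms(1) c(2)] assms(3)] c(1) by simp
qed

lemma smooth_fun_const: "smooth_fun A (\<lambda>q. c)"
  unfolding smooth_fun_iff_on by (rule smooth_fun_on_const)

lemma smooth_fun_add: "smooth_fun A f \<Longrightarrow> smooth_fun A g \<Longrightarrow> smooth_fun A (\<lambda>q. f q + g q)"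
  unfolding smooth_fun_iff_on by (rule smooth_fun_on_add[OF aopen_points])

lemma smooth_fun_bilinear:
  "bounded_bilinear B \<Longrightarrow> smooth_fun A f \<Longrightarrow> smooth_fun A g \<Longrightarrow> smooth_fun A (\<lambda>q. B (f q) (g q))"
  unfolding smooth_fun_iff_on by (rule smooth_fun_on_bilinear[OF aopen_points])

lemmas smooth_fun_mult = smooth_fun_bilinear[OF bounded_bilinear_mult]
lemma smooth_fun_linear: "bounded_linear L \<Longrightarrow> smooth_fun A f \<Longrightarrow> smooth_fun A (\<lambda>q. L (f q))"
  unfolding smooth_fun_iff_on by (rule smooth_fun_on_linear[OF aopen_points])

lemma smooth_fun_minus: "smooth_fun A f \<Longrightarrow> smooth_fun A (\<lambda>q. - f q)"
  by (rule smooth_fun_linear[OF bounded_linear_minus[OF bounded_linear_ident]])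

lemma smooth_fun_diff: "smooth_fun A f \<Longrightarrow> smooth_fun A g \<Longrightarrow> smooth_fun A (\<lambda>q. f q - g q)"
  using smooth_fun_add[of f "\<lambda>q. - g q"] smooth_fun_minus by auto

lemma smooth_fun_sum: "(\<And>i. i \<in> I \<Longrightarrow> smooth_fun A (f i)) \<Longrightarrow> smooth_fun A (\<lambda>q. \<Sum>i\<in>I. f i q)"
  unfolding smooth_fun_iff_on by (rule smooth_fun_on_sum[OF aopen_points])

lemmas smooth_fun_intros = smooth_fun_const smooth_fun_add smooth_fun_diff smooth_fun_minus
  smooth_fun_mult smooth_fun_sum

end

text \<open>C is a closed set containing the support. If the bump function merely vanished off N,
  extension by zero could fail to be smooth at boundary points of N; the open complement of C gives
  each of them a neighbourhood on which the product is zero.\<close>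

locale smooth_atlas = charted_space A for A :: "('a, 'e::euclidean_space) chart set" +
  assumes bump: "\<And>N p. aopen A N \<Longrightarrow> p \<in> N \<Longrightarrow> \<exists>\<kappa> C M. smooth_fun A (\<kappa> :: 'a \<Rightarrow> real) \<and> C \<subseteq> N \<and>
          aopen A (points A - C) \<and> (\<forall>q. \<kappa> q \<noteq> 0 \<longrightarrow> q \<in> C) \<and>
          aopen A M \<and> p \<in> M \<and> M \<subseteq> N \<and> (\<forall>q\<in>M. \<kappa> q = 1)"
begin

text \<open>N and the complement of C cover the manifold: on the first the product with f is smooth,
  on the second it is zero.\<close>

lemma bump_obtain:
  assumes "aopen A N" "p \<in> N"
  obtains \<kappa> :: "'a \<Rightarrow> real" and M where "smooth_fun A \<kappa>" "aopen A M" "p \<in> M" "M \<subseteq> N"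
    "\<And>q. q \<in> M \<Longrightarrow> \<kappa> q = 1" "\<And>q. q \<notin> N \<Longrightarrow> \<kappa> q = 0"
    "\<And>f :: 'a \<Rightarrow> 'b::real_normed_vector. smooth_fun_on A N f \<Longrightarrow> smooth_fun A (\<lambda>q. \<kappa> q *\<^sub>R f q)"
proof -
  obtain \<kappa> :: "'a \<Rightarrow> real" and C M where \<kappa>: "smooth_fun A \<kappa>" "C \<subseteq> N" "aopen A (points A - C)"
    "\<And>q. \<kappa> q \<noteq> 0 \<Longrightarrow> q \<in> C" "aopen A M" "p \<in> M" "M \<subseteq> N" "\<And>q. q \<in> M \<Longrightarrow> \<kappa> q = 1"
    using bump[OF assms] by metis
  moreover have "smooth_fun A (\<lambda>q. \<kappa> q *\<^sub>R f q)" if "smooth_fun_on A N f" for f :: "'a \<Rightarrow> 'b"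
  proof (rule smooth_fun_local)
    fix q assume q: "q \<in> points A"
    show "\<exists>M. aopen A M \<and> q \<in> M \<and> smooth_fun_on A M (\<lambda>q. \<kappa> q *\<^sub>R f q)"
    proof (cases "q \<in> N")
      case True
      then show ?thesis
        using assms(1) that smooth_fun_imp_on[OF \<kappa>(1) aopen_subset_points[OF assms(1)]]
        by (intro exI[of _ N]) (auto intro: smooth_fun_on_bilinear[OF assms(1) bounded_bilinear_scaleR])
    next
      case False
      have "smooth_fun_on A (points A - C) (\<lambda>q. \<kappa> q *\<^sub>R f q)"
        by (rule smooth_fun_on_cong[OF \<kappa>(3) _ smooth_fun_on_const[of _ 0]]) (use \<kappa>(4) in force)
      then show ?thesis using False \<kappa>(2,3) q by blast
    qed
  qed
  ultimately show thesis using that by blast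
qed

text \<open>Derivations act on globally smooth functions only. A function given near p reaches them
  through a global function with the same germ.\<close>

lemma extend_germ:
  fixes f :: "'a \<Rightarrow> 'b::real_normed_vector"
  assumes "aopen A N" "p \<in> N" "smooth_fun_on A N f"
  obtains g M where "smooth_fun A g" "aopen A M" "p \<in> M" "M \<subseteq> N" "\<And>q. q \<in> M \<Longrightarrow> g q = f q"
proof -
  obtain \<kappa> :: "'a \<Rightarrow> real" and M where "smooth_fun A \<kappa>" "aopen A M" "p \<in> M" "M \<subseteq> N"
    "\<And>q. q \<in> M \<Longrightarrow> \<kappa> q = 1" "\<And>q. q \<notin> N \<Longrightarrow> \<kappa> q = 0"
    "\<And>f :: 'a \<Rightarrow> 'b. smooth_fun_on A N f \<Longrightarrow> smooth_fun A (\<lambda>q. \<kappa> q *\<^sub>R f q)"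
    using bump_obtain[OF assms(1,2)] by metis
  then show thesis using that[of "\<lambda>q. \<kappa> q *\<^sub>R f q" M] assms(3) by simp
qed


subsection \<open>Tangent vectors\<close>

lemma tangent_lin:
  "v \<in> tangent_space A p \<Longrightarrow> smooth_fun A f \<Longrightarrow> smooth_fun A g \<Longrightarrow>
     v (\<lambda>q. a * f q + b * g q) = a * v f + b * v g"
  unfolding tangent_space_def by blast

lemma tangent_mult:
  "v \<in> tangent_space A p \<Longrightarrow> smooth_fun A f \<Longrightarrow> smooth_fun A g \<Longrightarrow>
     v (\<lambda>q. f q * g q) = f p * v g + g p * v f"
  unfolding tangent_space_def by blast

lemma tangent_nonsmooth: "v \<in> tangent_space A p \<Longrightarrow> \<not> smooth_fun A f \<Longrightarrow> v f = 0"
  unfolding tangent_space_def by blast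

lemma tangent_add:
  "v \<in> tangent_space A p \<Longrightarrow> smooth_fun A f \<Longrightarrow> smooth_fun A g \<Longrightarrow> v (\<lambda>q. f q + g q) = v f + v g"
  using tangent_lin[of v p f g 1 1] by simp

lemma tangent_diff:
  "v \<in> tangent_space A p \<Longrightarrow> smooth_fun A f \<Longrightarrow> smooth_fun A g \<Longrightarrow> v (\<lambda>q. f q - g q) = v f - v g"
  using tangent_lin[of v p f g 1 "-1"] by simp

lemma tangent_scale: "v \<in> tangent_space A p \<Longrightarrow> smooth_fun A f \<Longrightarrow> v (\<lambda>q. a * f q) = a * v f"
  using tangent_lin[of v p f f a 0] by simp

lemma tangent_const: "v \<in> tangent_space A p \<Longrightarrow> v (\<lambda>q. c) = 0"
  using tangent_mult[of v p "\<lambda>q. 1" "\<lambda>q. 1"] tangent_scale[of v p "\<lambda>q. 1" c]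
  by (simp add: smooth_fun_const)

lemma tangent_sum:
  "v \<in> tangent_space A p \<Longrightarrow> (\<And>i. i \<in> I \<Longrightarrow> smooth_fun A (f i)) \<Longrightarrow>
     v (\<lambda>q. \<Sum>i\<in>I. f i q) = (\<Sum>i\<in>I. v (f i))"
proof (induction I rule: infinite_finite_induct)
  case (insert i I)
  then have "v (\<lambda>q. f i q + (\<Sum>i\<in>I. f i q)) = v (f i) + v (\<lambda>q. \<Sum>i\<in>I. f i q)"
    by (intro tangent_add smooth_fun_sum) auto
  then show ?case using insert by simp
qed (simp_all add: tangent_const)

text \<open>A bump function times f - g is identically zero. Leibniz' rule at p, where the bump
  function is 1 and f - g vanishes, leaves v f - v g = 0.\<close>

lemma tangent_local:
  assumes "v \<in> tangent_space A p" "aopen A N" "p \<in> N" "smooth_fun A f" "smooth_fun A g"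
    and "\<And>q. q \<in> N \<Longrightarrow> f q = g q"
  shows "v f = v g"
proof -
  obtain \<kappa> :: "'a \<Rightarrow> real" and M where \<kappa>: "smooth_fun A \<kappa>" "p \<in> M"
    "\<And>q. q \<in> M \<Longrightarrow> \<kappa> q = 1" "\<And>q. q \<notin> N \<Longrightarrow> \<kappa> q = 0"
    using bump_obtain[OF assms(2,3)] by metis
  have "(\<lambda>q. \<kappa> q * (f q - g q)) = (\<lambda>q. 0)" using \<kappa>(4) assms(6) by fastforce
  then have "0 = v (\<lambda>q. \<kappa> q * (f q - g q))" by (simp add: tangent_const[OF assms(1)])
  also have "\<dots> = v f - v g"
    using \<kappa> assms(3,6) by (simp add: tangent_mult[OF assms(1)] tangent_diff[OF assms(1)] smooth_fun_diff assms(4,5))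
  finally show ?thesis by simp
qed

text \<open>Values off the manifold do not count. This covers non-smooth functions as well:
  smoothness ignores those values, and v is zero on non-smooth functions by convention.\<close>

lemma tangent_cong:
  assumes "v \<in> tangent_space A p" "p \<in> points A" "\<And>q. q \<in> points A \<Longrightarrow> f q = g q"
  shows "v f = v g"
proof (cases "smooth_fun A f")
  case True
  show ?thesis by (rule tangent_local[OF assms(1) aopen_points assms(2) True smooth_fun_cong[OF assms(3) True] assms(3)])
next
  case False
  then have "\<not> smooth_fun A g" using smooth_fun_cong[of g f] assms(3) by auto
  then show ?thesis using False assms(1) tangent_nonsmooth by metis
qed

lemma tangent_space_zero: "(\<lambda>f. 0) \<in> tangent_space A p"
  by (simp add: tangent_space_def)

lemma tangent_space_lin:
  "v \<in> tangent_space A p \<Longrightarrow> w \<in> tangent_space A p \<Longrightarrow> (\<lambda>f. a * v f + b * w f) \<in> tangent_space A p"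
  unfolding tangent_space_def by (auto simp: algebra_simps)

lemma tangent_space_add: "v \<in> tangent_space A p \<Longrightarrow> w \<in> tangent_space A p \<Longrightarrow> (\<lambda>f. v f + w f) \<in> tangent_space A p"
  using tangent_space_lin[of v p w 1 1] by simp

lemma tangent_space_diff: "v \<in> tangent_space A p \<Longrightarrow> w \<in> tangent_space A p \<Longrightarrow> (\<lambda>f. v f - w f) \<in> tangent_space A p"
  using tangent_space_lin[of v p w 1 "-1"] by simp

lemma tangent_space_scale: "v \<in> tangent_space A p \<Longrightarrow> (\<lambda>f. a * v f) \<in> tangent_space A p"
  using tangent_space_lin[of v p v a 0] by simp

lemma tangent_space_sum:
  "(\<And>i. i \<in> I \<Longrightarrow> v i \<in> tangent_space A p) \<Longrightarrow> (\<lambda>f. \<Sum>i\<in>I. v i f) \<in> tangent_space A p"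
  by (induction I rule: infinite_finite_induct) (simp_all add: tangent_space_zero tangent_space_add)

lemma tangent_eqI:
  assumes "v \<in> tangent_space A p" "w \<in> tangent_space A p" "\<And>f. smooth_fun A f \<Longrightarrow> v f = w f"
  shows "v = w"
  using assms tangent_nonsmooth by (metis ext)

lemma coord_vec_derivative:
  assumes "(U, \<phi>) \<in> A" "p \<in> U" "smooth_fun A f"
  shows "((f \<circ> inv_into U \<phi>) has_derivative (\<lambda>e. coord_vec A (U, \<phi>) e p f)) (at (\<phi> p))"
proof -
  have "smooth_on (\<phi> ` U) (f \<circ> inv_into U \<phi>)" using assms unfolding smooth_fun_def by blast
  from smooth_on_imp_differentiable[OF this] assms(2) show ?thesis
    by (simp add: coord_vec_def assms(3) frechet_derivative_works)
qed

lemma coord_vec_unique: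
  assumes "(U, \<phi>) \<in> A" "p \<in> U" "smooth_fun A f" "((f \<circ> inv_into U \<phi>) has_derivative f') (at (\<phi> p))"
  shows "coord_vec A (U, \<phi>) e p f = f' e"
  using has_derivative_unique[OF coord_vec_derivative[OF assms(1-3)] assms(4)] by metis

lemma coord_vec_in_tangent_space:
  assumes "(U, \<phi>) \<in> A" "p \<in> U"
  shows "coord_vec A (U, \<phi>) e p \<in> tangent_space A p"
proof -
  have "coord_vec A (U, \<phi>) e p (\<lambda>q. a * f q + b * g q) = a * coord_vec A (U, \<phi>) e p f + b * coord_vec A (U, \<phi>) e p g"
    if "smooth_fun A f" "smooth_fun A g" for f g a b
  proof (rule coord_vec_unique[OF assms])
    show "((\<lambda>q. a * f q + b * g q) \<circ> inv_into U \<phi> has_derivative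
        (\<lambda>e. a * coord_vec A (U, \<phi>) e p f + b * coord_vec A (U, \<phi>) e p g)) (at (\<phi> p))"
      using coord_vec_derivative[OF assms that(1)] coord_vec_derivative[OF assms that(2)]
      unfolding comp_def by (auto intro!: derivative_eq_intros)
  qed (intro smooth_fun_intros that)
  moreover have "coord_vec A (U, \<phi>) e p (\<lambda>q. f q * g q) = f p * coord_vec A (U, \<phi>) e p g + g p * coord_vec A (U, \<phi>) e p f"
    if "smooth_fun A f" "smooth_fun A g" for f g
  proof (rule coord_vec_unique[OF assms])
    show "((\<lambda>q. f q * g q) \<circ> inv_into U \<phi> has_derivative
        (\<lambda>e. f p * coord_vec A (U, \<phi>) e p g + g p * coord_vec A (U, \<phi>) e p f)) (at (\<phi> p))"
      using has_derivative_mult[OF coord_vec_derivative[OF assms that(1)] coord_vec_derivative[OF assms that(2)]]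
      unfolding comp_def by (simp add: inv_chart[OF assms] algebra_simps)
  qed (intro smooth_fun_intros that)
  ultimately show ?thesis unfolding tangent_space_def by (simp add: coord_vec_def)
qed

lemma smooth_coord_vec:
  assumes "(U, \<phi>) \<in> A" "smooth_fun A f"
  shows "smooth_fun_on A U (\<lambda>q. coord_vec A (U, \<phi>) e q f)"
proof (rule smooth_fun_on_in_chart[OF assms(1) aopen_chart[OF assms(1)] order_refl])
  have o: "open (\<phi> ` U)" using overlap_open[OF assms(1,1)] by simp
  have "smooth_on (\<phi> ` U) (f \<circ> inv_into U \<phi>)" using assms unfolding smooth_fun_def by blast
  from smooth_on_derivative[OF this, of e]
  show "smooth_on (\<phi> ` U) ((\<lambda>q. coord_vec A (U, \<phi>) e q f) \<circ> inv_into U \<phi>)"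
    by (rule smooth_on_cong[OF o, THEN iffD1, rotated])
       (auto simp: coord_vec_def assms(2) inv_chart[OF assms(1)])
qed

text \<open>By Hadamard's lemma f is, near p, its value at p plus coordinate differences times
  smooth coefficients, and a derivation sees only the values of the coefficients at p, which are the
  partial derivatives of f. The coordinates enter as global functions \<open>\<xi>\<close> agreeing
  with the chart on N, since v cannot act on the chart itself.\<close>

lemma tangent_expand:
  assumes "v \<in> tangent_space A p" "(U, \<phi>) \<in> A" "aopen A N" "p \<in> N" "N \<subseteq> U"
    and \<xi>: "\<And>b. b \<in> Basis \<Longrightarrow> smooth_fun A (\<xi> b)" "\<And>b q. b \<in> Basis \<Longrightarrow> q \<in> N \<Longrightarrow> \<xi> b q = \<phi> q \<bullet> b"
    and f: "smooth_fun A f"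
  shows "v f = (\<Sum>b\<in>Basis. v (\<xi> b) * coord_vec A (U, \<phi>) b p f)"
proof -
  have UN: "U \<inter> N = N" and pU: "p \<in> U" using assms by blast+
  have "open (\<phi> ` N)" using aopen_image[OF assms(3,2)] UN by simp
  then obtain r where r: "0 < r" "ball (\<phi> p) r \<subseteq> \<phi> ` N"
    using assms(4) open_contains_ball by blast
  have F: "smooth_on (\<phi> ` U) (f \<circ> inv_into U \<phi>)" using f assms(2) unfolding smooth_fun_def by blast
  have "ball (\<phi> p) r \<subseteq> \<phi> ` U" using r(2) assms(5) by blast
  then obtain g where g: "\<And>b. smooth_on (ball (\<phi> p) r) (g b)"
    "\<And>x. x \<in> ball (\<phi> p) r \<Longrightarrow> (f \<circ> inv_into U \<phi>) x = (f \<circ> inv_into U \<phi>) (\<phi> p) + (\<Sum>b\<in>Basis. ((x - \<phi> p) \<bullet> b) * g b x)"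
    "\<And>b. g b (\<phi> p) = frechet_derivative (f \<circ> inv_into U \<phi>) (at (\<phi> p)) b"
    using Hadamard_lemma[OF r(1) smooth_on_subset[OF F]] by blast
  define M where "M = {q \<in> N. \<phi> q \<in> ball (\<phi> p) r}"
  have M: "aopen A M" "p \<in> M" "M \<subseteq> N"
    unfolding M_def using r(1) assms(4)
      aopen_vimage[OF assms(3) smooth_fun_on_subset[OF smooth_fun_on_chart[OF assms(2)] assms(5)] open_ball]
    by auto
  \<comment> \<open>The Hadamard coefficients exist only on a ball of the chart. Global functions
    with the same germs replace them, each valid on its own neighbourhood; the basis is finite, so
    these neighbourhoods have an open intersection.\<close>
  have "\<exists>G K. smooth_fun A G \<and> aopen A K \<and> p \<in> K \<and> K \<subseteq> M \<and> (\<forall>q\<in>K. G q = g b (\<phi> q))" for b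
  proof -
    have "smooth_fun_on A M (\<lambda>q. g b (\<phi> q))"
      using M assms(5) by (intro smooth_fun_on_compose[OF M(1) _ _ open_ball g(1)]
          smooth_fun_on_subset[OF smooth_fun_on_chart[OF assms(2)]]) (auto simp: M_def)
    from extend_germ[OF M(1,2) this] show ?thesis by metis
  qed
  then obtain G K where G: "\<And>b. smooth_fun A (G b)" "\<And>b. aopen A (K b)" "\<And>b. p \<in> K b"
    "\<And>b. K b \<subseteq> M" "\<And>b q. q \<in> K b \<Longrightarrow> G b q = g b (\<phi> q)" by metis
  define K' where "K' = M \<inter> (\<Inter>b\<in>Basis. K b)"
  have "aopen A (M \<inter> (\<Inter>b\<in>B. K b))" if "finite B" for B
    using that
  proof induction
    case (insert b B)
    have "M \<inter> (\<Inter>b\<in>insert b B. K b) = K b \<inter> (M \<inter> (\<Inter>b\<in>B. K b))" by auto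
    then show ?case using insert G(2) aopen_Int by metis
  qed (simp add: M(1))
  then have K': "aopen A K'" "p \<in> K'" by (auto simp: K'_def M(2) G(3))
  have eq: "f q = f p + (\<Sum>b\<in>Basis. (\<xi> b q - \<xi> b p) * G b q)" if "q \<in> K'" for q
  proof -
    have q: "q \<in> M" "q \<in> N" "q \<in> U" "\<And>b. b \<in> Basis \<Longrightarrow> q \<in> K b" using that M(3) assms(5) by (auto simp: K'_def)
    then have "\<phi> q \<in> ball (\<phi> p) r" by (simp add: M_def)
    from g(2)[OF this] show ?thesis
      using q assms(4) by (auto simp: inv_chart[OF assms(2)] pU \<xi>(2) G(5) inner_diff_left intro!: sum.cong)
  qed
  have "v f = v (\<lambda>q. f p + (\<Sum>b\<in>Basis. (\<xi> b q - \<xi> b p) * G b q))"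
    by (rule tangent_local[OF assms(1) K' f _ eq]) (auto intro!: smooth_fun_intros \<xi>(1) G(1))
  also have "\<dots> = (\<Sum>b\<in>Basis. v (\<lambda>q. (\<xi> b q - \<xi> b p) * G b q))"
    by (subst tangent_add[OF assms(1)], (intro smooth_fun_intros \<xi>(1) G(1); assumption)+,
        subst tangent_sum[OF assms(1)], (intro smooth_fun_intros \<xi>(1) G(1); assumption)+)
      (simp add: tangent_const[OF assms(1)])
  also have "\<dots> = (\<Sum>b\<in>Basis. G b p * v (\<xi> b))"
    using \<xi>(1) G(1) by (intro sum.cong refl) (simp add: tangent_mult[OF assms(1)] tangent_diff[OF assms(1)]
        tangent_const[OF assms(1)] smooth_fun_intros)
  also have "\<dots> = (\<Sum>b\<in>Basis. v (\<xi> b) * coord_vec A (U, \<phi>) b p f)"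
    using G(3,5) g(3) by (intro sum.cong refl) (simp add: coord_vec_def f)
  finally show ?thesis .
qed

lemma coord_vec_coord:
  assumes "(U, \<phi>) \<in> A" "aopen A N" "p \<in> N" "N \<subseteq> U" "smooth_fun A f" "bounded_linear L"
    and "\<And>q. q \<in> N \<Longrightarrow> f q = L (\<phi> q)"
  shows "coord_vec A (U, \<phi>) e p f = L e"
proof (rule coord_vec_unique[OF assms(1) _ assms(5)])
  have "open (\<phi> ` (U \<inter> N))" by (rule aopen_image[OF assms(2,1)])
  moreover have "\<phi> p \<in> \<phi> ` (U \<inter> N)" using assms(3,4) by blast
  moreover have "L x = (f \<circ> inv_into U \<phi>) x" if "x \<in> \<phi> ` (U \<inter> N)" for x
    using that assms(4,7) by (auto simp: inv_chart[OF assms(1)])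
  ultimately show "(f \<circ> inv_into U \<phi> has_derivative L) (at (\<phi> p))"
    by (rule has_derivative_transform_within_open[OF bounded_linear_imp_has_derivative[OF assms(6)]])
qed (use assms in blast)


subsection \<open>Vector fields, one-forms and local frames\<close>

lemma vector_fields_iff: "X \<in> vector_fields A \<longleftrightarrow> vfield A X \<and> (\<forall>p. p \<notin> points A \<longrightarrow> X p = (\<lambda>f. 0))"
  unfolding vector_fields_def vfield_def by blast

lemma vfield_tangent: "vfield A X \<Longrightarrow> p \<in> points A \<Longrightarrow> X p \<in> tangent_space A p"
  and vfield_smooth: "vfield A X \<Longrightarrow> smooth_fun A f \<Longrightarrow> smooth_fun A (\<lambda>p. X p f)"
  unfolding vfield_def by blast+

lemma vf_tangent: "X \<in> vector_fields A \<Longrightarrow> X p \<in> tangent_space A p"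
  unfolding vector_fields_def by (cases "p \<in> points A") (auto simp: tangent_space_zero)

lemma vf_smooth: "X \<in> vector_fields A \<Longrightarrow> smooth_fun A f \<Longrightarrow> smooth_fun A (\<lambda>p. X p f)"
  and vf_vfield: "X \<in> vector_fields A \<Longrightarrow> vfield A X"
  unfolding vector_fields_def vfield_def by blast+

lemma vfield_add: "vfield A X \<Longrightarrow> vfield A Y \<Longrightarrow> vfield A (\<lambda>p f. X p f + Y p f)"
  unfolding vfield_def by (auto intro: tangent_space_add smooth_fun_intros)

lemma vfield_scale: "smooth_fun A h \<Longrightarrow> vfield A X \<Longrightarrow> vfield A (\<lambda>p f. h p * X p f)"
  unfolding vfield_def by (auto intro: tangent_space_scale smooth_fun_intros)

lemma vf_add: "X \<in> vector_fields A \<Longrightarrow> Y \<in> vector_fields A \<Longrightarrow> (\<lambda>p f. X p f + Y p f) \<in> vector_fields A"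
  unfolding vector_fields_iff using vfield_add by auto

lemma vf_scale: "smooth_fun A h \<Longrightarrow> X \<in> vector_fields A \<Longrightarrow> (\<lambda>p f. h p * X p f) \<in> vector_fields A"
  unfolding vector_fields_iff using vfield_scale by auto

lemma vf_zero: "(\<lambda>p f. 0) \<in> vector_fields A"
  unfolding vector_fields_def by (simp add: tangent_space_zero smooth_fun_const)

lemma vf_minus: "X \<in> vector_fields A \<Longrightarrow> (\<lambda>p f. - X p f) \<in> vector_fields A"
  using vf_scale[OF smooth_fun_const, of X "-1"] by simp

lemma vf_diff: "X \<in> vector_fields A \<Longrightarrow> Y \<in> vector_fields A \<Longrightarrow> (\<lambda>p f. X p f - Y p f) \<in> vector_fields A"
  using vf_add[OF _ vf_minus, of X Y] by simp

lemma vf_sum: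
  "(\<And>i. i \<in> I \<Longrightarrow> X i \<in> vector_fields A) \<Longrightarrow> (\<lambda>p f. \<Sum>i\<in>I. X i p f) \<in> vector_fields A"
  by (induction I rule: infinite_finite_induct) (simp_all add: vf_zero vf_add)

text \<open>Coordinates and coordinate fields of a chart, replaced by global objects that agree with
  them on M, together with a cut-off \<open>\<kappa>\<close> that is 1 on N and 0 off M. Global
  objects are required because connections and brackets take global fields. N and M are kept apart
  so that a function known on M only becomes global after multiplication by \<open>\<kappa>\<close>
  and is unchanged on N.\<close>

definition local_frame ::
    "'a set \<Rightarrow> ('a \<Rightarrow> 'e) \<Rightarrow> 'a \<Rightarrow> ('a \<Rightarrow> real) \<Rightarrow> 'a set \<Rightarrow> 'a set \<Rightarrow> ('e \<Rightarrow> 'a \<Rightarrow> real) \<Rightarrow> ('e \<Rightarrow> 'a \<Rightarrow> 'a tvec) \<Rightarrow> bool"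
  where "local_frame U \<phi> p \<kappa> N M \<xi> e \<longleftrightarrow>
    smooth_fun A \<kappa> \<and> aopen A N \<and> p \<in> N \<and> aopen A M \<and> N \<subseteq> M \<and> M \<subseteq> U \<and>
    (\<forall>q\<in>N. \<kappa> q = 1) \<and> (\<forall>q. q \<notin> M \<longrightarrow> \<kappa> q = 0) \<and>
    (\<forall>b. smooth_fun A (\<xi> b)) \<and> (\<forall>b. e b \<in> vector_fields A) \<and>
    (\<forall>q\<in>M. \<forall>b. \<xi> b q = \<phi> q \<bullet> b \<and> e b q = coord_vec A (U, \<phi>) b q) \<and>
    (\<forall>q\<in>M. \<forall>b c. e b q (\<xi> c) = b \<bullet> c) \<and>
    (\<forall>q\<in>M. \<forall>v\<in>tangent_space A q. \<forall>f. smooth_fun A f \<longrightarrow> v f = (\<Sum>b\<in>Basis. v (\<xi> b) * e b q f)) \<and>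
    (\<forall>f. smooth_fun_on A M f \<longrightarrow> smooth_fun A (\<lambda>q. \<kappa> q * f q))"

lemma local_frameD:
  assumes "local_frame U \<phi> p \<kappa> N M \<xi> e"
  shows "smooth_fun A \<kappa>" "aopen A N" "p \<in> N" "aopen A M" "N \<subseteq> M" "M \<subseteq> U" "p \<in> M" "p \<in> points A"
    "\<And>q. q \<in> N \<Longrightarrow> \<kappa> q = 1" "\<And>q. q \<notin> M \<Longrightarrow> \<kappa> q = 0" "\<And>b. smooth_fun A (\<xi> b)" "\<And>b. e b \<in> vector_fields A"
    "\<And>q b. q \<in> M \<Longrightarrow> \<xi> b q = \<phi> q \<bullet> b" "\<And>q b. q \<in> M \<Longrightarrow> e b q = coord_vec A (U, \<phi>) b q"
    "\<And>q b c. q \<in> M \<Longrightarrow> e b q (\<xi> c) = b \<bullet> c"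
    "\<And>q v f. q \<in> M \<Longrightarrow> v \<in> tangent_space A q \<Longrightarrow> smooth_fun A f \<Longrightarrow> v f = (\<Sum>b\<in>Basis. v (\<xi> b) * e b q f)"
    "\<And>f. smooth_fun_on A M f \<Longrightarrow> smooth_fun A (\<lambda>q. \<kappa> q * f q)"
  using assms aopen_subset_points unfolding local_frame_def by blast+

lemma local_frame_vector:
  assumes "local_frame U \<phi> p \<kappa> N M \<xi> e" "q \<in> M" "v \<in> tangent_space A q"
  shows "v = (\<lambda>f. \<Sum>b\<in>Basis. v (\<xi> b) * e b q f)"
proof (rule tangent_eqI[OF assms(3)])
  show "(\<lambda>f. \<Sum>b\<in>Basis. v (\<xi> b) * e b q f) \<in> tangent_space A q"
    by (intro tangent_space_sum tangent_space_scale vf_tangent local_frameD(12)[OF assms(1)])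
qed (rule local_frameD(16)[OF assms])

text \<open>Two nested bump functions: the first, vanishing off the chart domain, makes coordinates
  and coordinate fields global without changing them on M; the second, vanishing off M, is the
  cut-off \<open>\<kappa>\<close>.\<close>

lemma local_frame_exists:
  assumes c: "(U, \<phi>) \<in> A" and p: "p \<in> U"
  obtains \<kappa> N M \<xi> e where "local_frame U \<phi> p \<kappa> N M \<xi> e"
proof -
  obtain \<kappa>1 :: "'a \<Rightarrow> real" and M where 1: "smooth_fun A \<kappa>1" "aopen A M" "p \<in> M" "M \<subseteq> U"
    "\<And>q. q \<in> M \<Longrightarrow> \<kappa>1 q = 1" "\<And>q. q \<notin> U \<Longrightarrow> \<kappa>1 q = 0"
    "\<And>f :: 'a \<Rightarrow> real. smooth_fun_on A U f \<Longrightarrow> smooth_fun A (\<lambda>q. \<kappa>1 q *\<^sub>R f q)"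
    using bump_obtain[OF aopen_chart[OF c] p] by metis
  obtain \<kappa> :: "'a \<Rightarrow> real" and N where 2: "smooth_fun A \<kappa>" "aopen A N" "p \<in> N" "N \<subseteq> M"
    "\<And>q. q \<in> N \<Longrightarrow> \<kappa> q = 1" "\<And>q. q \<notin> M \<Longrightarrow> \<kappa> q = 0"
    "\<And>f :: 'a \<Rightarrow> real. smooth_fun_on A M f \<Longrightarrow> smooth_fun A (\<lambda>q. \<kappa> q *\<^sub>R f q)"
    using bump_obtain[OF 1(2,3)] by metis
  define \<xi> where "\<xi> = (\<lambda>b q. \<kappa>1 q * (\<phi> q \<bullet> b))"
  define e where "e = (\<lambda>b q f. \<kappa>1 q * coord_vec A (U, \<phi>) b q f)"
  have \<xi>: "smooth_fun A (\<xi> b)" for b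
    using 1(7)[OF smooth_fun_on_linear[OF aopen_chart[OF c] bounded_linear_inner_left smooth_fun_on_chart[OF c]]]
    by (simp add: \<xi>_def)
  have \<xi>': "\<xi> b q = \<phi> q \<bullet> b" if "q \<in> M" for b q using 1(5)[OF that] by (simp add: \<xi>_def)
  have e': "e b q = coord_vec A (U, \<phi>) b q" if "q \<in> M" for b q using 1(5)[OF that] by (simp add: e_def)
  have e: "e b \<in> vector_fields A" for b
    unfolding vector_fields_def
  proof (intro CollectI conjI allI ballI impI)
    fix q
    show "e b q \<in> tangent_space A q"
      using 1(6) coord_vec_in_tangent_space[OF c] tangent_space_scale tangent_space_zero
      by (cases "q \<in> U") (simp_all add: e_def)
    show "e b q = (\<lambda>f. 0)" if "q \<notin> points A"
    proof -
      have "\<kappa>1 q = 0" using 1(6) that chart_subset_points[OF c] by blast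
      then show ?thesis by (simp add: e_def)
    qed
  next
    fix f :: "'a \<Rightarrow> real" assume "smooth_fun A f"
    from 1(7)[OF smooth_coord_vec[OF c this]] show "smooth_fun A (\<lambda>q. e b q f)" by (simp add: e_def)
  qed
  have d: "e b q (\<xi> c') = b \<bullet> c'" if "q \<in> M" for q b c'
    using coord_vec_coord[OF c 1(2) that 1(4) \<xi> bounded_linear_inner_left \<xi>'] e'[OF that] by simp
  have x: "v f = (\<Sum>b\<in>Basis. v (\<xi> b) * e b q f)" if "q \<in> M" "v \<in> tangent_space A q" "smooth_fun A f" for q v f
    using tangent_expand[OF that(2) c 1(2) that(1) 1(4) \<xi> \<xi>' that(3)] e'[OF that(1)] by simp
  have m: "smooth_fun A (\<lambda>q. \<kappa> q * f q)" if "smooth_fun_on A M f" for f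
    using 2(7)[OF that] by simp
  show thesis
    by (rule that[of \<kappa> N M \<xi> e], unfold local_frame_def, intro conjI ballI allI impI)
      (fact 1 2 \<xi> \<xi>' e e' d x m)+
qed

lemma extend_tangent:
  assumes "p \<in> points A" "v \<in> tangent_space A p"
  obtains X where "X \<in> vector_fields A" "X p = v"
proof -
  obtain U \<phi> where c: "(U, \<phi>) \<in> A" "p \<in> U" using pointsE[OF assms(1)] by blast
  obtain \<kappa> N M \<xi> e where fr: "local_frame U \<phi> p \<kappa> N M \<xi> e" using local_frame_exists[OF c] by blast
  have "(\<lambda>q f. \<Sum>b\<in>Basis. v (\<xi> b) * e b q f) \<in> vector_fields A"
    by (intro vf_sum vf_scale smooth_fun_const local_frameD(12)[OF fr])
  then show thesis
    by (rule that) (rule local_frame_vector[OF fr local_frameD(7)[OF fr] assms(2), symmetric])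
qed

section \<open>Covectors and one-forms\<close>

lemma cotangent_lin:
  "\<eta> \<in> cotangent_space A p \<Longrightarrow> v \<in> tangent_space A p \<Longrightarrow> w \<in> tangent_space A p \<Longrightarrow>
     \<eta> (\<lambda>f. a * v f + b * w f) = a * \<eta> v + b * \<eta> w"
  unfolding cotangent_space_def by blast

lemma cotangent_off: "\<eta> \<in> cotangent_space A p \<Longrightarrow> v \<notin> tangent_space A p \<Longrightarrow> \<eta> v = 0"
  unfolding cotangent_space_def by blast

lemma cotangent_add:
  "\<eta> \<in> cotangent_space A p \<Longrightarrow> v \<in> tangent_space A p \<Longrightarrow> w \<in> tangent_space A p \<Longrightarrow> \<eta> (\<lambda>f. v f + w f) = \<eta> v + \<eta> w"
  using cotangent_lin[of \<eta> p v w 1 1] by simp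

lemma cotangent_diff:
  "\<eta> \<in> cotangent_space A p \<Longrightarrow> v \<in> tangent_space A p \<Longrightarrow> w \<in> tangent_space A p \<Longrightarrow> \<eta> (\<lambda>f. v f - w f) = \<eta> v - \<eta> w"
  using cotangent_lin[of \<eta> p v w 1 "-1"] by simp

lemma cotangent_scale:
  "\<eta> \<in> cotangent_space A p \<Longrightarrow> v \<in> tangent_space A p \<Longrightarrow> \<eta> (\<lambda>f. a * v f) = a * \<eta> v"
  using cotangent_lin[of \<eta> p v v a 0] by simp

lemma cotangent_zero: "\<eta> \<in> cotangent_space A p \<Longrightarrow> \<eta> (\<lambda>f. 0) = 0"
  using cotangent_scale[of \<eta> p "\<lambda>f. 0" 0] by (simp add: tangent_space_zero)

lemma cotangent_sum:
  "\<eta> \<in> cotangent_space A p \<Longrightarrow> (\<And>i. i \<in> I \<Longrightarrow> v i \<in> tangent_space A p) \<Longrightarrow>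
     \<eta> (\<lambda>f. \<Sum>i\<in>I. v i f) = (\<Sum>i\<in>I. \<eta> (v i))"
proof (induction I rule: infinite_finite_induct)
  case (insert i I)
  then have "\<eta> (\<lambda>f. v i f + (\<Sum>i\<in>I. v i f)) = \<eta> (v i) + \<eta> (\<lambda>f. \<Sum>i\<in>I. v i f)"
    by (intro cotangent_add tangent_space_sum) auto
  then show ?case using insert by simp
qed (simp_all add: cotangent_zero)

lemma cotangent_space_lin:
  "\<eta> \<in> cotangent_space A p \<Longrightarrow> \<zeta> \<in> cotangent_space A p \<Longrightarrow> (\<lambda>v. a * \<eta> v + b * \<zeta> v) \<in> cotangent_space A p"
  unfolding cotangent_space_def by (auto simp: algebra_simps)

lemma cotangent_space_zero: "(\<lambda>v. 0) \<in> cotangent_space A p"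
  unfolding cotangent_space_def by simp

lemma cotangent_space_add: "\<eta> \<in> cotangent_space A p \<Longrightarrow> \<zeta> \<in> cotangent_space A p \<Longrightarrow> (\<lambda>v. \<eta> v + \<zeta> v) \<in> cotangent_space A p"
  using cotangent_space_lin[of \<eta> p \<zeta> 1 1] by simp

lemma cotangent_space_scale: "\<eta> \<in> cotangent_space A p \<Longrightarrow> (\<lambda>v. a * \<eta> v) \<in> cotangent_space A p"
  using cotangent_space_lin[of \<eta> p \<eta> a 0] by simp

lemma cotangent_eqI:
  "\<eta> \<in> cotangent_space A p \<Longrightarrow> \<zeta> \<in> cotangent_space A p \<Longrightarrow> (\<And>v. v \<in> tangent_space A p \<Longrightarrow> \<eta> v = \<zeta> v) \<Longrightarrow> \<eta> = \<zeta>"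
  using cotangent_off by (metis ext)

lemma one_form_cotangent: "s \<in> one_forms A \<Longrightarrow> s p \<in> cotangent_space A p"
  unfolding one_forms_def by (cases "p \<in> points A") (auto simp: cotangent_space_zero)

lemma one_form_smooth: "s \<in> one_forms A \<Longrightarrow> X \<in> vector_fields A \<Longrightarrow> smooth_fun A (\<lambda>p. s p (X p))"
  unfolding one_forms_def by blast

lemma one_form_add: "s \<in> one_forms A \<Longrightarrow> t \<in> one_forms A \<Longrightarrow> (\<lambda>p v. s p v + t p v) \<in> one_forms A"
  unfolding one_forms_def by (auto intro: cotangent_space_add smooth_fun_intros)

lemma one_form_scale: "smooth_fun A h \<Longrightarrow> s \<in> one_forms A \<Longrightarrow> (\<lambda>p v. h p * s p v) \<in> one_forms A"
  unfolding one_forms_def by (auto intro: cotangent_space_scale smooth_fun_intros)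

lemma one_form_zero: "(\<lambda>p v. 0) \<in> one_forms A"
  unfolding one_forms_def by (auto intro: cotangent_space_zero smooth_fun_intros)

lemma one_form_sum:
  "(\<And>i. i \<in> I \<Longrightarrow> s i \<in> one_forms A) \<Longrightarrow> (\<lambda>p v. \<Sum>i\<in>I. s i p v) \<in> one_forms A"
  by (induction I rule: infinite_finite_induct) (simp_all add: one_form_zero one_form_add)

lemma dform_in_one_forms:
  assumes "smooth_fun A f"
  shows "dform A f \<in> one_forms A"
  unfolding one_forms_def
proof (intro CollectI conjI ballI allI impI)
  fix p assume "p \<in> points A"
  then show "dform A f p \<in> cotangent_space A p"
    by (auto simp: cotangent_space_def dform_def tangent_space_lin)
next
  fix X assume X: "X \<in> vector_fields A"
  show "smooth_fun A (\<lambda>p. dform A f p (X p))"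
    by (rule smooth_fun_cong[OF _ vf_smooth[OF X assms]]) (simp add: dform_def vf_tangent[OF X])
qed (simp add: dform_def)

lemma dform_apply: "p \<in> points A \<Longrightarrow> v \<in> tangent_space A p \<Longrightarrow> dform A f p v = v f"
  by (simp add: dform_def)

lemma extend_cotangent:
  assumes "p \<in> points A" "\<eta> \<in> cotangent_space A p"
  obtains s where "s \<in> one_forms A" "s p = \<eta>"
proof -
  obtain U \<phi> where c: "(U, \<phi>) \<in> A" "p \<in> U" using pointsE[OF assms(1)] by blast
  obtain \<kappa> N M \<xi> e where fr: "local_frame U \<phi> p \<kappa> N M \<xi> e" using local_frame_exists[OF c] by blast
  define s where "s = (\<lambda>q v. \<Sum>b\<in>Basis. \<eta> (e b p) * dform A (\<xi> b) q v)"
  have s: "s \<in> one_forms A"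
    unfolding s_def by (intro one_form_sum one_form_scale smooth_fun_const dform_in_one_forms local_frameD(11)[OF fr])
  have "s p v = \<eta> v" if v: "v \<in> tangent_space A p" for v
  proof -
    have "\<eta> v = \<eta> (\<lambda>f. \<Sum>b\<in>Basis. v (\<xi> b) * e b p f)"
      using local_frame_vector[OF fr local_frameD(7)[OF fr] v] by metis
    also have "\<dots> = (\<Sum>b\<in>Basis. v (\<xi> b) * \<eta> (e b p))"
    proof -
      have "e b p \<in> tangent_space A p" for b by (intro vf_tangent local_frameD(12)[OF fr])
      then show ?thesis
        by (simp add: cotangent_sum[OF assms(2)] tangent_space_scale cotangent_scale[OF assms(2)])
    qed
    finally show ?thesis using v by (simp add: s_def dform_apply[OF assms(1) v] mult.commute)
  qed
  then have "s p = \<eta>" by (rule cotangent_eqI[OF one_form_cotangent[OF s] assms(2)])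
  then show thesis using that s by blast
qed

end


text \<open>The gluing step shared by the constructions of bump functions on the manifold and on its
  cotangent manifold: a formula valid in one chart is continued by zero.\<close>

lemma charted_smooth_fun_on_zero_outside:
  assumes "charted_space A" "aopen A N" "smooth_fun_on A N f" "aopen A M" "points A \<subseteq> N \<union> M"
    and "\<And>q. q \<in> M \<Longrightarrow> f q = 0"
  shows "smooth_fun A f"
proof -
  interpret charted_space A by fact
  show ?thesis
  proof (rule smooth_fun_local)
    fix p assume "p \<in> points A"
    moreover have "smooth_fun_on A M f"
      by (rule smooth_fun_on_cong[OF assms(4) _ smooth_fun_on_const[of _ 0]]) (simp add: assms(6))
    ultimately show "\<exists>M. aopen A M \<and> p \<in> M \<and> smooth_fun_on A M f"
      using assms(2-5) by blast
  qed
qed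

section \<open>Bump functions on a smooth manifold\<close>

lemma (in smooth_manifold) openin_imp_aopen:
  assumes "openin T N"
  shows "aopen A N"
  unfolding aopen_def
proof (intro conjI ballI)
  show "N \<subseteq> points A" using openin_subset[OF assms] by (simp add: points_def charts_cover)
  fix c assume "c \<in> A"
  then obtain U \<phi> where c: "c = (U, \<phi>)" "(U, \<phi>) \<in> A" by (metis surj_pair)
  note ch = chart[OF c(2)]
  have "openin (subtopology T U) (U \<inter> N)" using assms openin_subtopology_Int2 by metis
  moreover have "U \<inter> N \<subseteq> topspace (subtopology T U)"
    using ch openin_subset by (auto simp: topspace_subtopology)
  ultimately have "openin (top_of_set (\<phi> ` U)) (\<phi> ` (U \<inter> N))"
    using homeomorphic_map_openness[of "subtopology T U" "top_of_set (\<phi> ` U)" \<phi> "U \<inter> N"] ch by blast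
  then have "open (\<phi> ` (U \<inter> N))" using ch openin_open_trans by metis
  then show "case c of (U, \<phi>) \<Rightarrow> open (\<phi> ` (U \<inter> N))" by (simp add: c)
qed

lemma (in smooth_manifold) smooth_atlas: "smooth_atlas A"
proof -
  have inj: "inj_on \<phi> U" if "(U, \<phi>) \<in> A" for U \<phi>
  proof -
    have "U \<subseteq> topspace T" using chart[OF that] openin_subset by blast
    then show ?thesis
      using chart[OF that] homeomorphic_imp_injective_map[of "subtopology T U" "top_of_set (\<phi> ` U)" \<phi>]
      by (simp add: topspace_subtopology inf.absorb2)
  qed
  have ov: "open (\<phi> ` (U \<inter> V))" if "(U, \<phi>) \<in> A" "(V, \<psi>) \<in> A" for U \<phi> V \<psi>
    using openin_imp_aopen[of V] chart[OF that(2)] that(1) unfolding aopen_def by blast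
  interpret charted_space A
    by unfold_locales (use inj ov compatible in auto)
  show ?thesis
  proof unfold_locales
    fix N p assume N: "aopen A N" and p: "p \<in> N"
    then obtain U \<phi> where c: "(U, \<phi>) \<in> A" "p \<in> U" using pointsE aopen_subset_points by (metis subsetD)
    have "open (\<phi> ` (U \<inter> N))" "\<phi> p \<in> \<phi> ` (U \<inter> N)" using aopen_image[OF N c(1)] c(2) p by auto
    then obtain r' where r': "0 < r'" "cball (\<phi> p) r' \<subseteq> \<phi> ` (U \<inter> N)"
      using open_contains_cball by blast
    \<comment> \<open>The bump function may be nonzero up to distance 2r, and the closed ball of
      that radius has to stay inside the chart image.\<close>
    define r where "r = r' / 2"
    have r: "0 < r" "cball (\<phi> p) (2 * r) \<subseteq> \<phi> ` (U \<inter> N)" using r' by (auto simp: r_def)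
    obtain \<rho> :: "'e \<Rightarrow> real" where \<rho>: "smooth_on UNIV \<rho>" "\<And>x. dist (\<phi> p) x < r \<Longrightarrow> \<rho> x = 1"
      "\<And>x. 2 * r < dist (\<phi> p) x \<Longrightarrow> \<rho> x = 0" using smooth_bump_exists[OF r(1)] by blast
    define C where "C = {q \<in> U. \<phi> q \<in> cball (\<phi> p) (2 * r)}"
    define M where "M = {q \<in> U. \<phi> q \<in> ball (\<phi> p) r}"
    define \<kappa> where "\<kappa> = (\<lambda>q. if q \<in> U then \<rho> (\<phi> q) else 0)"
    have CN: "C \<subseteq> N" using r(2) chart_inj[OF c(1)] by (fastforce simp: C_def inj_on_def)
    have CU: "C \<subseteq> topspace (subtopology T U)"
      using chart[OF c(1)] openin_subset by (auto simp: C_def topspace_subtopology)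
    have im: "\<phi> ` C = cball (\<phi> p) (2 * r)" using r(2) by (auto simp: C_def)
    have "compactin (top_of_set (\<phi> ` U)) (\<phi> ` C)"
      unfolding im by (subst compactin_subtopology) (use r(2) in auto)
    then have "compactin (subtopology T U) C"
      using homeomorphic_map_compactness[of "subtopology T U" "top_of_set (\<phi> ` U)" \<phi> C] chart[OF c(1)] CU by blast
    then have "compactin T C" by (simp add: compactin_subtopology)
    \<comment> \<open>Here the Hausdorff property enters. C is compact because the chart maps it to
      a closed Euclidean ball; that it is closed in the whole manifold, and not only in the chart
      domain, needs more than the chart.\<close>
    then have "closedin T C" using compactin_imp_closedin[OF Hausdorff] by blast
    then have cl: "aopen A (points A - C)"
      using openin_imp_aopen[of "topspace T - C"] by (simp add: points_def charts_cover openin_diff)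
    have "smooth_fun_on A U (\<lambda>q. \<rho> (\<phi> q))"
      by (rule smooth_fun_on_compose[OF aopen_chart[OF c(1)] smooth_fun_on_chart[OF c(1)] UNIV_I open_UNIV \<rho>(1)])
    then have "smooth_fun_on A U \<kappa>"
      by (rule smooth_fun_on_cong[OF aopen_chart[OF c(1)], rotated]) (simp add: \<kappa>_def)
    then have sm: "smooth_fun A \<kappa>"
      by (rule charted_smooth_fun_on_zero_outside[OF charted_space_axioms aopen_chart[OF c(1)] _ cl])
         (use \<rho>(3) in \<open>auto simp: C_def \<kappa>_def\<close>)
    have M: "aopen A M"
      unfolding M_def by (rule aopen_vimage[OF aopen_chart[OF c(1)] smooth_fun_on_chart[OF c(1)] open_ball])
    have "\<forall>q. \<kappa> q \<noteq> 0 \<longrightarrow> q \<in> C" using \<rho>(3) by (auto simp: C_def \<kappa>_def not_less[symmetric])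
    moreover have "p \<in> M" "\<forall>q\<in>M. \<kappa> q = 1" "M \<subseteq> N"
      using r(1) c(2) \<rho>(2) CN by (auto simp: M_def \<kappa>_def C_def)
    ultimately show "\<exists>\<kappa> C M. smooth_fun A (\<kappa> :: 'a \<Rightarrow> real) \<and> C \<subseteq> N \<and>
          aopen A (points A - C) \<and> (\<forall>q. \<kappa> q \<noteq> 0 \<longrightarrow> q \<in> C) \<and>
          aopen A M \<and> p \<in> M \<and> M \<subseteq> N \<and> (\<forall>q\<in>M. \<kappa> q = 1)"
      using sm CN cl M by (intro exI[of _ \<kappa>] exI[of _ C] exI[of _ M]) simp
  qed
qed


section \<open>The atlas of the cotangent manifold\<close>

text \<open>The part of the cotangent bundle over \<open>U\<close>, for arbitrary sets and not only
  for chart domains: neighbourhoods of the base are pulled back with it.\<close>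

definition ct_dom :: "('a, 'e::euclidean_space) chart set \<Rightarrow> 'a set \<Rightarrow> 'a ct set" where
  "ct_dom A U = {u. fst u \<in> U \<and> snd u \<in> cotangent_space A (fst u)}"

definition fibre_coords ::
    "('a, 'e::euclidean_space) chart set \<Rightarrow> 'a set \<Rightarrow> ('a \<Rightarrow> 'e) \<Rightarrow> 'a ct \<Rightarrow> 'e" where
  "fibre_coords A U \<phi> u = (\<Sum>b\<in>Basis. snd u (coord_vec A (U, \<phi>) b (fst u)) *\<^sub>R b)"

definition ct_map ::
    "('a, 'e::euclidean_space) chart set \<Rightarrow> 'a set \<Rightarrow> ('a \<Rightarrow> 'e) \<Rightarrow> 'a ct \<Rightarrow> 'e \<times> 'e" where
  "ct_map A U \<phi> u = (\<phi> (fst u), fibre_coords A U \<phi> u)"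

text \<open>Together with the pullbacks from the base, these functions determine every tangent vector of
  the cotangent manifold.\<close>

definition fib :: "('a \<Rightarrow> 'a tvec) \<Rightarrow> 'a ct \<Rightarrow> real" where
  "fib X u = snd u (X (fst u))"

lemma cotangent_atlas_charts: "cotangent_atlas A = (\<lambda>(U, \<phi>). (ct_dom A U, ct_map A U \<phi>)) ` A"
  unfolding cotangent_atlas_def
  by (rule image_cong) (auto simp: cotangent_chart_def ct_dom_def ct_map_def fibre_coords_def fun_eq_iff)

lemma cotangent_atlasE:
  assumes "(U', \<phi>') \<in> cotangent_atlas A"
  obtains U \<phi> where "(U, \<phi>) \<in> A" "U' = ct_dom A U" "\<phi>' = ct_map A U \<phi>"
  using assms by (auto simp: cotangent_atlas_charts)

lemma cotangent_atlasI: "(U, \<phi>) \<in> A \<Longrightarrow> (ct_dom A U, ct_map A U \<phi>) \<in> cotangent_atlas A"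
  by (force simp: cotangent_atlas_charts)

lemma points_cotangent_atlas: "points (cotangent_atlas A) = ct_dom A (points A)"
  by (force simp: points_def cotangent_atlas_charts ct_dom_def)

lemma fibre_coords_inner: "b \<in> Basis \<Longrightarrow> fibre_coords A U \<phi> u \<bullet> b = snd u (coord_vec A (U, \<phi>) b (fst u))"
  by (simp add: fibre_coords_def)

context smooth_atlas
begin

abbreviation "\<T> \<equiv> cotangent_atlas A"

lemma local_frame_covector:
  assumes "local_frame U \<phi> p \<kappa> N M \<xi> e" "q \<in> M" "v \<in> tangent_space A q" "\<eta> \<in> cotangent_space A q"
  shows "\<eta> v = (\<Sum>b\<in>Basis. v (\<xi> b) * \<eta> (e b q))"
proof -
  have e: "e b q \<in> tangent_space A q" for b by (intro vf_tangent local_frameD(12)[OF assms(1)])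
  have "\<eta> v = \<eta> (\<lambda>f. \<Sum>b\<in>Basis. v (\<xi> b) * e b q f)"
    by (rule arg_cong[OF local_frame_vector[OF assms(1-3)]])
  also have "\<dots> = (\<Sum>b\<in>Basis. v (\<xi> b) * \<eta> (e b q))"
    by (simp add: cotangent_sum[OF assms(4)] tangent_space_scale e cotangent_scale[OF assms(4)])
  finally show ?thesis .
qed

text \<open>The fibre coordinates take every value: the covector with coordinates y is the
  combination of the coordinate differentials with the components of y. Hence chart images are
  products with the whole model space, as \<open>ct_map_image\<close> states.\<close>

lemma covector_of_coords:
  assumes "(U, \<phi>) \<in> A" "p \<in> U"
  obtains \<eta> where "\<eta> \<in> cotangent_space A p" "fibre_coords A U \<phi> (p, \<eta>) = y"
proof -
  obtain \<kappa> N M \<xi> e where fr: "local_frame U \<phi> p \<kappa> N M \<xi> e" using local_frame_exists[OF assms] by blast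
  note D = local_frameD[OF fr]
  define \<eta> where "\<eta> = (\<lambda>v. \<Sum>b\<in>Basis. (y \<bullet> b) * dform A (\<xi> b) p v)"
  have s: "(\<lambda>q v. \<Sum>b\<in>Basis. (y \<bullet> b) * dform A (\<xi> b) q v) \<in> one_forms A"
    by (intro one_form_sum one_form_scale smooth_fun_const dform_in_one_forms D(11))
  have \<eta>: "\<eta> \<in> cotangent_space A p" using one_form_cotangent[OF s, of p] by (simp add: \<eta>_def)
  have "\<eta> (coord_vec A (U, \<phi>) b p) = y \<bullet> b" if b: "b \<in> Basis" for b
  proof -
    have "\<eta> (e b p) = (\<Sum>c\<in>Basis. (y \<bullet> c) * (b \<bullet> c))"
      by (simp add: \<eta>_def dform_apply D(8) vf_tangent[OF D(12)] D(15)[OF D(7)])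
    also have "\<dots> = (\<Sum>c\<in>Basis. if c = b then y \<bullet> c else 0)"
      by (rule sum.cong) (use b in \<open>auto simp: inner_Basis\<close>)
    finally show ?thesis using D(14)[OF D(7)] b by simp
  qed
  then have "fibre_coords A U \<phi> (p, \<eta>) \<bullet> b = y \<bullet> b" if "b \<in> Basis" for b
    using that by (simp add: fibre_coords_inner)
  then have "fibre_coords A U \<phi> (p, \<eta>) = y" by (rule euclidean_eqI)
  with \<eta> that show thesis by blast
qed

lemma covector_coords_inj:
  assumes "(U, \<phi>) \<in> A" "p \<in> U" "\<eta> \<in> cotangent_space A p" "\<zeta> \<in> cotangent_space A p"
    and eq: "fibre_coords A U \<phi> (p, \<eta>) = fibre_coords A U \<phi> (p, \<zeta>)"
  shows "\<eta> = \<zeta>"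
proof (rule cotangent_eqI[OF assms(3,4)])
  obtain \<kappa> N M \<xi> e where fr: "local_frame U \<phi> p \<kappa> N M \<xi> e" using local_frame_exists[OF assms(1,2)] by blast
  note D = local_frameD[OF fr]
  fix v assume v: "v \<in> tangent_space A p"
  have "\<eta> (e b p) = \<zeta> (e b p)" if "b \<in> Basis" for b
    using arg_cong[OF eq, of "\<lambda>y. y \<bullet> b"] by (simp add: D(14)[OF D(7)] fibre_coords_inner that)
  then show "\<eta> v = \<zeta> v"
    by (simp add: local_frame_covector[OF fr D(7) v] assms(3,4))
qed

lemma ct_map_inj: "(U, \<phi>) \<in> A \<Longrightarrow> inj_on (ct_map A U \<phi>) (ct_dom A U)"
proof (rule inj_onI)
  fix u v assume c: "(U, \<phi>) \<in> A" and u: "u \<in> ct_dom A U" and v: "v \<in> ct_dom A U" and eq: "ct_map A U \<phi> u = ct_map A U \<phi> v"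
  have 1: "fst u = fst v" using eq u v chart_inj[OF c] by (auto simp: ct_map_def ct_dom_def inj_on_def)
  moreover have "snd u = snd v"
  proof (rule covector_coords_inj[OF c])
    show "fibre_coords A U \<phi> (fst u, snd u) = fibre_coords A U \<phi> (fst u, snd v)"
      using eq 1 by (metis ct_map_def prod.collapse snd_conv)
  qed (use u v 1 in \<open>auto simp: ct_dom_def\<close>)
  ultimately show "u = v" by (rule prod_eqI)
qed

lemma ct_map_image:
  assumes "(U, \<phi>) \<in> A" "N \<subseteq> U"
  shows "ct_map A U \<phi> ` ct_dom A N = \<phi> ` N \<times> UNIV"
proof (intro equalityI subsetI)
  fix z assume "z \<in> \<phi> ` N \<times> (UNIV :: 'e set)"
  then obtain p y where z: "z = (\<phi> p, y)" "p \<in> N" by (cases z) auto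
  obtain \<eta> where "\<eta> \<in> cotangent_space A p" "fibre_coords A U \<phi> (p, \<eta>) = y"
    using covector_of_coords[OF assms(1), of p] z(2) assms(2) by blast
  then show "z \<in> ct_map A U \<phi> ` ct_dom A N"
    using z by (intro image_eqI[of _ _ "(p, \<eta>)"]) (auto simp: ct_map_def ct_dom_def)
qed (auto simp: ct_map_def ct_dom_def)

lemma ct_map_inv:
  assumes "(U, \<phi>) \<in> A" "u \<in> ct_dom A U"
  shows "inv_into (ct_dom A U) (ct_map A U \<phi>) (ct_map A U \<phi> u) = u"
  by (simp add: ct_map_inj assms)

lemma ct_dom_Int: "ct_dom A U \<inter> ct_dom A V = ct_dom A (U \<inter> V)"
  by (auto simp: ct_dom_def)

lemma cotangent_charted_space: "charted_space \<T>"
proof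
  fix U' \<phi>' assume "(U', \<phi>') \<in> \<T>"
  then show "inj_on \<phi>' U'" using ct_map_inj by (metis cotangent_atlasE)
next
  fix U' \<phi>' V' \<psi>' assume a: "(U', \<phi>') \<in> \<T>" "(V', \<psi>') \<in> \<T>"
  from a(1) obtain U \<phi> where U: "(U, \<phi>) \<in> A" "U' = ct_dom A U" "\<phi>' = ct_map A U \<phi>" by (rule cotangent_atlasE)
  from a(2) obtain V \<psi> where V: "(V, \<psi>) \<in> A" "V' = ct_dom A V" "\<psi>' = ct_map A V \<psi>" by (rule cotangent_atlasE)
  have im: "\<phi>' ` (U' \<inter> V') = \<phi> ` (U \<inter> V) \<times> UNIV"
    unfolding U V ct_dom_Int by (rule ct_map_image[OF U(1)]) simp
  show "open (\<phi>' ` (U' \<inter> V'))" unfolding im using overlap_open[OF U(1) V(1)] by (simp add: open_Times)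
  show "smooth_on (\<phi>' ` (U' \<inter> V')) (\<psi>' \<circ> inv_into U' \<phi>')"
  proof (rule smooth_on_local)
    fix z assume "z \<in> \<phi>' ` (U' \<inter> V')"
    then obtain p y where z: "z = (\<phi> p, y)" "p \<in> U" "p \<in> V" unfolding im by (cases z) auto
    obtain \<kappa> N M \<xi> e where fr: "local_frame U \<phi> p \<kappa> N M \<xi> e" using local_frame_exists[OF U(1) z(2)] by blast
    note D = local_frameD[OF fr]
    define W where "W = \<phi> ` (U \<inter> (M \<inter> V))"
    have W: "open W" unfolding W_def by (intro aopen_image[OF _ U(1)] aopen_Int D(4) aopen_chart[OF V(1)])
    \<comment> \<open>The Jacobian matrix of the first coordinates with respect to the second.
      Covector coordinates transform linearly by it, which makes the transition map \<open>Q\<close>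
      below explicit: the old transition map on the base, linear in the fibre.\<close>
    define G where "G = (\<lambda>b c q. coord_vec A (V, \<psi>) b q (\<xi> c))"
    have G: "smooth_on W (G b c \<circ> inv_into U \<phi>)" for b c
      unfolding W_def G_def
      by (intro smooth_fun_onD[OF _ U(1)] smooth_fun_on_subset[OF smooth_coord_vec[OF V(1) D(11)]]) auto
    define Q where "Q = (\<lambda>z::'e \<times> 'e. ((\<psi> \<circ> inv_into U \<phi>) (fst z),
        \<Sum>b\<in>Basis. (\<Sum>c\<in>Basis. (G b c \<circ> inv_into U \<phi>) (fst z) * (snd z \<bullet> c)) *\<^sub>R b))"
    have WU: "open (W \<times> (UNIV :: 'e set))" by (simp add: W open_Times)
    have comp: "smooth_on (W \<times> UNIV) (\<lambda>z::'e \<times> 'e. g (fst z))" if "smooth_on W g" for g :: "'e \<Rightarrow> 'b::real_normed_vector"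
      by (rule smooth_on_compose[OF WU W _ smooth_on_fst[OF WU] that]) auto
    have "smooth_on W (\<psi> \<circ> inv_into U \<phi>)"
      using transition_smooth[OF U(1) V(1)] by (rule smooth_on_subset) (auto simp: W_def)
    then have "smooth_on (W \<times> UNIV) Q"
      unfolding Q_def
      by (intro smooth_on_Pair WU comp smooth_on_sum smooth_on_scaleR smooth_on_mult G smooth_on_const
          smooth_on_bounded_linear[OF WU bounded_linear_inner_left smooth_on_snd])
    moreover have "Q z' = (\<psi>' \<circ> inv_into U' \<phi>') z'" if "z' \<in> W \<times> UNIV" for z'
    proof -
      have "z' \<in> \<phi>' ` ct_dom A (M \<inter> V)"
        using that D(6) ct_map_image[OF U(1), of "M \<inter> V"] unfolding U W_def by (auto simp: inf.absorb2 le_infI1)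
      then obtain u where u: "z' = \<phi>' u" "u \<in> ct_dom A (M \<inter> V)" by blast
      then have uU: "u \<in> ct_dom A U" using D(6) by (auto simp: ct_dom_def)
      have q: "fst u \<in> M" "fst u \<in> V" "fst u \<in> U" "snd u \<in> cotangent_space A (fst u)"
        using u(2) D(6) by (auto simp: ct_dom_def)
      have iu: "inv_into U' \<phi>' z' = u" unfolding u(1) U by (rule ct_map_inv[OF U(1) uU])
      have z': "fst z' = \<phi> (fst u)" "snd z' = fibre_coords A U \<phi> u" by (simp_all add: u(1) U ct_map_def)
      have "snd u (coord_vec A (V, \<psi>) b (fst u)) = (\<Sum>c\<in>Basis. G b c (fst u) * (snd z' \<bullet> c))" if "b \<in> Basis" for b
        using local_frame_covector[OF fr q(1) coord_vec_in_tangent_space[OF V(1) q(2)] q(4), of b]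
        by (simp add: z' G_def fibre_coords_inner D(14)[OF q(1)])
      then show ?thesis
        by (simp add: Q_def iu V ct_map_def fibre_coords_def z' inv_chart[OF U(1) q(3)])
    qed
    ultimately have "smooth_on (W \<times> UNIV) (\<psi>' \<circ> inv_into U' \<phi>')"
      using smooth_on_cong[OF WU] by blast
    moreover have "z \<in> W \<times> UNIV" using z D(7) by (auto simp: W_def)
    ultimately show "\<exists>S. open S \<and> z \<in> S \<and> smooth_on S (\<psi>' \<circ> inv_into U' \<phi>')" using WU by blast
  qed
qed

lemma aopen_ct_dom:
  assumes "aopen A N"
  shows "aopen \<T> (ct_dom A N)"
  unfolding aopen_def
proof (intro conjI ballI)
  show "ct_dom A N \<subseteq> points \<T>"
    using aopen_subset_points[OF assms] by (auto simp: points_cotangent_atlas ct_dom_def)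
  fix c assume "c \<in> \<T>"
  then obtain U \<phi> where c: "(U, \<phi>) \<in> A" "c = (ct_dom A U, ct_map A U \<phi>)" by (metis cotangent_atlasE surj_pair)
  have "ct_map A U \<phi> ` (ct_dom A U \<inter> ct_dom A N) = \<phi> ` (U \<inter> N) \<times> UNIV"
    unfolding ct_dom_Int by (rule ct_map_image[OF c(1)]) simp
  then show "case c of (U, \<phi>) \<Rightarrow> open (\<phi> ` (U \<inter> ct_dom A N))"
    using aopen_image[OF assms c(1)] by (simp add: c open_Times)
qed

lemma smooth_fibre_coords:
  assumes "(U, \<phi>) \<in> A"
  shows "smooth_fun_on \<T> (ct_dom A U) (fibre_coords A U \<phi>)"
    "smooth_fun_on \<T> (ct_dom A U) (\<lambda>u. \<phi> (fst u))"
proof -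
  interpret B: charted_space \<T> by (rule cotangent_charted_space)
  note c = cotangent_atlasI[OF assms]
  have 1: "smooth_fun_on \<T> (ct_dom A U) (ct_map A U \<phi>)"
    by (rule B.smooth_fun_on_chart[OF c])
  from B.smooth_fun_on_linear[OF B.aopen_chart[OF c] bounded_linear_snd 1]
  show "smooth_fun_on \<T> (ct_dom A U) (fibre_coords A U \<phi>)"
    by (simp add: ct_map_def)
  from B.smooth_fun_on_linear[OF B.aopen_chart[OF c] bounded_linear_fst 1]
  show "smooth_fun_on \<T> (ct_dom A U) (\<lambda>u. \<phi> (fst u))"
    by (simp add: ct_map_def)
qed

lemma smooth_pullback_on:
  fixes f :: "'a \<Rightarrow> 'b::real_normed_vector"
  assumes "aopen A N" "smooth_fun_on A N f"
  shows "smooth_fun_on \<T> (ct_dom A N) (\<lambda>u. f (fst u))"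
proof -
  interpret B: charted_space \<T> by (rule cotangent_charted_space)
  show ?thesis
  proof (rule B.smooth_fun_on_local)
    fix u assume u: "u \<in> ct_dom A N"
    then have "fst u \<in> points A" using aopen_subset_points[OF assms(1)] by (auto simp: ct_dom_def)
    then obtain U \<phi> where c: "(U, \<phi>) \<in> A" "fst u \<in> U" by (rule pointsE)
    have o: "aopen \<T> (ct_dom A (U \<inter> N))"
      by (intro aopen_ct_dom aopen_Int aopen_chart[OF c(1)] assms(1))
    have 1: "smooth_fun_on \<T> (ct_dom A (U \<inter> N)) (\<lambda>u. \<phi> (fst u))"
      by (rule smooth_fun_on_subset[OF smooth_fibre_coords(2)[OF c(1)]]) (auto simp: ct_dom_def)
    have "smooth_fun_on \<T> (ct_dom A (U \<inter> N)) (\<lambda>u. (f \<circ> inv_into U \<phi>) (\<phi> (fst u)))"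
      by (rule B.smooth_fun_on_compose[OF o 1 _ aopen_image[OF assms(1) c(1)] smooth_fun_onD[OF assms(2) c(1)]])
         (auto simp: ct_dom_def)
    then have "smooth_fun_on \<T> (ct_dom A (U \<inter> N)) (\<lambda>u. f (fst u))"
      by (rule B.smooth_fun_on_cong[OF o, rotated]) (auto simp: ct_dom_def inv_chart[OF c(1)])
    then show "\<exists>M. aopen \<T> M \<and> u \<in> M \<and> smooth_fun_on \<T> M (\<lambda>u. f (fst u))"
      using o u c(2) by (intro exI[of _ "ct_dom A (U \<inter> N)"]) (auto simp: ct_dom_def)
  qed
qed

lemma smooth_pullback: "smooth_fun A f \<Longrightarrow> smooth_fun \<T> (\<lambda>u. f (fst u))"
  using smooth_pullback_on[OF aopen_points] by (simp add: smooth_fun_iff_on points_cotangent_atlas)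

text \<open>The compactness argument used for M has no counterpart here. The bump function is a
  product instead: one pulled back from the base times a Euclidean one in the fibre coordinates,
  supported in a product neighbourhood. Charts contain entire fibres, so closedness of the support
  splits into the known statement on the base and a closed ball in the fibre coordinates.\<close>

lemma cotangent_smooth_atlas: "smooth_atlas \<T>"
proof -
  interpret B: charted_space \<T> by (rule cotangent_charted_space)
  show ?thesis
  proof unfold_locales
    fix N' u assume N: "aopen \<T> N'" and u: "u \<in> N'"
    then have uct: "u \<in> ct_dom A (points A)" using B.aopen_subset_points points_cotangent_atlas by blast
    then have "fst u \<in> points A" by (simp add: ct_dom_def)
    then obtain U \<phi> where c: "(U, \<phi>) \<in> A" "fst u \<in> U" by (rule pointsE)
    then have uU: "u \<in> ct_dom A U" using uct by (simp add: ct_dom_def)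
    let ?y = "fibre_coords A U \<phi>"
    have "open (ct_map A U \<phi> ` (ct_dom A U \<inter> N'))" by (rule B.aopen_image[OF N cotangent_atlasI[OF c(1)]])
    moreover have "(\<phi> (fst u), ?y u) \<in> ct_map A U \<phi> ` (ct_dom A U \<inter> N')"
      using u uU by (auto simp: ct_map_def image_iff)
    ultimately obtain W1 W2 where W: "open W1" "open W2" "(\<phi> (fst u), ?y u) \<in> W1 \<times> W2"
      "W1 \<times> W2 \<subseteq> ct_map A U \<phi> ` (ct_dom A U \<inter> N')"
      by (rule open_prod_elim)
    have sub: "v \<in> N'" if "v \<in> ct_dom A U" "\<phi> (fst v) \<in> W1" "?y v \<in> W2" for v
    proof -
      have "ct_map A U \<phi> v \<in> W1 \<times> W2" using that by (simp add: ct_map_def)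
      from subsetD[OF W(4) this] obtain v' where "ct_map A U \<phi> v = ct_map A U \<phi> v'" "v' \<in> ct_dom A U" "v' \<in> N'"
        by (elim imageE IntE)
      then show ?thesis using ct_map_inj[OF c(1)] that(1) by (metis inj_onD)
    qed
    define N1 where "N1 = {q \<in> U. \<phi> q \<in> W1}"
    have N1: "aopen A N1" "fst u \<in> N1"
      unfolding N1_def using c(2) W(3) by (auto intro: aopen_vimage[OF aopen_chart[OF c(1)] smooth_fun_on_chart[OF c(1)] W(1)])
    obtain \<kappa>1 :: "'a \<Rightarrow> real" and C1 M1 where 1: "smooth_fun A \<kappa>1" "C1 \<subseteq> N1" "aopen A (points A - C1)"
      "\<forall>q. \<kappa>1 q \<noteq> 0 \<longrightarrow> q \<in> C1" "aopen A M1" "fst u \<in> M1" "M1 \<subseteq> N1" "\<forall>q\<in>M1. \<kappa>1 q = 1"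
      using bump[OF N1] by blast
    obtain r' where r': "0 < r'" "cball (?y u) r' \<subseteq> W2" using W(2,3) open_contains_cball by blast
    define r where "r = r' / 2"
    have r: "0 < r" "cball (?y u) (2 * r) \<subseteq> W2" using r' by (auto simp: r_def)
    obtain \<rho> :: "'e \<Rightarrow> real" where \<rho>: "smooth_on UNIV \<rho>" "\<And>x. dist (?y u) x < r \<Longrightarrow> \<rho> x = 1"
      "\<And>x. 2 * r < dist (?y u) x \<Longrightarrow> \<rho> x = 0" using smooth_bump_exists[OF r(1)] by blast
    define \<kappa> where "\<kappa> = (\<lambda>v. if v \<in> ct_dom A U then \<kappa>1 (fst v) * \<rho> (?y v) else 0)"
    define C where "C = {v \<in> ct_dom A U. fst v \<in> C1 \<and> ?y v \<in> cball (?y u) (2 * r)}"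
    define M where "M = {v \<in> ct_dom A M1. ?y v \<in> ball (?y u) r}"
    have oU: "aopen \<T> (ct_dom A U)" by (rule aopen_ct_dom[OF aopen_chart[OF c(1)]])
    have M1U: "M1 \<subseteq> U" using 1(7) by (auto simp: N1_def)
    have "smooth_fun_on \<T> (ct_dom A M1) ?y"
      by (rule smooth_fun_on_subset[OF smooth_fibre_coords(1)[OF c(1)]]) (use M1U in \<open>auto simp: ct_dom_def\<close>)
    from B.aopen_vimage[OF aopen_ct_dom[OF 1(5)] this open_ball]
    have M: "aopen \<T> M" by (simp add: M_def)
    have uM: "u \<in> M" using 1(6) r(1) uct by (auto simp: M_def ct_dom_def)
    have CN: "C \<subseteq> N'"
    proof
      fix v assume v: "v \<in> C"
      have "?y v \<in> W2" using subsetD[OF r(2)] v by (simp add: C_def)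
      moreover have "v \<in> ct_dom A U" "\<phi> (fst v) \<in> W1" using v 1(2) by (auto simp: C_def N1_def)
      ultimately show "v \<in> N'" by (rule sub[rotated 2])
    qed
    have MN: "M \<subseteq> N'"
    proof
      fix v assume v: "v \<in> M"
      then have "?y v \<in> W2" using r by (auto simp: M_def)
      moreover have "v \<in> ct_dom A U" "\<phi> (fst v) \<in> W1" using v 1(7) by (auto simp: M_def ct_dom_def N1_def)
      ultimately show "v \<in> N'" by (rule sub[rotated 2])
    qed
    have \<kappa>1: "\<forall>v\<in>M. \<kappa> v = 1" using 1(8) M1U \<rho>(2) by (auto simp: M_def \<kappa>_def ct_dom_def)
    have \<kappa>C: "\<forall>v. \<kappa> v \<noteq> 0 \<longrightarrow> v \<in> C"
    proof (intro allI impI)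
      fix v assume v: "\<kappa> v \<noteq> 0"
      then have "v \<in> ct_dom A U" "\<kappa>1 (fst v) \<noteq> 0" "\<rho> (?y v) \<noteq> 0" by (auto simp: \<kappa>_def split: if_splits)
      then show "v \<in> C" using 1(4) \<rho>(3)[of "?y v"] by (auto simp: C_def not_less[symmetric])
    qed
    define R where "R = {v \<in> ct_dom A U. ?y v \<in> - cball (?y u) (2 * r)}"
    have R: "aopen \<T> R"
      unfolding R_def by (rule B.aopen_vimage[OF oU smooth_fibre_coords(1)[OF c(1)]]) auto
    \<comment> \<open>A point outside C lies over the complement of \<open>C1\<close>, or it lies in
      the chart and its fibre coordinates are outside the closed ball. Both conditions are
      open.\<close>
    have "points \<T> - C = \<Union>{ct_dom A (points A - C1), R}"
      using 1(2) chart_subset_points[OF c(1)] by (auto simp: points_cotangent_atlas ct_dom_def C_def R_def N1_def)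
    then have cl: "aopen \<T> (points \<T> - C)"
      using B.aopen_Union[of "{ct_dom A (points A - C1), R}"] aopen_ct_dom[OF 1(3)] R by auto
    have "smooth_fun_on \<T> (ct_dom A U) (\<lambda>v. \<kappa>1 (fst v) * \<rho> (?y v))"
      by (intro B.smooth_fun_on_bilinear[OF oU bounded_bilinear_mult] smooth_pullback_on aopen_chart[OF c(1)]
          smooth_fun_imp_on[OF 1(1) chart_subset_points[OF c(1)]]
          B.smooth_fun_on_compose[OF oU smooth_fibre_coords(1)[OF c(1)] UNIV_I open_UNIV \<rho>(1)])
    then have "smooth_fun_on \<T> (ct_dom A U) \<kappa>"
      by (rule B.smooth_fun_on_cong[OF oU, rotated]) (simp add: \<kappa>_def)
    then have sm: "smooth_fun \<T> \<kappa>"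
      by (rule charted_smooth_fun_on_zero_outside[OF B.charted_space_axioms oU _ aopen_ct_dom[OF 1(3)]])
         (use 1(2,4) in \<open>auto simp: points_cotangent_atlas ct_dom_def \<kappa>_def N1_def\<close>)
    show "\<exists>\<kappa> C M. smooth_fun \<T> (\<kappa> :: 'a ct \<Rightarrow> real) \<and> C \<subseteq> N' \<and>
          aopen \<T> (points \<T> - C) \<and> (\<forall>q. \<kappa> q \<noteq> 0 \<longrightarrow> q \<in> C) \<and>
          aopen \<T> M \<and> u \<in> M \<and> M \<subseteq> N' \<and> (\<forall>q\<in>M. \<kappa> q = 1)"
      using sm CN cl \<kappa>C M uM MN \<kappa>1 by blast
  qed
qed

text \<open>In a local frame the function is the sum of the coefficients of X times the fibre
  coordinates.\<close>

lemma smooth_fib: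
  assumes "X \<in> vector_fields A"
  shows "smooth_fun \<T> (fib X)"
proof -
  interpret B: smooth_atlas \<T> by (rule cotangent_smooth_atlas)
  show ?thesis
  proof (rule B.smooth_fun_local)
    fix u assume u: "u \<in> points \<T>"
    then have "fst u \<in> points A" by (simp add: ct_dom_def points_cotangent_atlas)
    then obtain U \<phi> where c: "(U, \<phi>) \<in> A" "fst u \<in> U" by (rule pointsE)
    obtain \<kappa> N M \<xi> e where fr: "local_frame U \<phi> (fst u) \<kappa> N M \<xi> e" using local_frame_exists[OF c] by blast
    note D = local_frameD[OF fr]
    have o: "aopen \<T> (ct_dom A M)" by (rule aopen_ct_dom[OF D(4)])
    have 1: "smooth_fun_on \<T> (ct_dom A M) (fibre_coords A U \<phi>)"
      by (rule smooth_fun_on_subset[OF smooth_fibre_coords(1)[OF c(1)]]) (use D(6) in \<open>auto simp: ct_dom_def\<close>)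
    have "smooth_fun_on \<T> (ct_dom A M) (\<lambda>v. \<Sum>b\<in>Basis. X (fst v) (\<xi> b) * (fibre_coords A U \<phi> v \<bullet> b))"
      by (intro B.smooth_fun_on_sum B.smooth_fun_on_bilinear[OF o bounded_bilinear_mult] o
          B.smooth_fun_on_linear[OF o bounded_linear_inner_left 1] smooth_pullback_on D(4)
          smooth_fun_imp_on[OF vf_smooth[OF assms D(11)]] aopen_subset_points)
    then have "smooth_fun_on \<T> (ct_dom A M) (fib X)"
      by (rule B.smooth_fun_on_cong[OF o, rotated])
         (auto simp: fib_def ct_dom_def fibre_coords_inner D(14) local_frame_covector[OF fr _ vf_tangent[OF assms]])
    then show "\<exists>M. aopen \<T> M \<and> u \<in> M \<and> smooth_fun_on \<T> M (fib X)"
      using o u D(7) by (intro exI[of _ "ct_dom A M"]) (auto simp: ct_dom_def points_cotangent_atlas)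
  qed
qed

end


section \<open>Splitting the tangent spaces of the cotangent manifold\<close>

context smooth_atlas
begin

section \<open>Lie brackets and tensorial functionals\<close>

lemma lie_bracket_tangent:
  assumes "vfield A X" "vfield A Y" "p \<in> points A"
  shows "lie_bracket X Y p \<in> tangent_space A p"
proof -
  note t = vfield_tangent[OF assms(1,3)] vfield_tangent[OF assms(2,3)]
  note s = vfield_smooth[OF assms(1)] vfield_smooth[OF assms(2)]
  have "lie_bracket X Y p (\<lambda>q. a * f q + b * g q) = a * lie_bracket X Y p f + b * lie_bracket X Y p g"
    if f: "smooth_fun A f" and g: "smooth_fun A g" for f g a b
  proof -
    \<comment> \<open>\<open>X q\<close> is known to be a derivation at points of the manifold only,
      so the inner expression is rewritten through \<open>tangent_cong\<close>.\<close>
    have "Y p (\<lambda>q. X q (\<lambda>q. a * f q + b * g q)) = a * Y p (\<lambda>q. X q f) + b * Y p (\<lambda>q. X q g)"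
      by (subst tangent_cong[OF t(2) assms(3), of _ "\<lambda>q. a * X q f + b * X q g"])
        (simp_all add: tangent_lin[OF vfield_tangent[OF assms(1)] f g] tangent_lin[OF t(2)] s f g)
    moreover have "X p (\<lambda>q. Y q (\<lambda>q. a * f q + b * g q)) = a * X p (\<lambda>q. Y q f) + b * X p (\<lambda>q. Y q g)"
      by (subst tangent_cong[OF t(1) assms(3), of _ "\<lambda>q. a * Y q f + b * Y q g"])
        (simp_all add: tangent_lin[OF vfield_tangent[OF assms(2)] f g] tangent_lin[OF t(1)] s f g)
    ultimately show ?thesis by (simp add: lie_bracket_def algebra_simps)
  qed
  moreover have "lie_bracket X Y p (\<lambda>q. f q * g q) = f p * lie_bracket X Y p g + g p * lie_bracket X Y p f"
    if f: "smooth_fun A f" and g: "smooth_fun A g" for f g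
  proof -
    have "Y p (\<lambda>q. X q (\<lambda>q. f q * g q)) = f p * Y p (\<lambda>q. X q g) + X p g * Y p f + (g p * Y p (\<lambda>q. X q f) + X p f * Y p g)"
      by (subst tangent_cong[OF t(2) assms(3), of _ "\<lambda>q. f q * X q g + g q * X q f"])
        (simp_all add: tangent_mult[OF vfield_tangent[OF assms(1)] f g] tangent_add[OF t(2)] tangent_mult[OF t(2)] s f g smooth_fun_mult)
    moreover have "X p (\<lambda>q. Y q (\<lambda>q. f q * g q)) = f p * X p (\<lambda>q. Y q g) + Y p g * X p f + (g p * X p (\<lambda>q. Y q f) + Y p f * X p g)"
      by (subst tangent_cong[OF t(1) assms(3), of _ "\<lambda>q. f q * Y q g + g q * Y q f"])
        (simp_all add: tangent_mult[OF vfield_tangent[OF assms(2)] f g] tangent_add[OF t(1)] tangent_mult[OF t(1)] s f g smooth_fun_mult)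
    ultimately show ?thesis by (simp add: lie_bracket_def algebra_simps)
  qed
  moreover have "lie_bracket X Y p f = 0" if "\<not> smooth_fun A f" for f
  proof -
    have "X p (\<lambda>q. Y q f) = X p (\<lambda>q. 0)" "Y p (\<lambda>q. X q f) = Y p (\<lambda>q. 0)"
      by (rule tangent_cong[OF t(1) assms(3)], rule tangent_nonsmooth[OF vfield_tangent[OF assms(2)] that], assumption)
        (rule tangent_cong[OF t(2) assms(3)], rule tangent_nonsmooth[OF vfield_tangent[OF assms(1)] that], assumption)
    then show ?thesis by (simp add: lie_bracket_def tangent_const[OF t(1)] tangent_const[OF t(2)])
  qed
  ultimately show ?thesis unfolding tangent_space_def by simp
qed

lemma vfield_lie_bracket: "vfield A X \<Longrightarrow> vfield A Y \<Longrightarrow> vfield A (lie_bracket X Y)"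
  unfolding vfield_def[of A "lie_bracket X Y"]
proof (intro conjI ballI allI impI)
  fix f :: "'a \<Rightarrow> real" assume X: "vfield A X" and Y: "vfield A Y" and f: "smooth_fun A f"
  show "smooth_fun A (\<lambda>p. lie_bracket X Y p f)"
    unfolding lie_bracket_def
    by (rule smooth_fun_diff[OF vfield_smooth[OF X vfield_smooth[OF Y f]] vfield_smooth[OF Y vfield_smooth[OF X f]]])
qed (rule lie_bracket_tangent)

lemma vf_lie_bracket: "X \<in> vector_fields A \<Longrightarrow> Y \<in> vector_fields A \<Longrightarrow> lie_bracket X Y \<in> vector_fields A"
  using vfield_lie_bracket unfolding vector_fields_iff by (auto simp: lie_bracket_def)

lemma local_frame_field:
  assumes "local_frame U \<phi> p \<kappa> N M \<xi> e" "Y \<in> vector_fields A"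
  shows "(\<lambda>q f. \<kappa> q * Y q f) = (\<lambda>q f. \<Sum>b\<in>Basis. (\<kappa> q * Y q (\<xi> b)) * e b q f)"
proof (intro ext)
  fix q f
  show "\<kappa> q * Y q f = (\<Sum>b\<in>Basis. (\<kappa> q * Y q (\<xi> b)) * e b q f)"
  proof (cases "q \<in> M")
    case True
    have "Y q f = (\<Sum>b\<in>Basis. Y q (\<xi> b) * e b q f)"
      by (rule fun_cong[OF local_frame_vector[OF assms(1) True vf_tangent[OF assms(2)]]])
    then show ?thesis by (simp add: sum_distrib_left mult.assoc)
  qed (simp add: local_frameD(10)[OF assms(1)])
qed

text \<open>Multiplying Y by a cut-off that is 1 at p does not change G, and the product is a
  combination of global frame fields whose coefficients G turns into their values at p. Applied to a
  connection in its first argument, to the vertical part of a tangent vector, and to the derivative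
  of a one-form.\<close>

lemma tensorial_functional:
  assumes "p \<in> points A"
    and add: "\<And>X Y. X \<in> vector_fields A \<Longrightarrow> Y \<in> vector_fields A \<Longrightarrow> G (\<lambda>q f. X q f + Y q f) = G X + G Y"
    and scale: "\<And>h X. smooth_fun A h \<Longrightarrow> X \<in> vector_fields A \<Longrightarrow> G (\<lambda>q f. h q * X q f) = h p * (G X :: real)"
  obtains \<eta> where "\<eta> \<in> cotangent_space A p" "\<And>Y. Y \<in> vector_fields A \<Longrightarrow> G Y = \<eta> (Y p)"
proof -
  obtain U \<phi> where c: "(U, \<phi>) \<in> A" "p \<in> U" using pointsE[OF assms(1)] by blast
  obtain \<kappa> N M \<xi> e where fr: "local_frame U \<phi> p \<kappa> N M \<xi> e" using local_frame_exists[OF c] by blast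
  note D = local_frameD[OF fr]
  define \<eta> where "\<eta> = (\<lambda>v. \<Sum>b\<in>Basis. G (e b) * dform A (\<xi> b) p v)"
  have s: "(\<lambda>q v. \<Sum>b\<in>Basis. G (e b) * dform A (\<xi> b) q v) \<in> one_forms A"
    by (intro one_form_sum one_form_scale smooth_fun_const dform_in_one_forms D(11))
  have \<eta>: "\<eta> \<in> cotangent_space A p" using one_form_cotangent[OF s, of p] by (simp add: \<eta>_def)
  have zero: "G (\<lambda>q f. 0) = 0" using scale[OF smooth_fun_const vf_zero, of 0] by simp
  have sum: "G (\<lambda>q f. \<Sum>i\<in>I. X i q f) = (\<Sum>i\<in>I. G (X i))" if "\<And>i. X i \<in> vector_fields A" for I :: "'e set" and X
    by (induction I rule: infinite_finite_induct) (simp_all add: zero add that vf_sum)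
  have "G Y = \<eta> (Y p)" if Y: "Y \<in> vector_fields A" for Y
  proof -
    have sm: "smooth_fun A (\<lambda>q. \<kappa> q * Y q (\<xi> b))" for b
      by (intro smooth_fun_mult D(1) vf_smooth[OF Y D(11)])
    have "G Y = G (\<lambda>q f. \<kappa> q * Y q f)" by (simp add: scale[OF D(1) Y] D(9)[OF D(3)])
    also have "\<dots> = (\<Sum>b\<in>Basis. G (\<lambda>q f. (\<kappa> q * Y q (\<xi> b)) * e b q f))"
      unfolding local_frame_field[OF fr Y] by (rule sum) (intro vf_scale sm D(12))
    also have "\<dots> = (\<Sum>b\<in>Basis. (\<kappa> p * Y p (\<xi> b)) * G (e b))"
      by (simp only: scale[OF sm D(12)])
    also have "\<dots> = \<eta> (Y p)"
      by (simp add: \<eta>_def D(9)[OF D(3)] dform_apply[OF assms(1) vf_tangent[OF Y]] mult.commute)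
    finally show ?thesis .
  qed
  with \<eta> that show thesis by blast
qed

section \<open>Tangent vectors and vector fields of the cotangent manifold in coordinates\<close>

lemma cotangent_point:
  assumes "u \<in> points \<T>"
  shows "fst u \<in> points A" "snd u \<in> cotangent_space A (fst u)"
  using assms by (auto simp: points_cotangent_atlas ct_dom_def)

lemma fib_add: "u \<in> points \<T> \<Longrightarrow> X \<in> vector_fields A \<Longrightarrow> Y \<in> vector_fields A \<Longrightarrow>
    fib (\<lambda>p f. X p f + Y p f) u = fib X u + fib Y u"
  unfolding fib_def by (rule cotangent_add[OF cotangent_point(2) vf_tangent vf_tangent])

lemma fib_scale: "u \<in> points \<T> \<Longrightarrow> X \<in> vector_fields A \<Longrightarrow>
    fib (\<lambda>p f. h p * X p f) u = h (fst u) * fib X u"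
  unfolding fib_def by (rule cotangent_scale[OF cotangent_point(2) vf_tangent])

lemma sum_Basis_prod:
  fixes f :: "'c::euclidean_space \<times> 'd::euclidean_space \<Rightarrow> real"
  shows "sum f Basis = (\<Sum>b\<in>Basis. f (b, 0)) + (\<Sum>b\<in>Basis. f (0, b))"
  unfolding Basis_prod_def
  by (subst sum.union_disjoint) (auto simp: sum.reindex inj_on_def nonzero_Basis)

lemma ct_tangent_expand:
  assumes fr: "local_frame U \<phi> p \<kappa> N M \<xi> e" and "(U, \<phi>) \<in> A"
    and u: "u \<in> ct_dom A M" and w: "w \<in> tangent_space \<T> u" and F: "smooth_fun \<T> F"
  shows "w F = (\<Sum>b\<in>Basis. w (\<lambda>v. \<xi> b (fst v)) * coord_vec \<T> (ct_dom A U, ct_map A U \<phi>) (b, 0) u F)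
    + (\<Sum>b\<in>Basis. w (fib (e b)) * coord_vec \<T> (ct_dom A U, ct_map A U \<phi>) (0, b) u F)"
proof -
  interpret B: smooth_atlas \<T> by (rule cotangent_smooth_atlas)
  note D = local_frameD[OF fr]
  \<comment> \<open>Global stand-ins for the induced coordinates. Basis vectors of the product have
    the form (b, 0) or (0, c) with c nonzero, so the test on the second component tells base from
    fibre coordinates.\<close>
  define \<Xi> where "\<Xi> = (\<lambda>(b::'e, c::'e). if c = 0 then (\<lambda>v. \<xi> b (fst v)) else fib (e c))"
  have 1: "smooth_fun \<T> (\<Xi> b)" for b
    by (cases b) (simp add: \<Xi>_def smooth_pullback[OF D(11)] smooth_fib[OF D(12)])
  have 2: "\<Xi> b v = ct_map A U \<phi> v \<bullet> b" if "b \<in> Basis" "v \<in> ct_dom A M" for b v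
  proof -
    have v: "fst v \<in> M" using that(2) by (simp add: ct_dom_def)
    from that(1) consider c where "b = (c, 0)" "c \<in> Basis" | c where "b = (0, c)" "c \<in> Basis" by (auto simp: Basis_prod_def)
    then show ?thesis
    proof cases
      case 1
      then show ?thesis by (simp add: \<Xi>_def D(13)[OF v] ct_map_def)
    next
      case 2
      then show ?thesis
        by (simp add: \<Xi>_def fib_def D(14)[OF v] ct_map_def fibre_coords_inner nonzero_Basis)
    qed
  qed
  have "ct_dom A M \<subseteq> ct_dom A U" using D(6) by (auto simp: ct_dom_def)
  from B.tangent_expand[OF w cotangent_atlasI[OF assms(2)] aopen_ct_dom[OF D(4)] u this 1 2 F]
  have "w F = (\<Sum>b\<in>Basis. w (\<Xi> b) * coord_vec \<T> (ct_dom A U, ct_map A U \<phi>) b u F)" .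
  also have "\<dots> = (\<Sum>b\<in>Basis. w (\<Xi> (b, 0)) * coord_vec \<T> (ct_dom A U, ct_map A U \<phi>) (b, 0) u F)
    + (\<Sum>b\<in>Basis. w (\<Xi> (0, b)) * coord_vec \<T> (ct_dom A U, ct_map A U \<phi>) (0, b) u F)"
    by (rule sum_Basis_prod)
  also have "(\<Sum>b\<in>Basis. w (\<Xi> (0, b)) * coord_vec \<T> (ct_dom A U, ct_map A U \<phi>) (0, b) u F)
    = (\<Sum>b\<in>Basis. w (fib (e b)) * coord_vec \<T> (ct_dom A U, ct_map A U \<phi>) (0, b) u F)"
    by (rule sum.cong) (auto simp: \<Xi>_def nonzero_Basis)
  finally show ?thesis by (simp add: \<Xi>_def)
qed

lemma ct_tangent_eqI:
  assumes "u \<in> points \<T>" "w \<in> tangent_space \<T> u" "w' \<in> tangent_space \<T> u"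
    and "\<And>f. smooth_fun A f \<Longrightarrow> w (\<lambda>v. f (fst v)) = w' (\<lambda>v. f (fst v))"
    and "\<And>X. X \<in> vector_fields A \<Longrightarrow> w (fib X) = w' (fib X)"
  shows "w = w'"
proof -
  interpret B: smooth_atlas \<T> by (rule cotangent_smooth_atlas)
  note p = cotangent_point[OF assms(1)]
  obtain U \<phi> where c: "(U, \<phi>) \<in> A" "fst u \<in> U" using pointsE[OF p(1)] by blast
  obtain \<kappa> N M \<xi> e where fr: "local_frame U \<phi> (fst u) \<kappa> N M \<xi> e" using local_frame_exists[OF c] by blast
  note D = local_frameD[OF fr]
  have u: "u \<in> ct_dom A M" using D(7) p(2) by (simp add: ct_dom_def)
  show ?thesis
    by (rule B.tangent_eqI[OF assms(2,3)])
       (simp add: ct_tangent_expand[OF fr c(1) u assms(2)] ct_tangent_expand[OF fr c(1) u assms(3)] assms(4)[OF D(11)] assms(5)[OF D(12)])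
qed

text \<open>Smoothness needs testing on pullbacks and fibrewise linear functions only, because the
  coefficients in \<open>ct_tangent_expand\<close> are values on such functions.\<close>

lemma ct_vfieldI:
  assumes t: "\<And>u. u \<in> points \<T> \<Longrightarrow> W u \<in> tangent_space \<T> u"
    and f: "\<And>f. smooth_fun A f \<Longrightarrow> smooth_fun \<T> (\<lambda>u. W u (\<lambda>v. f (fst v)))"
    and X: "\<And>X. X \<in> vector_fields A \<Longrightarrow> smooth_fun \<T> (\<lambda>u. W u (fib X))"
  shows "vfield \<T> W"
  unfolding vfield_def
proof (intro conjI ballI allI impI t)
  interpret B: smooth_atlas \<T> by (rule cotangent_smooth_atlas)
  fix F :: "'a ct \<Rightarrow> real" assume F: "smooth_fun \<T> F"
  show "smooth_fun \<T> (\<lambda>u. W u F)"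
  proof (rule B.smooth_fun_local)
    fix u assume "u \<in> points \<T>"
    note p = cotangent_point[OF this]
    obtain U \<phi> where c: "(U, \<phi>) \<in> A" "fst u \<in> U" using pointsE[OF p(1)] by blast
    obtain \<kappa> N M \<xi> e where fr: "local_frame U \<phi> (fst u) \<kappa> N M \<xi> e" using local_frame_exists[OF c] by blast
    note D = local_frameD[OF fr]
    have u: "u \<in> ct_dom A M" using D(7) p(2) by (simp add: ct_dom_def)
    have o: "aopen \<T> (ct_dom A M)" by (rule aopen_ct_dom[OF D(4)])
    note sub = B.aopen_subset_points[OF o]
    have cv: "smooth_fun_on \<T> (ct_dom A M) (\<lambda>u. coord_vec \<T> (ct_dom A U, ct_map A U \<phi>) b u F)" for b
      by (rule smooth_fun_on_subset[OF B.smooth_coord_vec[OF cotangent_atlasI[OF c(1)] F]]) (use D(6) in \<open>auto simp: ct_dom_def\<close>)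
    have "smooth_fun_on \<T> (ct_dom A M)
      (\<lambda>u. (\<Sum>b\<in>Basis. W u (\<lambda>v. \<xi> b (fst v)) * coord_vec \<T> (ct_dom A U, ct_map A U \<phi>) (b, 0) u F)
        + (\<Sum>b\<in>Basis. W u (fib (e b)) * coord_vec \<T> (ct_dom A U, ct_map A U \<phi>) (0, b) u F))"
      by (intro B.smooth_fun_on_add B.smooth_fun_on_sum B.smooth_fun_on_bilinear[OF o bounded_bilinear_mult] o cv
          smooth_fun_imp_on[OF f[OF D(11)] sub] smooth_fun_imp_on[OF X[OF D(12)] sub])
    then have "smooth_fun_on \<T> (ct_dom A M) (\<lambda>u. W u F)"
      by (rule B.smooth_fun_on_cong[OF o, rotated])
         (rule ct_tangent_expand[OF fr c(1) _ t F, symmetric], assumption, rule subsetD[OF sub])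
    then show "\<exists>M. aopen \<T> M \<and> u \<in> M \<and> smooth_fun_on \<T> M (\<lambda>u. W u F)"
      using o u by blast
  qed
qed

text \<open>A one-form is a smooth map into the cotangent manifold: its components in the induced
  charts are base coordinates and values on frame fields. This makes the pushforwards in
  \<open>horizontal_space\<close> tangent vectors.\<close>

lemma smooth_along_one_form:
  assumes "s \<in> one_forms A" "smooth_fun \<T> F"
  shows "smooth_fun A (\<lambda>q. F (q, s q))"
proof (rule smooth_fun_local)
  interpret B: smooth_atlas \<T> by (rule cotangent_smooth_atlas)
  fix p assume "p \<in> points A"
  then obtain U \<phi> where c: "(U, \<phi>) \<in> A" "p \<in> U" by (rule pointsE)
  obtain \<kappa> N M \<xi> e where fr: "local_frame U \<phi> p \<kappa> N M \<xi> e" using local_frame_exists[OF c] by blast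
  note D = local_frameD[OF fr]
  note s = one_form_cotangent[OF assms(1)]
  have MU: "(q, s q) \<in> ct_dom A U" if "q \<in> M" for q using that D(6) s by (auto simp: ct_dom_def)
  have comp: "smooth_fun_on A M (\<lambda>q. (ct_map A U \<phi> (q, s q)) \<bullet> b)" if b: "b \<in> Basis" for b
  proof -
    from b consider c where "b = (c, 0)" "c \<in> Basis" | c where "b = (0, c)" "c \<in> Basis" by (auto simp: Basis_prod_def)
    then show ?thesis
    proof cases
      case 1
      then have "smooth_fun_on A M (\<lambda>q. \<phi> q \<bullet> c)"
        by (intro smooth_fun_on_linear[OF D(4) bounded_linear_inner_left] smooth_fun_on_subset[OF smooth_fun_on_chart[OF c(1)] D(6)])
      with 1 show ?thesis by (simp add: ct_map_def)
    next
      case 2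
      have "smooth_fun_on A M (\<lambda>q. s q (e c q))"
        by (rule smooth_fun_imp_on[OF one_form_smooth[OF assms(1) D(12)] aopen_subset_points[OF D(4)]])
      then show ?thesis
        by (rule smooth_fun_on_cong[OF D(4), rotated]) (simp add: 2 ct_map_def fibre_coords_inner D(14))
    qed
  qed
  have "smooth_fun_on A M (\<lambda>q. \<Sum>b\<in>Basis. (ct_map A U \<phi> (q, s q) \<bullet> b) *\<^sub>R b)"
    by (intro smooth_fun_on_sum D(4) smooth_fun_on_bilinear[OF D(4) bounded_bilinear_scaleR] smooth_fun_on_const comp)
  then have 1: "smooth_fun_on A M (\<lambda>q. ct_map A U \<phi> (q, s q))" by (simp add: euclidean_representation)
  have "open (ct_map A U \<phi> ` ct_dom A U)" using B.overlap_open[OF cotangent_atlasI[OF c(1)] cotangent_atlasI[OF c(1)]] by simp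
  moreover have "smooth_on (ct_map A U \<phi> ` ct_dom A U) (F \<circ> inv_into (ct_dom A U) (ct_map A U \<phi>))"
    using assms(2) cotangent_atlasI[OF c(1)] unfolding smooth_fun_def by blast
  ultimately have "smooth_fun_on A M (\<lambda>q. (F \<circ> inv_into (ct_dom A U) (ct_map A U \<phi>)) (ct_map A U \<phi> (q, s q)))"
    by (rule smooth_fun_on_compose[OF D(4) 1, rotated 1]) (use MU in blast)
  then have "smooth_fun_on A M (\<lambda>q. F (q, s q))"
    by (rule smooth_fun_on_cong[OF D(4), rotated]) (simp add: ct_map_inv[OF c(1) MU])
  then show "\<exists>M. aopen A M \<and> p \<in> M \<and> smooth_fun_on A M (\<lambda>q. F (q, s q))" using D(4,7) by blast
qed

text \<open>In an induced chart, moving along \<eta> inside a fibre is motion on a straight line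
  with direction (0, y), where y are the coordinates of \<eta>. So the \<open>deriv\<close> in
  \<open>vertical_lift\<close> is an actual derivative, and the derivation laws follow by uniqueness
  of derivatives.\<close>

lemma fibre_differentiable:
  assumes u: "u \<in> points \<T>" and "\<eta> \<in> cotangent_space A (fst u)" and F: "smooth_fun \<T> F"
  shows "((\<lambda>t. F (fst u, \<lambda>v. snd u v + t * \<eta> v)) has_field_derivative vertical_lift A u \<eta> F) (at 0)"
proof -
  note p = cotangent_point[OF u]
  obtain U \<phi> where c: "(U, \<phi>) \<in> A" "fst u \<in> U" using pointsE[OF p(1)] by blast
  let ?G = "F \<circ> inv_into (ct_dom A U) (ct_map A U \<phi>)"
  have mem: "(fst u, \<lambda>v. snd u v + t * \<eta> v) \<in> ct_dom A U" for t
    using c(2) cotangent_space_lin[OF p(2) assms(2), of 1 t] by (simp add: ct_dom_def)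
  define y where "y = fibre_coords A U \<phi> (fst u, \<eta>)"
  have map: "ct_map A U \<phi> (fst u, \<lambda>v. snd u v + t * \<eta> v) = ct_map A U \<phi> u + t *\<^sub>R (0, y)" for t
    by (simp add: ct_map_def y_def fibre_coords_def sum.distrib scaleR_sum_right scaleR_add_left)
  have uU: "u \<in> ct_dom A U" using c p by (simp add: ct_dom_def)
  have "smooth_on (ct_map A U \<phi> ` ct_dom A U) ?G"
    using F cotangent_atlasI[OF c(1)] unfolding smooth_fun_def by blast
  from smooth_on_imp_differentiable[OF this imageI[OF uU]]
  obtain G' where G': "(?G has_derivative G') (at (ct_map A U \<phi> u))" unfolding differentiable_def by blast
  have "((\<lambda>t. ?G (ct_map A U \<phi> u + t *\<^sub>R (0, y))) has_derivative (\<lambda>t. G' (t *\<^sub>R (0, y)))) (at 0)"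
    by (rule has_derivative_compose[of "\<lambda>t. ct_map A U \<phi> u + t *\<^sub>R (0, y)" "\<lambda>t. t *\<^sub>R (0, y)" 0 UNIV ?G G'])
       (auto intro!: derivative_eq_intros G'[unfolded comp_def] simp del: scaleR_Pair simp: comp_def)
  moreover have "?G (ct_map A U \<phi> u + t *\<^sub>R (0, y)) = F (fst u, \<lambda>v. snd u v + t * \<eta> v)" for t
    by (simp only: map[symmetric] comp_def ct_map_inv[OF c(1) mem])
  moreover have "G' (t *\<^sub>R (0, y)) = G' (0, y) * t" for t
    using linear_scale[OF has_derivative_linear[OF G'], of t "(0, y)"] by simp
  ultimately have "((\<lambda>t. F (fst u, \<lambda>v. snd u v + t * \<eta> v)) has_field_derivative G' (0, y)) (at 0)"
    by (simp only: has_field_derivative_def)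
  then show ?thesis using F by (simp add: vertical_lift_def DERIV_imp_deriv)
qed

lemma vertical_lift_tangent:
  assumes u: "u \<in> points \<T>" and \<eta>: "\<eta> \<in> cotangent_space A (fst u)"
  shows "vertical_lift A u \<eta> \<in> tangent_space \<T> u"
proof -
  interpret B: smooth_atlas \<T> by (rule cotangent_smooth_atlas)
  note der = fibre_differentiable[OF u \<eta>]
  have "vertical_lift A u \<eta> (\<lambda>v. a * F v + b * G v) = a * vertical_lift A u \<eta> F + b * vertical_lift A u \<eta> G"
    if "smooth_fun \<T> F" "smooth_fun \<T> G" for F G a b
    by (rule DERIV_unique[OF der]) (auto intro!: derivative_eq_intros der that B.smooth_fun_intros)
  moreover have "vertical_lift A u \<eta> (\<lambda>v. F v * G v) = F u * vertical_lift A u \<eta> G + G u * vertical_lift A u \<eta> F"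
    if "smooth_fun \<T> F" "smooth_fun \<T> G" for F G
    by (rule DERIV_unique[OF der]) (auto intro!: derivative_eq_intros der that B.smooth_fun_intros)
  ultimately show ?thesis unfolding tangent_space_def by (simp add: vertical_lift_def)
qed

end

section \<open>Horizontal and vertical parts of a tangent vector\<close>

locale connection_atlas = smooth_atlas A for A :: "('a, 'e::euclidean_space) chart set" +
  fixes D :: "('a \<Rightarrow> 'a tvec) \<Rightarrow> ('a \<Rightarrow> 'a tvec) \<Rightarrow> 'a \<Rightarrow> 'a tvec"
  assumes connection: "linear_connection A D"
begin

lemma conn_vf: "X \<in> vector_fields A \<Longrightarrow> Y \<in> vector_fields A \<Longrightarrow> D X Y \<in> vector_fields A"
  and conn_add1: "X \<in> vector_fields A \<Longrightarrow> Y \<in> vector_fields A \<Longrightarrow> Z \<in> vector_fields A \<Longrightarrow>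
        D (\<lambda>p f. X p f + Y p f) Z = (\<lambda>p f. D X Z p f + D Y Z p f)"
  and conn_scale1: "smooth_fun A h \<Longrightarrow> X \<in> vector_fields A \<Longrightarrow> Y \<in> vector_fields A \<Longrightarrow>
        D (\<lambda>p f. h p * X p f) Y = (\<lambda>p f. h p * D X Y p f)"
  and conn_add2: "X \<in> vector_fields A \<Longrightarrow> Y \<in> vector_fields A \<Longrightarrow> Z \<in> vector_fields A \<Longrightarrow>
        D X (\<lambda>p f. Y p f + Z p f) = (\<lambda>p f. D X Y p f + D X Z p f)"
  and conn_scale2: "smooth_fun A h \<Longrightarrow> X \<in> vector_fields A \<Longrightarrow> Y \<in> vector_fields A \<Longrightarrow>
        D X (\<lambda>p f. h p * Y p f) = (\<lambda>p f. X p h * Y p f + h p * D X Y p f)"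
  using connection unfolding linear_connection_def by blast+

lemma conn_lin1: "X \<in> vector_fields A \<Longrightarrow> Y \<in> vector_fields A \<Longrightarrow> Z \<in> vector_fields A \<Longrightarrow>
    D (\<lambda>p f. a * X p f + b * Y p f) Z = (\<lambda>p f. a * D X Z p f + b * D Y Z p f)"
  by (simp add: conn_add1[OF vf_scale[OF smooth_fun_const] vf_scale[OF smooth_fun_const]] conn_scale1 smooth_fun_const)

lemma conn_lin2: "X \<in> vector_fields A \<Longrightarrow> Y \<in> vector_fields A \<Longrightarrow> Z \<in> vector_fields A \<Longrightarrow>
    D X (\<lambda>p f. a * Y p f + b * Z p f) = (\<lambda>p f. a * D X Y p f + b * D X Z p f)"
  by (auto simp: conn_add2[OF _ vf_scale[OF smooth_fun_const] vf_scale[OF smooth_fun_const]] conn_scale2 smooth_fun_const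
      tangent_const[OF vf_tangent])

text \<open>For fixed Y and f, the map sending X to \<open>D X Y p f\<close> is a tensorial
  functional, hence it depends on the value of X at p only.\<close>

lemma conn_tensorial:
  assumes "X \<in> vector_fields A" "X' \<in> vector_fields A" "Y \<in> vector_fields A" "X p = X' p"
  shows "D X Y p = D X' Y p"
proof (cases "p \<in> points A")
  case True
  show ?thesis
  proof
    fix f
    obtain \<eta> where "\<And>X. X \<in> vector_fields A \<Longrightarrow> D X Y p f = \<eta> (X p)"
      by (rule tensorial_functional[OF True, of "\<lambda>X. D X Y p f"]) (auto simp: conn_add1 conn_scale1 assms(3))
    then show "D X Y p f = D X' Y p f" using assms by simp
  qed
qed (use conn_vf[of X Y] conn_vf[of X' Y] assms in \<open>simp add: vector_fields_iff\<close>)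

text \<open>After multiplication by a bump function supported near p the two fields coincide.
  Leibniz' rule undoes this at p, since the terms that differentiate the bump function involve only
  the common value there.\<close>

lemma conn_local:
  assumes "X \<in> vector_fields A" "Y \<in> vector_fields A" "Y' \<in> vector_fields A" "aopen A N" "p \<in> N"
    and eq: "\<And>q. q \<in> N \<Longrightarrow> Y q = Y' q"
  shows "D X Y p = D X Y' p"
proof
  fix f
  obtain \<kappa> :: "'a \<Rightarrow> real" and M where \<kappa>: "smooth_fun A \<kappa>" "p \<in> M" "\<And>q. q \<in> M \<Longrightarrow> \<kappa> q = 1" "\<And>q. q \<notin> N \<Longrightarrow> \<kappa> q = 0"
    using bump_obtain[OF assms(4,5)] by metis
  have "\<kappa> q * Y q f = \<kappa> q * Y' q f" for q f using \<kappa>(4) eq by (cases "q \<in> N") auto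
  then have "D X (\<lambda>q f. \<kappa> q * Y q f) = D X (\<lambda>q f. \<kappa> q * Y' q f)" by presburger
  then have "D X (\<lambda>q f. \<kappa> q * Y q f) p f = D X (\<lambda>q f. \<kappa> q * Y' q f) p f" by simp
  then show "D X Y p f = D X Y' p f"
    using \<kappa> eq[OF assms(5)] by (simp add: conn_scale2[OF \<kappa>(1) assms(1)] assms(2,3))
qed

text \<open>\<open>w\<close> is the sum of the horizontal lift of \<open>a\<close> and the vertical lift of \<open>\<eta>\<close>, expressed through
  the values of \<open>w\<close> on the functions that determine it.\<close>

definition splits :: "'a ct \<Rightarrow> 'a ct tvec \<Rightarrow> 'a tvec \<Rightarrow> 'a covec \<Rightarrow> bool" where
  "splits u w a \<eta> \<longleftrightarrow> w \<in> tangent_space \<T> u \<and> a \<in> tangent_space A (fst u) \<and>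
     \<eta> \<in> cotangent_space A (fst u) \<and> (\<forall>f. smooth_fun A f \<longrightarrow> w (\<lambda>v. f (fst v)) = a f) \<and>
     (\<forall>X\<in>vector_fields A. \<forall>Y\<in>vector_fields A. X (fst u) = a \<longrightarrow>
        w (fib Y) = snd u (D X Y (fst u)) + \<eta> (Y (fst u)))"

lemma splitsD:
  assumes "splits u w a \<eta>"
  shows "w \<in> tangent_space \<T> u" "a \<in> tangent_space A (fst u)" "\<eta> \<in> cotangent_space A (fst u)"
    "\<And>f. smooth_fun A f \<Longrightarrow> w (\<lambda>v. f (fst v)) = a f"
    "\<And>X Y. X \<in> vector_fields A \<Longrightarrow> Y \<in> vector_fields A \<Longrightarrow> X (fst u) = a \<Longrightarrow>
        w (fib Y) = snd u (D X Y (fst u)) + \<eta> (Y (fst u))"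
  using assms unfolding splits_def by blast+

text \<open>The definition tests all fields with the prescribed value at the base point; by
  tensoriality one of them decides.\<close>

lemma splitsI:
  assumes "w \<in> tangent_space \<T> u" "X \<in> vector_fields A" "\<eta> \<in> cotangent_space A (fst u)"
    and "\<And>f. smooth_fun A f \<Longrightarrow> w (\<lambda>v. f (fst v)) = X (fst u) f"
    and "\<And>Y. Y \<in> vector_fields A \<Longrightarrow> w (fib Y) = snd u (D X Y (fst u)) + \<eta> (Y (fst u))"
  shows "splits u w (X (fst u)) \<eta>"
  unfolding splits_def
proof (intro conjI ballI allI impI)
  fix X' Y assume "X' \<in> vector_fields A" "Y \<in> vector_fields A" "X' (fst u) = X (fst u)"
  then have "D X' Y (fst u) = D X Y (fst u)" by (intro conn_tensorial assms(2))
  then show "w (fib Y) = snd u (D X' Y (fst u)) + \<eta> (Y (fst u))"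
    using assms(5)[OF \<open>Y \<in> vector_fields A\<close>] by simp
qed (simp_all add: assms(1,3,4) vf_tangent[OF assms(2)])

lemma pushforward_fst_tangent:
  assumes "u \<in> points \<T>" "w \<in> tangent_space \<T> u"
  shows "pushforward A fst w \<in> tangent_space A (fst u)"
proof -
  interpret B: smooth_atlas \<T> by (rule cotangent_smooth_atlas)
  show ?thesis
    unfolding tangent_space_def[of A]
    by (simp add: pushforward_def comp_def smooth_fun_intros B.tangent_lin[OF assms(2)] B.tangent_mult[OF assms(2)] smooth_pullback)
qed

text \<open>The vertical part sends Y to w(fib Y) - \<xi>(D_X Y). Replacing Y by h Y produces the
  term X(h) \<xi>(Y) in both summands, where it cancels, so the expression is tensorial in Y and
  therefore a covector.\<close>

lemma splits_exists:
  assumes u: "u \<in> points \<T>" and w: "w \<in> tangent_space \<T> u"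
  obtains \<eta> where "splits u w (pushforward A fst w) \<eta>"
proof -
  interpret B: smooth_atlas \<T> by (rule cotangent_smooth_atlas)
  note p = cotangent_point[OF u]
  obtain X where X: "X \<in> vector_fields A" "X (fst u) = pushforward A fst w"
    using extend_tangent[OF p(1) pushforward_fst_tangent[OF u w]] by blast
  have Xf: "w (\<lambda>v. f (fst v)) = X (fst u) f" if "smooth_fun A f" for f
    by (simp add: X(2) pushforward_def that comp_def)
  define G where "G = (\<lambda>Y. w (fib Y) - snd u (D X Y (fst u)))"
  have "G (\<lambda>p f. Y p f + Z p f) = G Y + G Z" if Y: "Y \<in> vector_fields A" and Z: "Z \<in> vector_fields A" for Y Z
  proof -
    have "w (fib (\<lambda>p f. Y p f + Z p f)) = w (\<lambda>v. fib Y v + fib Z v)"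
      by (rule B.tangent_cong[OF w u]) (rule fib_add[OF _ Y Z])
    then show ?thesis
      using cotangent_add[OF p(2) vf_tangent[OF conn_vf[OF X(1) Y]] vf_tangent[OF conn_vf[OF X(1) Z]]]
      by (simp add: G_def B.tangent_add[OF w] smooth_fib Y Z conn_add2[OF X(1)])
  qed
  moreover have "G (\<lambda>p f. h p * Y p f) = h (fst u) * G Y" if h: "smooth_fun A h" and Y: "Y \<in> vector_fields A" for h Y
  proof -
    have "w (fib (\<lambda>p f. h p * Y p f)) = w (\<lambda>v. h (fst v) * fib Y v)"
      by (rule B.tangent_cong[OF w u]) (rule fib_scale[OF _ Y])
    also have "\<dots> = h (fst u) * w (fib Y) + fib Y u * X (fst u) h"
      by (simp add: B.tangent_mult[OF w smooth_pullback[OF h] smooth_fib[OF Y]] Xf[OF h])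
    finally show ?thesis
      using cotangent_lin[OF p(2) vf_tangent[OF Y] vf_tangent[OF conn_vf[OF X(1) Y]], of "X (fst u) h" "h (fst u)"]
      by (simp add: G_def conn_scale2[OF h X(1) Y] fib_def algebra_simps)
  qed
  ultimately obtain \<eta> where \<eta>: "\<eta> \<in> cotangent_space A (fst u)" "\<And>Y. Y \<in> vector_fields A \<Longrightarrow> G Y = \<eta> (Y (fst u))"
    using tensorial_functional[OF p(1), of G] by blast
  have "splits u w (X (fst u)) \<eta>"
    by (rule splitsI[OF w X(1) \<eta>(1) Xf]) (use \<eta>(2) in \<open>auto simp: G_def algebra_simps\<close>)
  then show thesis using that X(2) by simp
qed

lemma splits_unique:
  assumes u: "u \<in> points \<T>" and "splits u w a \<eta>" "splits u w' a \<eta>"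
  shows "w = w'"
proof -
  obtain X where X: "X \<in> vector_fields A" "X (fst u) = a"
    using extend_tangent[OF cotangent_point(1)[OF u] splitsD(2)[OF assms(2)]] by blast
  show ?thesis
    using splitsD[OF assms(2)] splitsD[OF assms(3)] X
    by (intro ct_tangent_eqI[OF u]) auto
qed

lemma splits_functional:
  assumes u: "u \<in> points \<T>" and "splits u w a \<eta>" "splits u w a' \<eta>'"
  shows "a = a'" "\<eta> = \<eta>'"
proof -
  show a: "a = a'"
    using splitsD(2,4)[OF assms(2)] splitsD(2,4)[OF assms(3)] by (intro tangent_eqI) auto
  note p = cotangent_point[OF u]
  obtain X where X: "X \<in> vector_fields A" "X (fst u) = a"
    using extend_tangent[OF p(1) splitsD(2)[OF assms(2)]] by blast
  show "\<eta> = \<eta>'"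
  proof (rule cotangent_eqI[OF splitsD(3)[OF assms(2)] splitsD(3)[OF assms(3)]])
    fix v assume "v \<in> tangent_space A (fst u)"
    then obtain Y where "Y \<in> vector_fields A" "Y (fst u) = v" using extend_tangent[OF p(1)] by blast
    then show "\<eta> v = \<eta>' v" using splitsD(5)[OF assms(2) X(1)] splitsD(5)[OF assms(3) X(1)] X(2) a by fastforce
  qed
qed

lemma splits_lin:
  assumes u: "u \<in> points \<T>" and 1: "splits u w1 a1 \<eta>1" and 2: "splits u w2 a2 \<eta>2"
  shows "splits u (\<lambda>F. c * w1 F + d * w2 F) (\<lambda>f. c * a1 f + d * a2 f) (\<lambda>v. c * \<eta>1 v + d * \<eta>2 v)"
proof -
  interpret B: smooth_atlas \<T> by (rule cotangent_smooth_atlas)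
  note p = cotangent_point[OF u]
  obtain X1 where X1: "X1 \<in> vector_fields A" "X1 (fst u) = a1" using extend_tangent[OF p(1) splitsD(2)[OF 1]] by blast
  obtain X2 where X2: "X2 \<in> vector_fields A" "X2 (fst u) = a2" using extend_tangent[OF p(1) splitsD(2)[OF 2]] by blast
  let ?X = "\<lambda>p f. c * X1 p f + d * X2 p f"
  have "splits u (\<lambda>F. c * w1 F + d * w2 F) (?X (fst u)) (\<lambda>v. c * \<eta>1 v + d * \<eta>2 v)"
  proof (rule splitsI)
    show "?X \<in> vector_fields A" by (intro vf_add vf_scale smooth_fun_const X1(1) X2(1))
    show "(\<lambda>F. c * w1 F + d * w2 F) \<in> tangent_space \<T> u"
      by (rule B.tangent_space_lin[OF splitsD(1)[OF 1] splitsD(1)[OF 2]])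
    show "(\<lambda>v. c * \<eta>1 v + d * \<eta>2 v) \<in> cotangent_space A (fst u)"
      by (rule cotangent_space_lin[OF splitsD(3)[OF 1] splitsD(3)[OF 2]])
  next
    fix Y assume Y: "Y \<in> vector_fields A"
    show "c * w1 (fib Y) + d * w2 (fib Y) = snd u (D ?X Y (fst u)) + (c * \<eta>1 (Y (fst u)) + d * \<eta>2 (Y (fst u)))"
      using cotangent_lin[OF p(2) vf_tangent[OF conn_vf[OF X1(1) Y]] vf_tangent[OF conn_vf[OF X2(1) Y]], of c d]
      by (simp add: splitsD(5)[OF 1 X1(1) Y X1(2)] splitsD(5)[OF 2 X2(1) Y X2(2)] conn_lin1[OF X1(1) X2(1) Y] algebra_simps)
  qed (simp add: splitsD(4)[OF 1] splitsD(4)[OF 2] X1 X2)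
  then show ?thesis by (simp add: X1(2) X2(2))
qed

lemma conn_zero1: "X \<in> vector_fields A \<Longrightarrow> D (\<lambda>p f. 0) X = (\<lambda>p f. 0)"
  using conn_lin1[OF vf_zero vf_zero, of X 0 0] by simp

lemma splits_vertical:
  assumes u: "u \<in> points \<T>" and \<eta>: "\<eta> \<in> cotangent_space A (fst u)"
  shows "splits u (vertical_lift A u \<eta>) (\<lambda>f. 0) \<eta>"
proof -
  note p = cotangent_point[OF u]
  have "splits u (vertical_lift A u \<eta>) ((\<lambda>p f. 0) (fst u)) \<eta>"
  proof (rule splitsI[OF vertical_lift_tangent[OF u \<eta>] vf_zero \<eta>])
    fix f :: "'a \<Rightarrow> real" assume "smooth_fun A f"
    from fibre_differentiable[OF u \<eta> smooth_pullback[OF this]]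
    have "((\<lambda>t. f (fst u)) has_field_derivative vertical_lift A u \<eta> (\<lambda>v. f (fst v))) (at 0)" by simp
    then show "vertical_lift A u \<eta> (\<lambda>v. f (fst v)) = 0" by (rule DERIV_unique[OF _ DERIV_const])
  next
    fix Y assume Y: "Y \<in> vector_fields A"
    have "((\<lambda>t. fib Y (fst u, \<lambda>v. snd u v + t * \<eta> v)) has_field_derivative \<eta> (Y (fst u))) (at 0)"
      by (auto simp: fib_def intro!: derivative_eq_intros)
    then have "vertical_lift A u \<eta> (fib Y) = \<eta> (Y (fst u))"
      using fibre_differentiable[OF u \<eta> smooth_fib[OF Y]] DERIV_unique by blast
    then show "vertical_lift A u \<eta> (fib Y) = snd u (D (\<lambda>p f. 0) Y (fst u)) + \<eta> (Y (fst u))"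
      by (simp add: conn_zero1[OF Y] cotangent_zero[OF p(2)])
  qed
  then show ?thesis .
qed

lemma pushforward_one_form_tangent:
  assumes "s \<in> one_forms A" "a \<in> tangent_space A p"
  shows "pushforward \<T> (\<lambda>q. (q, s q)) a \<in> tangent_space \<T> (p, s p)"
proof -
  interpret B: smooth_atlas \<T> by (rule cotangent_smooth_atlas)
  show ?thesis
    unfolding tangent_space_def[of \<T>]
    by (simp add: pushforward_def comp_def B.smooth_fun_intros tangent_lin[OF assms(2)] tangent_mult[OF assms(2)]
        smooth_along_one_form[OF assms(1)])
qed

text \<open>Along a one-form s the function \<open>fib Y\<close> becomes s(Y). Thus w(fib Y) =
  X(s(Y)), and D_X s = 0 turns this into s(D_X Y), which is the value for vanishing vertical
  part.\<close>

lemma horizontal_imp_splits: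
  assumes u: "u \<in> points \<T>" and w: "w \<in> horizontal_space A D u"
  obtains a where "splits u w a (\<lambda>v. 0)"
proof -
  obtain s X where s: "s \<in> one_forms A" "X \<in> vector_fields A" "s (fst u) = snd u"
    "\<And>Y. Y \<in> vector_fields A \<Longrightarrow> dual_conn D X s Y (fst u) = 0"
    "w = pushforward \<T> (\<lambda>q. (q, s q)) (X (fst u))"
    using w unfolding horizontal_space_def by blast
  have "splits u w (X (fst u)) (\<lambda>v. 0)"
  proof (rule splitsI[OF _ s(2) cotangent_space_zero])
    show "w \<in> tangent_space \<T> u"
      using pushforward_one_form_tangent[OF s(1) vf_tangent[OF s(2)], of "fst u"] s(3,5) by simp
    show "w (\<lambda>v. f (fst v)) = X (fst u) f" if "smooth_fun A f" for f
      by (simp add: s(5) pushforward_def smooth_pullback[OF that] comp_def)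
    show "w (fib Y) = snd u (D X Y (fst u)) + 0" if "Y \<in> vector_fields A" for Y
      using s(4)[OF that] by (simp add: s(3,5) pushforward_def smooth_fib[OF that] comp_def fib_def dual_conn_def)
  qed
  then show thesis by (rule that)
qed

text \<open>Start from any one-form s0 through u and subtract h t, where h vanishes at the base
  point with derivative 1 along a, and t has there the value of D_X s0. The difference still passes
  through u, and its derivative along X at the base point is D_X s0 - a(h) t = 0.\<close>

lemma horizontal_exists:
  assumes u: "u \<in> points \<T>" and a: "a \<in> tangent_space A (fst u)"
  obtains w where "w \<in> horizontal_space A D u" "splits u w a (\<lambda>v. 0)"
proof -
  note p = cotangent_point[OF u]
  obtain X where X: "X \<in> vector_fields A" "X (fst u) = a" using extend_tangent[OF p(1) a] by blast
  obtain s0 where s0: "s0 \<in> one_forms A" "s0 (fst u) = snd u" using extend_cotangent[OF p] by blast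
  note s0c = one_form_cotangent[OF s0(1)]
  have sm: "smooth_fun A (\<lambda>q. s q (Y q))" if "s \<in> one_forms A" "Y \<in> vector_fields A" for s Y
    using that by (rule one_form_smooth)
  have "\<exists>s\<in>one_forms A. s (fst u) = snd u \<and> (\<forall>Y\<in>vector_fields A. dual_conn D X s Y (fst u) = 0)"
  proof (cases "a = (\<lambda>f. 0)")
    case True
    \<comment> \<open>For a = 0 no function has derivative 1 along a, but then the derivative of
      every one-form along X already vanishes at the base point.\<close>
    have "D X Y (fst u) = (\<lambda>f. 0)" if "Y \<in> vector_fields A" for Y
      using conn_tensorial[OF X(1) vf_zero that, of "fst u"] X(2) True conn_zero1[OF that] by simp
    then show ?thesis
      using s0 by (intro bexI[of _ s0]) (simp_all add: dual_conn_def X(2) True cotangent_zero[OF p(2)])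
  next
    case False
    then obtain g where "a g \<noteq> 0" by blast
    then have g: "smooth_fun A g" "a g \<noteq> 0" using tangent_nonsmooth[OF a] by blast+
    define h where "h = (\<lambda>q. inverse (a g) * (g q - g (fst u)))"
    have h: "smooth_fun A h" unfolding h_def by (intro smooth_fun_intros g(1))
    have ah: "a h = 1"
      using g(2) by (simp add: h_def tangent_scale[OF a] tangent_diff[OF a] tangent_const[OF a] smooth_fun_intros g(1))
    have hp: "h (fst u) = 0" by (simp add: h_def)
    obtain \<eta> where \<eta>: "\<eta> \<in> cotangent_space A (fst u)" "\<And>Y. Y \<in> vector_fields A \<Longrightarrow> dual_conn D X s0 Y (fst u) = \<eta> (Y (fst u))"
    proof (rule tensorial_functional[OF p(1), of "\<lambda>Y. dual_conn D X s0 Y (fst u)"])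
      fix Y Z assume Y: "Y \<in> vector_fields A" and Z: "Z \<in> vector_fields A"
      have "(\<lambda>q. s0 q (\<lambda>f. Y q f + Z q f)) = (\<lambda>q. s0 q (Y q) + s0 q (Z q))"
        by (intro ext cotangent_add[OF s0c] vf_tangent Y Z)
      then show "dual_conn D X s0 (\<lambda>p f. Y p f + Z p f) (fst u) = dual_conn D X s0 Y (fst u) + dual_conn D X s0 Z (fst u)"
        by (simp add: dual_conn_def conn_add2[OF X(1) Y Z] cotangent_add[OF s0c vf_tangent[OF conn_vf[OF X(1) Y]] vf_tangent[OF conn_vf[OF X(1) Z]]]
            tangent_add[OF vf_tangent[OF X(1)]] sm s0(1) Y Z)
    next
      fix k :: "'a \<Rightarrow> real" and Y assume k: "smooth_fun A k" and Y: "Y \<in> vector_fields A"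
      have "(\<lambda>q. s0 q (\<lambda>f. k q * Y q f)) = (\<lambda>q. k q * s0 q (Y q))"
        by (intro ext cotangent_scale[OF s0c] vf_tangent Y)
      then show "dual_conn D X s0 (\<lambda>p f. k p * Y p f) (fst u) = k (fst u) * dual_conn D X s0 Y (fst u)"
        by (simp add: dual_conn_def conn_scale2[OF k X(1) Y] cotangent_lin[OF s0c vf_tangent[OF Y] vf_tangent[OF conn_vf[OF X(1) Y]]]
            tangent_mult[OF vf_tangent[OF X(1)]] sm s0(1) Y k algebra_simps)
    qed blast
    obtain t where t: "t \<in> one_forms A" "t (fst u) = \<eta>" using extend_cotangent[OF p(1) \<eta>(1)] by blast
    define s where "s = (\<lambda>q v. s0 q v + (- h q) * t q v)"
    have s: "s \<in> one_forms A" unfolding s_def by (intro one_form_add one_form_scale smooth_fun_minus h s0(1) t(1))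
    have "dual_conn D X s Y (fst u) = 0" if Y: "Y \<in> vector_fields A" for Y
    proof -
      have "X (fst u) (\<lambda>q. s q (Y q)) = X (fst u) (\<lambda>q. s0 q (Y q)) - \<eta> (Y (fst u))"
        by (simp add: s_def tangent_diff[OF a] tangent_mult[OF a] smooth_fun_mult h sm s0(1) t Y hp X(2) ah)
      then show ?thesis using \<eta>(2)[OF Y] by (simp add: dual_conn_def) (simp add: s_def hp)
    qed
    moreover have "s (fst u) = snd u" by (simp add: s_def hp s0(2))
    ultimately show ?thesis using s by blast
  qed
  then obtain s where s: "s \<in> one_forms A" "s (fst u) = snd u" "\<And>Y. Y \<in> vector_fields A \<Longrightarrow> dual_conn D X s Y (fst u) = 0" by blast
  define w where "w = pushforward \<T> (\<lambda>q. (q, s q)) (X (fst u))"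
  have w: "w \<in> horizontal_space A D u"
    unfolding horizontal_space_def w_def using s X(1) by blast
  then obtain a' where a': "splits u w a' (\<lambda>v. 0)" using horizontal_imp_splits[OF u] by blast
  have "a' = a"
  proof (rule tangent_eqI[OF splitsD(2)[OF a'] a])
    fix f :: "'a \<Rightarrow> real" assume f: "smooth_fun A f"
    have "w (\<lambda>v. f (fst v)) = a f" by (simp add: w_def pushforward_def smooth_pullback[OF f] comp_def X(2))
    then show "a' f = a f" using splitsD(4)[OF a' f] by simp
  qed
  then show thesis using that w a' by blast
qed

lemma splits_surj:
  assumes u: "u \<in> points \<T>" and a: "a \<in> tangent_space A (fst u)" and \<eta>: "\<eta> \<in> cotangent_space A (fst u)"
  obtains w where "splits u w a \<eta>"
proof -
  obtain w where w: "splits u w a (\<lambda>v. 0)" using horizontal_exists[OF u a] by blast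
  from splits_lin[OF u w splits_vertical[OF u \<eta>], of 1 1] that show thesis by simp
qed

text \<open>Replaces the definite description in the splitting by the relation
  \<open>splits\<close>: existence is \<open>horizontal_exists\<close>, uniqueness
  \<open>splits_functional\<close>.\<close>

lemma split_eq:
  assumes u: "u \<in> points \<T>" and w: "splits u w a \<eta>"
  shows "horizontal_vertical_split A D u w = (a, \<eta>)"
proof -
  have "pushforward A fst w = a"
    using splits_exists[OF u splitsD(1)[OF w]] splits_functional(1)[OF u w] by metis
  moreover have "(THE \<eta>. \<eta> \<in> cotangent_space A (fst u) \<and> (\<lambda>F. w F - vertical_lift A u \<eta> F) \<in> horizontal_space A D u) = \<eta>"
  proof (rule the_equality)
    have s: "splits u (\<lambda>F. w F - vertical_lift A u \<eta> F) a (\<lambda>v. 0)"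
      using splits_lin[OF u w splits_vertical[OF u splitsD(3)[OF w]], of 1 "-1"] by simp
    obtain w' where w': "w' \<in> horizontal_space A D u" "splits u w' a (\<lambda>v. 0)"
      by (rule horizontal_exists[OF u splitsD(2)[OF w]])
    show "\<eta> \<in> cotangent_space A (fst u) \<and> (\<lambda>F. w F - vertical_lift A u \<eta> F) \<in> horizontal_space A D u"
      using splits_unique[OF u s w'(2)] w'(1) splitsD(3)[OF w] by simp
  next
    fix \<eta>' assume \<eta>': "\<eta>' \<in> cotangent_space A (fst u) \<and> (\<lambda>F. w F - vertical_lift A u \<eta>' F) \<in> horizontal_space A D u"
    then obtain a' where a': "splits u (\<lambda>F. w F - vertical_lift A u \<eta>' F) a' (\<lambda>v. 0)"
      using horizontal_imp_splits[OF u] by blast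
    have "splits u w a' \<eta>'"
      using splits_lin[OF u a' splits_vertical[OF u], of \<eta>' 1 1] \<eta>' by simp
    then show "\<eta>' = \<eta>" using splits_functional(2)[OF u w] by simp
  qed
  ultimately show ?thesis by (simp add: horizontal_vertical_split_def)
qed

lemma cotangent_acs_splits:
  assumes u: "u \<in> points \<T>" and w: "splits u w a \<eta>" and J: "J (fst u) (a, \<eta>) = (b, \<zeta>)"
    and bz: "b \<in> tangent_space A (fst u)" "\<zeta> \<in> cotangent_space A (fst u)"
  shows "splits u (cotangent_acs A J D u w) b \<zeta>"
proof -
  obtain w' where w': "splits u w' b \<zeta>" by (rule splits_surj[OF u bz])
  have "inj_on (horizontal_vertical_split A D u) (tangent_space \<T> u)"
  proof (rule inj_onI)
    fix w1 w2 assume a: "w1 \<in> tangent_space \<T> u" "w2 \<in> tangent_space \<T> u"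
      "horizontal_vertical_split A D u w1 = horizontal_vertical_split A D u w2"
    obtain \<eta>1 where 1: "splits u w1 (pushforward A fst w1) \<eta>1" using splits_exists[OF u a(1)] by blast
    obtain \<eta>2 where 2: "splits u w2 (pushforward A fst w2) \<eta>2" using splits_exists[OF u a(2)] by blast
    show "w1 = w2" using splits_unique[OF u] 1 2 a(3) split_eq[OF u 1] split_eq[OF u 2] by (metis prod.inject)
  qed
  from inv_into_f_f[OF this splitsD(1)[OF w']] have "cotangent_acs A J D u w = w'"
    by (simp add: cotangent_acs_def split_eq[OF u w] J split_eq[OF u w'])
  then show ?thesis using w' by simp
qed

section \<open>Lifts of sections and their brackets\<close>

definition lift :: "('a \<Rightarrow> 'a tvec) \<Rightarrow> ('a \<Rightarrow> 'a covec) \<Rightarrow> 'a ct \<Rightarrow> 'a ct tvec" where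
  "lift X s u = (if u \<in> points \<T> then THE w. splits u w (X (fst u)) (s (fst u)) else (\<lambda>F. 0))"

lemma lift_splits:
  assumes "X \<in> vector_fields A" "s \<in> one_forms A" and u: "u \<in> points \<T>"
  shows "splits u (lift X s u) (X (fst u)) (s (fst u))"
proof -
  obtain w where w: "splits u w (X (fst u)) (s (fst u))"
    by (rule splits_surj[OF u vf_tangent[OF assms(1)] one_form_cotangent[OF assms(2)]])
  then have "lift X s u = w"
    unfolding lift_def if_P[OF u] using splits_unique[OF u _ w] by (intro the_equality)
  then show ?thesis using w by simp
qed

lemma lift_pullback:
  assumes "X \<in> vector_fields A" "s \<in> one_forms A" "u \<in> points \<T>" "smooth_fun A f"
  shows "lift X s u (\<lambda>v. f (fst v)) = X (fst u) f"
  using splitsD(4)[OF lift_splits[OF assms(1-3)] assms(4)] .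

lemma lift_fib:
  assumes "X \<in> vector_fields A" "s \<in> one_forms A" "u \<in> points \<T>" "Y \<in> vector_fields A"
  shows "lift X s u (fib Y) = fib (D X Y) u + s (fst u) (Y (fst u))"
  using splitsD(5)[OF lift_splits[OF assms(1-3)] assms(1,4)] by (simp add: fib_def)

lemma lift_vf:
  assumes "X \<in> vector_fields A" "s \<in> one_forms A"
  shows "lift X s \<in> vector_fields \<T>"
proof -
  interpret B: smooth_atlas \<T> by (rule cotangent_smooth_atlas)
  have "vfield \<T> (lift X s)"
  proof (rule ct_vfieldI)
    show "lift X s u \<in> tangent_space \<T> u" if "u \<in> points \<T>" for u
      using splitsD(1)[OF lift_splits[OF assms that]] .
    show "smooth_fun \<T> (\<lambda>u. lift X s u (\<lambda>v. f (fst v)))" if "smooth_fun A f" for f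
      using smooth_pullback[OF vf_smooth[OF assms(1) that]]
      by (rule B.smooth_fun_cong[rotated]) (simp add: lift_pullback[OF assms _ that])
    show "smooth_fun \<T> (\<lambda>u. lift X s u (fib Y))" if "Y \<in> vector_fields A" for Y
      using B.smooth_fun_add[OF smooth_fib[OF conn_vf[OF assms(1) that]] smooth_pullback[OF one_form_smooth[OF assms(2) that]]]
      by (rule B.smooth_fun_cong[rotated]) (simp add: lift_fib[OF assms _ that])
  qed
  then show ?thesis by (simp add: B.vector_fields_iff lift_def)
qed

lemma lift_bracket_pullback:
  assumes X: "X \<in> vector_fields A" "s \<in> one_forms A" and Y: "Y \<in> vector_fields A" "t \<in> one_forms A"
    and u: "u \<in> points \<T>" and f: "smooth_fun A f"
  shows "lie_bracket (lift X s) (lift Y t) u (\<lambda>v. f (fst v)) = lie_bracket X Y (fst u) f"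
proof -
  interpret B: smooth_atlas \<T> by (rule cotangent_smooth_atlas)
  have "lift X s u (\<lambda>v. lift Y t v (\<lambda>v. f (fst v))) = X (fst u) (\<lambda>q. Y q f)"
    if X: "X \<in> vector_fields A" "s \<in> one_forms A" and Y: "Y \<in> vector_fields A" "t \<in> one_forms A" for X Y s t
    by (subst B.tangent_cong[OF splitsD(1)[OF lift_splits[OF X u]] u lift_pullback[OF Y _ f]])
       (simp_all add: lift_pullback[OF X u vf_smooth[OF Y(1) f]])
  from this[OF X Y] this[OF Y X] show ?thesis by (simp add: lie_bracket_def)
qed

lemma lift_bracket_fib:
  assumes X: "X \<in> vector_fields A" "s \<in> one_forms A" and Y: "Y \<in> vector_fields A" "t \<in> one_forms A"
    and u: "u \<in> points \<T>" and Z: "Z \<in> vector_fields A"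
  shows "lie_bracket (lift X s) (lift Y t) u (fib Z) = fib (D X (D Y Z)) u - fib (D Y (D X Z)) u
     + dual_conn D X t Z (fst u) - dual_conn D Y s Z (fst u)"
proof -
  interpret B: smooth_atlas \<T> by (rule cotangent_smooth_atlas)
  have "lift X s u (\<lambda>v. lift Y t v (fib Z)) = fib (D X (D Y Z)) u + s (fst u) (D Y Z (fst u)) + X (fst u) (\<lambda>q. t q (Z q))"
    if X: "X \<in> vector_fields A" "s \<in> one_forms A" and Y: "Y \<in> vector_fields A" "t \<in> one_forms A" for X Y s t
  proof -
    note tv = splitsD(1)[OF lift_splits[OF X u]]
    note sm = one_form_smooth[OF Y(2) Z]
    have "lift X s u (\<lambda>v. lift Y t v (fib Z)) = lift X s u (\<lambda>v. fib (D Y Z) v + t (fst v) (Z (fst v)))"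
      by (rule B.tangent_cong[OF tv u lift_fib[OF Y _ Z]])
    also have "\<dots> = lift X s u (fib (D Y Z)) + lift X s u (\<lambda>v. t (fst v) (Z (fst v)))"
      by (rule B.tangent_add[OF tv smooth_fib[OF conn_vf[OF Y(1) Z]] smooth_pullback[OF sm]])
    also have "\<dots> = fib (D X (D Y Z)) u + s (fst u) (D Y Z (fst u)) + X (fst u) (\<lambda>q. t q (Z q))"
      by (simp add: lift_fib[OF X u conn_vf[OF Y(1) Z]] lift_pullback[OF X u sm])
    finally show ?thesis .
  qed
  from this[OF X Y] this[OF Y X] show ?thesis by (simp add: lie_bracket_def dual_conn_def)
qed

text \<open>The vertical part is measured against the horizontal lift of [X, Y], whose value on
  \<open>fib Z\<close> is the term with \<open>D (lie_bracket X Y) Z\<close>. Subtracting it from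
  the commutator in \<open>lift_bracket_fib\<close> completes the curvature.\<close>

lemma lift_bracket_splits:
  assumes X: "X \<in> vector_fields A" "s \<in> one_forms A" and Y: "Y \<in> vector_fields A" "t \<in> one_forms A"
    and u: "u \<in> points \<T>"
  obtains \<eta> where "splits u (lie_bracket (lift X s) (lift Y t) u) (lie_bracket X Y (fst u)) \<eta>"
    "\<And>Z. Z \<in> vector_fields A \<Longrightarrow> \<eta> (Z (fst u)) = dual_conn D X t Z (fst u) - dual_conn D Y s Z (fst u)
       + snd u (D X (D Y Z) (fst u)) - snd u (D Y (D X Z) (fst u)) - snd u (D (lie_bracket X Y) Z (fst u))"
proof -
  interpret B: smooth_atlas \<T> by (rule cotangent_smooth_atlas)
  let ?w = "lie_bracket (lift X s) (lift Y t) u"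
  have w: "?w \<in> tangent_space \<T> u"
    by (intro B.lie_bracket_tangent B.vf_vfield lift_vf assms)
  obtain \<eta> where \<eta>: "splits u ?w (pushforward A fst ?w) \<eta>" using splits_exists[OF u w] by blast
  have XY: "lie_bracket X Y \<in> vector_fields A" by (rule vf_lie_bracket[OF X(1) Y(1)])
  have eq: "pushforward A fst ?w = lie_bracket X Y (fst u)"
    using splitsD(4)[OF \<eta>] lift_bracket_pullback[OF X Y u]
    by (intro tangent_eqI[OF splitsD(2)[OF \<eta>] vf_tangent[OF XY]]) simp
  show thesis
  proof (rule that)
    show "splits u ?w (lie_bracket X Y (fst u)) \<eta>" using \<eta> eq by simp
    fix Z assume Z: "Z \<in> vector_fields A"
    show "\<eta> (Z (fst u)) = dual_conn D X t Z (fst u) - dual_conn D Y s Z (fst u)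
       + snd u (D X (D Y Z) (fst u)) - snd u (D Y (D X Z) (fst u)) - snd u (D (lie_bracket X Y) Z (fst u))"
      using splitsD(5)[OF \<eta> XY Z eq[symmetric]] lift_bracket_fib[OF X Y u Z] by (simp add: fib_def)
  qed
qed

end


section \<open>Tensoriality of the Nijenhuis tensor\<close>

context smooth_atlas
begin

text \<open>Fields are compared on the manifold only; off it an expression such as
  \<open>K q (X q)\<close> has uncontrolled values.\<close>

lemma lie_bracket_cong:
  assumes "vfield A X" "vfield A Y" "vfield A X'" "vfield A Y'" "p \<in> points A"
    and X: "\<And>q. q \<in> points A \<Longrightarrow> X q = X' q" and Y: "\<And>q. q \<in> points A \<Longrightarrow> Y q = Y' q"
  shows "lie_bracket X Y p = lie_bracket X' Y' p"
proof
  fix f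
  have "X p (\<lambda>q. Y q f) = X p (\<lambda>q. Y' q f)" "Y p (\<lambda>q. X q f) = Y p (\<lambda>q. X' q f)"
    by (rule tangent_cong[OF vfield_tangent[OF assms(1,5)] assms(5)], simp add: Y)
      (rule tangent_cong[OF vfield_tangent[OF assms(2,5)] assms(5)], simp add: X)
  then show "lie_bracket X Y p f = lie_bracket X' Y' p f"
    using X Y assms(5) by (simp add: lie_bracket_def)
qed

lemma lie_bracket_skew: "lie_bracket X Y p = (\<lambda>f. - lie_bracket Y X p f)"
  by (simp add: lie_bracket_def)

lemma lie_bracket_add:
  assumes X: "vfield A X" and X': "vfield A X'" and Y: "vfield A Y" and p: "p \<in> points A"
  shows "lie_bracket (\<lambda>q f. X q f + X' q f) Y p = (\<lambda>f. lie_bracket X Y p f + lie_bracket X' Y p f)"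
proof (rule tangent_eqI[where p=p])
  fix f :: "'a \<Rightarrow> real" assume f: "smooth_fun A f"
  show "lie_bracket (\<lambda>q f. X q f + X' q f) Y p f = lie_bracket X Y p f + lie_bracket X' Y p f"
    by (simp add: lie_bracket_def tangent_add[OF vfield_tangent[OF Y p]] vfield_smooth[OF X f] vfield_smooth[OF X' f])
qed (intro lie_bracket_tangent vfield_add tangent_space_add assms)+

lemma lie_bracket_scale:
  assumes h: "smooth_fun A h" and X: "vfield A X" and Y: "vfield A Y" and p: "p \<in> points A"
  shows "lie_bracket (\<lambda>q f. h q * X q f) Y p = (\<lambda>f. h p * lie_bracket X Y p f + (- Y p h) * X p f)"
proof (rule tangent_eqI[where p=p])
  show "(\<lambda>f. h p * lie_bracket X Y p f + (- Y p h) * X p f) \<in> tangent_space A p"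
    by (intro tangent_space_lin lie_bracket_tangent vfield_tangent X Y p)
  fix f :: "'a \<Rightarrow> real" assume f: "smooth_fun A f"
  show "lie_bracket (\<lambda>q f. h q * X q f) Y p f = h p * lie_bracket X Y p f + (- Y p h) * X p f"
    by (simp add: lie_bracket_def tangent_mult[OF vfield_tangent[OF Y p] h vfield_smooth[OF X f]] algebra_simps)
qed (intro lie_bracket_tangent vfield_scale assms)

end

text \<open>\<open>K_vfield\<close> speaks of \<open>vfield\<close> because \<open>K q (X q)\<close>
  need not vanish off the manifold even if \<open>X q\<close> does.\<close>

locale acs_atlas = smooth_atlas A for A :: "('a, 'e::euclidean_space) chart set" +
  fixes K :: "'a \<Rightarrow> 'a tvec \<Rightarrow> 'a tvec"
  assumes K_tangent: "\<And>p v. p \<in> points A \<Longrightarrow> v \<in> tangent_space A p \<Longrightarrow> K p v \<in> tangent_space A p"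
    and K_lin: "\<And>p v w a b. p \<in> points A \<Longrightarrow> v \<in> tangent_space A p \<Longrightarrow> w \<in> tangent_space A p \<Longrightarrow>
          K p (\<lambda>f. a * v f + b * w f) = (\<lambda>f. a * K p v f + b * K p w f)"
    and K_square: "\<And>p v. p \<in> points A \<Longrightarrow> v \<in> tangent_space A p \<Longrightarrow> K p (K p v) = (\<lambda>f. - v f)"
    and K_vfield: "\<And>X. vfield A X \<Longrightarrow> vfield A (\<lambda>q. K q (X q))"
begin

lemma K_add: "p \<in> points A \<Longrightarrow> v \<in> tangent_space A p \<Longrightarrow> w \<in> tangent_space A p \<Longrightarrow>
    K p (\<lambda>f. v f + w f) = (\<lambda>f. K p v f + K p w f)"
  using K_lin[of p v w 1 1] by simp

lemma K_scale: "p \<in> points A \<Longrightarrow> v \<in> tangent_space A p \<Longrightarrow> K p (\<lambda>f. a * v f) = (\<lambda>f. a * K p v f)"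
  using K_lin[of p v v a 0] by simp

lemma K_minus: "p \<in> points A \<Longrightarrow> v \<in> tangent_space A p \<Longrightarrow> K p (\<lambda>f. - v f) = (\<lambda>f. - K p v f)"
  using K_scale[of p v "-1"] by simp

lemma nijenhuis_cong:
  assumes X: "vfield A X" and X': "vfield A X'" and Y: "vfield A Y" and p: "p \<in> points A"
    and eq: "\<And>q. q \<in> points A \<Longrightarrow> X q = X' q"
  shows "nijenhuis K X Y p = nijenhuis K X' Y p"
proof -
  have "lie_bracket (\<lambda>q. K q (X q)) (\<lambda>q. K q (Y q)) p = lie_bracket (\<lambda>q. K q (X' q)) (\<lambda>q. K q (Y q)) p"
    "lie_bracket (\<lambda>q. K q (X q)) Y p = lie_bracket (\<lambda>q. K q (X' q)) Y p"
    "lie_bracket X (\<lambda>q. K q (Y q)) p = lie_bracket X' (\<lambda>q. K q (Y q)) p"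
    "lie_bracket X Y p = lie_bracket X' Y p"
    using lie_bracket_cong[OF K_vfield[OF X] K_vfield[OF Y] K_vfield[OF X'] K_vfield[OF Y] p]
      lie_bracket_cong[OF K_vfield[OF X] Y K_vfield[OF X'] Y p]
      lie_bracket_cong[OF X K_vfield[OF Y] X' K_vfield[OF Y] p]
      lie_bracket_cong[OF X Y X' Y p] by (simp_all add: eq)
  then show ?thesis by (simp add: nijenhuis_def)
qed

lemma nijenhuis_skew:
  assumes X: "vfield A X" and Y: "vfield A Y" and p: "p \<in> points A"
  shows "nijenhuis K X Y p = (\<lambda>f. - nijenhuis K Y X p f)"
proof -
  note KX = K_vfield[OF X] and KY = K_vfield[OF Y]
  show ?thesis
    unfolding nijenhuis_def
    by (simp add: lie_bracket_skew[of X] lie_bracket_skew[of "\<lambda>q. K q (X q)"]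
        K_minus[OF p lie_bracket_tangent[OF Y KX p]] K_minus[OF p lie_bracket_tangent[OF KY X p]] algebra_simps)
qed

lemma nijenhuis_add:
  assumes X: "vfield A X" and X': "vfield A X'" and Y: "vfield A Y" and p: "p \<in> points A"
  shows "nijenhuis K (\<lambda>q f. X q f + X' q f) Y p = (\<lambda>f. nijenhuis K X Y p f + nijenhuis K X' Y p f)"
proof -
  note KX = K_vfield[OF X] and KX' = K_vfield[OF X'] and KY = K_vfield[OF Y]
  have K: "lie_bracket (\<lambda>q. K q (\<lambda>f. X q f + X' q f)) Z p = lie_bracket (\<lambda>q f. K q (X q) f + K q (X' q) f) Z p"
    if "vfield A Z" for Z
    by (rule lie_bracket_cong) (intro K_vfield vfield_add X X' that p KX KX' K_add vfield_tangent refl | assumption)+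
  show ?thesis
    unfolding nijenhuis_def
    by (simp add: K[OF KY] K[OF Y] lie_bracket_add[OF KX KX' KY p] lie_bracket_add[OF KX KX' Y p]
        lie_bracket_add[OF X X' KY p] lie_bracket_add[OF X X' Y p]
        K_add[OF p] lie_bracket_tangent[OF _ _ p] X X' Y KX KX' KY algebra_simps)
qed

text \<open>Four terms contain derivatives of h. Those with KY(h) cancel by linearity of K, those
  with Y(h) because K squares to minus the identity.\<close>

lemma nijenhuis_scale:
  assumes h: "smooth_fun A h" and X: "vfield A X" and Y: "vfield A Y" and p: "p \<in> points A"
  shows "nijenhuis K (\<lambda>q f. h q * X q f) Y p = (\<lambda>f. h p * nijenhuis K X Y p f)"
proof -
  note KX = K_vfield[OF X] and KY = K_vfield[OF Y]
  have K: "lie_bracket (\<lambda>q. K q (\<lambda>f. h q * X q f)) Z p = lie_bracket (\<lambda>q f. h q * K q (X q) f) Z p"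
    if "vfield A Z" for Z
    by (rule lie_bracket_cong) (intro K_vfield vfield_scale h X that p KX K_scale vfield_tangent refl | assumption)+
  have 1: "K p (\<lambda>f. h p * lie_bracket (\<lambda>q. K q (X q)) Y p f + (- Y p h) * K p (X p) f)
    = (\<lambda>f. h p * K p (lie_bracket (\<lambda>q. K q (X q)) Y p) f + Y p h * X p f)"
    by (subst K_lin[OF p lie_bracket_tangent[OF KX Y p] K_tangent[OF p vfield_tangent[OF X p]]])
      (simp add: K_square[OF p vfield_tangent[OF X p]])
  have 2: "K p (\<lambda>f. h p * lie_bracket X (\<lambda>q. K q (Y q)) p f + (- K p (Y p) h) * X p f)
    = (\<lambda>f. h p * K p (lie_bracket X (\<lambda>q. K q (Y q)) p) f + (- K p (Y p) h) * K p (X p) f)"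
    by (rule K_lin[OF p lie_bracket_tangent[OF X KY p] vfield_tangent[OF X p]])
  show ?thesis
    unfolding nijenhuis_def K[OF KY] K[OF Y] lie_bracket_scale[OF h KX KY p] lie_bracket_scale[OF h KX Y p]
        lie_bracket_scale[OF h X KY p] lie_bracket_scale[OF h X Y p] 1 2
    by (simp add: algebra_simps)
qed

lemma nijenhuis_sum_zero:
  assumes "\<And>i. i \<in> I \<Longrightarrow> smooth_fun A (h i)" "\<And>i. i \<in> I \<Longrightarrow> X i \<in> vector_fields A"
    and Y: "vfield A Y" and p: "p \<in> points A" and "\<And>i. i \<in> I \<Longrightarrow> nijenhuis K (X i) Y p = (\<lambda>f. 0)"
  shows "nijenhuis K (\<lambda>q f. \<Sum>i\<in>I. h i q * X i q f) Y p = (\<lambda>f. 0)"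
  using assms(1,2,5)
proof (induction I rule: infinite_finite_induct)
  have "nijenhuis K (\<lambda>q f. 0) Y p = (\<lambda>f. 0)"
    using nijenhuis_scale[OF smooth_fun_const vf_vfield[OF vf_zero] Y p, of 0] by simp
  then show "nijenhuis K (\<lambda>q f. \<Sum>i\<in>I. h i q * X i q f) Y p = (\<lambda>f. 0)" if "infinite I" for I using that by simp
  show "nijenhuis K (\<lambda>q f. \<Sum>i\<in>{}. h i q * X i q f) Y p = (\<lambda>f. 0)"
    using \<open>nijenhuis K (\<lambda>q f. 0) Y p = (\<lambda>f. 0)\<close> by simp
next
  fix i I assume i: "finite I" "i \<notin> I" and
    IH: "(\<And>i. i \<in> I \<Longrightarrow> smooth_fun A (h i)) \<Longrightarrow> (\<And>i. i \<in> I \<Longrightarrow> X i \<in> vector_fields A) \<Longrightarrow>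
      (\<And>i. i \<in> I \<Longrightarrow> nijenhuis K (X i) Y p = (\<lambda>f. 0)) \<Longrightarrow> nijenhuis K (\<lambda>q f. \<Sum>i\<in>I. h i q * X i q f) Y p = (\<lambda>f. 0)"
    and prems: "\<And>j. j \<in> insert i I \<Longrightarrow> smooth_fun A (h j)" "\<And>j. j \<in> insert i I \<Longrightarrow> X j \<in> vector_fields A"
      "\<And>j. j \<in> insert i I \<Longrightarrow> nijenhuis K (X j) Y p = (\<lambda>f. 0)"
  have X: "vfield A (X i)" using prems(2) vf_vfield by blast
  have S: "vfield A (\<lambda>q f. \<Sum>i\<in>I. h i q * X i q f)"
    using prems by (intro vf_vfield vf_sum vf_scale) auto
  have "nijenhuis K (\<lambda>q f. h i q * X i q f + (\<Sum>i\<in>I. h i q * X i q f)) Y p = (\<lambda>f. 0)"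
    using prems IH by (simp add: nijenhuis_add[OF vfield_scale[OF _ X] S Y p] nijenhuis_scale[OF _ X Y p])
  then show "nijenhuis K (\<lambda>q f. \<Sum>j\<in>insert i I. h j q * X j q f) Y p = (\<lambda>f. 0)" using i by simp
qed

end


section \<open>The almost complex structure of the cotangent manifold\<close>

text \<open>The value on a vector field \<open>Z\<close> of the cotangent part of the bracket of the lifts of
  \<open>X + s\<close> and \<open>Y + t\<close> at \<open>(p, \<xi>)\<close>.\<close>

definition covector_bracket ::
    "(('a \<Rightarrow> 'a tvec) \<Rightarrow> ('a \<Rightarrow> 'a tvec) \<Rightarrow> 'a \<Rightarrow> 'a tvec) \<Rightarrow> ('a \<Rightarrow> 'a tvec) \<Rightarrow> ('a \<Rightarrow> 'a covec) \<Rightarrow>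
     ('a \<Rightarrow> 'a tvec) \<Rightarrow> ('a \<Rightarrow> 'a covec) \<Rightarrow> 'a ct \<Rightarrow> ('a \<Rightarrow> 'a tvec) \<Rightarrow> real" where
  "covector_bracket D X s Y t u Z = dual_conn D X t Z (fst u) - dual_conn D Y s Z (fst u)
       + snd u (D X (D Y Z) (fst u)) - snd u (D Y (D X Z) (fst u)) - snd u (D (lie_bracket X Y) Z (fst u))"

locale gcs_atlas = connection_atlas A D for A :: "('a, 'e::euclidean_space) chart set" and D +
  fixes J :: "'a gen_endo"
  assumes gcs: "generalized_complex_structure A J"
begin

lemma J_tangent: "p \<in> points A \<Longrightarrow> a \<in> tangent_space A p \<Longrightarrow> \<eta> \<in> cotangent_space A p \<Longrightarrow> fst (J p (a, \<eta>)) \<in> tangent_space A p"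
  and J_cotangent: "p \<in> points A \<Longrightarrow> a \<in> tangent_space A p \<Longrightarrow> \<eta> \<in> cotangent_space A p \<Longrightarrow> snd (J p (a, \<eta>)) \<in> cotangent_space A p"
  and J_square: "p \<in> points A \<Longrightarrow> a \<in> tangent_space A p \<Longrightarrow> \<eta> \<in> cotangent_space A p \<Longrightarrow>
        J p (J p (a, \<eta>)) = (\<lambda>f. - a f, \<lambda>v. - \<eta> v)"
proof -
  assume "p \<in> points A" "a \<in> tangent_space A p" "\<eta> \<in> cotangent_space A p"
  moreover have "\<forall>p\<in>points A. \<forall>u \<in> tangent_space A p \<times> cotangent_space A p.
      J p u \<in> tangent_space A p \<times> cotangent_space A p \<and> J p (J p u) = (\<lambda>f. - fst u f, \<lambda>v. - snd u v)"
    using gcs unfolding generalized_complex_structure_def by blast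
  ultimately have "J p (a, \<eta>) \<in> tangent_space A p \<times> cotangent_space A p \<and> J p (J p (a, \<eta>)) = (\<lambda>f. - a f, \<lambda>v. - \<eta> v)"
    by force
  then show "fst (J p (a, \<eta>)) \<in> tangent_space A p" "snd (J p (a, \<eta>)) \<in> cotangent_space A p"
    "J p (J p (a, \<eta>)) = (\<lambda>f. - a f, \<lambda>v. - \<eta> v)"
    by (auto simp: mem_Times_iff)
qed

lemma J_lin:
  assumes "p \<in> points A" "a \<in> tangent_space A p" "\<eta> \<in> cotangent_space A p" "b \<in> tangent_space A p" "\<zeta> \<in> cotangent_space A p"
  shows "J p (\<lambda>f. c * a f + d * b f, \<lambda>v. c * \<eta> v + d * \<zeta> v) =
    (\<lambda>f. c * fst (J p (a, \<eta>)) f + d * fst (J p (b, \<zeta>)) f, \<lambda>v. c * snd (J p (a, \<eta>)) v + d * snd (J p (b, \<zeta>)) v)"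
proof -
  have "\<forall>p\<in>points A. \<forall>u \<in> tangent_space A p \<times> cotangent_space A p.
        \<forall>w \<in> tangent_space A p \<times> cotangent_space A p. \<forall>a b.
        J p (\<lambda>f. a * fst u f + b * fst w f, \<lambda>v. a * snd u v + b * snd w v) =
          (\<lambda>f. a * fst (J p u) f + b * fst (J p w) f,
           \<lambda>v. a * snd (J p u) v + b * snd (J p w) v)"
    using gcs unfolding generalized_complex_structure_def by blast
  from this[rule_format, OF assms(1), of "(a, \<eta>)" "(b, \<zeta>)" c d] show ?thesis using assms by simp
qed

lemma J_minus:
  assumes "p \<in> points A" "a \<in> tangent_space A p" "\<eta> \<in> cotangent_space A p"
  shows "J p (\<lambda>f. - a f, \<lambda>v. - \<eta> v) = (\<lambda>f. - fst (J p (a, \<eta>)) f, \<lambda>v. - snd (J p (a, \<eta>)) v)"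
  using J_lin[OF assms assms(2,3), of "-1" 0] by simp

definition J_vec :: "('a \<Rightarrow> 'a tvec) \<Rightarrow> ('a \<Rightarrow> 'a covec) \<Rightarrow> 'a \<Rightarrow> 'a tvec" where
  "J_vec X s p = (if p \<in> points A then fst (J p (X p, s p)) else (\<lambda>f. 0))"

definition J_cov :: "('a \<Rightarrow> 'a tvec) \<Rightarrow> ('a \<Rightarrow> 'a covec) \<Rightarrow> 'a \<Rightarrow> 'a covec" where
  "J_cov X s p = (if p \<in> points A then snd (J p (X p, s p)) else (\<lambda>v. 0))"

lemma J_smooth:
  assumes "X \<in> vector_fields A" "s \<in> one_forms A"
  shows "smooth_fun A f \<Longrightarrow> smooth_fun A (\<lambda>p. fst (J p (X p, s p)) f)"
    "Y \<in> vector_fields A \<Longrightarrow> smooth_fun A (\<lambda>p. snd (J p (X p, s p)) (Y p))"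
proof -
  have "\<forall>X\<in>vector_fields A. \<forall>s\<in>one_forms A.
        (\<forall>f. smooth_fun A f \<longrightarrow> smooth_fun A (\<lambda>p. fst (J p (X p, s p)) f)) \<and>
        (\<forall>Y\<in>vector_fields A. smooth_fun A (\<lambda>p. snd (J p (X p, s p)) (Y p)))"
    using gcs unfolding generalized_complex_structure_def by blast
  with assms show "smooth_fun A f \<Longrightarrow> smooth_fun A (\<lambda>p. fst (J p (X p, s p)) f)"
    "Y \<in> vector_fields A \<Longrightarrow> smooth_fun A (\<lambda>p. snd (J p (X p, s p)) (Y p))" by blast+
qed

lemma J_vec_vf:
  assumes "X \<in> vector_fields A" "s \<in> one_forms A"
  shows "J_vec X s \<in> vector_fields A"
  unfolding vector_fields_iff vfield_def
proof (intro conjI ballI allI impI)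
  fix f :: "'a \<Rightarrow> real" assume "smooth_fun A f"
  from J_smooth(1)[OF assms this] show "smooth_fun A (\<lambda>p. J_vec X s p f)"
    by (rule smooth_fun_cong[rotated]) (simp add: J_vec_def)
qed (use assms in \<open>simp_all add: J_vec_def J_tangent vf_tangent one_form_cotangent\<close>)

lemma J_cov_one_form:
  assumes "X \<in> vector_fields A" "s \<in> one_forms A"
  shows "J_cov X s \<in> one_forms A"
  unfolding one_forms_def
proof (intro CollectI conjI ballI allI impI)
  fix Y assume "Y \<in> vector_fields A"
  from J_smooth(2)[OF assms this] show "smooth_fun A (\<lambda>p. J_cov X s p (Y p))"
    by (rule smooth_fun_cong[rotated]) (simp add: J_cov_def)
qed (use assms in \<open>simp_all add: J_cov_def J_cotangent vf_tangent one_form_cotangent\<close>)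

abbreviation "K \<equiv> cotangent_acs A J D"

lemma acs_splits:
  assumes "u \<in> points \<T>" "splits u w a \<eta>"
  shows "splits u (K u w) (fst (J (fst u) (a, \<eta>))) (snd (J (fst u) (a, \<eta>)))"
  using cotangent_acs_splits[OF assms, of J] cotangent_point[OF assms(1)] splitsD[OF assms(2)]
  by (simp add: J_tangent J_cotangent)

lemma acs_lift:
  assumes "X \<in> vector_fields A" "s \<in> one_forms A" "u \<in> points \<T>"
  shows "K u (lift X s u) = lift (J_vec X s) (J_cov X s) u"
  using acs_splits[OF assms(3) lift_splits[OF assms]] lift_splits[OF J_vec_vf[OF assms(1,2)] J_cov_one_form[OF assms(1,2)] assms(3)]
    cotangent_point[OF assms(3)]
  by (intro splits_unique[OF assms(3)]) (auto simp: J_vec_def J_cov_def)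

lemma ct_splitsE:
  assumes "u \<in> points \<T>" "w \<in> tangent_space \<T> u"
  obtains a \<eta> where "splits u w a \<eta>"
  using splits_exists[OF assms] by blast

lemma acs_lin:
  assumes u: "u \<in> points \<T>" and "v \<in> tangent_space \<T> u" "w \<in> tangent_space \<T> u"
  shows "K u (\<lambda>f. a * v f + b * w f) = (\<lambda>f. a * K u v f + b * K u w f)"
proof -
  obtain c \<eta> where v: "splits u v c \<eta>" using ct_splitsE[OF u assms(2)] by blast
  obtain d \<zeta> where w: "splits u w d \<zeta>" using ct_splitsE[OF u assms(3)] by blast
  note p = cotangent_point[OF u]
  have "splits u (K u (\<lambda>f. a * v f + b * w f)) (\<lambda>f. a * fst (J (fst u) (c, \<eta>)) f + b * fst (J (fst u) (d, \<zeta>)) f)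
     (\<lambda>f. a * snd (J (fst u) (c, \<eta>)) f + b * snd (J (fst u) (d, \<zeta>)) f)"
    using acs_splits[OF u splits_lin[OF u v w, of a b]]
    by (simp add: J_lin[OF p(1) splitsD(2,3)[OF v] splitsD(2,3)[OF w]])
  then show ?thesis
    by (rule splits_unique[OF u _ splits_lin[OF u acs_splits[OF u v] acs_splits[OF u w]]])
qed

lemma acs_square:
  assumes u: "u \<in> points \<T>" and "v \<in> tangent_space \<T> u"
  shows "K u (K u v) = (\<lambda>f. - v f)"
proof -
  obtain c \<eta> where v: "splits u v c \<eta>" using ct_splitsE[OF u assms(2)] by blast
  note p = cotangent_point[OF u]
  have "splits u (K u (K u v)) (\<lambda>f. - c f) (\<lambda>v. - \<eta> v)"
    using acs_splits[OF u acs_splits[OF u v]] by (simp add: J_square[OF p(1) splitsD(2,3)[OF v]])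
  moreover have "splits u (\<lambda>F. - v F) (\<lambda>f. - c f) (\<lambda>v. - \<eta> v)"
    using splits_lin[OF u v v, of "-1" 0] by simp
  ultimately show ?thesis by (rule splits_unique[OF u])
qed

text \<open>The horizontal coefficients are the values of w on the base coordinates. The horizontal
  lift of \<open>e c\<close> takes the value \<open>fib (D (e c) (e b))\<close> on
  \<open>fib (e b)\<close>; what remains of w(fib (e b)) after subtracting these contributions is
  the vertical coefficient.\<close>

lemma lift_frame:
  assumes fr: "local_frame U \<phi> p \<kappa> N M \<xi> e" and c: "(U, \<phi>) \<in> A" and u: "u \<in> ct_dom A M"
    and w: "w \<in> tangent_space \<T> u"
  shows "w = (\<lambda>F. (\<Sum>b\<in>Basis. w (\<lambda>v. \<xi> b (fst v)) * lift (e b) (\<lambda>p v. 0) u F)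
     + (\<Sum>b\<in>Basis. (w (fib (e b)) - (\<Sum>c\<in>Basis. w (\<lambda>v. \<xi> c (fst v)) * fib (D (e c) (e b)) u)) * lift (\<lambda>p f. 0) (dform A (\<xi> b)) u F))"
    (is "w = ?w")
proof -
  interpret B: smooth_atlas \<T> by (rule cotangent_smooth_atlas)
  note F = local_frameD[OF fr]
  have uB: "u \<in> points \<T>" using B.aopen_subset_points[OF aopen_ct_dom[OF F(4)]] u by blast
  have uM: "fst u \<in> M" using u by (simp add: ct_dom_def)
  note d = dform_in_one_forms[OF F(11)]
  have l: "lift (e b) (\<lambda>p v. 0) u \<in> tangent_space \<T> u" "lift (\<lambda>p f. 0) (dform A (\<xi> b)) u \<in> tangent_space \<T> u" for b
    by (intro splitsD(1)[OF lift_splits] F(12) one_form_zero vf_zero d uB)+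
  have w': "?w \<in> tangent_space \<T> u"
    by (intro B.tangent_space_add B.tangent_space_sum B.tangent_space_scale l)
  have delta: "(\<Sum>c\<in>Basis. g c * (c \<bullet> b)) = g b" if "b \<in> Basis" for g :: "'e \<Rightarrow> real" and b
  proof -
    have "(\<Sum>c\<in>Basis. g c * (c \<bullet> b)) = (\<Sum>c\<in>Basis. if c = b then g c else 0)"
      by (rule sum.cong) (use that in \<open>auto simp: inner_Basis\<close>)
    then show ?thesis using that by simp
  qed
  have "?w (\<lambda>v. \<xi> b (fst v)) = w (\<lambda>v. \<xi> b (fst v))" if "b \<in> Basis" for b
    using that by (simp add: lift_pullback[OF F(12) one_form_zero uB F(11)] lift_pullback[OF vf_zero d uB F(11)] F(15)[OF uM] delta)
  moreover have "?w (fib (e b)) = w (fib (e b))" if "b \<in> Basis" for b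
  proof -
    have "fib (D (\<lambda>p f. 0) (e b)) u = 0"
      by (simp add: conn_zero1[OF F(12)] fib_def cotangent_zero[OF cotangent_point(2)[OF uB]])
    moreover have "dform A (\<xi> c) (fst u) (e b (fst u)) = c \<bullet> b" for c
      by (simp add: dform_apply[OF cotangent_point(1)[OF uB] vf_tangent[OF F(12)]] F(15)[OF uM] inner_commute)
    ultimately show ?thesis
      using that by (simp add: lift_fib[OF F(12) one_form_zero uB F(12)] lift_fib[OF vf_zero d uB F(12)] delta)
  qed
  ultimately show ?thesis
    using ct_tangent_expand[OF fr c u w] ct_tangent_expand[OF fr c u w']
    by (intro B.tangent_eqI[OF w w']) (simp cong: sum.cong)
qed

text \<open>The factor \<open>\<kappa>\<close> makes the coefficients smooth on the whole cotangent
  manifold, both sides being zero off M. It equals 1 over N, where no information is lost.\<close>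

lemma vfield_lift_frame:
  assumes fr: "local_frame U \<phi> p \<kappa> N M \<xi> e" and c: "(U, \<phi>) \<in> A" and W: "vfield \<T> W"
  shows "\<exists>g h. (\<forall>b. smooth_fun \<T> (g b)) \<and> (\<forall>b. smooth_fun \<T> (h b)) \<and>
    (\<forall>u\<in>points \<T>. (\<lambda>F. \<kappa> (fst u) * W u F) =
      (\<lambda>F. (\<Sum>b\<in>Basis. g b u * lift (e b) (\<lambda>p v. 0) u F) + (\<Sum>b\<in>Basis. h b u * lift (\<lambda>p f. 0) (dform A (\<xi> b)) u F)))"
proof -
  interpret B: smooth_atlas \<T> by (rule cotangent_smooth_atlas)
  note F = local_frameD[OF fr]
  define g where "g = (\<lambda>b u. \<kappa> (fst u) * W u (\<lambda>v. \<xi> b (fst v)))"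
  define h where "h = (\<lambda>b u. \<kappa> (fst u) * (W u (fib (e b)) - (\<Sum>c\<in>Basis. W u (\<lambda>v. \<xi> c (fst v)) * fib (D (e c) (e b)) u)))"
  have "smooth_fun \<T> (g b)" for b
    unfolding g_def by (intro B.smooth_fun_mult smooth_pullback F(1) B.vfield_smooth[OF W] F(11))
  moreover have "smooth_fun \<T> (h b)" for b
    unfolding h_def by (intro B.smooth_fun_mult B.smooth_fun_diff B.smooth_fun_sum smooth_pullback F(1) B.vfield_smooth[OF W] F(11)
        smooth_fib F(12) conn_vf)
  moreover have "(\<lambda>F. \<kappa> (fst u) * W u F) =
      (\<lambda>F. (\<Sum>b\<in>Basis. g b u * lift (e b) (\<lambda>p v. 0) u F) + (\<Sum>b\<in>Basis. h b u * lift (\<lambda>p f. 0) (dform A (\<xi> b)) u F))"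
    if u: "u \<in> points \<T>" for u
  proof (cases "fst u \<in> M")
    case True
    then have "u \<in> ct_dom A M" using cotangent_point[OF u] by (simp add: ct_dom_def)
    from fun_cong[OF lift_frame[OF fr c this B.vfield_tangent[OF W u]]]
    have e: "W u F = (\<Sum>b\<in>Basis. W u (\<lambda>v. \<xi> b (fst v)) * lift (e b) (\<lambda>p v. 0) u F)
     + (\<Sum>b\<in>Basis. (W u (fib (e b)) - (\<Sum>c\<in>Basis. W u (\<lambda>v. \<xi> c (fst v)) * fib (D (e c) (e b)) u)) * lift (\<lambda>p f. 0) (dform A (\<xi> b)) u F)" for F .
    show ?thesis
      by (rule ext, subst e) (simp add: g_def h_def distrib_left sum_distrib_left mult.assoc)
  qed (simp add: g_def h_def F(10))
  ultimately show ?thesis by (intro exI[of _ g] exI[of _ h]) blast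
qed

text \<open>K is defined point by point through an inverse of the splitting, so smoothness is not
  visible from its definition. By \<open>acs_lift\<close> it sends the frame of lifts to lifts of
  smooth sections, and linearity passes smoothness on to all fields.\<close>

lemma acs_vfield:
  assumes W: "vfield \<T> W"
  shows "vfield \<T> (\<lambda>u. K u (W u))"
  unfolding vfield_def
proof (intro conjI ballI allI impI)
  interpret B: smooth_atlas \<T> by (rule cotangent_smooth_atlas)
  show KT: "K u (W u) \<in> tangent_space \<T> u" if u: "u \<in> points \<T>" for u
    using ct_splitsE[OF u B.vfield_tangent[OF W u]] acs_splits[OF u] splitsD(1) by metis
  fix F :: "'a ct \<Rightarrow> real" assume F: "smooth_fun \<T> F"
  show "smooth_fun \<T> (\<lambda>u. K u (W u) F)"
  proof (rule B.smooth_fun_local)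
    fix u assume u: "u \<in> points \<T>"
    note p = cotangent_point[OF u]
    obtain U \<phi> where c: "(U, \<phi>) \<in> A" "fst u \<in> U" using pointsE[OF p(1)] by blast
    obtain \<kappa> N M \<xi> e where fr: "local_frame U \<phi> (fst u) \<kappa> N M \<xi> e" using local_frame_exists[OF c] by blast
    note E = local_frameD[OF fr]
    obtain g h where gh': "(\<forall>b. smooth_fun \<T> (g b)) \<and> (\<forall>b. smooth_fun \<T> (h b)) \<and>
      (\<forall>u\<in>points \<T>. (\<lambda>F. \<kappa> (fst u) * W u F) =
      (\<lambda>F. (\<Sum>b\<in>Basis. g b u * lift (e b) (\<lambda>p v. 0) u F) + (\<Sum>b\<in>Basis. h b u * lift (\<lambda>p f. 0) (dform A (\<xi> b)) u F)))"
      using vfield_lift_frame[OF fr c(1) W] by (elim exE)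
    note gh = gh'[THEN conjunct1, rule_format] gh'[THEN conjunct2, THEN conjunct1, rule_format]
      gh'[THEN conjunct2, THEN conjunct2, rule_format]
    define X where "X = (\<lambda>b. lift (e b) (\<lambda>p v. 0))"
    define Y where "Y = (\<lambda>b. lift (\<lambda>p f. 0) (dform A (\<xi> b)))"
    have X: "X b \<in> vector_fields \<T>" and Y: "Y b \<in> vector_fields \<T>" for b
      unfolding X_def Y_def by (intro lift_vf E(12) one_form_zero vf_zero dform_in_one_forms E(11))+
    have KX: "smooth_fun \<T> (\<lambda>u. K u (X b u) F)" and KY: "smooth_fun \<T> (\<lambda>u. K u (Y b u) F)" for b
      unfolding X_def Y_def
       apply (rule B.smooth_fun_cong[OF _ B.vf_smooth[OF lift_vf[OF J_vec_vf[OF E(12)[of b] one_form_zero] J_cov_one_form[OF E(12)[of b] one_form_zero]] F]])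
       apply (simp add: acs_lift[OF E(12) one_form_zero])
      apply (rule B.smooth_fun_cong[OF _ B.vf_smooth[OF lift_vf[OF J_vec_vf[OF vf_zero dform_in_one_forms[OF E(11)[of b]]] J_cov_one_form[OF vf_zero dform_in_one_forms[OF E(11)[of b]]]] F]])
      apply (simp add: acs_lift[OF vf_zero dform_in_one_forms[OF E(11)]])
      done
    have sumK: "K v (\<lambda>F. \<Sum>b\<in>I. k b * Z b v F) = (\<lambda>F. \<Sum>b\<in>I. k b * K v (Z b v) F)"
      if v: "v \<in> points \<T>" and Z: "\<And>b. Z b \<in> vector_fields \<T>" for I :: "'e set" and k Z v
    proof (induction I rule: infinite_finite_induct)
      case (insert b I)
      have "K v (\<lambda>F. k b * Z b v F + 1 * (\<Sum>b\<in>I. k b * Z b v F)) = (\<lambda>F. k b * K v (Z b v) F + 1 * K v (\<lambda>F. \<Sum>b\<in>I. k b * Z b v F) F)"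
        by (intro acs_lin v B.vf_tangent Z B.tangent_space_sum B.tangent_space_scale)
      then show ?case using insert by simp
    qed (use acs_lin[OF v B.tangent_space_zero B.tangent_space_zero, of 0 0] in auto)
    have eq: "(\<Sum>b\<in>Basis. g b v * K v (X b v) F) + (\<Sum>b\<in>Basis. h b v * K v (Y b v) F) = \<kappa> (fst v) * K v (W v) F"
      if v: "v \<in> points \<T>" for v
    proof -
      have sX: "(\<lambda>F. \<Sum>b\<in>Basis. g b v * X b v F) \<in> tangent_space \<T> v"
        and sY: "(\<lambda>F. \<Sum>b\<in>Basis. h b v * Y b v F) \<in> tangent_space \<T> v"
        by (intro B.tangent_space_sum B.tangent_space_scale B.vf_tangent X Y)+
      have "K v (\<lambda>F. \<kappa> (fst v) * W v F) = (\<lambda>F. (\<Sum>b\<in>Basis. g b v * K v (X b v) F) + (\<Sum>b\<in>Basis. h b v * K v (Y b v) F))"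
        unfolding gh(3)[OF v] X_def[symmetric] Y_def[symmetric]
        using acs_lin[OF v sX sY, of 1 1] sumK[OF v X, where k="\<lambda>b. g b v" and I=Basis] sumK[OF v Y, where k="\<lambda>b. h b v" and I=Basis]
        by (simp add: X_def Y_def)
      moreover have "K v (\<lambda>F. \<kappa> (fst v) * W v F) = (\<lambda>F. \<kappa> (fst v) * K v (W v) F)"
        using acs_lin[OF v B.vfield_tangent[OF W v] B.vfield_tangent[OF W v], of "\<kappa> (fst v)" 0] by simp
      ultimately show ?thesis by (metis (no_types, lifting))
    qed
    have o: "aopen \<T> (ct_dom A N)" by (rule aopen_ct_dom[OF E(2)])
    have "smooth_fun \<T> (\<lambda>v. (\<Sum>b\<in>Basis. g b v * K v (X b v) F) + (\<Sum>b\<in>Basis. h b v * K v (Y b v) F))"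
      by (intro B.smooth_fun_add B.smooth_fun_sum B.smooth_fun_mult gh KX KY)
    from smooth_fun_imp_on[OF this B.aopen_subset_points[OF o]]
    have "smooth_fun_on \<T> (ct_dom A N) (\<lambda>u. K u (W u) F)"
    proof (rule B.smooth_fun_on_cong[OF o, rotated])
      fix v assume v: "v \<in> ct_dom A N"
      then have "v \<in> points \<T>" "\<kappa> (fst v) = 1"
        using B.aopen_subset_points[OF o] E(9) by (auto simp: ct_dom_def)
      then show "(\<Sum>b\<in>Basis. g b v * K v (X b v) F) + (\<Sum>b\<in>Basis. h b v * K v (Y b v) F) = K v (W v) F"
        using eq by simp
    qed
    moreover have "u \<in> ct_dom A N" using p E(3) by (simp add: ct_dom_def)
    ultimately show "\<exists>M. aopen \<T> M \<and> u \<in> M \<and> smooth_fun_on \<T> M (\<lambda>u. K u (W u) F)"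
      using o by blast
  qed
qed

lemma cotangent_acs_atlas: "acs_atlas \<T> K"
proof -
  interpret B: smooth_atlas \<T> by (rule cotangent_smooth_atlas)
  show ?thesis
  proof
    fix u w assume u: "u \<in> points \<T>" and w: "w \<in> tangent_space \<T> u"
    show "K u w \<in> tangent_space \<T> u"
      using ct_splitsE[OF u w] acs_splits[OF u] splitsD(1) by metis
  qed (simp_all add: acs_lin acs_square acs_vfield)
qed

section \<open>The Nijenhuis tensor on lifts\<close>

lemma nijenhuis_zero_by_lifts:
  assumes Y: "vfield \<T> Y" and W: "vfield \<T> W" and u: "u \<in> points \<T>"
    and 0: "\<And>X s. X \<in> vector_fields A \<Longrightarrow> s \<in> one_forms A \<Longrightarrow> nijenhuis K (lift X s) Y u = (\<lambda>F. 0)"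
  shows "nijenhuis K W Y u = (\<lambda>F. 0)"
proof -
  interpret B: acs_atlas \<T> K by (rule cotangent_acs_atlas)
  note p = cotangent_point[OF u]
  obtain U \<phi> where c: "(U, \<phi>) \<in> A" "fst u \<in> U" using pointsE[OF p(1)] by blast
  obtain \<kappa> N M \<xi> e where fr: "local_frame U \<phi> (fst u) \<kappa> N M \<xi> e" using local_frame_exists[OF c] by blast
  note E = local_frameD[OF fr]
  obtain g h where gh': "(\<forall>b. smooth_fun \<T> (g b)) \<and> (\<forall>b. smooth_fun \<T> (h b)) \<and>
      (\<forall>u\<in>points \<T>. (\<lambda>F. \<kappa> (fst u) * W u F) =
      (\<lambda>F. (\<Sum>b\<in>Basis. g b u * lift (e b) (\<lambda>p v. 0) u F) + (\<Sum>b\<in>Basis. h b u * lift (\<lambda>p f. 0) (dform A (\<xi> b)) u F)))"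
      using vfield_lift_frame[OF fr c(1) W] by (elim exE)
    note gh = gh'[THEN conjunct1, rule_format] gh'[THEN conjunct2, THEN conjunct1, rule_format]
      gh'[THEN conjunct2, THEN conjunct2, rule_format]
  define X where "X = (\<lambda>b. lift (e b) (\<lambda>p v. 0))"
  define Z where "Z = (\<lambda>b. lift (\<lambda>p f. 0) (dform A (\<xi> b)))"
  have X: "X b \<in> vector_fields \<T>" and Z: "Z b \<in> vector_fields \<T>" for b
    unfolding X_def Z_def by (intro lift_vf E(12) one_form_zero vf_zero dform_in_one_forms E(11))+
  have nX: "nijenhuis K (X b) Y u = (\<lambda>F. 0)" and nZ: "nijenhuis K (Z b) Y u = (\<lambda>F. 0)" for b
    unfolding X_def Z_def by (intro 0 E(12) one_form_zero vf_zero dform_in_one_forms E(11))+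
  let ?X = "\<lambda>u F. \<Sum>b\<in>Basis. g b u * X b u F" and ?Z = "\<lambda>u F. \<Sum>b\<in>Basis. h b u * Z b u F"
  have vX: "vfield \<T> ?X" and vZ: "vfield \<T> ?Z"
    by (intro B.vf_vfield B.vf_sum B.vf_scale gh X Z)+
  have "nijenhuis K (\<lambda>u F. \<kappa> (fst u) * W u F) Y u = nijenhuis K (\<lambda>u F. ?X u F + ?Z u F) Y u"
    by (rule B.nijenhuis_cong[OF B.vfield_scale[OF smooth_pullback[OF E(1)] W] B.vfield_add[OF vX vZ] Y u])
       (simp add: gh(3) X_def Z_def)
  also have "\<dots> = (\<lambda>F. 0)"
    by (simp add: B.nijenhuis_add[OF vX vZ Y u] B.nijenhuis_sum_zero[OF gh(1) X Y u nX] B.nijenhuis_sum_zero[OF gh(2) Z Y u nZ])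
  finally show ?thesis
    by (simp add: B.nijenhuis_scale[OF smooth_pullback[OF E(1)] W Y u] E(9)[OF E(3)])
qed

lemma integrable_iff_lifts:
  "integrable_acs \<T> K \<longleftrightarrow>
    (\<forall>X\<in>vector_fields A. \<forall>s\<in>one_forms A. \<forall>Y\<in>vector_fields A. \<forall>t\<in>one_forms A.
       \<forall>u\<in>points \<T>. nijenhuis K (lift X s) (lift Y t) u = (\<lambda>F. 0))"
proof
  assume "integrable_acs \<T> K"
  then show "\<forall>X\<in>vector_fields A. \<forall>s\<in>one_forms A. \<forall>Y\<in>vector_fields A. \<forall>t\<in>one_forms A.
       \<forall>u\<in>points \<T>. nijenhuis K (lift X s) (lift Y t) u = (\<lambda>F. 0)"
    unfolding integrable_acs_def using lift_vf by blast
next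
  interpret B: acs_atlas \<T> K by (rule cotangent_acs_atlas)
  assume 0: "\<forall>X\<in>vector_fields A. \<forall>s\<in>one_forms A. \<forall>Y\<in>vector_fields A. \<forall>t\<in>one_forms A.
       \<forall>u\<in>points \<T>. nijenhuis K (lift X s) (lift Y t) u = (\<lambda>F. 0)"
  show "integrable_acs \<T> K"
    unfolding integrable_acs_def
  proof (intro ballI)
    fix V W u assume V: "V \<in> vector_fields \<T>" and W: "W \<in> vector_fields \<T>"
      and u: "u \<in> points \<T>"
    note v = B.vf_vfield[OF V] B.vf_vfield[OF W]
    have "nijenhuis K (lift X s) W u = (\<lambda>F. 0)" if X: "X \<in> vector_fields A" "s \<in> one_forms A" for X s
    proof -
      note l = B.vf_vfield[OF lift_vf[OF X]]
      \<comment> \<open>The reduction to lifts works in the first argument; skew symmetry carries it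
        over to the second.\<close>
      have "nijenhuis K W (lift X s) u = (\<lambda>F. 0)"
        by (rule nijenhuis_zero_by_lifts[OF l v(2) u]) (use 0 X u in blast)
      then show ?thesis by (simp add: B.nijenhuis_skew[OF l v(2) u])
    qed
    then show "nijenhuis K V W u = (\<lambda>F. 0)" by (rule nijenhuis_zero_by_lifts[OF v(2,1) u])
  qed
qed

text \<open>The hypotheses say that K maps \<open>lift X1 s1\<close> to minus
  \<open>lift X2 s2\<close>, so the first lift plus i times the second lies in the i-eigenbundle,
  and likewise for Y. The final condition says that the bracket of these two complex fields lies
  there too.\<close>

lemma nijenhuis_lift_iff:
  assumes X1: "X1 \<in> vector_fields A" "s1 \<in> one_forms A" and X2: "X2 \<in> vector_fields A" "s2 \<in> one_forms A"
    and Y1: "Y1 \<in> vector_fields A" "t1 \<in> one_forms A" and Y2: "Y2 \<in> vector_fields A" "t2 \<in> one_forms A"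
    and JX: "\<And>p. p \<in> points A \<Longrightarrow> J p (X1 p, s1 p) = (\<lambda>f. - X2 p f, \<lambda>v. - s2 p v)"
    and JY: "\<And>p. p \<in> points A \<Longrightarrow> J p (Y1 p, t1 p) = (\<lambda>f. - Y2 p f, \<lambda>v. - t2 p v)"
    and u: "u \<in> points \<T>"
  obtains \<eta> \<zeta> where "\<eta> \<in> cotangent_space A (fst u)" "\<zeta> \<in> cotangent_space A (fst u)"
    "\<And>Z. Z \<in> vector_fields A \<Longrightarrow> \<eta> (Z (fst u)) = covector_bracket D X1 s1 Y1 t1 u Z - covector_bracket D X2 s2 Y2 t2 u Z"
    "\<And>Z. Z \<in> vector_fields A \<Longrightarrow> \<zeta> (Z (fst u)) = covector_bracket D X2 s2 Y1 t1 u Z + covector_bracket D X1 s1 Y2 t2 u Z"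
    "nijenhuis K (lift X1 s1) (lift Y1 t1) u = (\<lambda>F. 0) \<longleftrightarrow>
      J (fst u) (\<lambda>f. lie_bracket X1 Y1 (fst u) f - lie_bracket X2 Y2 (fst u) f, \<eta>)
       = (\<lambda>f. - (lie_bracket X2 Y1 (fst u) f + lie_bracket X1 Y2 (fst u) f), \<lambda>v. - \<zeta> v)"
proof -
  interpret B: acs_atlas \<T> K by (rule cotangent_acs_atlas)
  note p = cotangent_point[OF u]
  have Km: "K v (lift X s v) = (\<lambda>F. (-1) * lift X' s' v F)"
    if X: "X \<in> vector_fields A" "s \<in> one_forms A" and X': "X' \<in> vector_fields A" "s' \<in> one_forms A"
      and J: "\<And>p. p \<in> points A \<Longrightarrow> J p (X p, s p) = (\<lambda>f. - X' p f, \<lambda>v. - s' p v)" and v: "v \<in> points \<T>"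
    for X s X' s' v
  proof (rule splits_unique[OF v])
    show "splits v (K v (lift X s v)) (\<lambda>f. - X' (fst v) f) (\<lambda>w. - s' (fst v) w)"
      using acs_splits[OF v lift_splits[OF X v]] J[OF cotangent_point(1)[OF v]] by simp
    show "splits v (\<lambda>F. (-1) * lift X' s' v F) (\<lambda>f. - X' (fst v) f) (\<lambda>w. - s' (fst v) w)"
      using splits_lin[OF v lift_splits[OF X' v] lift_splits[OF X' v], of "-1" 0] by simp
  qed
  define l1 l2 m1 m2 where "l1 = lift X1 s1" and "l2 = lift X2 s2" and "m1 = lift Y1 t1" and "m2 = lift Y2 t2"
  note defs = l1_def l2_def m1_def m2_def
  have vf: "vfield \<T> l1" "vfield \<T> l2" "vfield \<T> m1" "vfield \<T> m2"
    unfolding defs by (intro B.vf_vfield lift_vf assms)+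
  have neg: "vfield \<T> (\<lambda>v F. (-1) * l v F)" if "vfield \<T> l" for l
    by (intro B.vfield_scale B.smooth_fun_const that)
  have Kl: "K v (l1 v) = (\<lambda>F. (-1) * l2 v F)" and Kk: "K v (m1 v) = (\<lambda>F. (-1) * m2 v F)" if "v \<in> points \<T>" for v
    unfolding defs by (intro Km X1 X2 Y1 Y2 JX JY that; assumption)+
  have minus: "lie_bracket (\<lambda>v F. (-1) * l v F) m u = (\<lambda>F. - lie_bracket l m u F)"
    if "vfield \<T> l" "vfield \<T> m" for l m
    using B.lie_bracket_scale[OF B.smooth_fun_const that u, of "-1"] by (simp add: B.tangent_const[OF B.vfield_tangent[OF that(2) u]])
  have minus2: "lie_bracket l (\<lambda>v F. (-1) * m v F) u = (\<lambda>F. - lie_bracket l m u F)"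
    if "vfield \<T> l" "vfield \<T> m" for l m
    using minus[OF that(2,1)] by (simp add: B.lie_bracket_skew[of l])
  have 1: "lie_bracket (\<lambda>v. K v (l1 v)) (\<lambda>v. K v (m1 v)) u = lie_bracket l2 m2 u"
    by (subst B.lie_bracket_cong[OF B.K_vfield[OF vf(1)] B.K_vfield[OF vf(3)] neg[OF vf(2)] neg[OF vf(4)] u Kl Kk])
       (simp_all only: minus[OF vf(2) neg[OF vf(4)]] minus2[OF vf(2,4)] minus_minus)
  have 2: "lie_bracket (\<lambda>v. K v (l1 v)) m1 u = (\<lambda>F. - lie_bracket l2 m1 u F)"
    by (subst B.lie_bracket_cong[OF B.K_vfield[OF vf(1)] vf(3) neg[OF vf(2)] vf(3) u Kl refl])
       (simp_all only: minus[OF vf(2,3)])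
  have 3: "lie_bracket l1 (\<lambda>v. K v (m1 v)) u = (\<lambda>F. - lie_bracket l1 m2 u F)"
    by (subst B.lie_bracket_cong[OF vf(1) B.K_vfield[OF vf(3)] vf(1) neg[OF vf(4)] u refl Kk])
       (simp_all only: minus2[OF vf(1,4)])
  note lt = B.lie_bracket_tangent[OF _ _ u]
  note t11 = lt[OF vf(1,3)] and t12 = lt[OF vf(1,4)] and t21 = lt[OF vf(2,3)] and t22 = lt[OF vf(2,4)]
  let ?P = "\<lambda>F. lie_bracket l1 m1 u F - lie_bracket l2 m2 u F"
  let ?Q = "\<lambda>F. lie_bracket l2 m1 u F + lie_bracket l1 m2 u F"
  have P: "?P \<in> tangent_space \<T> u" and Q: "?Q \<in> tangent_space \<T> u"
    by (intro B.tangent_space_diff B.tangent_space_add t11 t12 t21 t22)+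
  \<comment> \<open>P + iQ is the bracket of l1 + i l2 with m1 + i m2. Applying K to KQ = P gives KP
    = -Q and conversely, which is the eigenvalue equation for P + iQ.\<close>
  have "nijenhuis K l1 m1 u = (\<lambda>F. K u ?Q F - ?P F)"
    unfolding nijenhuis_def 1 2 3 B.K_minus[OF u t21] B.K_minus[OF u t12] B.K_add[OF u t21 t12]
    by (simp add: algebra_simps)
  then have "nijenhuis K l1 m1 u = (\<lambda>F. 0) \<longleftrightarrow> K u ?Q = ?P" by (auto simp: fun_eq_iff)
  also have "\<dots> \<longleftrightarrow> K u ?P = (\<lambda>F. - ?Q F)"
  proof
    assume "K u ?Q = ?P"
    then have "K u ?P = K u (K u ?Q)" by simp
    then show "K u ?P = (\<lambda>F. - ?Q F)" by (simp only: B.K_square[OF u Q])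
  next
    assume "K u ?P = (\<lambda>F. - ?Q F)"
    then have "K u (K u ?P) = K u (\<lambda>F. - ?Q F)" by simp
    then have eq: "(\<lambda>F. - ?P F) = (\<lambda>F. - K u ?Q F)" by (simp only: B.K_square[OF u P] B.K_minus[OF u Q])
    show "K u ?Q = ?P"
    proof
      fix F
      show "K u ?Q F = ?P F" using fun_cong[OF eq, of F] by linarith
    qed
  qed
  finally have iff: "nijenhuis K l1 m1 u = (\<lambda>F. 0) \<longleftrightarrow> K u ?P = (\<lambda>F. - ?Q F)" .
  obtain \<eta>11 where 11: "splits u (lie_bracket l1 m1 u) (lie_bracket X1 Y1 (fst u)) \<eta>11"
    "\<And>Z. Z \<in> vector_fields A \<Longrightarrow> \<eta>11 (Z (fst u)) = covector_bracket D X1 s1 Y1 t1 u Z"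
    unfolding covector_bracket_def defs using lift_bracket_splits[OF X1 Y1 u] by blast
  obtain \<eta>12 where 12: "splits u (lie_bracket l1 m2 u) (lie_bracket X1 Y2 (fst u)) \<eta>12"
    "\<And>Z. Z \<in> vector_fields A \<Longrightarrow> \<eta>12 (Z (fst u)) = covector_bracket D X1 s1 Y2 t2 u Z"
    unfolding covector_bracket_def defs using lift_bracket_splits[OF X1 Y2 u] by blast
  obtain \<eta>21 where 21: "splits u (lie_bracket l2 m1 u) (lie_bracket X2 Y1 (fst u)) \<eta>21"
    "\<And>Z. Z \<in> vector_fields A \<Longrightarrow> \<eta>21 (Z (fst u)) = covector_bracket D X2 s2 Y1 t1 u Z"
    unfolding covector_bracket_def defs using lift_bracket_splits[OF X2 Y1 u] by blast
  obtain \<eta>22 where 22: "splits u (lie_bracket l2 m2 u) (lie_bracket X2 Y2 (fst u)) \<eta>22"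
    "\<And>Z. Z \<in> vector_fields A \<Longrightarrow> \<eta>22 (Z (fst u)) = covector_bracket D X2 s2 Y2 t2 u Z"
    unfolding covector_bracket_def defs using lift_bracket_splits[OF X2 Y2 u] by blast
  define \<eta> \<zeta> where "\<eta> = (\<lambda>v. \<eta>11 v - \<eta>22 v)" and "\<zeta> = (\<lambda>v. \<eta>21 v + \<eta>12 v)"
  have sP: "splits u ?P (\<lambda>f. lie_bracket X1 Y1 (fst u) f - lie_bracket X2 Y2 (fst u) f) \<eta>"
    using splits_lin[OF u 11(1) 22(1), of 1 "-1"] by (simp add: \<eta>_def)
  have sQ: "splits u (\<lambda>F. - ?Q F) (\<lambda>f. - (lie_bracket X2 Y1 (fst u) f + lie_bracket X1 Y2 (fst u) f)) (\<lambda>v. - \<zeta> v)"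
    using splits_lin[OF u 21(1) 12(1), of "-1" "-1"] by (simp add: \<zeta>_def)
  let ?JP = "J (fst u) (\<lambda>f. lie_bracket X1 Y1 (fst u) f - lie_bracket X2 Y2 (fst u) f, \<eta>)"
  have KP: "splits u (K u ?P) (fst ?JP) (snd ?JP)" by (rule acs_splits[OF u sP])
  have "K u ?P = (\<lambda>F. - ?Q F) \<longleftrightarrow>
      ?JP = (\<lambda>f. - (lie_bracket X2 Y1 (fst u) f + lie_bracket X1 Y2 (fst u) f), \<lambda>v. - \<zeta> v)"
  proof
    assume "K u ?P = (\<lambda>F. - ?Q F)"
    then have "splits u (K u ?P) (\<lambda>f. - (lie_bracket X2 Y1 (fst u) f + lie_bracket X1 Y2 (fst u) f)) (\<lambda>v. - \<zeta> v)"
      using sQ by (simp only:)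
    from splits_functional[OF u KP this] show "?JP = (\<lambda>f. - (lie_bracket X2 Y1 (fst u) f + lie_bracket X1 Y2 (fst u) f), \<lambda>v. - \<zeta> v)"
      by (intro prod_eqI) (simp_all only: fst_conv snd_conv)
  next
    assume eq: "?JP = (\<lambda>f. - (lie_bracket X2 Y1 (fst u) f + lie_bracket X1 Y2 (fst u) f), \<lambda>v. - \<zeta> v)"
    show "K u ?P = (\<lambda>F. - ?Q F)"
      using KP unfolding eq fst_conv snd_conv by (rule splits_unique[OF u _ sQ])
  qed
  with iff have fin: "nijenhuis K (lift X1 s1) (lift Y1 t1) u = (\<lambda>F. 0) \<longleftrightarrow>
      ?JP = (\<lambda>f. - (lie_bracket X2 Y1 (fst u) f + lie_bracket X1 Y2 (fst u) f), \<lambda>v. - \<zeta> v)"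
    unfolding defs by (rule trans)
  have \<zeta>c: "\<zeta> \<in> cotangent_space A (fst u)"
    unfolding \<zeta>_def by (intro cotangent_space_add splitsD(3)[OF 21(1)] splitsD(3)[OF 12(1)])
  show thesis
    by (rule that[OF splitsD(3)[OF sP] \<zeta>c _ _ fin]) (simp_all add: \<eta>_def \<zeta>_def 11(2) 22(2) 12(2) 21(2))
qed

end


section \<open>Complex vector fields and one-forms\<close>

abbreviation re_field :: "('a \<Rightarrow> 'a ctvec) \<Rightarrow> 'a \<Rightarrow> 'a tvec" where
  "re_field X \<equiv> (\<lambda>p f. Re (X p f))"

abbreviation im_field :: "('a \<Rightarrow> 'a ctvec) \<Rightarrow> 'a \<Rightarrow> 'a tvec" where
  "im_field X \<equiv> (\<lambda>p f. Im (X p f))"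

definition cforms :: "('a, 'e::euclidean_space) chart set \<Rightarrow> ('a \<Rightarrow> 'a ccovec) set" where
  "cforms A = {\<theta>. (\<forall>p\<in>points A. \<theta> p \<in> ccotangent_space A p) \<and> (\<forall>p. p \<notin> points A \<longrightarrow> \<theta> p = (\<lambda>V. 0)) \<and>
     (\<forall>X\<in>cvector_fields A. smooth_fun A (\<lambda>p. \<theta> p (X p)))}"

definition cdform :: "('a, 'e::euclidean_space) chart set \<Rightarrow> ('a \<Rightarrow> real) \<Rightarrow> 'a \<Rightarrow> 'a ccovec" where
  "cdform A f p = (\<lambda>V. if p \<in> points A \<and> V \<in> ctangent_space A p then V f else 0)"

context smooth_atlas
begin

lemma smooth_complex_iff: "smooth_fun A g \<longleftrightarrow> smooth_fun A (\<lambda>q. Re (g q)) \<and> smooth_fun A (\<lambda>q. Im (g q))"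
proof
  assume "smooth_fun A (\<lambda>q. Re (g q)) \<and> smooth_fun A (\<lambda>q. Im (g q))"
  then have "smooth_fun A (\<lambda>q. complex_of_real (Re (g q)) + \<i> * complex_of_real (Im (g q)))"
    by (intro smooth_fun_add smooth_fun_mult smooth_fun_const smooth_fun_linear[OF bounded_linear_of_real]) auto
  then show "smooth_fun A g" by (simp flip: complex_eq)
qed (auto intro: smooth_fun_linear[OF bounded_linear_Re] smooth_fun_linear[OF bounded_linear_Im])

lemma cvf_iff: "X \<in> cvector_fields A \<longleftrightarrow> re_field X \<in> vector_fields A \<and> im_field X \<in> vector_fields A"
proof -
  have "X p = (\<lambda>f. 0) \<longleftrightarrow> (\<lambda>f. Re (X p f)) = (\<lambda>f. 0) \<and> (\<lambda>f. Im (X p f)) = (\<lambda>f. 0)" for p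
    by (auto simp: fun_eq_iff complex_eq_iff)
  then show ?thesis
    unfolding cvector_fields_def vector_fields_def ctangent_space_def
    using smooth_complex_iff by (auto 4 4)
qed

lemma cvf_re: "X \<in> cvector_fields A \<Longrightarrow> re_field X \<in> vector_fields A"
  and cvf_im: "X \<in> cvector_fields A \<Longrightarrow> im_field X \<in> vector_fields A"
  by (simp_all add: cvf_iff)

lemma cvfI: "X \<in> vector_fields A \<Longrightarrow> Y \<in> vector_fields A \<Longrightarrow> (\<lambda>p f. Complex (X p f) (Y p f)) \<in> cvector_fields A"
  by (simp add: cvf_iff)

lemma cvf_of_real: "X \<in> vector_fields A \<Longrightarrow> (\<lambda>p f. complex_of_real (X p f)) \<in> cvector_fields A"
  by (simp add: cvf_iff vf_zero)

lemma ctangentI: "(\<lambda>f. Re (V f)) \<in> tangent_space A p \<Longrightarrow> (\<lambda>f. Im (V f)) \<in> tangent_space A p \<Longrightarrow> V \<in> ctangent_space A p"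
  by (simp add: ctangent_space_def)

lemma ctangent_re: "V \<in> ctangent_space A p \<Longrightarrow> (\<lambda>f. Re (V f)) \<in> tangent_space A p"
  and ctangent_im: "V \<in> ctangent_space A p \<Longrightarrow> (\<lambda>f. Im (V f)) \<in> tangent_space A p"
  by (simp_all add: ctangent_space_def)

lemma cvf_ctangent: "X \<in> cvector_fields A \<Longrightarrow> X p \<in> ctangent_space A p"
  by (intro ctangentI vf_tangent[of "re_field X"] vf_tangent[of "im_field X"] cvf_re cvf_im)

lemma cvf_smooth: "X \<in> cvector_fields A \<Longrightarrow> smooth_fun A f \<Longrightarrow> smooth_fun A (\<lambda>p. X p f)"
  unfolding cvector_fields_def by blast

lemma ctangent_nonsmooth: "V \<in> ctangent_space A p \<Longrightarrow> \<not> smooth_fun A f \<Longrightarrow> V f = 0"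
  using tangent_nonsmooth[OF ctangent_re] tangent_nonsmooth[OF ctangent_im] by (simp add: complex_eq_iff)

lemma ctangent_eqI:
  assumes "V \<in> ctangent_space A p" "W \<in> ctangent_space A p" "\<And>f. smooth_fun A f \<Longrightarrow> V f = W f"
  shows "V = W"
  using assms ctangent_nonsmooth by (metis ext)

lemma ctangent_zero: "(\<lambda>f. 0) \<in> ctangent_space A p"
  by (simp add: ctangent_space_def tangent_space_zero)

lemma ctangent_of_real: "v \<in> tangent_space A p \<Longrightarrow> (\<lambda>f. complex_of_real (v f)) \<in> ctangent_space A p"
  by (simp add: ctangent_space_def tangent_space_zero)

lemma ctangent_scale: "V \<in> ctangent_space A p \<Longrightarrow> (\<lambda>f. a * V f) \<in> ctangent_space A p"
proof (rule ctangentI)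
  assume V: "V \<in> ctangent_space A p"
  note t = ctangent_re[OF V] ctangent_im[OF V]
  show "(\<lambda>f. Re (a * V f)) \<in> tangent_space A p"
    using tangent_space_lin[OF t, of "Re a" "- Im a"] by simp
  show "(\<lambda>f. Im (a * V f)) \<in> tangent_space A p"
    using tangent_space_lin[OF t, of "Im a" "Re a"] by (simp add: add.commute)
qed

lemma ctangent_add: "V \<in> ctangent_space A p \<Longrightarrow> W \<in> ctangent_space A p \<Longrightarrow> (\<lambda>f. V f + W f) \<in> ctangent_space A p"
  unfolding ctangent_space_def by (simp add: tangent_space_add)

lemma ctangent_sum: "(\<And>i. i \<in> I \<Longrightarrow> V i \<in> ctangent_space A p) \<Longrightarrow> (\<lambda>f. \<Sum>i\<in>I. V i f) \<in> ctangent_space A p"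
  by (induction I rule: infinite_finite_induct) (simp_all add: ctangent_zero ctangent_add)

lemma cvf_scale:
  assumes "smooth_fun A h" "X \<in> cvector_fields A"
  shows "(\<lambda>p f. h p * X p f) \<in> cvector_fields A"
  using assms unfolding cvector_fields_def by (auto intro: ctangent_scale smooth_fun_mult)

lemma cvf_add: "X \<in> cvector_fields A \<Longrightarrow> Y \<in> cvector_fields A \<Longrightarrow> (\<lambda>p f. X p f + Y p f) \<in> cvector_fields A"
  unfolding cvector_fields_def by (auto intro: ctangent_add smooth_fun_add)

lemma cvf_zero: "(\<lambda>p f. 0) \<in> cvector_fields A"
  by (simp add: cvf_iff vf_zero)

lemma cvf_sum: "(\<And>i. i \<in> I \<Longrightarrow> X i \<in> cvector_fields A) \<Longrightarrow> (\<lambda>p f. \<Sum>i\<in>I. X i p f) \<in> cvector_fields A"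
  by (induction I rule: infinite_finite_induct) (simp_all add: cvf_zero cvf_add)

lemma cvf_cnj: "X \<in> cvector_fields A \<Longrightarrow> (\<lambda>p f. cnj (X p f)) \<in> cvector_fields A"
  by (simp add: cvf_iff vf_minus)

lemma extend_ctangent:
  assumes "p \<in> points A" "V \<in> ctangent_space A p"
  obtains X where "X \<in> cvector_fields A" "X p = V"
proof -
  obtain X where X: "X \<in> vector_fields A" "X p = (\<lambda>f. Re (V f))" by (rule extend_tangent[OF assms(1) ctangent_re[OF assms(2)]])
  obtain Y where Y: "Y \<in> vector_fields A" "Y p = (\<lambda>f. Im (V f))" by (rule extend_tangent[OF assms(1) ctangent_im[OF assms(2)]])
  show thesis by (rule that[OF cvfI[OF X(1) Y(1)]]) (simp add: X Y)
qed

lemma smooth_of_real: "smooth_fun A h \<Longrightarrow> smooth_fun A (\<lambda>q. complex_of_real (h q))"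
  by (rule smooth_fun_linear[OF bounded_linear_of_real])

lemma cderiv_eq:
  "cderiv V g = Complex (Re (V (\<lambda>q. Re (g q))) - Im (V (\<lambda>q. Im (g q)))) (Im (V (\<lambda>q. Re (g q))) + Re (V (\<lambda>q. Im (g q))))"
  by (simp add: cderiv_def complex_eq_iff)

lemma cderiv_local:
  assumes "V \<in> ctangent_space A p" "aopen A N" "p \<in> N" "smooth_fun A g" "smooth_fun A h" "\<And>q. q \<in> N \<Longrightarrow> g q = h q"
  shows "cderiv V g = cderiv V h"
proof -
  have "Re (V (\<lambda>q. Re (g q))) = Re (V (\<lambda>q. Re (h q)))" "Re (V (\<lambda>q. Im (g q))) = Re (V (\<lambda>q. Im (h q)))"
    "Im (V (\<lambda>q. Re (g q))) = Im (V (\<lambda>q. Re (h q)))" "Im (V (\<lambda>q. Im (g q))) = Im (V (\<lambda>q. Im (h q)))"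
    using assms smooth_complex_iff[of g] smooth_complex_iff[of h]
    by (auto intro!: tangent_local[OF ctangent_re[OF assms(1)] assms(2,3)] tangent_local[OF ctangent_im[OF assms(1)] assms(2,3)])
  then show ?thesis by (simp add: cderiv_eq)
qed

lemma cderiv_const: "V \<in> ctangent_space A p \<Longrightarrow> cderiv V (\<lambda>q. c) = 0"
  using tangent_const[OF ctangent_re] tangent_const[OF ctangent_im] by (simp add: cderiv_eq complex_eq_iff)

lemma re_clie_bracket: "re_field (clie_bracket X Y) =
    (\<lambda>p f. lie_bracket (re_field X) (re_field Y) p f - lie_bracket (im_field X) (im_field Y) p f)"
  and im_clie_bracket: "im_field (clie_bracket X Y) =
    (\<lambda>p f. lie_bracket (im_field X) (re_field Y) p f + lie_bracket (re_field X) (im_field Y) p f)"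
  by (simp_all add: clie_bracket_def lie_bracket_def cderiv_def fun_eq_iff)

lemma cvf_clie_bracket: "X \<in> cvector_fields A \<Longrightarrow> Y \<in> cvector_fields A \<Longrightarrow> clie_bracket X Y \<in> cvector_fields A"
  unfolding cvf_iff[of "clie_bracket X Y"] re_clie_bracket im_clie_bracket
  by (intro conjI vf_diff vf_add vf_lie_bracket cvf_re cvf_im)

lemma clie_bracket_local:
  assumes "X \<in> cvector_fields A" "Y \<in> cvector_fields A" "X' \<in> cvector_fields A" "Y' \<in> cvector_fields A"
    and "aopen A N" "p \<in> N" and X: "\<And>q. q \<in> N \<Longrightarrow> X q = X' q" and Y: "\<And>q. q \<in> N \<Longrightarrow> Y q = Y' q"
  shows "clie_bracket X Y p = clie_bracket X' Y' p"
proof (rule ctangent_eqI[where p=p])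
  fix f :: "'a \<Rightarrow> real" assume f: "smooth_fun A f"
  note s = cvf_smooth[OF assms(1) f] cvf_smooth[OF assms(2) f] cvf_smooth[OF assms(3) f] cvf_smooth[OF assms(4) f]
  have "cderiv (X p) (\<lambda>q. Y q f) = cderiv (X p) (\<lambda>q. Y' q f)"
    by (rule cderiv_local[OF cvf_ctangent[OF assms(1)] assms(5,6) s(2,4)]) (simp add: Y)
  moreover have "cderiv (Y p) (\<lambda>q. X q f) = cderiv (Y p) (\<lambda>q. X' q f)"
    by (rule cderiv_local[OF cvf_ctangent[OF assms(2)] assms(5,6) s(1,3)]) (simp add: X)
  ultimately show "clie_bracket X Y p f = clie_bracket X' Y' p f"
    by (simp add: clie_bracket_def X[OF assms(6)] Y[OF assms(6)])
qed (rule cvf_ctangent[OF cvf_clie_bracket] assms)+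

section \<open>Complex covectors, complex one-forms and dual coframes\<close>

lemma ccotangent_lin:
  "\<theta> \<in> ccotangent_space A p \<Longrightarrow> V \<in> ctangent_space A p \<Longrightarrow> W \<in> ctangent_space A p \<Longrightarrow>
     \<theta> (\<lambda>f. a * V f + b * W f) = a * \<theta> V + b * \<theta> W"
  unfolding ccotangent_space_def by blast

lemma ccotangent_off: "\<theta> \<in> ccotangent_space A p \<Longrightarrow> V \<notin> ctangent_space A p \<Longrightarrow> \<theta> V = 0"
  unfolding ccotangent_space_def by blast

lemma ccotangent_scale: "\<theta> \<in> ccotangent_space A p \<Longrightarrow> V \<in> ctangent_space A p \<Longrightarrow> \<theta> (\<lambda>f. a * V f) = a * \<theta> V"
  using ccotangent_lin[of \<theta> p V V a 0] by simp

lemma ccotangent_zero: "\<theta> \<in> ccotangent_space A p \<Longrightarrow> \<theta> (\<lambda>f. 0) = 0"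
  using ccotangent_scale[of \<theta> p "\<lambda>f. 0" 0] by (simp add: ctangent_zero)

lemma ccotangent_sum:
  assumes "\<theta> \<in> ccotangent_space A p" "\<And>i. i \<in> I \<Longrightarrow> V i \<in> ctangent_space A p"
  shows "\<theta> (\<lambda>f. \<Sum>i\<in>I. c i * V i f) = (\<Sum>i\<in>I. c i * \<theta> (V i))"
  using assms(2)
proof (induction I rule: infinite_finite_induct)
  case (insert i I)
  then have "\<theta> (\<lambda>f. c i * V i f + 1 * (\<Sum>i\<in>I. c i * V i f)) = c i * \<theta> (V i) + 1 * \<theta> (\<lambda>f. \<Sum>i\<in>I. c i * V i f)"
    by (intro ccotangent_lin[OF assms(1)] ctangent_sum ctangent_scale) auto
  then show ?case using insert by simp
qed (simp_all add: ccotangent_zero[OF assms(1)])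

lemma ccotangent_eqI:
  "\<theta> \<in> ccotangent_space A p \<Longrightarrow> \<theta>' \<in> ccotangent_space A p \<Longrightarrow> (\<And>V. V \<in> ctangent_space A p \<Longrightarrow> \<theta> V = \<theta>' V) \<Longrightarrow> \<theta> = \<theta>'"
  using ccotangent_off by (metis ext)

lemma ccotangent_space_zero: "(\<lambda>V. 0) \<in> ccotangent_space A p"
  by (simp add: ccotangent_space_def)

lemma ccovec_decomp:
  assumes "\<theta> \<in> ccotangent_space A p" "V \<in> ctangent_space A p"
  shows "\<theta> V = Complex (re_covec \<theta> (\<lambda>f. Re (V f)) - im_covec \<theta> (\<lambda>f. Im (V f)))
     (re_covec \<theta> (\<lambda>f. Im (V f)) + im_covec \<theta> (\<lambda>f. Re (V f)))"
proof -
  have "V = (\<lambda>f. 1 * complex_of_real (Re (V f)) + \<i> * complex_of_real (Im (V f)))"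
    by (simp add: fun_eq_iff flip: complex_eq)
  then have "\<theta> V = \<theta> (\<lambda>f. 1 * complex_of_real (Re (V f)) + \<i> * complex_of_real (Im (V f)))" by simp
  also have "\<dots> = 1 * \<theta> (\<lambda>f. complex_of_real (Re (V f))) + \<i> * \<theta> (\<lambda>f. complex_of_real (Im (V f)))"
    by (intro ccotangent_lin[OF assms(1)] ctangent_of_real ctangent_re ctangent_im assms(2))
  finally show ?thesis by (simp add: re_covec_def im_covec_def complex_eq_iff)
qed

lemma re_covec_cotangent:
  assumes "\<theta> \<in> ccotangent_space A p"
  shows "re_covec \<theta> \<in> cotangent_space A p" "im_covec \<theta> \<in> cotangent_space A p"
proof -
  have "\<theta> (\<lambda>f. complex_of_real (a * v f + b * w f)) = complex_of_real a * \<theta> (\<lambda>f. complex_of_real (v f)) + complex_of_real b * \<theta> (\<lambda>f. complex_of_real (w f))"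
    if "v \<in> tangent_space A p" "w \<in> tangent_space A p" for v w a b
    using ccotangent_lin[OF assms ctangent_of_real[OF that(1)] ctangent_of_real[OF that(2)], of "complex_of_real a" "complex_of_real b"] by simp
  moreover have "\<theta> (\<lambda>f. complex_of_real (v f)) = 0" if "v \<notin> tangent_space A p" for v
    using that by (intro ccotangent_off[OF assms]) (simp add: ctangent_space_def)
  ultimately show "re_covec \<theta> \<in> cotangent_space A p" "im_covec \<theta> \<in> cotangent_space A p"
    unfolding cotangent_space_def re_covec_def im_covec_def by simp_all
qed

lemma join_covec_ccotangent:
  assumes "\<eta> \<in> cotangent_space A p" "\<zeta> \<in> cotangent_space A p"
  shows "join_covec A p \<eta> \<zeta> \<in> ccotangent_space A p"
  unfolding ccotangent_space_def
proof (intro CollectI conjI ballI allI impI)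
  fix V W a b assume V: "V \<in> ctangent_space A p" and W: "W \<in> ctangent_space A p"
  note t = ctangent_re[OF V] ctangent_im[OF V] ctangent_re[OF W] ctangent_im[OF W]
  have VW: "(\<lambda>f. a * V f + b * W f) \<in> ctangent_space A p" by (intro ctangent_add ctangent_scale V W)
  have lin: "\<xi> (\<lambda>f. Re (a * V f + b * W f)) = Re a * \<xi> (\<lambda>f. Re (V f)) - Im a * \<xi> (\<lambda>f. Im (V f)) + (Re b * \<xi> (\<lambda>f. Re (W f)) - Im b * \<xi> (\<lambda>f. Im (W f)))"
    "\<xi> (\<lambda>f. Im (a * V f + b * W f)) = Im a * \<xi> (\<lambda>f. Re (V f)) + Re a * \<xi> (\<lambda>f. Im (V f)) + (Im b * \<xi> (\<lambda>f. Re (W f)) + Re b * \<xi> (\<lambda>f. Im (W f)))"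
    if "\<xi> \<in> cotangent_space A p" for \<xi>
  proof -
    have "\<xi> (\<lambda>f. (Re a * Re (V f) + (- Im a) * Im (V f)) + (Re b * Re (W f) + (- Im b) * Im (W f)))
      = (Re a * \<xi> (\<lambda>f. Re (V f)) + (- Im a) * \<xi> (\<lambda>f. Im (V f))) + (Re b * \<xi> (\<lambda>f. Re (W f)) + (- Im b) * \<xi> (\<lambda>f. Im (W f)))"
      by (subst cotangent_add[OF that]) (simp_all only: cotangent_lin[OF that t(1,2)] cotangent_lin[OF that t(3,4)] tangent_space_lin t)
    then show "\<xi> (\<lambda>f. Re (a * V f + b * W f)) = Re a * \<xi> (\<lambda>f. Re (V f)) - Im a * \<xi> (\<lambda>f. Im (V f)) + (Re b * \<xi> (\<lambda>f. Re (W f)) - Im b * \<xi> (\<lambda>f. Im (W f)))"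
      by simp
    have "\<xi> (\<lambda>f. (Im a * Re (V f) + Re a * Im (V f)) + (Im b * Re (W f) + Re b * Im (W f)))
      = (Im a * \<xi> (\<lambda>f. Re (V f)) + Re a * \<xi> (\<lambda>f. Im (V f))) + (Im b * \<xi> (\<lambda>f. Re (W f)) + Re b * \<xi> (\<lambda>f. Im (W f)))"
      by (subst cotangent_add[OF that]) (simp_all only: cotangent_lin[OF that t(1,2)] cotangent_lin[OF that t(3,4)] tangent_space_lin t)
    then show "\<xi> (\<lambda>f. Im (a * V f + b * W f)) = Im a * \<xi> (\<lambda>f. Re (V f)) + Re a * \<xi> (\<lambda>f. Im (V f)) + (Im b * \<xi> (\<lambda>f. Re (W f)) + Re b * \<xi> (\<lambda>f. Im (W f)))"
      by (simp add: add.commute)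
  qed
  show "join_covec A p \<eta> \<zeta> (\<lambda>f. a * V f + b * W f) = a * join_covec A p \<eta> \<zeta> V + b * join_covec A p \<eta> \<zeta> W"
    unfolding join_covec_def using VW V W
    by (simp only: if_True lin[OF assms(1)] lin[OF assms(2)]) (simp add: complex_eq_iff algebra_simps)
qed (simp add: join_covec_def)

lemma re_join_covec:
  assumes "\<eta> \<in> cotangent_space A p" "\<zeta> \<in> cotangent_space A p"
  shows "re_covec (join_covec A p \<eta> \<zeta>) = \<eta>" "im_covec (join_covec A p \<eta> \<zeta>) = \<zeta>"
proof -
  have j: "join_covec A p \<eta> \<zeta> (\<lambda>f. complex_of_real (v f)) = Complex (\<eta> v) (\<zeta> v)" for v
  proof (cases "v \<in> tangent_space A p")
    case True
    then show ?thesis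
      by (simp add: join_covec_def ctangent_of_real cotangent_zero[OF assms(1)] cotangent_zero[OF assms(2)] complex_eq_iff)
  next
    case False
    then have "(\<lambda>f. complex_of_real (v f)) \<notin> ctangent_space A p" by (simp add: ctangent_space_def)
    then show ?thesis using False assms by (simp add: join_covec_def cotangent_off complex_eq_iff)
  qed
  show "re_covec (join_covec A p \<eta> \<zeta>) = \<eta>" "im_covec (join_covec A p \<eta> \<zeta>) = \<zeta>"
    by (simp_all add: re_covec_def im_covec_def j)
qed

lemma cform_ccotangent: "\<theta> \<in> cforms A \<Longrightarrow> \<theta> p \<in> ccotangent_space A p"
  unfolding cforms_def by (cases "p \<in> points A") (auto simp: ccotangent_space_zero)

lemma cform_smooth: "\<theta> \<in> cforms A \<Longrightarrow> X \<in> cvector_fields A \<Longrightarrow> smooth_fun A (\<lambda>p. \<theta> p (X p))"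
  unfolding cforms_def by blast

lemma cform_add: "\<theta> \<in> cforms A \<Longrightarrow> \<sigma> \<in> cforms A \<Longrightarrow> (\<lambda>p V. \<theta> p V + \<sigma> p V) \<in> cforms A"
  unfolding cforms_def by (auto simp: ccotangent_space_def algebra_simps intro!: smooth_fun_add)

lemma cform_scale: "smooth_fun A h \<Longrightarrow> \<theta> \<in> cforms A \<Longrightarrow> (\<lambda>p V. h p * \<theta> p V) \<in> cforms A"
  unfolding cforms_def by (auto simp: ccotangent_space_def algebra_simps intro!: smooth_fun_mult)

lemma cform_zero: "(\<lambda>p V. 0) \<in> cforms A"
  unfolding cforms_def by (auto simp: ccotangent_space_def smooth_fun_const)

lemma cform_sum: "(\<And>i. i \<in> I \<Longrightarrow> \<theta> i \<in> cforms A) \<Longrightarrow> (\<lambda>p V. \<Sum>i\<in>I. \<theta> i p V) \<in> cforms A"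
  by (induction I rule: infinite_finite_induct) (simp_all add: cform_zero cform_add)

lemma cform_diff: "\<theta> \<in> cforms A \<Longrightarrow> \<sigma> \<in> cforms A \<Longrightarrow> (\<lambda>p V. \<theta> p V - \<sigma> p V) \<in> cforms A"
  using cform_add[OF _ cform_scale[OF smooth_fun_const], of \<theta> \<sigma> "-1"] by simp

lemma cdform_cform:
  assumes "smooth_fun A f"
  shows "cdform A f \<in> cforms A"
  unfolding cforms_def
proof (intro CollectI conjI ballI allI impI)
  fix p assume "p \<in> points A"
  then show "cdform A f p \<in> ccotangent_space A p"
    by (auto simp: ccotangent_space_def cdform_def intro!: ctangent_add ctangent_scale)
next
  fix X assume X: "X \<in> cvector_fields A"
  show "smooth_fun A (\<lambda>p. cdform A f p (X p))"
    by (rule smooth_fun_cong[OF _ cvf_smooth[OF X assms]]) (simp add: cdform_def cvf_ctangent[OF X])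
qed (simp add: cdform_def)

lemma re_form_one_form:
  assumes "\<theta> \<in> cforms A"
  shows "(\<lambda>p. re_covec (\<theta> p)) \<in> one_forms A" "(\<lambda>p. im_covec (\<theta> p)) \<in> one_forms A"
proof -
  have "smooth_fun A (\<lambda>p. \<theta> p (\<lambda>f. complex_of_real (X p f)))" if "X \<in> vector_fields A" for X
    using cform_smooth[OF assms cvf_of_real[OF that]] .
  then have "smooth_fun A (\<lambda>p. re_covec (\<theta> p) (X p))" "smooth_fun A (\<lambda>p. im_covec (\<theta> p) (X p))" if "X \<in> vector_fields A" for X
    using that smooth_complex_iff[of "\<lambda>p. \<theta> p (\<lambda>f. complex_of_real (X p f))"] by (simp_all add: re_covec_def im_covec_def)
  moreover have "re_covec (\<theta> p) = (\<lambda>v. 0)" "im_covec (\<theta> p) = (\<lambda>v. 0)" if "p \<notin> points A" for p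
    using assms that by (simp_all add: cforms_def re_covec_def im_covec_def)
  ultimately show "(\<lambda>p. re_covec (\<theta> p)) \<in> one_forms A" "(\<lambda>p. im_covec (\<theta> p)) \<in> one_forms A"
    unfolding one_forms_def using re_covec_cotangent[OF cform_ccotangent[OF assms]] by auto
qed

lemma join_form_cform:
  assumes "s \<in> one_forms A" "t \<in> one_forms A"
  shows "(\<lambda>p. join_covec A p (s p) (t p)) \<in> cforms A"
  unfolding cforms_def
proof (intro CollectI conjI ballI allI impI)
  fix p assume "p \<in> points A"
  show "join_covec A p (s p) (t p) \<in> ccotangent_space A p"
    by (intro join_covec_ccotangent one_form_cotangent assms)
next
  fix p assume "p \<notin> points A"
  then show "join_covec A p (s p) (t p) = (\<lambda>V. 0)"
    using assms by (auto simp: one_forms_def join_covec_def complex_eq_iff)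
next
  fix X assume X: "X \<in> cvector_fields A"
  note f = one_form_smooth[OF assms(1) cvf_re[OF X]] one_form_smooth[OF assms(1) cvf_im[OF X]]
    one_form_smooth[OF assms(2) cvf_re[OF X]] one_form_smooth[OF assms(2) cvf_im[OF X]]
  show "smooth_fun A (\<lambda>p. join_covec A p (s p) (t p) (X p))"
    by (subst smooth_complex_iff) (simp add: join_covec_def cvf_ctangent[OF X] f smooth_fun_diff smooth_fun_add)
qed

text \<open>A construction in the manner of Gram-Schmidt, with differentials of functions as raw
  material. Independence is assumed at p only; the inequality it yields there persists nearby, which
  spreads duality to a neighbourhood.\<close>

lemma dual_coframe:
  fixes n :: nat
  assumes "aopen A U" "p \<in> U" "\<And>i. i < n \<Longrightarrow> W i \<in> cvector_fields A"
    and "\<And>c. (\<And>f. (\<Sum>i<n. c i * W i p f) = 0) \<Longrightarrow> \<forall>i<n. c i = 0"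
  shows "\<exists>\<theta> N. aopen A N \<and> p \<in> N \<and> N \<subseteq> U \<and> (\<forall>i<n. \<theta> i \<in> cforms A) \<and>
    (\<forall>q\<in>N. \<forall>i<n. \<forall>j<n. \<theta> i q (W j q) = (if i = j then 1 else 0))"
  using assms(3,4)
proof (induction n)
  case 0
  then show ?case using assms(1,2) by auto
next
  case (Suc n)
  have indep: "\<forall>i<n. c i = 0" if "\<And>f. (\<Sum>i<n. c i * W i p f) = 0" for c
  proof -
    have "(\<Sum>i<Suc n. (if i < n then c i else 0) * W i p f) = 0" for f
      using that[of f] by (simp cong: sum.cong_simp)
    from Suc.prems(2)[OF this] show ?thesis by (metis less_Suc_eq)
  qed
  obtain \<theta> N where IH: "aopen A N \<and> p \<in> N \<and> N \<subseteq> U \<and> (\<forall>i<n. \<theta> i \<in> cforms A) \<and>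
      (\<forall>q\<in>N. \<forall>i<n. \<forall>j<n. \<theta> i q (W j q) = (if i = j then 1 else 0))"
  proof -
    have "\<exists>\<theta> N. aopen A N \<and> p \<in> N \<and> N \<subseteq> U \<and> (\<forall>i<n. \<theta> i \<in> cforms A) \<and>
      (\<forall>q\<in>N. \<forall>i<n. \<forall>j<n. \<theta> i q (W j q) = (if i = j then 1 else 0))"
    proof (rule Suc.IH)
      show "W i \<in> cvector_fields A" if "i < n" for i using Suc.prems(1) that by simp
    qed (rule indep)
    then show thesis using that by (elim exE)
  qed
  then have N: "aopen A N" "p \<in> N" "N \<subseteq> U" and \<theta>: "\<And>i. i < n \<Longrightarrow> \<theta> i \<in> cforms A"
    and dual: "\<And>q i j. q \<in> N \<Longrightarrow> i < n \<Longrightarrow> j < n \<Longrightarrow> \<theta> i q (W j q) = (if i = j then 1 else 0)"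
    by blast+
  have W: "W i \<in> cvector_fields A" if "i \<le> n" for i using Suc.prems(1) that by simp
  \<comment> \<open>What remains of W n after removing the components seen by the earlier forms. If
    it vanished at p on every function, W n would depend on the earlier fields there.\<close>
  define g where "g = (\<lambda>f q. W n q f - (\<Sum>i<n. \<theta> i q (W n q) * W i q f))"
  have "\<exists>f. g f p \<noteq> 0"
  proof (rule ccontr)
    assume "\<not> (\<exists>f. g f p \<noteq> 0)"
    then have "(\<Sum>i<Suc n. (if i < n then - \<theta> i p (W n p) else 1) * W i p f) = 0" for f
      by (simp add: g_def sum_negf cong: sum.cong_simp)
    from Suc.prems(2)[OF this] show False by (metis lessI less_irrefl zero_neq_one)
  qed
  then obtain f where f0: "g f p \<noteq> 0" by blast
  \<comment> \<open>Complex tangent vectors vanish on non-smooth functions, so a function that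
    detects the remainder is smooth.\<close>
  have f: "smooth_fun A f"
  proof (rule ccontr)
    assume "\<not> smooth_fun A f"
    then have "W i p f = 0" if "i \<le> n" for i using ctangent_nonsmooth[OF cvf_ctangent[OF W[OF that]]] by blast
    then show False using f0 by (simp add: g_def)
  qed
  have g: "smooth_fun A (g f)"
    unfolding g_def by (intro smooth_fun_diff smooth_fun_sum smooth_fun_mult cvf_smooth[OF _ f] cform_smooth W \<theta>) auto
  have pA: "N \<subseteq> points A" by (rule aopen_subset_points[OF N(1)])
  define O' where "O' = {q \<in> N. g f q \<in> - {0}}"
  have O': "aopen A O'" "p \<in> O'"
    unfolding O'_def
    by (rule aopen_vimage[OF N(1) smooth_fun_imp_on[OF g pA]]) (use f0 N(2) in auto)
  obtain \<kappa> :: "'a \<Rightarrow> real" and M where \<kappa>: "aopen A M" "p \<in> M" "M \<subseteq> O'" "\<And>q. q \<in> M \<Longrightarrow> \<kappa> q = 1"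
    "\<And>f :: 'a \<Rightarrow> complex. smooth_fun_on A O' f \<Longrightarrow> smooth_fun A (\<lambda>q. \<kappa> q *\<^sub>R f q)"
    using bump_obtain[OF O'] by metis
  \<comment> \<open>The reciprocal is smooth only where g f is nonzero; cut off, it is global and
    still exact on M.\<close>
  define h where "h = (\<lambda>q. \<kappa> q *\<^sub>R inverse (g f q))"
  have h: "smooth_fun A h"
    unfolding h_def
    by (intro \<kappa>(5) smooth_fun_on_inverse[OF O'(1) smooth_fun_imp_on[OF g aopen_subset_points[OF O'(1)]]]) (simp add: O'_def)
  \<comment> \<open>The differential of f, corrected to annihilate the earlier fields and normalised
    to be 1 on W n over M.\<close>
  define \<theta>n where "\<theta>n = (\<lambda>q V. h q * (cdform A f q V - (\<Sum>i<n. W i q f * \<theta> i q V)))"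
  have \<theta>n: "\<theta>n \<in> cforms A"
    unfolding \<theta>n_def by (intro cform_scale h cform_diff cdform_cform f cform_sum cvf_smooth[OF _ f] W \<theta>) auto
  \<comment> \<open>Subtracting its value on W n times the new form makes each earlier form
    annihilate W n without changing it on the earlier fields.\<close>
  define \<theta>' where "\<theta>' = (\<lambda>i q V. if i < n then \<theta> i q V - \<theta> i q (W n q) * \<theta>n q V else \<theta>n q V)"
  have "\<theta>' i \<in> cforms A" if "i < Suc n" for i
  proof (cases "i < n")
    case True
    then show ?thesis
      using cform_diff[OF \<theta>[OF True] cform_scale[OF cform_smooth[OF \<theta>[OF True] W[OF order_refl]] \<theta>n]]
      by (simp add: \<theta>'_def)
  qed (simp add: \<theta>'_def \<theta>n)
  moreover have "\<theta>' i q (W j q) = (if i = j then 1 else 0)" if "q \<in> M" "i < Suc n" "j < Suc n" for q i j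
  proof -
    have q: "q \<in> N" "g f q \<noteq> 0" "q \<in> points A" using that(1) \<kappa>(3) pA by (auto simp: O'_def)
    have cd: "cdform A f q (W j q) = W j q f" if "j \<le> n" for j
      using q(3) cvf_ctangent[OF W[OF that]] by (simp add: cdform_def)
    have n0: "\<theta>n q (W j q) = 0" if "j < n" for j
    proof -
      have "(\<Sum>i<n. W i q f * \<theta> i q (W j q)) = (\<Sum>i<n. if i = j then W i q f else 0)"
        by (rule sum.cong) (auto simp: dual[OF q(1) _ that])
      then show ?thesis using that by (simp add: \<theta>n_def cd)
    qed
    have n1: "\<theta>n q (W n q) = 1"
      using q(2) by (simp add: \<theta>n_def cd h_def \<kappa>(4)[OF \<open>q \<in> M\<close>] g_def mult.commute)
    show ?thesis
      using that(2,3) n0 n1 dual[OF q(1)] by (auto simp: \<theta>'_def less_Suc_eq)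
  qed
  ultimately show ?case
    using \<kappa>(1,2,3) N(3) by (intro exI[of _ \<theta>'] exI[of _ M]) (auto simp: O'_def)
qed

end


section \<open>Sections of the holomorphic bundle\<close>

text \<open>The negative of the curvature in the convention of \<open>complex_curvature\<close>;
  with this sign it appears in \<open>covector_bracket\<close>.\<close>

definition real_curvature ::
    "(('a \<Rightarrow> 'a tvec) \<Rightarrow> ('a \<Rightarrow> 'a tvec) \<Rightarrow> 'a \<Rightarrow> 'a tvec) \<Rightarrow>
     ('a \<Rightarrow> 'a tvec) \<Rightarrow> ('a \<Rightarrow> 'a tvec) \<Rightarrow> ('a \<Rightarrow> 'a tvec) \<Rightarrow> 'a \<Rightarrow> 'a tvec" where
  "real_curvature D X Y Z p f = D X (D Y Z) p f - D Y (D X Z) p f - D (lie_bracket X Y) Z p f"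

definition complex_dual_conn ::
    "(('a \<Rightarrow> 'a tvec) \<Rightarrow> ('a \<Rightarrow> 'a tvec) \<Rightarrow> 'a \<Rightarrow> 'a tvec) \<Rightarrow>
     ('a \<Rightarrow> 'a ctvec) \<Rightarrow> ('a \<Rightarrow> 'a ccovec) \<Rightarrow> ('a \<Rightarrow> 'a ctvec) \<Rightarrow> 'a \<Rightarrow> complex" where
  "complex_dual_conn D X \<tau> Z p = cderiv (X p) (\<lambda>q. \<tau> q (Z q)) - \<tau> p (complex_conn D X Z p)"

text \<open>The complex-bilinear extension of \<^const>\<open>covector_bracket\<close>; the sign of the last term comes
  from the curvature convention.\<close>

definition complex_covector_bracket ::
    "(('a \<Rightarrow> 'a tvec) \<Rightarrow> ('a \<Rightarrow> 'a tvec) \<Rightarrow> 'a \<Rightarrow> 'a tvec) \<Rightarrow> ('a \<Rightarrow> 'a ctvec) \<Rightarrow> ('a \<Rightarrow> 'a ccovec) \<Rightarrow>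
     ('a \<Rightarrow> 'a ctvec) \<Rightarrow> ('a \<Rightarrow> 'a ccovec) \<Rightarrow> 'a ct \<Rightarrow> ('a \<Rightarrow> 'a ctvec) \<Rightarrow> complex" where
  "complex_covector_bracket D X \<sigma> Y \<tau> u Z =
     complex_dual_conn D X \<tau> Z (fst u) - complex_dual_conn D Y \<sigma> Z (fst u)
     - Complex (snd u (\<lambda>f. Re (complex_curvature D X Y Z (fst u) f))) (snd u (\<lambda>f. Im (complex_curvature D X Y Z (fst u) f)))"

context connection_atlas
begin

lemma conn_diff1: "X \<in> vector_fields A \<Longrightarrow> Y \<in> vector_fields A \<Longrightarrow> Z \<in> vector_fields A \<Longrightarrow>
    D (\<lambda>p f. X p f - Y p f) Z = (\<lambda>p f. D X Z p f - D Y Z p f)"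
  using conn_lin1[of X Y Z 1 "-1"] by simp

lemma conn_diff2: "X \<in> vector_fields A \<Longrightarrow> Y \<in> vector_fields A \<Longrightarrow> Z \<in> vector_fields A \<Longrightarrow>
    D X (\<lambda>p f. Y p f - Z p f) = (\<lambda>p f. D X Y p f - D X Z p f)"
  using conn_lin2[of X Y Z 1 "-1"] by simp

lemma re_complex_conn: "re_field (complex_conn D X Y) =
    (\<lambda>p f. D (re_field X) (re_field Y) p f - D (im_field X) (im_field Y) p f)"
  and im_complex_conn: "im_field (complex_conn D X Y) =
    (\<lambda>p f. D (re_field X) (im_field Y) p f + D (im_field X) (re_field Y) p f)"
  by (simp_all add: complex_conn_def Let_def)

lemma cvf_complex_conn: "X \<in> cvector_fields A \<Longrightarrow> Y \<in> cvector_fields A \<Longrightarrow> complex_conn D X Y \<in> cvector_fields A"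
  unfolding cvf_iff[of "complex_conn D X Y"] re_complex_conn im_complex_conn
  by (intro conjI vf_diff vf_add conn_vf cvf_re cvf_im)

lemma complex_conn_local:
  assumes X: "X \<in> cvector_fields A" "X' \<in> cvector_fields A" and Y: "Y \<in> cvector_fields A" "Y' \<in> cvector_fields A"
    and N: "aopen A N" "p \<in> N" and eqX: "X p = X' p" and eqY: "\<And>q. q \<in> N \<Longrightarrow> Y q = Y' q"
  shows "complex_conn D X Y p = complex_conn D X' Y' p"
proof -
  note x = cvf_re[OF X(1)] cvf_im[OF X(1)] cvf_re[OF X(2)] cvf_im[OF X(2)]
  note y = cvf_re[OF Y(1)] cvf_im[OF Y(1)] cvf_re[OF Y(2)] cvf_im[OF Y(2)]
  have "D (re_field X) (re_field Y) p = D (re_field X') (re_field Y') p"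
    by (rule trans[OF conn_tensorial[OF x(1,3) y(1)] conn_local[OF x(3) y(1,3) N]]) (simp_all add: eqX eqY)
  moreover have "D (re_field X) (im_field Y) p = D (re_field X') (im_field Y') p"
    by (rule trans[OF conn_tensorial[OF x(1,3) y(2)] conn_local[OF x(3) y(2,4) N]]) (simp_all add: eqX eqY)
  moreover have "D (im_field X) (re_field Y) p = D (im_field X') (re_field Y') p"
    by (rule trans[OF conn_tensorial[OF x(2,4) y(1)] conn_local[OF x(4) y(1,3) N]]) (simp_all add: eqX eqY)
  moreover have "D (im_field X) (im_field Y) p = D (im_field X') (im_field Y') p"
    by (rule trans[OF conn_tensorial[OF x(2,4) y(2)] conn_local[OF x(4) y(2,4) N]]) (simp_all add: eqX eqY)
  ultimately show ?thesis by (simp add: complex_conn_def Let_def)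
qed

lemma complex_conn_zero: "Z \<in> cvector_fields A \<Longrightarrow> complex_conn D (\<lambda>p f. 0) Z = (\<lambda>p f. 0)"
  by (simp add: complex_conn_def Let_def conn_zero1 cvf_re cvf_im complex_eq_iff fun_eq_iff)

text \<open>\<open>complex_curvature\<close> is composed of complex-linear extensions of D, whereas
  brackets of real lifts yield real curvatures. Expanding all three arguments shows that it is, up
  to sign, the complex-trilinear extension of the latter.\<close>

lemma complex_curvature_eq:
  assumes X: "X \<in> cvector_fields A" and Y: "Y \<in> cvector_fields A" and Z: "Z \<in> cvector_fields A"
  shows "re_field (complex_curvature D X Y Z) = (\<lambda>p f. - (
      real_curvature D (re_field X) (re_field Y) (re_field Z) p f - real_curvature D (im_field X) (im_field Y) (re_field Z) p f
      - real_curvature D (re_field X) (im_field Y) (im_field Z) p f - real_curvature D (im_field X) (re_field Y) (im_field Z) p f))"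
    "im_field (complex_curvature D X Y Z) = (\<lambda>p f. - (
      real_curvature D (re_field X) (re_field Y) (im_field Z) p f - real_curvature D (im_field X) (im_field Y) (im_field Z) p f
      + real_curvature D (re_field X) (im_field Y) (re_field Z) p f + real_curvature D (im_field X) (re_field Y) (re_field Z) p f))"
proof -
  note v = cvf_re[OF X] cvf_im[OF X] cvf_re[OF Y] cvf_im[OF Y] cvf_re[OF Z] cvf_im[OF Z]
  have c: "Re (complex_conn D X Y p f) = D (re_field X) (re_field Y) p f - D (im_field X) (im_field Y) p f"
    "Im (complex_conn D X Y p f) = D (re_field X) (im_field Y) p f + D (im_field X) (re_field Y) p f" for X Y p f
    by (simp_all add: complex_conn_def Let_def)
  note r = conn_diff2 conn_add2 conn_diff1 conn_add1 conn_vf vf_lie_bracket v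
  show "re_field (complex_curvature D X Y Z) = (\<lambda>p f. - (
      real_curvature D (re_field X) (re_field Y) (re_field Z) p f - real_curvature D (im_field X) (im_field Y) (re_field Z) p f
      - real_curvature D (re_field X) (im_field Y) (im_field Z) p f - real_curvature D (im_field X) (re_field Y) (im_field Z) p f))"
    unfolding complex_curvature_def uminus_complex.sel plus_complex.sel c re_clie_bracket im_clie_bracket
    by (simp add: r real_curvature_def algebra_simps)
  show "im_field (complex_curvature D X Y Z) = (\<lambda>p f. - (
      real_curvature D (re_field X) (re_field Y) (im_field Z) p f - real_curvature D (im_field X) (im_field Y) (im_field Z) p f
      + real_curvature D (re_field X) (im_field Y) (re_field Z) p f + real_curvature D (im_field X) (re_field Y) (re_field Z) p f))"
    unfolding complex_curvature_def uminus_complex.sel plus_complex.sel c re_clie_bracket im_clie_bracket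
    by (simp add: r real_curvature_def algebra_simps)
qed

lemma real_curvature_vf: "X \<in> vector_fields A \<Longrightarrow> Y \<in> vector_fields A \<Longrightarrow> Z \<in> vector_fields A \<Longrightarrow>
    real_curvature D X Y Z \<in> vector_fields A"
proof -
  assume a: "X \<in> vector_fields A" "Y \<in> vector_fields A" "Z \<in> vector_fields A"
  have "(\<lambda>p f. D X (D Y Z) p f - D Y (D X Z) p f - D (lie_bracket X Y) Z p f) \<in> vector_fields A"
    by (intro vf_diff conn_vf vf_lie_bracket a)
  moreover have "real_curvature D X Y Z = (\<lambda>p f. D X (D Y Z) p f - D Y (D X Z) p f - D (lie_bracket X Y) Z p f)"
    by (intro ext) (simp add: real_curvature_def)
  ultimately show ?thesis by simp
qed

lemma cvf_complex_curvature:
  assumes "X \<in> cvector_fields A" "Y \<in> cvector_fields A" "Z \<in> cvector_fields A"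
  shows "complex_curvature D X Y Z \<in> cvector_fields A"
  unfolding cvf_iff[of "complex_curvature D X Y Z"] complex_curvature_eq[OF assms]
  by (intro conjI vf_minus vf_diff vf_add real_curvature_vf cvf_re cvf_im assms)

lemma complex_curvature_local:
  assumes X: "X \<in> cvector_fields A" "X' \<in> cvector_fields A" and Y: "Y \<in> cvector_fields A" "Y' \<in> cvector_fields A"
    and Z: "Z \<in> cvector_fields A" and N: "aopen A N" "p \<in> N"
    and eqX: "\<And>q. q \<in> N \<Longrightarrow> X q = X' q" and eqY: "\<And>q. q \<in> N \<Longrightarrow> Y q = Y' q"
  shows "complex_curvature D X Y Z p = complex_curvature D X' Y' Z p"
proof -
  have 1: "complex_conn D X Z q = complex_conn D X' Z q" "complex_conn D Y Z q = complex_conn D Y' Z q" if "q \<in> N" for q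
    using complex_conn_local[OF X Z Z N(1) that] complex_conn_local[OF Y Z Z N(1) that] eqX[OF that] eqY[OF that] by auto
  have "complex_conn D X (complex_conn D Y Z) p = complex_conn D X' (complex_conn D Y' Z) p"
    by (rule complex_conn_local[OF X cvf_complex_conn[OF Y(1) Z] cvf_complex_conn[OF Y(2) Z] N eqX[OF N(2)] 1(2)])
  moreover have "complex_conn D Y (complex_conn D X Z) p = complex_conn D Y' (complex_conn D X' Z) p"
    by (rule complex_conn_local[OF Y cvf_complex_conn[OF X(1) Z] cvf_complex_conn[OF X(2) Z] N eqY[OF N(2)] 1(1)])
  moreover have "complex_conn D (clie_bracket X Y) Z p = complex_conn D (clie_bracket X' Y') Z p"
    by (rule complex_conn_local[OF cvf_clie_bracket[OF X(1) Y(1)] cvf_clie_bracket[OF X(2) Y(2)] Z Z N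
          clie_bracket_local[OF X(1) Y(1) X(2) Y(2) N eqX eqY] refl])
  ultimately show ?thesis by (simp add: complex_curvature_def)
qed

lemma complex_dual_conn_eq:
  assumes X: "X \<in> cvector_fields A" and Z: "Z \<in> cvector_fields A" and \<tau>: "\<tau> \<in> cforms A"
  defines "s \<equiv> \<lambda>q. re_covec (\<tau> q)" and "t \<equiv> \<lambda>q. im_covec (\<tau> q)"
  shows "complex_dual_conn D X \<tau> Z p = Complex
      (dual_conn D (re_field X) s (re_field Z) p - dual_conn D (re_field X) t (im_field Z) p
       - dual_conn D (im_field X) s (im_field Z) p - dual_conn D (im_field X) t (re_field Z) p)
      (dual_conn D (re_field X) s (im_field Z) p + dual_conn D (re_field X) t (re_field Z) p
       + dual_conn D (im_field X) s (re_field Z) p - dual_conn D (im_field X) t (im_field Z) p)"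
proof -
  note Z' = cvf_re[OF Z] cvf_im[OF Z] and X' = cvf_re[OF X] cvf_im[OF X]
  note f = re_form_one_form[OF \<tau>, folded s_def t_def]
  note sm = one_form_smooth[OF f(1) Z'(1)] one_form_smooth[OF f(1) Z'(2)] one_form_smooth[OF f(2) Z'(1)] one_form_smooth[OF f(2) Z'(2)]
  have g: "\<tau> q (Z q) = Complex (s q (re_field Z q) - t q (im_field Z q)) (s q (im_field Z q) + t q (re_field Z q))" for q
    unfolding s_def t_def by (rule ccovec_decomp[OF cform_ccotangent[OF \<tau>] cvf_ctangent[OF Z]])
  note tx = ctangent_re[OF cvf_ctangent[OF X]] ctangent_im[OF cvf_ctangent[OF X]]
  have c: "cderiv (X p) (\<lambda>q. \<tau> q (Z q)) = Complex
      (re_field X p (\<lambda>q. s q (re_field Z q)) - re_field X p (\<lambda>q. t q (im_field Z q))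
        - (im_field X p (\<lambda>q. s q (im_field Z q)) + im_field X p (\<lambda>q. t q (re_field Z q))))
      (im_field X p (\<lambda>q. s q (re_field Z q)) - im_field X p (\<lambda>q. t q (im_field Z q))
        + (re_field X p (\<lambda>q. s q (im_field Z q)) + re_field X p (\<lambda>q. t q (re_field Z q))))"
    unfolding cderiv_eq g
    by (simp add: tangent_diff[OF tx(1)] tangent_diff[OF tx(2)] tangent_add[OF tx(1)] tangent_add[OF tx(2)] sm)
  have st: "s p \<in> cotangent_space A p" "t p \<in> cotangent_space A p" by (intro one_form_cotangent f)+
  have st_eq: "re_covec (\<tau> p) = s p" "im_covec (\<tau> p) = t p" by (simp_all add: s_def t_def)
  have dt: "D V W p \<in> tangent_space A p" if "V \<in> vector_fields A" "W \<in> vector_fields A" for V W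
    by (intro vf_tangent conn_vf that)
  have e: "\<tau> p (complex_conn D X Z p) = Complex
    (s p (D (re_field X) (re_field Z) p) - s p (D (im_field X) (im_field Z) p)
      - (t p (D (re_field X) (im_field Z) p) + t p (D (im_field X) (re_field Z) p)))
    (s p (D (re_field X) (im_field Z) p) + s p (D (im_field X) (re_field Z) p)
      + (t p (D (re_field X) (re_field Z) p) - t p (D (im_field X) (im_field Z) p)))"
    by (subst ccovec_decomp[OF cform_ccotangent[OF \<tau>] cvf_ctangent[OF cvf_complex_conn[OF X Z]]])
      (simp add: fun_cong[OF re_complex_conn] fun_cong[OF im_complex_conn] st_eq
        cotangent_diff[OF st(1)] cotangent_diff[OF st(2)] cotangent_add[OF st(1)] cotangent_add[OF st(2)] dt X' Z')
  show ?thesis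
    unfolding complex_dual_conn_def c e by (simp add: dual_conn_def complex_eq_iff)
qed

text \<open>(b11 - b22) + i (b21 + b12) is the complex-bilinear extension in the two sections;
  splitting Z into real and imaginary part then gives the two components. These combinations are the
  \<eta> and \<zeta> of \<open>nijenhuis_lift_iff\<close>.\<close>

lemma complex_covector_bracket_eq:
  assumes X: "X \<in> cvector_fields A" and Y: "Y \<in> cvector_fields A" and Z: "Z \<in> cvector_fields A"
    and \<sigma>: "\<sigma> \<in> cforms A" and \<tau>: "\<tau> \<in> cforms A" and u: "u \<in> points \<T>"
  defines "b11 \<equiv> covector_bracket D (re_field X) (\<lambda>q. re_covec (\<sigma> q)) (re_field Y) (\<lambda>q. re_covec (\<tau> q)) u"
    and "b12 \<equiv> covector_bracket D (re_field X) (\<lambda>q. re_covec (\<sigma> q)) (im_field Y) (\<lambda>q. im_covec (\<tau> q)) u"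
    and "b21 \<equiv> covector_bracket D (im_field X) (\<lambda>q. im_covec (\<sigma> q)) (re_field Y) (\<lambda>q. re_covec (\<tau> q)) u"
    and "b22 \<equiv> covector_bracket D (im_field X) (\<lambda>q. im_covec (\<sigma> q)) (im_field Y) (\<lambda>q. im_covec (\<tau> q)) u"
  shows "complex_covector_bracket D X \<sigma> Y \<tau> u Z = Complex
    ((b11 (re_field Z) - b22 (re_field Z)) - (b21 (im_field Z) + b12 (im_field Z)))
    ((b11 (im_field Z) - b22 (im_field Z)) + (b21 (re_field Z) + b12 (re_field Z)))"
proof -
  let ?p = "fst u" and ?\<xi> = "snd u"
  note \<xi> = cotangent_point(2)[OF u]
  note v = cvf_re[OF X] cvf_im[OF X] cvf_re[OF Y] cvf_im[OF Y] cvf_re[OF Z] cvf_im[OF Z]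
  have tan: "D V W ?p \<in> tangent_space A ?p" if "V \<in> vector_fields A" "W \<in> vector_fields A" for V W
    by (intro vf_tangent conn_vf that)
  have R: "?\<xi> (D V (D W U) ?p) - ?\<xi> (D W (D V U) ?p) - ?\<xi> (D (lie_bracket V W) U ?p) = ?\<xi> (real_curvature D V W U ?p)"
    if "V \<in> vector_fields A" "W \<in> vector_fields A" "U \<in> vector_fields A" for V W U
  proof -
    have "real_curvature D V W U ?p = (\<lambda>f. (D V (D W U) ?p f - D W (D V U) ?p f) - D (lie_bracket V W) U ?p f)"
      by (intro ext) (simp add: real_curvature_def)
    then show ?thesis
      by (simp add: cotangent_diff[OF \<xi>] tangent_space_diff tan conn_vf vf_lie_bracket that)
  qed
  have cb: "covector_bracket D V s W t u U = dual_conn D V t U ?p - dual_conn D W s U ?p + ?\<xi> (real_curvature D V W U ?p)"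
    if "V \<in> vector_fields A" "W \<in> vector_fields A" "U \<in> vector_fields A" for V W U s t
    using R[OF that] by (simp add: covector_bracket_def)
  have rt: "real_curvature D V W U ?p \<in> tangent_space A ?p"
    if "V \<in> vector_fields A" "W \<in> vector_fields A" "U \<in> vector_fields A" for V W U
    by (intro vf_tangent real_curvature_vf that)
  have m: "?\<xi> (\<lambda>f. - a f) = - ?\<xi> a" if "a \<in> tangent_space A ?p" for a
    using cotangent_scale[OF \<xi> that, of "-1"] by simp
  have re: "?\<xi> (re_field (complex_curvature D X Y Z) ?p) = - (
      ?\<xi> (real_curvature D (re_field X) (re_field Y) (re_field Z) ?p) - ?\<xi> (real_curvature D (im_field X) (im_field Y) (re_field Z) ?p)
      - ?\<xi> (real_curvature D (re_field X) (im_field Y) (im_field Z) ?p) - ?\<xi> (real_curvature D (im_field X) (re_field Y) (im_field Z) ?p))"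
    unfolding fun_cong[OF complex_curvature_eq(1)[OF X Y Z]]
    by (subst m) (simp_all only: cotangent_diff[OF \<xi>] tangent_space_diff rt v)
  have im: "?\<xi> (im_field (complex_curvature D X Y Z) ?p) = - (
      ?\<xi> (real_curvature D (re_field X) (re_field Y) (im_field Z) ?p) - ?\<xi> (real_curvature D (im_field X) (im_field Y) (im_field Z) ?p)
      + ?\<xi> (real_curvature D (re_field X) (im_field Y) (re_field Z) ?p) + ?\<xi> (real_curvature D (im_field X) (re_field Y) (re_field Z) ?p))"
    unfolding fun_cong[OF complex_curvature_eq(2)[OF X Y Z]]
    by (subst m) (simp_all only: cotangent_diff[OF \<xi>] cotangent_add[OF \<xi>] tangent_space_diff tangent_space_add rt v)
  show ?thesis
    unfolding complex_covector_bracket_def complex_dual_conn_eq[OF X Z \<tau>] complex_dual_conn_eq[OF Y Z \<sigma>] re im b11_def b12_def b21_def b22_def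
    by (simp add: cb v complex_eq_iff)
qed

end

context gcs_atlas
begin

text \<open>The equation J(a + i b) = i (a + i b) has real part J a = -b and imaginary part J b = a.
  The second follows from the first by applying J.\<close>

lemma holomorphic_bundle_iff:
  assumes p: "p \<in> points A" and V: "V \<in> ctangent_space A p" and \<theta>: "\<theta> \<in> ccotangent_space A p"
  shows "(V, \<theta>) \<in> holomorphic_bundle A J p \<longleftrightarrow>
    J p (\<lambda>f. Re (V f), re_covec \<theta>) = (\<lambda>f. - Im (V f), \<lambda>v. - im_covec \<theta> v)"
proof -
  note r = ctangent_re[OF V] re_covec_cotangent(1)[OF \<theta>] and i = ctangent_im[OF V] re_covec_cotangent(2)[OF \<theta>]
  let ?u = "J p (\<lambda>f. Re (V f), re_covec \<theta>)" and ?w = "J p (\<lambda>f. Im (V f), im_covec \<theta>)"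
  have c: "complexify A J p (V, \<theta>) = (\<lambda>f. Complex (fst ?u f) (fst ?w f), join_covec A p (snd ?u) (snd ?w))"
    by (simp add: complexify_def Let_def)
  have u: "snd ?u \<in> cotangent_space A p" and w: "snd ?w \<in> cotangent_space A p"
    by (intro J_cotangent p r i)+
  have mem: "(V, \<theta>) \<in> holomorphic_bundle A J p \<longleftrightarrow> complexify A J p (V, \<theta>) = (\<lambda>f. \<i> * V f, \<lambda>W. \<i> * \<theta> W)"
    using V \<theta> by (simp add: holomorphic_bundle_def)
  show ?thesis
  proof
    assume "(V, \<theta>) \<in> holomorphic_bundle A J p"
    then have 1: "(\<lambda>f. Complex (fst ?u f) (fst ?w f)) = (\<lambda>f. \<i> * V f)" and 2: "join_covec A p (snd ?u) (snd ?w) = (\<lambda>W. \<i> * \<theta> W)"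
      using mem c by simp_all
    have "fst ?u f = - Im (V f)" for f using fun_cong[OF 1, of f] by (simp add: complex_eq_iff)
    moreover have "snd ?u = re_covec (\<lambda>W. \<i> * \<theta> W)" using re_join_covec(1)[OF u w] 2 by simp
    then have "snd ?u = (\<lambda>v. - im_covec \<theta> v)" by (simp add: re_covec_def im_covec_def)
    ultimately show "?u = (\<lambda>f. - Im (V f), \<lambda>v. - im_covec \<theta> v)" by (intro prod_eqI) auto
  next
    assume eq: "?u = (\<lambda>f. - Im (V f), \<lambda>v. - im_covec \<theta> v)"
    have "J p ?u = (\<lambda>f. - Re (V f), \<lambda>v. - re_covec \<theta> v)" by (rule J_square[OF p r])
    moreover have "J p ?u = (\<lambda>f. - fst ?w f, \<lambda>v. - snd ?w v)" unfolding eq by (rule J_minus[OF p i])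
    ultimately have "fst ?w f = Re (V f)" "snd ?w v = re_covec \<theta> v" for f v
      by (auto simp: fun_eq_iff)
    then have w': "fst ?w = (\<lambda>f. Re (V f))" "snd ?w = re_covec \<theta>" by auto
    have "join_covec A p (\<lambda>v. - im_covec \<theta> v) (re_covec \<theta>) W = \<i> * \<theta> W" for W
    proof (cases "W \<in> ctangent_space A p")
      case True
      then show ?thesis by (simp add: join_covec_def ccovec_decomp[OF \<theta> True] complex_eq_iff)
    next
      case False
      then show ?thesis using ccotangent_off[OF \<theta>] by (simp add: join_covec_def)
    qed
    then show "(V, \<theta>) \<in> holomorphic_bundle A J p"
      unfolding mem c eq w' by (auto simp: complex_eq_iff fun_eq_iff)
  qed
qed

definition hol_sections :: "(('a \<Rightarrow> 'a ctvec) \<times> ('a \<Rightarrow> 'a ccovec)) set" where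
  "hol_sections = {(X, \<sigma>). X \<in> cvector_fields A \<and> \<sigma> \<in> cforms A \<and> (\<forall>p\<in>points A. (X p, \<sigma> p) \<in> holomorphic_bundle A J p)}"

lemma hol_sectionsD:
  assumes "(X, \<sigma>) \<in> hol_sections"
  shows "X \<in> cvector_fields A" "\<sigma> \<in> cforms A"
    "\<And>p. p \<in> points A \<Longrightarrow> J p (re_field X p, re_covec (\<sigma> p)) = (\<lambda>f. - im_field X p f, \<lambda>v. - im_covec (\<sigma> p) v)"
  using assms holomorphic_bundle_iff[OF _ cvf_ctangent cform_ccotangent] by (auto simp: hol_sections_def)

text \<open>The section is (X + s) - i J(X + s). It lets statements about all real sections be
  tested on sections of L.\<close>

lemma real_hol_section:
  assumes "X \<in> vector_fields A" "s \<in> one_forms A"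
  obtains Y \<sigma> where "(Y, \<sigma>) \<in> hol_sections" "re_field Y = X" "(\<lambda>p. re_covec (\<sigma> p)) = s"
proof -
  define X2 where "X2 = (\<lambda>p f. - J_vec X s p f)"
  define s2 where "s2 = (\<lambda>p v. (-1) * J_cov X s p v)"
  define Y where "Y = (\<lambda>p f. Complex (X p f) (X2 p f))"
  define \<sigma> where "\<sigma> = (\<lambda>p. join_covec A p (s p) (s2 p))"
  have X2: "X2 \<in> vector_fields A" unfolding X2_def by (intro vf_minus J_vec_vf assms)
  have s2: "s2 \<in> one_forms A" unfolding s2_def by (intro one_form_scale smooth_fun_const J_cov_one_form assms)
  have Y: "Y \<in> cvector_fields A" unfolding Y_def by (intro cvfI assms X2)
  have \<sigma>: "\<sigma> \<in> cforms A" unfolding \<sigma>_def by (intro join_form_cform assms s2)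
  have r: "re_covec (\<sigma> p) = s p" "im_covec (\<sigma> p) = s2 p" for p
    unfolding \<sigma>_def by (intro re_join_covec one_form_cotangent assms s2)+
  have "(Y p, \<sigma> p) \<in> holomorphic_bundle A J p" if p: "p \<in> points A" for p
    unfolding holomorphic_bundle_iff[OF p cvf_ctangent[OF Y] cform_ccotangent[OF \<sigma>]] r
    by (rule prod_eqI) (simp_all add: Y_def X2_def s2_def J_vec_def J_cov_def p)
  then show thesis using that[of Y \<sigma>] Y \<sigma> r by (simp add: hol_sections_def Y_def)
qed

text \<open>\<theta> = \<eta> + i \<zeta> with the covectors of \<open>nijenhuis_lift_iff\<close>.
  It exists whether or not the Nijenhuis tensor vanishes, so vanishing becomes a membership
  statement about a fixed pair.\<close>

lemma hol_sections_bracket: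
  assumes XS: "(X, \<sigma>) \<in> hol_sections" and YT: "(Y, \<tau>) \<in> hol_sections" and u: "u \<in> points \<T>"
  shows "\<exists>\<theta>. \<theta> \<in> ccotangent_space A (fst u) \<and>
    (\<forall>Z\<in>cvector_fields A. \<theta> (Z (fst u)) = complex_covector_bracket D X \<sigma> Y \<tau> u Z) \<and>
    (nijenhuis K (lift (re_field X) (\<lambda>p. re_covec (\<sigma> p))) (lift (re_field Y) (\<lambda>p. re_covec (\<tau> p))) u = (\<lambda>F. 0) \<longleftrightarrow>
      (clie_bracket X Y (fst u), \<theta>) \<in> holomorphic_bundle A J (fst u))"
proof -
  note X = hol_sectionsD[OF XS] and Y = hol_sectionsD[OF YT]
  note p = cotangent_point[OF u]
  note rx = cvf_re[OF X(1)] re_form_one_form(1)[OF X(2)] and ix = cvf_im[OF X(1)] re_form_one_form(2)[OF X(2)]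
  note ry = cvf_re[OF Y(1)] re_form_one_form(1)[OF Y(2)] and iy = cvf_im[OF Y(1)] re_form_one_form(2)[OF Y(2)]
  let ?N = "nijenhuis K (lift (re_field X) (\<lambda>p. re_covec (\<sigma> p))) (lift (re_field Y) (\<lambda>p. re_covec (\<tau> p))) u = (\<lambda>F. 0)"
  obtain \<eta> \<zeta> where \<eta>: "\<eta> \<in> cotangent_space A (fst u)" and \<zeta>: "\<zeta> \<in> cotangent_space A (fst u)"
    and e: "\<And>Z. Z \<in> vector_fields A \<Longrightarrow> \<eta> (Z (fst u)) =
      covector_bracket D (re_field X) (\<lambda>p. re_covec (\<sigma> p)) (re_field Y) (\<lambda>p. re_covec (\<tau> p)) u Z
      - covector_bracket D (im_field X) (\<lambda>p. im_covec (\<sigma> p)) (im_field Y) (\<lambda>p. im_covec (\<tau> p)) u Z"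
    and z: "\<And>Z. Z \<in> vector_fields A \<Longrightarrow> \<zeta> (Z (fst u)) =
      covector_bracket D (im_field X) (\<lambda>p. im_covec (\<sigma> p)) (re_field Y) (\<lambda>p. re_covec (\<tau> p)) u Z
      + covector_bracket D (re_field X) (\<lambda>p. re_covec (\<sigma> p)) (im_field Y) (\<lambda>p. im_covec (\<tau> p)) u Z"
    and iff: "?N \<longleftrightarrow> J (fst u) (\<lambda>f. lie_bracket (re_field X) (re_field Y) (fst u) f - lie_bracket (im_field X) (im_field Y) (fst u) f, \<eta>)
     = (\<lambda>f. - (lie_bracket (im_field X) (re_field Y) (fst u) f + lie_bracket (re_field X) (im_field Y) (fst u) f), \<lambda>v. - \<zeta> v)"
    using nijenhuis_lift_iff[OF rx ix ry iy X(3) Y(3) u] by blast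
  define \<theta> where "\<theta> = join_covec A (fst u) \<eta> \<zeta>"
  have \<theta>: "\<theta> \<in> ccotangent_space A (fst u)" unfolding \<theta>_def by (rule join_covec_ccotangent[OF \<eta> \<zeta>])
  have val: "\<theta> (Z (fst u)) = complex_covector_bracket D X \<sigma> Y \<tau> u Z" if Z: "Z \<in> cvector_fields A" for Z
    unfolding complex_covector_bracket_eq[OF X(1) Y(1) Z X(2) Y(2) u] e[OF cvf_re[OF Z], symmetric] e[OF cvf_im[OF Z], symmetric]
      z[OF cvf_re[OF Z], symmetric] z[OF cvf_im[OF Z], symmetric]
    by (simp add: \<theta>_def join_covec_def cvf_ctangent[OF Z] complex_eq_iff)
  have br: "clie_bracket X Y (fst u) \<in> ctangent_space A (fst u)" by (intro cvf_ctangent cvf_clie_bracket X Y)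
  have hol: "?N \<longleftrightarrow> (clie_bracket X Y (fst u), \<theta>) \<in> holomorphic_bundle A J (fst u)"
    unfolding iff holomorphic_bundle_iff[OF p(1) br \<theta>] unfolding \<theta>_def re_join_covec[OF \<eta> \<zeta>]
    by (simp only: fun_cong[OF re_clie_bracket] fun_cong[OF fun_cong[OF im_clie_bracket]])
  show ?thesis using \<theta> val hol by blast
qed

text \<open>An almost complex structure is integrable iff its \<open>i\<close>-eigenbundle is involutive; here the
  eigenbundle is spanned by the lifts of sections of the holomorphic bundle, and \<open>\<theta>\<close> is the
  cotangent part of their bracket.\<close>

lemma integrable_iff_hol_sections:
  "integrable_acs \<T> K \<longleftrightarrow>
    (\<forall>X \<sigma> Y \<tau>. (X, \<sigma>) \<in> hol_sections \<longrightarrow> (Y, \<tau>) \<in> hol_sections \<longrightarrow>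
      (\<forall>u\<in>points \<T>. \<exists>\<theta>. (clie_bracket X Y (fst u), \<theta>) \<in> holomorphic_bundle A J (fst u) \<and>
        (\<forall>Z\<in>cvector_fields A. \<theta> (Z (fst u)) = complex_covector_bracket D X \<sigma> Y \<tau> u Z)))"
proof -
  have key: "nijenhuis K (lift (re_field X) (\<lambda>p. re_covec (\<sigma> p))) (lift (re_field Y) (\<lambda>p. re_covec (\<tau> p))) u = (\<lambda>F. 0) \<longleftrightarrow>
      (\<exists>\<theta>. (clie_bracket X Y (fst u), \<theta>) \<in> holomorphic_bundle A J (fst u) \<and>
        (\<forall>Z\<in>cvector_fields A. \<theta> (Z (fst u)) = complex_covector_bracket D X \<sigma> Y \<tau> u Z))"
    if XS: "(X, \<sigma>) \<in> hol_sections" and YT: "(Y, \<tau>) \<in> hol_sections" and u: "u \<in> points \<T>" for X \<sigma> Y \<tau> u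
  proof -
    note p = cotangent_point[OF u]
    let ?N = "nijenhuis K (lift (re_field X) (\<lambda>p. re_covec (\<sigma> p))) (lift (re_field Y) (\<lambda>p. re_covec (\<tau> p))) u = (\<lambda>F. 0)"
    obtain \<theta> where \<theta>: "\<theta> \<in> ccotangent_space A (fst u)"
      and val: "\<And>Z. Z \<in> cvector_fields A \<Longrightarrow> \<theta> (Z (fst u)) = complex_covector_bracket D X \<sigma> Y \<tau> u Z"
      and hol: "?N \<longleftrightarrow> (clie_bracket X Y (fst u), \<theta>) \<in> holomorphic_bundle A J (fst u)"
      using hol_sections_bracket[OF XS YT u] by blast
    show ?thesis
    proof
      assume ?N
      then show "\<exists>\<theta>. (clie_bracket X Y (fst u), \<theta>) \<in> holomorphic_bundle A J (fst u) \<and>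
        (\<forall>Z\<in>cvector_fields A. \<theta> (Z (fst u)) = complex_covector_bracket D X \<sigma> Y \<tau> u Z)" using hol val by blast
    next
      assume "\<exists>\<theta>. (clie_bracket X Y (fst u), \<theta>) \<in> holomorphic_bundle A J (fst u) \<and>
        (\<forall>Z\<in>cvector_fields A. \<theta> (Z (fst u)) = complex_covector_bracket D X \<sigma> Y \<tau> u Z)"
      then obtain \<theta>' where \<theta>': "(clie_bracket X Y (fst u), \<theta>') \<in> holomorphic_bundle A J (fst u)"
        "\<And>Z. Z \<in> cvector_fields A \<Longrightarrow> \<theta>' (Z (fst u)) = complex_covector_bracket D X \<sigma> Y \<tau> u Z" by blast
      have \<theta>'c: "\<theta>' \<in> ccotangent_space A (fst u)" using \<theta>'(1) by (simp add: holomorphic_bundle_def)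
      \<comment> \<open>Every complex tangent vector extends to a field, so the values on fields
        determine the covector.\<close>
      have "\<theta>' = \<theta>"
      proof (rule ccotangent_eqI[OF \<theta>'c \<theta>])
        fix V assume "V \<in> ctangent_space A (fst u)"
        then obtain Z where "Z \<in> cvector_fields A" "Z (fst u) = V" using extend_ctangent[OF p(1)] by blast
        then show "\<theta>' V = \<theta> V" using val[of Z] \<theta>'(2)[of Z] by simp
      qed
      then show ?N using hol \<theta>'(1) by simp
    qed
  qed
  show ?thesis
    unfolding integrable_iff_lifts
  proof (intro iffI allI impI ballI)
    fix X \<sigma> Y \<tau> u
    assume N: "\<forall>X\<in>vector_fields A. \<forall>s\<in>one_forms A. \<forall>Y\<in>vector_fields A. \<forall>t\<in>one_forms A.
       \<forall>u\<in>points \<T>. nijenhuis K (lift X s) (lift Y t) u = (\<lambda>F. 0)"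
      and X: "(X, \<sigma>) \<in> hol_sections" and Y: "(Y, \<tau>) \<in> hol_sections" and u: "u \<in> points \<T>"
    show "\<exists>\<theta>. (clie_bracket X Y (fst u), \<theta>) \<in> holomorphic_bundle A J (fst u) \<and>
        (\<forall>Z\<in>cvector_fields A. \<theta> (Z (fst u)) = complex_covector_bracket D X \<sigma> Y \<tau> u Z)"
      using key[OF X Y u] N[rule_format, OF cvf_re[OF hol_sectionsD(1)[OF X]] re_form_one_form(1)[OF hol_sectionsD(2)[OF X]]
          cvf_re[OF hol_sectionsD(1)[OF Y]] re_form_one_form(1)[OF hol_sectionsD(2)[OF Y]] u] by blast
  next
    fix X s Y t u
    assume H: "\<forall>X \<sigma> Y \<tau>. (X, \<sigma>) \<in> hol_sections \<longrightarrow> (Y, \<tau>) \<in> hol_sections \<longrightarrow>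
      (\<forall>u\<in>points \<T>. \<exists>\<theta>. (clie_bracket X Y (fst u), \<theta>) \<in> holomorphic_bundle A J (fst u) \<and>
        (\<forall>Z\<in>cvector_fields A. \<theta> (Z (fst u)) = complex_covector_bracket D X \<sigma> Y \<tau> u Z))"
      and X: "X \<in> vector_fields A" "s \<in> one_forms A" and Y: "Y \<in> vector_fields A" "t \<in> one_forms A"
      and u: "u \<in> points \<T>"
    obtain X' \<sigma> where X': "(X', \<sigma>) \<in> hol_sections" "re_field X' = X" "(\<lambda>p. re_covec (\<sigma> p)) = s" by (rule real_hol_section[OF X])
    obtain Y' \<tau> where Y': "(Y', \<tau>) \<in> hol_sections" "re_field Y' = Y" "(\<lambda>p. re_covec (\<tau> p)) = t" by (rule real_hol_section[OF Y])
    show "nijenhuis K (lift X s) (lift Y t) u = (\<lambda>F. 0)"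
      using key[OF X'(1) Y'(1) u] H X'(1) Y'(1) u unfolding X'(2,3) Y'(2,3) by blast
  qed
qed

end


section \<open>Complex subbundles with local frames\<close>

text \<open>Openness refers to the atlas alone, and coefficients are arbitrary functions of the
  index: spanning and independence replace the bijection on extensional functions. In this form
  conjugation carries frames of E to frames of \<tau>(E).\<close>

definition frames_over :: "('a, 'e::euclidean_space) chart set \<Rightarrow> ('a \<Rightarrow> 'a ctvec set) \<Rightarrow> 'a set \<Rightarrow> nat \<Rightarrow> (nat \<Rightarrow> 'a \<Rightarrow> 'a ctvec) \<Rightarrow> bool" where
  "frames_over A E U r X \<longleftrightarrow> aopen A U \<and> (\<forall>i<r. X i \<in> cvector_fields A) \<and>
     (\<forall>q\<in>U. E q = range (\<lambda>c f. \<Sum>i<r. c i * X i q f)) \<and>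
     (\<forall>q\<in>U. \<forall>c. (\<forall>f. (\<Sum>i<r. c i * X i q f) = 0) \<longrightarrow> (\<forall>i<r. c i = 0))"

lemma frames_overD:
  assumes "frames_over A E U r X"
  shows "aopen A U" "\<And>i. i < r \<Longrightarrow> X i \<in> cvector_fields A"
    "\<And>q. q \<in> U \<Longrightarrow> E q = range (\<lambda>c f. \<Sum>i<r. c i * X i q f)"
    "\<And>q c. q \<in> U \<Longrightarrow> (\<And>f. (\<Sum>i<r. c i * X i q f) = 0) \<Longrightarrow> \<forall>i<r. c i = 0"
  using assms unfolding frames_over_def by blast+

definition has_local_frames :: "('a, 'e::euclidean_space) chart set \<Rightarrow> ('a \<Rightarrow> 'a ctvec set) \<Rightarrow> bool" where
  "has_local_frames A E \<longleftrightarrow> (\<forall>p\<in>points A. \<exists>U r X. p \<in> U \<and> frames_over A E U r X)"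

lemma has_local_framesE:
  assumes "has_local_frames A E" "p \<in> points A"
  obtains U r X where "p \<in> U" "frames_over A E U r X"
  using assms unfolding has_local_frames_def by blast

lemma range_combinationI:
  "V = (\<lambda>f. \<Sum>i\<in>I. c i * Y i f) \<Longrightarrow> V \<in> range (\<lambda>c f. \<Sum>i\<in>I. c i * Y i f)"
  by (rule range_eqI)

lemma frame_of_bij_betw:
  fixes Y :: "nat \<Rightarrow> 'b \<Rightarrow> complex"
  assumes "bij_betw (\<lambda>c f. \<Sum>i<r. c i * Y i f) ({..<r} \<rightarrow>\<^sub>E UNIV) S"
  shows "S = range (\<lambda>c f. \<Sum>i<r. c i * Y i f)"
    and "(\<And>f. (\<Sum>i<r. c i * Y i f) = 0) \<Longrightarrow> \<forall>i<r. c i = 0"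
proof -
  define g where "g = (\<lambda>c f. \<Sum>i<r. c i * Y i f)"
  have res: "g c = g (restrict c {..<r})" for c unfolding g_def by (intro ext sum.cong) auto
  have im: "S = g ` ({..<r} \<rightarrow>\<^sub>E UNIV)" and inj: "inj_on g ({..<r} \<rightarrow>\<^sub>E UNIV)"
    using assms by (simp_all add: bij_betw_def g_def)
  have "g c \<in> S" for c unfolding im by (rule image_eqI[where x="restrict c {..<r}"], rule res) auto
  then show "S = range (\<lambda>c f. \<Sum>i<r. c i * Y i f)" unfolding g_def[symmetric] im by blast
  assume "\<And>f. (\<Sum>i<r. c i * Y i f) = 0"
  then have "g c = g (\<lambda>i. 0)" by (simp add: g_def)
  then have "g (restrict c {..<r}) = g (restrict (\<lambda>i. 0) {..<r})" unfolding res[symmetric] .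
  then have "restrict c {..<r} = restrict (\<lambda>i. 0) {..<r}" by (rule inj_onD[OF inj]) auto
  then show "\<forall>i<r. c i = 0" by (metis lessThan_iff restrict_apply')
qed

context smooth_atlas
begin

lemma frames_subspace:
  assumes E: "has_local_frames A E" and p: "p \<in> points A"
  shows "E p \<subseteq> ctangent_space A p" "(\<lambda>f. 0) \<in> E p"
    "V \<in> E p \<Longrightarrow> W \<in> E p \<Longrightarrow> (\<lambda>f. a * V f + b * W f) \<in> E p"
proof -
  obtain U r X where X: "p \<in> U" "frames_over A E U r X" by (rule has_local_framesE[OF E p])
  note fr = frames_overD[OF X(2)]
  note Ep = fr(3)[OF X(1)]
  show "E p \<subseteq> ctangent_space A p"
  proof
    fix V assume "V \<in> E p"
    then obtain c where V: "V = (\<lambda>f. \<Sum>i<r. c i * X i p f)" unfolding Ep by (rule rangeE)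
    show "V \<in> ctangent_space A p"
      unfolding V by (intro ctangent_sum ctangent_scale cvf_ctangent fr(2)) simp
  qed
  show "(\<lambda>f. 0) \<in> E p" unfolding Ep by (rule range_eqI[of _ _ "\<lambda>i. 0"]) simp
  show "(\<lambda>f. a * V f + b * W f) \<in> E p" if VW: "V \<in> E p" "W \<in> E p"
  proof -
    obtain c where c: "V = (\<lambda>f. \<Sum>i<r. c i * X i p f)" using VW(1) unfolding Ep by (rule rangeE)
    obtain d where d: "W = (\<lambda>f. \<Sum>i<r. d i * X i p f)" using VW(2) unfolding Ep by (rule rangeE)
    from c d have "(\<lambda>f. a * V f + b * W f) = (\<lambda>f. \<Sum>i<r. (a * c i + b * d i) * X i p f)"
      by (simp add: sum_distrib_left sum.distrib distrib_right mult.assoc)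
    then show ?thesis unfolding Ep by (rule range_combinationI)
  qed
qed

lemma frames_scale: "has_local_frames A E \<Longrightarrow> p \<in> points A \<Longrightarrow> V \<in> E p \<Longrightarrow> (\<lambda>f. a * V f) \<in> E p"
  using frames_subspace(3)[of E p V V a 0] by simp

lemma frames_sum:
  assumes "has_local_frames A E" "p \<in> points A" "\<And>i. i \<in> I \<Longrightarrow> V i \<in> E p"
  shows "(\<lambda>f. \<Sum>i\<in>I. c i * V i f) \<in> E p"
  using assms(3)
proof (induction I rule: infinite_finite_induct)
  case (insert i I)
  then have "(\<lambda>f. c i * V i f + 1 * (\<Sum>i\<in>I. c i * V i f)) \<in> E p"
    by (intro frames_subspace(3)[OF assms(1,2)]) auto
  then show ?case using insert by simp
qed (simp_all add: frames_subspace(2)[OF assms(1,2)])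

lemma sections_cvf: "X \<in> sections A E \<Longrightarrow> X \<in> cvector_fields A"
  and sections_mem: "X \<in> sections A E \<Longrightarrow> p \<in> points A \<Longrightarrow> X p \<in> E p"
  by (simp_all add: sections_def)

lemma sections_scale:
  assumes "has_local_frames A E" "smooth_fun A h" "X \<in> sections A E"
  shows "(\<lambda>p f. h p * X p f) \<in> sections A E"
  using assms by (auto simp: sections_def intro: cvf_scale frames_scale)

text \<open>The \<open>\<theta> i\<close> extend the coordinate functionals of F to the whole
  complexified tangent space, so that the sum of \<open>\<theta> i q V\<close> times
  \<open>W i q\<close> projects it onto F over N.\<close>

definition dual_frames :: "('a \<Rightarrow> 'a ctvec set) \<Rightarrow> 'a set \<Rightarrow> nat \<Rightarrow> (nat \<Rightarrow> 'a \<Rightarrow> 'a ctvec) \<Rightarrow> (nat \<Rightarrow> 'a \<Rightarrow> 'a ccovec) \<Rightarrow> bool" where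
  "dual_frames F N r W \<theta> \<longleftrightarrow> aopen A N \<and> (\<forall>i<r. W i \<in> cvector_fields A \<and> \<theta> i \<in> cforms A) \<and>
    (\<forall>q\<in>N. (\<forall>i<r. W i q \<in> F q) \<and> (\<forall>V\<in>F q. V = (\<lambda>f. \<Sum>i<r. \<theta> i q V * W i q f)))"

lemma dual_framesD:
  assumes "dual_frames F N r W \<theta>"
  shows "aopen A N" "\<And>i. i < r \<Longrightarrow> W i \<in> cvector_fields A" "\<And>i. i < r \<Longrightarrow> \<theta> i \<in> cforms A"
    "\<And>q i. q \<in> N \<Longrightarrow> i < r \<Longrightarrow> W i q \<in> F q"
    "\<And>q V f. q \<in> N \<Longrightarrow> V \<in> F q \<Longrightarrow> V f = (\<Sum>i<r. \<theta> i q V * W i q f)"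
proof -
  show "aopen A N" "\<And>i. i < r \<Longrightarrow> W i \<in> cvector_fields A" "\<And>i. i < r \<Longrightarrow> \<theta> i \<in> cforms A"
    "\<And>q i. q \<in> N \<Longrightarrow> i < r \<Longrightarrow> W i q \<in> F q"
    using assms unfolding dual_frames_def by blast+
  fix q V f assume "q \<in> N" "V \<in> F q"
  then have "V = (\<lambda>f. \<Sum>i<r. \<theta> i q V * W i q f)" using assms unfolding dual_frames_def by blast
  then show "V f = (\<Sum>i<r. \<theta> i q V * W i q f)" by (rule fun_cong)
qed

lemma dual_frames_exist:
  assumes F: "has_local_frames A F" and p: "p \<in> points A"
  obtains N r W \<theta> where "p \<in> N" "dual_frames F N r W \<theta>"
proof -
  obtain U r W where U: "p \<in> U" "frames_over A F U r W" by (rule has_local_framesE[OF F p])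
  note W = frames_overD[OF U(2)]
  from dual_coframe[OF W(1) U(1) W(2) W(4)[OF U(1)]]
  have "\<exists>\<theta> N. aopen A N \<and> p \<in> N \<and> N \<subseteq> U \<and> (\<forall>i<r. \<theta> i \<in> cforms A) \<and>
    (\<forall>q\<in>N. \<forall>i<r. \<forall>j<r. \<theta> i q (W j q) = (if i = j then 1 else 0))" .
  then obtain \<theta> N where N: "aopen A N" "p \<in> N" "N \<subseteq> U" and \<theta>: "\<And>i. i < r \<Longrightarrow> \<theta> i \<in> cforms A"
    and dual: "\<And>q i j. q \<in> N \<Longrightarrow> i < r \<Longrightarrow> j < r \<Longrightarrow> \<theta> i q (W j q) = (if i = j then 1 else 0)"
    by blast
  have Fq: "F q = range (\<lambda>c f. \<Sum>i<r. c i * W i q f)" if "q \<in> N" for q using W(3) N(3) that by blast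
  have "dual_frames F N r W \<theta>"
    unfolding dual_frames_def
  proof (intro conjI ballI allI impI N(1) W(2) \<theta>)
    fix q i assume q: "q \<in> N" and i: "i < r"
    have "W i q = (\<lambda>f. \<Sum>j<r. (if j = i then 1 else 0) * W j q f)"
    proof
      fix f
      have "(\<Sum>j<r. (if j = i then 1 else 0) * W j q f) = (\<Sum>j<r. if j = i then W j q f else 0)"
        by (rule sum.cong) auto
      then show "W i q f = (\<Sum>j<r. (if j = i then 1 else 0) * W j q f)" using i by simp
    qed
    then show "W i q \<in> F q" unfolding Fq[OF q] by (rule range_combinationI)
  next
    fix q V assume q: "q \<in> N" and "V \<in> F q"
    then obtain c where V: "V = (\<lambda>f. \<Sum>j<r. c j * W j q f)" unfolding Fq[OF q] by blast
    have "\<theta> i q V = c i" if i: "i < r" for i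
    proof -
      have "\<theta> i q V = (\<Sum>j<r. c j * \<theta> i q (W j q))"
        unfolding V by (rule ccotangent_sum[OF cform_ccotangent[OF \<theta>[OF i]]]) (simp add: cvf_ctangent W)
      also have "\<dots> = (\<Sum>j<r. if j = i then c j else 0)"
        by (rule sum.cong) (auto simp: dual[OF q i])
      finally show ?thesis using i by simp
    qed
    then show "V = (\<lambda>f. \<Sum>i<r. \<theta> i q V * W i q f)" by (subst V) simp
  qed
  then show thesis using that N(2) by blast
qed

text \<open>The coefficients \<open>\<theta> i p V\<close> are kept constant and the frame is cut
  off, since outside N its fields need not lie in F.\<close>

lemma frames_extend:
  assumes F: "has_local_frames A F" and p: "p \<in> points A" and V: "V \<in> F p"
  obtains Z where "Z \<in> sections A F" "Z p = V"
proof -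
  obtain N r W \<theta> where N: "p \<in> N" "dual_frames F N r W \<theta>" by (rule dual_frames_exist[OF F p])
  note d = dual_framesD[OF N(2)]
  obtain \<kappa> :: "'a \<Rightarrow> real" and M where \<kappa>: "smooth_fun A \<kappa>" "p \<in> M" "\<And>q. q \<in> M \<Longrightarrow> \<kappa> q = 1" "\<And>q. q \<notin> N \<Longrightarrow> \<kappa> q = 0"
    using bump_obtain[OF d(1) N(1)] by metis
  define Z where "Z = (\<lambda>q f. \<Sum>i<r. (\<theta> i p V * complex_of_real (\<kappa> q)) * W i q f)"
  have "Z \<in> cvector_fields A"
    unfolding Z_def by (intro cvf_sum cvf_scale smooth_fun_mult smooth_fun_const smooth_of_real \<kappa>(1)) (simp add: d(2))
  moreover have "Z q \<in> F q" if q: "q \<in> points A" for q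
  proof (cases "q \<in> N")
    case True
    then show ?thesis unfolding Z_def by (intro frames_sum[OF F q]) (simp add: d(4))
  next
    case False
    then show ?thesis unfolding Z_def by (simp add: \<kappa>(4) frames_subspace(2)[OF F q])
  qed
  moreover have "Z p = V"
    using d(5)[OF N(1) V] by (intro ext) (simp add: Z_def \<kappa>(3)[OF \<kappa>(2)])
  ultimately show thesis by (intro that[of Z]) (simp_all add: sections_def)
qed

end


section \<open>The integrability criterion\<close>

text \<open>\<open>F\<close> stands for \<open>\<tau>(E)\<close>.\<close>

locale holomorphic_data = gcs_atlas A D J for A :: "('a, 'e::euclidean_space) chart set" and D J +
  fixes E F :: "'a \<Rightarrow> 'a ctvec set" and \<alpha> :: "'a \<Rightarrow> 'a ctvec \<Rightarrow> 'a ctvec \<Rightarrow> complex"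
  assumes framesE: "has_local_frames A E" and framesF: "has_local_frames A F"
    and bilinear: "bilinear_section A E F \<alpha>"
    and holomorphic: "\<And>p. p \<in> points A \<Longrightarrow> holomorphic_bundle A J p =
          {(X, \<xi>). X \<in> E p \<and> \<xi> \<in> ccotangent_space A p \<and> (\<forall>Y\<in>F p. \<xi> Y = \<alpha> p X Y)}"
begin

lemma alpha_lin1: "p \<in> points A \<Longrightarrow> V \<in> E p \<Longrightarrow> V' \<in> E p \<Longrightarrow> W \<in> F p \<Longrightarrow>
    \<alpha> p (\<lambda>f. a * V f + b * V' f) W = a * \<alpha> p V W + b * \<alpha> p V' W"
  and alpha_lin2: "p \<in> points A \<Longrightarrow> V \<in> E p \<Longrightarrow> W \<in> F p \<Longrightarrow> W' \<in> F p \<Longrightarrow>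
    \<alpha> p V (\<lambda>f. a * W f + b * W' f) = a * \<alpha> p V W + b * \<alpha> p V W'"
  and alpha_smooth: "X \<in> sections A E \<Longrightarrow> Y \<in> sections A F \<Longrightarrow> smooth_fun A (\<lambda>p. \<alpha> p (X p) (Y p))"
  using bilinear unfolding bilinear_section_def by blast+

lemma alpha_scale1: "p \<in> points A \<Longrightarrow> V \<in> E p \<Longrightarrow> W \<in> F p \<Longrightarrow> \<alpha> p (\<lambda>f. a * V f) W = a * \<alpha> p V W"
  using alpha_lin1[of p V V W a 0] by simp

lemma alpha_zero1: "p \<in> points A \<Longrightarrow> W \<in> F p \<Longrightarrow> \<alpha> p (\<lambda>f. 0) W = 0"
  using alpha_scale1[of p "\<lambda>f. 0" W 0] frames_subspace(2)[OF framesE] by simp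

lemma alpha_scale2: "p \<in> points A \<Longrightarrow> V \<in> E p \<Longrightarrow> W \<in> F p \<Longrightarrow> \<alpha> p V (\<lambda>f. a * W f) = a * \<alpha> p V W"
  using alpha_lin2[of p V W W a 0] by simp

lemma alpha_zero2: "p \<in> points A \<Longrightarrow> V \<in> E p \<Longrightarrow> \<alpha> p V (\<lambda>f. 0) = 0"
  using alpha_scale2[of p V "\<lambda>f. 0" 0] frames_subspace(2)[OF framesF] by simp

lemma alpha_sum2:
  assumes "p \<in> points A" "V \<in> E p" "\<And>i. i \<in> I \<Longrightarrow> W i \<in> F p"
  shows "\<alpha> p V (\<lambda>f. \<Sum>i\<in>I. c i * W i f) = (\<Sum>i\<in>I. c i * \<alpha> p V (W i))"
  using assms(3)
proof (induction I rule: infinite_finite_induct)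
  case (insert i I)
  then have "\<alpha> p V (\<lambda>f. c i * W i f + 1 * (\<Sum>i\<in>I. c i * W i f)) = c i * \<alpha> p V (W i) + 1 * \<alpha> p V (\<lambda>f. \<Sum>i\<in>I. c i * W i f)"
    by (intro alpha_lin2 assms(1,2) frames_sum[OF framesF assms(1)]) auto
  then show ?case using insert by simp
qed (simp_all add: alpha_zero2 assms(1,2))

lemma hol_sectionsI:
  assumes "X \<in> sections A E" "\<sigma> \<in> cforms A" "\<And>q W. q \<in> points A \<Longrightarrow> W \<in> F q \<Longrightarrow> \<sigma> q W = \<alpha> q (X q) W"
  shows "(X, \<sigma>) \<in> hol_sections"
  using assms by (auto simp: hol_sections_def holomorphic sections_def cform_ccotangent)

text \<open>A section of \<open>E\<close> lifts to \<open>L\<close> only after cutting off near the given point, where a dual frame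
  of \<open>F\<close> extends \<open>\<alpha>(X, _)\<close> from \<open>F\<close> to the complexified tangent bundle.\<close>

lemma hol_section_near:
  assumes X: "X \<in> sections A E" and p: "p \<in> points A"
  obtains X' \<sigma> N where "(X', \<sigma>) \<in> hol_sections" "X' \<in> sections A E" "aopen A N" "p \<in> N" "\<And>q. q \<in> N \<Longrightarrow> X' q = X q"
proof -
  obtain N r W \<theta> where N: "p \<in> N" "dual_frames F N r W \<theta>" by (rule dual_frames_exist[OF framesF p])
  note d = dual_framesD[OF N(2)]
  have NA: "q \<in> points A" if "q \<in> N" for q using that aopen_subset_points[OF d(1)] by blast
  obtain \<kappa> :: "'a \<Rightarrow> real" and M where \<kappa>: "smooth_fun A \<kappa>" "aopen A M" "p \<in> M" "\<And>q. q \<in> M \<Longrightarrow> \<kappa> q = 1" "\<And>q. q \<notin> N \<Longrightarrow> \<kappa> q = 0"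
    using bump_obtain[OF d(1) N(1)] by metis
  \<comment> \<open>Smoothness of \<alpha> is given for global sections only, while the frame fields
    are known to lie in F just over N.\<close>
  define W' where "W' = (\<lambda>i q f. complex_of_real (\<kappa> q) * W i q f)"
  have W': "W' i \<in> sections A F" if "i < r" for i
    unfolding sections_def W'_def
  proof (intro CollectI conjI ballI cvf_scale smooth_of_real \<kappa>(1) d(2) that)
    fix q assume "q \<in> points A"
    then show "(\<lambda>f. complex_of_real (\<kappa> q) * W i q f) \<in> F q"
      using d(4)[OF _ that] frames_scale[OF framesF] frames_subspace(2)[OF framesF] \<kappa>(5) by (cases "q \<in> N") auto
  qed
  define X' where "X' = (\<lambda>q f. complex_of_real (\<kappa> q) * X q f)"
  have X': "X' \<in> sections A E" unfolding X'_def by (intro sections_scale[OF framesE] smooth_of_real \<kappa>(1) X)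
  \<comment> \<open>\<sigma> carries the factor \<open>\<kappa>\<close> once, through
    \<open>W'\<close>. As X' carries it too, \<sigma> equals \<alpha>(X', _) on F everywhere, also
    outside N, where both sides vanish.\<close>
  define \<sigma> where "\<sigma> = (\<lambda>q V. \<Sum>i<r. \<alpha> q (X q) (W' i q) * \<theta> i q V)"
  have \<sigma>: "\<sigma> \<in> cforms A"
    unfolding \<sigma>_def by (intro cform_sum cform_scale alpha_smooth X W' d(3)) auto
  have "\<sigma> q V = \<alpha> q (X' q) V" if q: "q \<in> points A" and V: "V \<in> F q" for q V
  proof (cases "q \<in> N")
    case True
    note Xq = sections_mem[OF X q]
    have "\<sigma> q V = complex_of_real (\<kappa> q) * (\<Sum>i<r. \<theta> i q V * \<alpha> q (X q) (W i q))"
      unfolding \<sigma>_def sum_distrib_left W'_def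
      by (rule sum.cong) (auto simp: alpha_scale2[OF q Xq d(4)[OF True]])
    also have "(\<Sum>i<r. \<theta> i q V * \<alpha> q (X q) (W i q)) = \<alpha> q (X q) (\<lambda>f. \<Sum>i<r. \<theta> i q V * W i q f)"
      by (rule alpha_sum2[OF q Xq, symmetric]) (simp add: d(4)[OF True])
    also have "(\<lambda>f. \<Sum>i<r. \<theta> i q V * W i q f) = V" using d(5)[OF True V] by (intro ext) simp
    finally show ?thesis by (simp add: X'_def alpha_scale1[OF q Xq V])
  next
    case False
    then show ?thesis using q V sections_mem[OF X q]
      by (simp add: \<sigma>_def X'_def W'_def \<kappa>(5) alpha_zero1 alpha_zero2)
  qed
  then have "(X', \<sigma>) \<in> hol_sections" by (rule hol_sectionsI[OF X' \<sigma>])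
  moreover have "X' q = X q" if "q \<in> M" for q by (simp add: X'_def \<kappa>(4)[OF that])
  ultimately show thesis using that X' \<kappa>(2,3) by blast
qed

text \<open>\<open>F\<close> is the common kernel of the covectors annihilating it, and those are sections of \<open>L\<close>.\<close>

lemma mem_F_by_annihilators:
  assumes p: "p \<in> points A" and V: "V \<in> ctangent_space A p"
    and ann: "\<And>\<eta>. (\<lambda>p f. 0, \<eta>) \<in> hol_sections \<Longrightarrow> (\<And>q W. q \<in> points A \<Longrightarrow> W \<in> F q \<Longrightarrow> \<eta> q W = 0) \<Longrightarrow> \<eta> p V = 0"
  shows "V \<in> F p"
proof -
  obtain N r W \<theta> where N: "p \<in> N" "dual_frames F N r W \<theta>" by (rule dual_frames_exist[OF framesF p])
  note d = dual_framesD[OF N(2)]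
  obtain \<kappa> :: "'a \<Rightarrow> real" and M where \<kappa>: "smooth_fun A \<kappa>" "p \<in> M" "\<And>q. q \<in> M \<Longrightarrow> \<kappa> q = 1" "\<And>q. q \<notin> N \<Longrightarrow> \<kappa> q = 0"
    using bump_obtain[OF d(1) N(1)] by metis
  let ?W = "\<lambda>f. \<Sum>i<r. \<theta> i p V * W i p f"
  have zero: "(\<lambda>p f. 0) \<in> sections A E" by (simp add: sections_def cvf_zero frames_subspace(2)[OF framesE])
  have "V = ?W"
  proof (rule ctangent_eqI[OF V])
    show "?W \<in> ctangent_space A p" by (intro ctangent_sum ctangent_scale cvf_ctangent d(2)) simp
    fix f :: "'a \<Rightarrow> real" assume f: "smooth_fun A f"
    \<comment> \<open>The differential of f minus its composition with the projection onto F. It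
      annihilates F, and on V it gives the value at f of the difference between V and its
      projection.\<close>
    define \<eta> where "\<eta> = (\<lambda>q V. complex_of_real (\<kappa> q) * (cdform A f q V - (\<Sum>i<r. W i q f * \<theta> i q V)))"
    have \<eta>: "\<eta> \<in> cforms A"
      unfolding \<eta>_def by (intro cform_scale smooth_of_real \<kappa>(1) cform_diff cdform_cform f cform_sum cvf_smooth[OF _ f] d(2,3)) auto
    have kill: "\<eta> q U = 0" if q: "q \<in> points A" and U: "U \<in> F q" for q U
    proof (cases "q \<in> N")
      case True
      have "U \<in> ctangent_space A q" using frames_subspace(1)[OF framesF q] U by blast
      then show ?thesis using d(5)[OF True U, of f] q by (simp add: \<eta>_def cdform_def mult.commute)
    qed (simp add: \<eta>_def \<kappa>(4))
    have "(\<lambda>p f. 0, \<eta>) \<in> hol_sections"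
      by (rule hol_sectionsI[OF zero \<eta>]) (simp add: kill alpha_zero1)
    from ann[OF this kill] have "\<eta> p V = 0" by simp
    then show "V f = ?W f" using p V by (simp add: \<eta>_def cdform_def \<kappa>(3)[OF \<kappa>(2)] mult.commute)
  qed
  moreover have "?W \<in> F p" by (intro frames_sum[OF framesF p]) (simp add: d(4)[OF N(1)])
  ultimately show ?thesis by simp
qed

lemma zero_point: "p \<in> points A \<Longrightarrow> (p, \<lambda>v. 0) \<in> points \<T>"
  by (simp add: points_cotangent_atlas ct_dom_def cotangent_space_zero)

lemma integrable_iff:
  "integrable_acs \<T> K \<longleftrightarrow>
    involutive A E \<and>
    ((\<forall>X\<in>sections A E. \<forall>Z\<in>sections A F. complex_conn D X Z \<in> sections A F) \<and>
     (\<forall>X\<in>sections A E. \<forall>Y\<in>sections A E. \<forall>Z\<in>sections A F. \<forall>p\<in>points A. complex_curvature D X Y Z p = (\<lambda>f. 0))) \<and>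
    (\<forall>X\<in>sections A E. \<forall>Y\<in>sections A E. \<forall>W\<in>sections A F. \<forall>p\<in>points A.
        cderiv (X p) (\<lambda>q. \<alpha> q (Y q) (W q)) - cderiv (Y p) (\<lambda>q. \<alpha> q (X q) (W q))
        - \<alpha> p (Y p) (complex_conn D X W p) + \<alpha> p (X p) (complex_conn D Y W p)
        - \<alpha> p (clie_bracket X Y p) (W p) = 0)"
    (is "_ \<longleftrightarrow> ?i \<and> (?ii \<and> ?ii') \<and> ?iii")
proof
  assume int: "integrable_acs \<T> K"
  have brE: "clie_bracket X Y (fst u) \<in> E (fst u)"
    and br: "\<And>W. W \<in> sections A F \<Longrightarrow>
      complex_covector_bracket D X \<sigma> Y \<tau> u W = \<alpha> (fst u) (clie_bracket X Y (fst u)) (W (fst u))"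
    if h: "(X, \<sigma>) \<in> hol_sections" "(Y, \<tau>) \<in> hol_sections" "u \<in> points \<T>" for X \<sigma> Y \<tau> u
  proof -
    note p = cotangent_point(1)[OF h(3)]
    obtain \<theta> where \<theta>: "(clie_bracket X Y (fst u), \<theta>) \<in> holomorphic_bundle A J (fst u)"
      "\<And>Z. Z \<in> cvector_fields A \<Longrightarrow> \<theta> (Z (fst u)) = complex_covector_bracket D X \<sigma> Y \<tau> u Z"
      using int[unfolded integrable_iff_hol_sections, rule_format, OF h] by blast
    show "clie_bracket X Y (fst u) \<in> E (fst u)" using \<theta>(1) by (simp add: holomorphic[OF p])
    show "complex_covector_bracket D X \<sigma> Y \<tau> u W = \<alpha> (fst u) (clie_bracket X Y (fst u)) (W (fst u))"
      if "W \<in> sections A F" for W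
      using \<theta>(1) \<theta>(2)[OF sections_cvf[OF that]] sections_mem[OF that p] by (simp add: holomorphic[OF p])
  qed
  have val: "\<tau> q (W q) = \<alpha> q (Y q) (W q)"
    if "(Y, \<tau>) \<in> hol_sections" "W \<in> sections A F" "q \<in> points A" for Y \<tau> W q
    using that sections_mem[OF that(2,3)] holomorphic[OF that(3)] by (auto simp: hol_sections_def)
  have i: ?i
    unfolding involutive_def
  proof (intro ballI)
    fix X Y assume X: "X \<in> sections A E" and Y: "Y \<in> sections A E"
    \<comment> \<open>Only sections that lift to L can be used, so X and Y are replaced by such
      sections agreeing with them near p; the bracket at p does not notice.\<close>
    have "clie_bracket X Y p \<in> E p" if p: "p \<in> points A" for p
    proof -
      obtain X' \<sigma> N where X': "(X', \<sigma>) \<in> hol_sections" "X' \<in> sections A E" "aopen A N" "p \<in> N" "\<And>q. q \<in> N \<Longrightarrow> X' q = X q"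
        using hol_section_near[OF X p] by blast
      obtain Y' \<tau> M where Y': "(Y', \<tau>) \<in> hol_sections" "Y' \<in> sections A E" "aopen A M" "p \<in> M" "\<And>q. q \<in> M \<Longrightarrow> Y' q = Y q"
        using hol_section_near[OF Y p] by blast
      have "clie_bracket X' Y' p = clie_bracket X Y p"
        by (rule clie_bracket_local[OF sections_cvf[OF X'(2)] sections_cvf[OF Y'(2)] sections_cvf[OF X] sections_cvf[OF Y]
              aopen_Int[OF X'(3) Y'(3)]]) (use X' Y' in auto)
      then show ?thesis using brE[OF X'(1) Y'(1) zero_point[OF p]] by simp
    qed
    then show "clie_bracket X Y \<in> sections A E"
      using cvf_clie_bracket[OF sections_cvf[OF X] sections_cvf[OF Y]] by (simp add: sections_def)
  qed
  \<comment> \<open>This has to precede the other conditions: \<tau> is known to be \<alpha>(Y, _)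
    on F only, so its value on D_X W can be rewritten only once D_X W lies in F.\<close>
  have ii: ?ii
  proof (intro ballI)
    fix X Z assume X: "X \<in> sections A E" and Z: "Z \<in> sections A F"
    have XZ: "complex_conn D X Z \<in> cvector_fields A" by (rule cvf_complex_conn[OF sections_cvf[OF X] sections_cvf[OF Z]])
    have "complex_conn D X Z p \<in> F p" if p: "p \<in> points A" for p
    proof (rule mem_F_by_annihilators[OF p cvf_ctangent[OF XZ]])
      fix \<eta> assume \<eta>: "(\<lambda>p f. 0, \<eta>) \<in> hol_sections" and kill: "\<And>q W. q \<in> points A \<Longrightarrow> W \<in> F q \<Longrightarrow> \<eta> q W = 0"
      obtain X' \<sigma> N where X': "(X', \<sigma>) \<in> hol_sections" "X' \<in> sections A E" "aopen A N" "p \<in> N" "\<And>q. q \<in> N \<Longrightarrow> X' q = X q"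
        using hol_section_near[OF X p] by blast
      note cX' = sections_cvf[OF X'(2)] and cZ = sections_cvf[OF Z]
      have "clie_bracket X' (\<lambda>p f. 0) p = (\<lambda>f. 0)"
        using cderiv_const[OF cvf_ctangent[OF cX', of p], of 0] by (simp add: clie_bracket_def cderiv_def)
      then have b: "complex_covector_bracket D X' \<sigma> (\<lambda>p f. 0) \<eta> (p, \<lambda>v. 0) Z = 0"
        using br[OF X'(1) \<eta> zero_point[OF p] Z] alpha_zero1[OF p sections_mem[OF Z p]] by simp
      have "cderiv (X' p) (\<lambda>q. \<eta> q (Z q)) = cderiv (X' p) (\<lambda>q. 0)"
        by (rule cderiv_local[OF cvf_ctangent[OF cX'] aopen_points p cform_smooth[OF hol_sectionsD(2)[OF \<eta>] cZ] smooth_fun_const])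
          (rule kill[OF _ sections_mem[OF Z]])
      then have "complex_dual_conn D X' \<eta> Z p = - \<eta> p (complex_conn D X' Z p)"
        by (simp add: complex_dual_conn_def cderiv_const[OF cvf_ctangent[OF cX']])
      moreover have "complex_dual_conn D (\<lambda>p f. 0) \<sigma> Z p = 0"
        by (simp add: complex_dual_conn_def complex_conn_zero[OF cZ] cderiv_def ccotangent_zero[OF cform_ccotangent[OF hol_sectionsD(2)[OF X'(1)]]])
      ultimately have "\<eta> p (complex_conn D X' Z p) = 0" using b by (simp add: complex_covector_bracket_def complex_eq_iff)
      moreover have "complex_conn D X' Z p = complex_conn D X Z p"
        by (rule complex_conn_local[OF cX' sections_cvf[OF X] cZ cZ X'(3,4) X'(5)[OF X'(4)] refl])
      ultimately show "\<eta> p (complex_conn D X Z p) = 0" by simp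
    qed
    then show "complex_conn D X Z \<in> sections A F" using XZ by (simp add: sections_def)
  qed
  have ii'_iii: "complex_curvature D X Y W p = (\<lambda>f. 0)"
    "cderiv (X p) (\<lambda>q. \<alpha> q (Y q) (W q)) - cderiv (Y p) (\<lambda>q. \<alpha> q (X q) (W q))
        - \<alpha> p (Y p) (complex_conn D X W p) + \<alpha> p (X p) (complex_conn D Y W p)
        - \<alpha> p (clie_bracket X Y p) (W p) = 0"
    if X: "X \<in> sections A E" and Y: "Y \<in> sections A E" and W: "W \<in> sections A F" and p: "p \<in> points A" for X Y W p
  proof -
    obtain X' \<sigma> N where X': "(X', \<sigma>) \<in> hol_sections" "X' \<in> sections A E" "aopen A N" "p \<in> N" "\<And>q. q \<in> N \<Longrightarrow> X' q = X q"
      using hol_section_near[OF X p] by blast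
    obtain Y' \<tau> M where Y': "(Y', \<tau>) \<in> hol_sections" "Y' \<in> sections A E" "aopen A M" "p \<in> M" "\<And>q. q \<in> M \<Longrightarrow> Y' q = Y q"
      using hol_section_near[OF Y p] by blast
    note NM = aopen_Int[OF X'(3) Y'(3)]
    have pNM: "p \<in> N \<inter> M" using X'(4) Y'(4) by blast
    note cX = sections_cvf[OF X] and cY = sections_cvf[OF Y] and cW = sections_cvf[OF W]
    note cX' = sections_cvf[OF X'(2)] and cY' = sections_cvf[OF Y'(2)]
    have eq: "X' p = X p" "Y' p = Y p" using X'(4,5) Y'(4,5) by auto
    have lie: "clie_bracket X' Y' p = clie_bracket X Y p"
      by (rule clie_bracket_local[OF cX' cY' cX cY NM pNM]) (use X' Y' in auto)
    have curv: "complex_curvature D X' Y' W p = complex_curvature D X Y W p"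
      by (rule complex_curvature_local[OF cX' cX cY' cY cW NM pNM]) (use X' Y' in auto)
    have conn: "complex_conn D X' W p = complex_conn D X W p" "complex_conn D Y' W p = complex_conn D Y W p"
      by (rule complex_conn_local[OF cX' cX cW cW NM pNM eq(1) refl], rule complex_conn_local[OF cY' cY cW cW NM pNM eq(2) refl])
    have mem: "complex_conn D X W p \<in> F p" "complex_conn D Y W p \<in> F p"
      using ii X Y W sections_mem[OF _ p] by blast+
    \<comment> \<open>Stated for arbitrary fields, because it is applied a second time with X and Y
      exchanged.\<close>
    have dual: "complex_dual_conn D X' \<tau> W p = cderiv (X p) (\<lambda>q. \<alpha> q (Y q) (W q)) - \<alpha> p (Y p) (complex_conn D X W p)"
      if X: "X \<in> sections A E" "X' p = X p" and conn: "complex_conn D X' W p = complex_conn D X W p" "complex_conn D X W p \<in> F p"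
        and Y: "Y \<in> sections A E" "(Y', \<tau>) \<in> hol_sections" "aopen A M" "p \<in> M" "\<And>q. q \<in> M \<Longrightarrow> Y' q = Y q"
      for X X' Y Y' \<tau> M
    proof -
      have "cderiv (X p) (\<lambda>q. \<tau> q (W q)) = cderiv (X p) (\<lambda>q. \<alpha> q (Y q) (W q))"
      proof (rule cderiv_local[OF cvf_ctangent[OF sections_cvf[OF X(1)]] Y(3,4) cform_smooth[OF hol_sectionsD(2)[OF Y(2)] cW] alpha_smooth[OF Y(1) W]])
        fix q assume q: "q \<in> M"
        then have "q \<in> points A" using aopen_subset_points[OF Y(3)] by blast
        then show "\<tau> q (W q) = \<alpha> q (Y q) (W q)" using val[OF Y(2) W] Y(5)[OF q] by simp
      qed
      moreover have "\<tau> p (complex_conn D X W p) = \<alpha> p (Y p) (complex_conn D X W p)"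
        using Y(2) Y(5)[OF Y(4)] conn(2) p holomorphic[OF p] by (auto simp: hol_sections_def)
      ultimately show ?thesis by (simp add: complex_dual_conn_def X(2) conn(1))
    qed
    have b0: "cderiv (X p) (\<lambda>q. \<alpha> q (Y q) (W q)) - \<alpha> p (Y p) (complex_conn D X W p)
        - (cderiv (Y p) (\<lambda>q. \<alpha> q (X q) (W q)) - \<alpha> p (X p) (complex_conn D Y W p))
        - Complex (\<xi> (\<lambda>f. Re (complex_curvature D X Y W p f))) (\<xi> (\<lambda>f. Im (complex_curvature D X Y W p f)))
        = \<alpha> p (clie_bracket X Y p) (W p)" if \<xi>: "\<xi> \<in> cotangent_space A p" for \<xi>
    proof -
      have u: "(p, \<xi>) \<in> points \<T>" using p \<xi> by (simp add: points_cotangent_atlas ct_dom_def)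
      show ?thesis
        using br[OF X'(1) Y'(1) u W] lie curv
        by (simp add: complex_covector_bracket_def dual[OF X eq(1) conn(1) mem(1) Y Y'(1,3,4,5)] dual[OF Y eq(2) conn(2) mem(2) X X'(1,3,4,5)])
    qed
    from b0[OF cotangent_space_zero]
    show *: "cderiv (X p) (\<lambda>q. \<alpha> q (Y q) (W q)) - cderiv (Y p) (\<lambda>q. \<alpha> q (X q) (W q))
        - \<alpha> p (Y p) (complex_conn D X W p) + \<alpha> p (X p) (complex_conn D Y W p)
        - \<alpha> p (clie_bracket X Y p) (W p) = 0" by (simp add: complex_eq_iff)
    have cc: "complex_curvature D X Y W p \<in> ctangent_space A p" by (intro cvf_ctangent cvf_complex_curvature cX cY cW)
    show "complex_curvature D X Y W p = (\<lambda>f. 0)"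
    proof (rule ctangent_eqI[OF cc ctangent_zero])
      fix f :: "'a \<Rightarrow> real" assume f: "smooth_fun A f"
      \<comment> \<open>Subtracting the identity at \<xi> = 0 from the one at \<xi> = df leaves the
        value of the curvature at f, separately in real and imaginary part.\<close>
      have "Complex (dform A f p (\<lambda>f. Re (complex_curvature D X Y W p f))) (dform A f p (\<lambda>f. Im (complex_curvature D X Y W p f))) = 0"
        using b0[OF one_form_cotangent[OF dform_in_one_forms[OF f]]] * by (simp add: complex_eq_iff)
      then show "complex_curvature D X Y W p f = 0"
        by (simp add: dform_apply[OF p ctangent_re[OF cc]] dform_apply[OF p ctangent_im[OF cc]] complex_eq_iff)
    qed
  qed
  show "?i \<and> (?ii \<and> ?ii') \<and> ?iii" using i ii ii'_iii by blast
next
  assume H: "?i \<and> (?ii \<and> ?ii') \<and> ?iii"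
  show "integrable_acs \<T> K"
    unfolding integrable_iff_hol_sections
  proof (intro allI impI ballI)
    fix X \<sigma> Y \<tau> u assume XS: "(X, \<sigma>) \<in> hol_sections" and YT: "(Y, \<tau>) \<in> hol_sections" and u: "u \<in> points \<T>"
    note p = cotangent_point[OF u]
    have sec: "X \<in> sections A E" "\<And>q W. q \<in> points A \<Longrightarrow> W \<in> F q \<Longrightarrow> \<sigma> q W = \<alpha> q (X q) W" if "(X, \<sigma>) \<in> hol_sections" for X \<sigma>
      using that holomorphic by (auto simp: hol_sections_def sections_def)
    note X = sec[OF XS] and Y = sec[OF YT]
    note cX = hol_sectionsD[OF XS] and cY = hol_sectionsD[OF YT]
    have lie: "clie_bracket X Y \<in> sections A E" using H X(1) Y(1) unfolding involutive_def by blast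
    obtain \<theta> where \<theta>: "\<theta> \<in> ccotangent_space A (fst u)"
      and val: "\<And>Z. Z \<in> cvector_fields A \<Longrightarrow> \<theta> (Z (fst u)) = complex_covector_bracket D X \<sigma> Y \<tau> u Z"
      using hol_sections_bracket[OF XS YT u] by blast
    have "\<theta> V = \<alpha> (fst u) (clie_bracket X Y (fst u)) V" if VF: "V \<in> F (fst u)" for V
    proof -
      \<comment> \<open>The conditions speak of sections, so the vector V of F is extended to
        one.\<close>
      obtain W where W: "W \<in> sections A F" "W (fst u) = V" by (rule frames_extend[OF framesF p(1) VF])
      have DF: "complex_conn D X W \<in> sections A F" "complex_conn D Y W \<in> sections A F" using H X(1) Y(1) W(1) by blast+
      have curv: "complex_curvature D X Y W (fst u) = (\<lambda>f. 0)" using H X(1) Y(1) W(1) p(1) by blast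
      have dual: "complex_dual_conn D X \<tau> W (fst u) = cderiv (X (fst u)) (\<lambda>q. \<alpha> q (Y q) (W q)) - \<alpha> (fst u) (Y (fst u)) (complex_conn D X W (fst u))"
        if X: "X \<in> sections A E" and XW: "complex_conn D X W \<in> sections A F" and Y: "Y \<in> sections A E"
          and T: "\<tau> \<in> cforms A" "\<And>q W. q \<in> points A \<Longrightarrow> W \<in> F q \<Longrightarrow> \<tau> q W = \<alpha> q (Y q) W" for X Y \<tau>
      proof -
        have "cderiv (X (fst u)) (\<lambda>q. \<tau> q (W q)) = cderiv (X (fst u)) (\<lambda>q. \<alpha> q (Y q) (W q))"
          by (rule cderiv_local[OF cvf_ctangent[OF sections_cvf[OF X]] aopen_points p(1) cform_smooth[OF T(1) sections_cvf[OF W(1)]] alpha_smooth[OF Y W(1)]])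
            (simp add: T(2) sections_mem[OF W(1)])
        then show ?thesis by (simp add: complex_dual_conn_def T(2) p(1) sections_mem[OF XW])
      qed
      have "cderiv (X (fst u)) (\<lambda>q. \<alpha> q (Y q) (W q)) - cderiv (Y (fst u)) (\<lambda>q. \<alpha> q (X q) (W q))
        - \<alpha> (fst u) (Y (fst u)) (complex_conn D X W (fst u)) + \<alpha> (fst u) (X (fst u)) (complex_conn D Y W (fst u))
        - \<alpha> (fst u) (clie_bracket X Y (fst u)) (W (fst u)) = 0"
        using H X(1) Y(1) W(1) p(1) by blast
      then have "complex_covector_bracket D X \<sigma> Y \<tau> u W = \<alpha> (fst u) (clie_bracket X Y (fst u)) (W (fst u))"
        by (simp add: complex_covector_bracket_def dual[OF X(1) DF(1) Y(1) cY(2) Y(2)] dual[OF Y(1) DF(2) X(1) cX(2) X(2)]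
            curv cotangent_zero[OF p(2)] algebra_simps flip: zero_complex.code)
      then show ?thesis using val[OF sections_cvf[OF W(1)]] W(2) by simp
    qed
    then have "(clie_bracket X Y (fst u), \<theta>) \<in> holomorphic_bundle A J (fst u)"
      using \<theta> sections_mem[OF lie p(1)] by (simp add: holomorphic[OF p(1)])
    with val show "\<exists>\<theta>. (clie_bracket X Y (fst u), \<theta>) \<in> holomorphic_bundle A J (fst u) \<and>
        (\<forall>Z\<in>cvector_fields A. \<theta> (Z (fst u)) = complex_covector_bracket D X \<sigma> Y \<tau> u Z)" by blast
  qed
qed

end

section \<open>The map tau and the integrability theorem\<close>

lemma tau_tau [simp]: "tau k (tau k v) = v"
  by (cases k) (simp_all add: tau_def)

text \<open>In the symmetric case the conjugate fields form the frame: conjugation is antilinear, so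
  it conjugates the coefficients, which does not affect spans or independence.\<close>

lemma tau_frames:
  assumes "smooth_atlas A" "has_local_frames A E"
  shows "has_local_frames A (\<lambda>p. tau k ` E p)"
proof (cases k)
  case Skew
  then show ?thesis using assms(2) by (simp add: tau_def)
next
  case Symmetric
  interpret smooth_atlas A by fact
  show ?thesis
    unfolding has_local_frames_def
  proof
    fix p assume "p \<in> points A"
    from assms(2) this obtain U r X where X: "p \<in> U" "frames_over A E U r X" by (rule has_local_framesE)
    note fr = frames_overD[OF X(2)]
    define Y where "Y = (\<lambda>i q f. cnj (X i q f))"
    have t: "tau k (\<lambda>f. \<Sum>i<r. c i * X i q f) = (\<lambda>f. \<Sum>i<r. cnj (c i) * Y i q f)" for c q
      by (simp add: tau_def Symmetric Y_def)
    have "frames_over A (\<lambda>p. tau k ` E p) U r Y"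
      unfolding frames_over_def
    proof (intro conjI allI impI ballI fr(1))
      fix q assume q: "q \<in> U"
      show "tau k ` E q = range (\<lambda>c f. \<Sum>i<r. c i * Y i q f)"
        unfolding fr(3)[OF q]
      proof (intro equalityI subsetI)
        fix V assume "V \<in> tau k ` range (\<lambda>c f. \<Sum>i<r. c i * X i q f)"
        then obtain c where "V = tau k (\<lambda>f. \<Sum>i<r. c i * X i q f)" by blast
        then show "V \<in> range (\<lambda>c f. \<Sum>i<r. c i * Y i q f)" unfolding t by (auto intro: range_combinationI)
      next
        fix V assume "V \<in> range (\<lambda>c f. \<Sum>i<r. c i * Y i q f)"
        then obtain c where "V = (\<lambda>f. \<Sum>i<r. c i * Y i q f)" by blast
        then have "V = tau k (\<lambda>f. \<Sum>i<r. cnj (c i) * X i q f)" using t[of "\<lambda>i. cnj (c i)" q] by simp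
        then show "V \<in> tau k ` range (\<lambda>c f. \<Sum>i<r. c i * X i q f)" by (intro image_eqI[OF _ range_combinationI[OF refl]])
      qed
    next
      fix q c i assume q: "q \<in> U" and z: "\<forall>f. (\<Sum>i<r. c i * Y i q f) = 0" and i: "i < r"
      have "(\<Sum>i<r. cnj (c i) * X i q f) = cnj (\<Sum>i<r. c i * Y i q f)" for f by (simp add: Y_def)
      then have "(\<Sum>i<r. cnj (c i) * X i q f) = 0" for f using z by simp
      from fr(4)[OF q this] i show "c i = 0" by simp
    qed (simp add: Y_def cvf_cnj fr(2))
    then show "\<exists>U r X. p \<in> U \<and> frames_over A (\<lambda>p. tau k ` E p) U r X" using X(1) by blast
  qed
qed

lemma tau_sections:
  assumes "smooth_atlas A"
  shows "X \<in> sections A E \<Longrightarrow> (\<lambda>q. tau k (X q)) \<in> sections A (\<lambda>p. tau k ` E p)"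
    and "X \<in> sections A (\<lambda>p. tau k ` E p) \<Longrightarrow> (\<lambda>q. tau k (X q)) \<in> sections A E"
proof -
  interpret smooth_atlas A by fact
  have c: "(\<lambda>q. tau k (X q)) \<in> cvector_fields A" if "X \<in> cvector_fields A" for X
    using cvf_cnj[OF that] that by (cases k) (simp_all add: tau_def)
  show "X \<in> sections A E \<Longrightarrow> (\<lambda>q. tau k (X q)) \<in> sections A (\<lambda>p. tau k ` E p)"
    using c by (simp add: sections_def)
  show "X \<in> sections A (\<lambda>p. tau k ` E p) \<Longrightarrow> (\<lambda>q. tau k (X q)) \<in> sections A E"
    using c by (fastforce simp: sections_def)
qed

theorem theorem16:
  fixes T :: "'a topology" and A :: "('a, 'e::euclidean_space) chart set"
    and J :: "'a gen_endo" and k :: gcs_type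
    and D :: "('a \<Rightarrow> 'a tvec) \<Rightarrow> ('a \<Rightarrow> 'a tvec) \<Rightarrow> 'a \<Rightarrow> 'a tvec"
    and E :: "'a \<Rightarrow> 'a ctvec set" and \<alpha> :: "'a \<Rightarrow> 'a ctvec \<Rightarrow> 'a ctvec \<Rightarrow> complex"
  assumes "smooth_manifold T A"
    and "generalized_complex_structure A J"
    and "gcs_has_type A J k"
    and "linear_connection A D"
    and "complex_subbundle T A E"
    and "bilinear_section A E (\<lambda>p. tau k ` E p) \<alpha>"
    and "\<forall>p\<in>points A. holomorphic_bundle A J p = L_tau A k E \<alpha> p"
  shows "integrable_acs (cotangent_atlas A) (cotangent_acs A J D) \<longleftrightarrow>
    involutive A E \<and>
    ((\<forall>X\<in>sections A E. \<forall>Z\<in>sections A (\<lambda>p. tau k ` E p).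
        complex_conn D X Z \<in> sections A (\<lambda>p. tau k ` E p)) \<and>
     (\<forall>X\<in>sections A E. \<forall>Y\<in>sections A E. \<forall>Z\<in>sections A (\<lambda>p. tau k ` E p).
        \<forall>p\<in>points A. complex_curvature D X Y Z p = (\<lambda>f. 0))) \<and>
    (\<forall>X\<in>sections A E. \<forall>Y\<in>sections A E. \<forall>Z\<in>sections A E. \<forall>p\<in>points A.
        cderiv (X p) (\<lambda>q. \<alpha> q (Y q) (tau k (Z q)))
        - cderiv (Y p) (\<lambda>q. \<alpha> q (X q) (tau k (Z q)))
        - \<alpha> p (Y p) (complex_conn D X (\<lambda>q. tau k (Z q)) p)
        + \<alpha> p (X p) (complex_conn D Y (\<lambda>q. tau k (Z q)) p)
        - \<alpha> p (clie_bracket X Y p) (tau k (Z p)) = 0)"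
proof -
  interpret smooth_manifold T A by fact
  interpret smooth_atlas A by (rule smooth_atlas)
  \<comment> \<open>The frames of \<open>complex_subbundle\<close> live over sets open in T; they
    are restated with the open sets of the atlas.\<close>
  have frames: "has_local_frames A E"
    unfolding has_local_frames_def
  proof
    fix p assume p: "p \<in> points A"
    obtain r :: nat where r: "\<forall>p\<in>points A. \<exists>U X. openin T U \<and> p \<in> U \<and> (\<forall>i<r. X i \<in> cvector_fields A) \<and>
       (\<forall>q\<in>U. bij_betw (\<lambda>c f. \<Sum>i<r. c i * X i q f) ({..<r} \<rightarrow>\<^sub>E UNIV) (E q))"
      using assms(5) unfolding complex_subbundle_def by (elim exE)
    from bspec[OF r p] obtain U X where UX: "openin T U \<and> p \<in> U \<and> (\<forall>i<r. X i \<in> cvector_fields A) \<and>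
       (\<forall>q\<in>U. bij_betw (\<lambda>c f. \<Sum>i<r. c i * X i q f) ({..<r} \<rightarrow>\<^sub>E UNIV) (E q))" by (elim exE)
    then have X: "openin T U" "p \<in> U" "\<And>i. i < r \<Longrightarrow> X i \<in> cvector_fields A" by simp_all
    have b: "bij_betw (\<lambda>c f. \<Sum>i<r. c i * X i q f) ({..<r} \<rightarrow>\<^sub>E UNIV) (E q)" if "q \<in> U" for q
      using UX that by (elim conjE) (rule bspec)
    have "frames_over A E U r X"
      unfolding frames_over_def
    proof (intro conjI allI impI ballI)
      fix q c i assume "q \<in> U" "\<forall>f. (\<Sum>i<r. c i * X i q f) = 0" "i < r"
      then show "c i = 0" using frame_of_bij_betw(2)[OF b, of q c] by simp
    qed (simp_all add: openin_imp_aopen[OF X(1)] X(3) frame_of_bij_betw(1)[OF b])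
    then show "\<exists>U r X. p \<in> U \<and> frames_over A E U r X" using X(2) by blast
  qed
  interpret holomorphic_data A D J E "\<lambda>p. tau k ` E p" \<alpha>
  proof unfold_locales
    fix p assume "p \<in> points A"
    then show "holomorphic_bundle A J p =
        {(X, \<xi>). X \<in> E p \<and> \<xi> \<in> ccotangent_space A p \<and> (\<forall>Y\<in>tau k ` E p. \<xi> Y = \<alpha> p X Y)}"
      unfolding L_tau_def[symmetric] by (rule assms(7)[rule_format])
  qed (fact assms(2) assms(4) assms(6) frames tau_frames[OF smooth_atlas_axioms frames])+
  note tau_sec = tau_sections[OF smooth_atlas_axioms, where E=E and k=k]
  \<comment> \<open>The criterion tests sections W of \<tau>(E), the theorem \<tau>(Z) with Z a
    section of E. These are the same fields, as \<tau> is an involution.\<close>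
  have swap: "(\<forall>W\<in>sections A (\<lambda>p. tau k ` E p). P W) \<longleftrightarrow> (\<forall>Z\<in>sections A E. P (\<lambda>q. tau k (Z q)))" for P
  proof
    assume H: "\<forall>Z\<in>sections A E. P (\<lambda>q. tau k (Z q))"
    show "\<forall>W\<in>sections A (\<lambda>p. tau k ` E p). P W"
    proof
      fix W assume "W \<in> sections A (\<lambda>p. tau k ` E p)"
      from H[rule_format, OF tau_sec(2)[OF this]] show "P W" by simp
    qed
  qed (use tau_sec(1) in blast)
  show ?thesis
    unfolding integrable_iff by (intro conj_cong refl ball_cong[OF refl] swap)
qed

end
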